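(* Let $\mathcal A$ be a unital $C^*$-algebra and let $\mathcal B\subseteq\mathbb B(G)$ be an injective $C^*$-algebra, where $G$ is a Hilbert space. Let $\iota:\mathcal B\to\mathbb B(G)$ be the inclusion map. For any two UCP maps $\phi_1,\phi_2:\mathcal A\to\mathcal B$, put $\tilde\phi_i:=\iota\circ\phi_i\in\mathrm{UCP}(\mathcal A,\mathbb B(G))$, $i=1,2$. Then $$\gamma(\tilde\phi_1,\tilde\phi_2)=\gamma(\phi_1,\phi_2).$$ Consequently, $\gamma$ is a metric on $\mathrm{UCP}(\mathcal A,\mathcal B)$.
   Context: When $\mathcal B\subseteq\mathbb B(G)$, the unit of $\mathcal B$ is assumed to be the identity operator of $G$. For unital $C^*$-algebras $\mathcal A,\mathcal D$, $\mathrm{UCP}(\mathcal A,\mathcal D)$ is the set of unital completely positive maps $\mathcal A\to\mathcal D$. For a Hilbert (right) $\mathcal D$-module $\mathcal E$, $\mathbf B^a(\mathcal E)$ is the $C^*$-algebra of bounded adjointable maps on $\mathcal E$; inner products are linear in the second variable. A joint representation tuple for $\phi_1,\phi_2\in\mathrm{UCP}(\mathcal A,\mathcal D)$ is $(\mathcal E,\sigma_1,\sigma_2,x)$ with $\mathcal E$ a Hilbert $\mathcal D$-module, $\sigma_1,\sigma_2:\mathcal A\to\mathbf B^a(\mathcal E)$ unital $*$-homomorphisms, and $x\in\mathcal E$ with $\langle x,x\rangle=1$ such that $\phi_i(a)=\langle x,\sigma_i(a)x\rangle$ for all $a\in\mathcal A$, $i=1,2$. Define $\gamma(\phi_1,\phi_2)=\inf\|\sigma_1-\sigma_2\|_{cb}$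 over all joint representation tuples, where $\|\cdot\|_{cb}$ is the completely bounded norm. Note that $\gamma$ depends on the range algebra: $\gamma(\phi_1,\phi_2)$ uses $\mathcal D=\mathcal B$ and $\gamma(\tilde\phi_1,\tilde\phi_2)$ uses $\mathcal D=\mathbb B(G)$. *)

theory Defs
  imports "HOL-Analysis.Analysis" "HOL-Algebra.Module"
begin

section \<open>Complex Hilbert spaces and unital C*-algebras\<close>

class scaleC =
  fixes scaleC :: "complex \<Rightarrow> 'a \<Rightarrow> 'a"  (infixr "*\<^sub>C" 75)

class complex_vector = real_vector + scaleC +
  assumes scaleC_add_right: "c *\<^sub>C (x + y) = c *\<^sub>C x + c *\<^sub>C y"
    and scaleC_add_left: "(c + d) *\<^sub>C x = c *\<^sub>C x + d *\<^sub>C x"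
    and scaleC_scaleC: "c *\<^sub>C d *\<^sub>C x = (c * d) *\<^sub>C x"
    and scaleR_scaleC: "r *\<^sub>R x = complex_of_real r *\<^sub>C x"

text \<open>The inner product is linear in the second variable. Its real part is the real inner product
  of the library, so that the norm is the usual one; completeness comes from \<open>banach\<close>.\<close>

class chilbert_space = complex_vector + real_inner + banach +
  fixes cinner :: "'a \<Rightarrow> 'a \<Rightarrow> complex"
  assumes cinner_commute: "cinner x y = cnj (cinner y x)"
    and cinner_add_right: "cinner x (y + z) = cinner x y + cinner x z"
    and cinner_scaleC_right: "cinner x (c *\<^sub>C y) = c * cinner x y"
    and inner_eq_Re_cinner: "inner x y = Re (cinner x y)"

text \<open>\<open>monoid_mult\<close> instead of \<open>ring_1\<close>: the zero algebra is not excluded, so that the bounded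
  operators on the zero Hilbert space are covered.\<close>

class unital_cstar_algebra = complex_vector + real_normed_algebra + banach + monoid_mult +
  fixes star :: "'a \<Rightarrow> 'a"
  assumes norm_scaleC: "norm (c *\<^sub>C x) = cmod c * norm x"
    and mult_scaleC_left: "(c *\<^sub>C x) * y = c *\<^sub>C (x * y)"
    and mult_scaleC_right: "x * (c *\<^sub>C y) = c *\<^sub>C (x * y)"
    and star_add: "star (x + y) = star x + star y"
    and star_scaleC: "star (c *\<^sub>C x) = cnj c *\<^sub>C star x"
    and star_mult: "star (x * y) = star y * star x"
    and star_star: "star (star x) = x"
    and cstar_identity: "norm (star x * x) = (norm x)\<^sup>2"

text \<open>A unital C*-subalgebra with the unit of the ambient algebra.\<close>

definition cstar_subalgebra :: "'d::unital_cstar_algebra set \<Rightarrow> bool" where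
  "cstar_subalgebra D \<longleftrightarrow>
     1 \<in> D \<and> (\<forall>x\<in>D. \<forall>y\<in>D. x + y \<in> D \<and> x * y \<in> D) \<and>
     (\<forall>c. \<forall>x\<in>D. c *\<^sub>C x \<in> D) \<and> (\<forall>x\<in>D. star x \<in> D) \<and> closed D"


section \<open>The C*-algebra of bounded operators on a Hilbert space\<close>

typedef (overloaded) 'g bop =
  "{T :: 'g::chilbert_space \<Rightarrow>\<^sub>L 'g. \<forall>c x. blinfun_apply T (c *\<^sub>C x) = c *\<^sub>C blinfun_apply T x}"
  morphisms blinfun_of_bop Abs_bop
proof
  have "c *\<^sub>C (0::'g) = 0" for c
    using scaleC_add_right[of c "0::'g" 0] by simp
  then show "0 \<in> {T :: 'g \<Rightarrow>\<^sub>L 'g. \<forall>c x. blinfun_apply T (c *\<^sub>C x) = c *\<^sub>C blinfun_apply T x}"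
    by simp
qed

definition bop_apply :: "'g::chilbert_space bop \<Rightarrow> 'g \<Rightarrow> 'g" where
  "bop_apply T = blinfun_apply (blinfun_of_bop T)"

lemma bop_apply_scaleC: "bop_apply T (c *\<^sub>C x) = c *\<^sub>C bop_apply T x"
  using blinfun_of_bop[of T] by (simp add: bop_apply_def)

lemma bop_apply_add: "bop_apply T (x + y) = bop_apply T x + bop_apply T y"
  by (simp add: bop_apply_def blinfun.bilinear_simps)

lemma bop_apply_scaleR: "bop_apply T (r *\<^sub>R x) = r *\<^sub>R bop_apply T x"
  by (simp add: bop_apply_def blinfun.bilinear_simps)

lemma bop_eqI: "(\<And>x. bop_apply S x = bop_apply T x) \<Longrightarrow> S = T"
  by (metis blinfun_eqI bop_apply_def blinfun_of_bop_inject)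

lemma scaleC_zero_right [simp]: "c *\<^sub>C (0::'v::complex_vector) = 0"
  using scaleC_add_right[of c "0::'v" 0] by simp

lemma scaleC_one: "1 *\<^sub>C (x :: 'v::complex_vector) = x"
  using scaleR_scaleC[of 1 x] by simp

lemma scaleC_minus_right: "c *\<^sub>C (- x :: 'v::complex_vector) = - (c *\<^sub>C x)"
  using scaleC_add_right[of c x "- x"] by (simp add: eq_neg_iff_add_eq_0 add.commute)

lemma scaleC_diff_right: "c *\<^sub>C (x - y :: 'v::complex_vector) = c *\<^sub>C x - c *\<^sub>C y"
  using scaleC_add_right[of c x "- y"] by (simp add: scaleC_minus_right)

lemma scaleC_scaleR: "c *\<^sub>C (r *\<^sub>R x :: 'v::complex_vector) = r *\<^sub>R (c *\<^sub>C x)"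
  by (simp add: scaleR_scaleC scaleC_scaleC mult.commute)

lemma cinner_scaleC_left: "cinner (c *\<^sub>C x) y = cnj c * cinner x y"
  by (metis cinner_commute cinner_scaleC_right complex_cnj_mult complex_cnj_cnj)

lemma chilbert_norm_scaleC: "norm (c *\<^sub>C (x::'g::chilbert_space)) = cmod c * norm x"
proof -
  have "inner (c *\<^sub>C x) (c *\<^sub>C x) = Re ((cnj c * c) * cinner x x)"
    by (simp only: inner_eq_Re_cinner cinner_scaleC_left cinner_scaleC_right mult.assoc
        mult.left_commute)
  also have "cnj c * c = complex_of_real ((cmod c)\<^sup>2)"
    by (metis complex_norm_square mult.commute)
  also have "Re (complex_of_real ((cmod c)\<^sup>2) * cinner x x) = (cmod c)\<^sup>2 * inner x x"
    by (simp add: inner_eq_Re_cinner)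
  finally show ?thesis
    by (simp add: norm_eq_sqrt_inner real_sqrt_mult)
qed

lemma cinner_eq_inner:
  "cinner x (y::'g::chilbert_space) = Complex (inner x y) (inner (\<i> *\<^sub>C x) y)"
  by (rule complex_eqI) (simp_all add: inner_eq_Re_cinner cinner_scaleC_left)

lemma real_riesz:
  fixes f :: "'v::{real_inner,banach} \<Rightarrow> real"
  assumes f: "bounded_linear f"
  shows "\<exists>u. \<forall>x. f x = inner u x"
proof -
  interpret f: bounded_linear f by fact
  define J where "J x = inner x x - 2 * f x" for x
  obtain K where K: "\<And>x. norm (f x) \<le> norm x * K" using f.bounded by blast
  have lower: "- K\<^sup>2 \<le> J x" for x
  proof -
    have "f x \<le> norm x * K" using K[of x] by simp
    moreover have "0 \<le> (norm x - K)\<^sup>2" by simp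
    ultimately show ?thesis
      by (simp add: J_def power2_norm_eq_inner[symmetric] power2_eq_square algebra_simps)
  qed
  define m where "m = (INF x. J x)"
  have bdd: "bdd_below (range J)" by (rule bdd_belowI2[of _ "- K\<^sup>2"]) (rule lower)
  have m: "m \<le> J x" for x unfolding m_def by (rule cINF_lower[OF bdd]) simp
  have "\<exists>x. J x < m + 1 / real (Suc n)" for n
  proof -
    have "(INF x. J x) < m + 1 / real (Suc n)" by (simp add: m_def)
    then show ?thesis by (subst (asm) cINF_less_iff) (use bdd in auto)
  qed
  then obtain X where X: "\<And>n. J (X n) < m + 1 / real (Suc n)" by metis
  have par: "(norm (a - b))\<^sup>2 \<le> 2 * (J a - m) + 2 * (J b - m)" for a b
  proof -
    have "(norm (a - b))\<^sup>2 = 2 * J a + 2 * J b - 4 * J ((1/2) *\<^sub>R (a + b))"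
      by (simp add: J_def power2_norm_eq_inner f.scaleR f.add inner_add_left inner_add_right
          inner_diff_left inner_diff_right inner_commute algebra_simps)
    then show ?thesis using m[of "(1/2) *\<^sub>R (a + b)"] by simp
  qed
  have "Cauchy X"
  proof (rule metric_CauchyI)
    fix e :: real assume e: "0 < e"
    obtain N where N: "4 / e\<^sup>2 < real N" using reals_Archimedean2 by blast
    have "dist (X i) (X j) < e" if ij: "N \<le> i" "N \<le> j" for i j
    proof -
      have Np: "0 < real N" using N e by (smt (verit) divide_nonneg_nonneg zero_le_power2)
      have le: "1 / real (Suc k) \<le> 1 / real N" if "N \<le> k" for k
        using that Np by (intro divide_left_mono) auto
      have "(norm (X i - X j))\<^sup>2 < 4 * (1 / real N)"
      proof -
        have "J (X i) < m + 1 / real N" "J (X j) < m + 1 / real N"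
          using X[of i] X[of j] le[OF ij(1)] le[OF ij(2)] by auto
        then show ?thesis using par[of "X i" "X j"] by argo
      qed
      also have "4 * (1 / real N) < e\<^sup>2" using N e Np by (simp add: field_simps)
      finally show ?thesis using e by (simp add: dist_norm power2_less_imp_less)
    qed
    then show "\<exists>M. \<forall>m\<ge>M. \<forall>n\<ge>M. dist (X m) (X n) < e" by blast
  qed
  then obtain u where u: "X \<longlonglongrightarrow> u" by (auto simp: Cauchy_convergent_iff convergent_def)
  have "(\<lambda>n. J (X n)) \<longlonglongrightarrow> J u"
    unfolding J_def by (intro tendsto_intros u f.tendsto)
  moreover have "(\<lambda>n. m + 1 / real (Suc n)) \<longlonglongrightarrow> m + 0"
    by (intro tendsto_intros LIMSEQ_Suc[OF lim_1_over_n])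
  ultimately have Ju: "J u \<le> m"
    using X by (intro LIMSEQ_le[of "\<lambda>n. J (X n)" _ "\<lambda>n. m + 1 / real (Suc n)"])
      (auto intro: less_imp_le)
  have "f x = inner u x" for x
  proof (rule ccontr)
    assume ne: "f x \<noteq> inner u x"
    define d where "d = f x - inner u x"
    define q where "q = inner x x + 1"
    have q: "0 < q" "inner x x < q" unfolding q_def by (simp_all add: add_nonneg_pos)
    have ex: "J (u + t *\<^sub>R x) = J u + (t\<^sup>2 * inner x x - 2 * t * d)" for t
      by (simp add: J_def d_def f.add f.scaleR inner_add_left inner_add_right inner_commute[of x u]
          power2_eq_square algebra_simps)
    have "J u \<le> J (u + (d / q) *\<^sub>R x)" using Ju m order_trans by blast
    then have "0 \<le> (d / q)\<^sup>2 * inner x x - 2 * (d / q) * d"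
      by (simp only: ex le_add_same_cancel1)
    also have "\<dots> \<le> (d / q)\<^sup>2 * q - 2 * (d / q) * d"
      using q by (simp add: mult_left_mono)
    also have "\<dots> = - (d\<^sup>2 / q)" using q by (simp add: power2_eq_square field_simps)
    also have "\<dots> < 0" using q ne by (simp add: d_def)
    finally show False by simp
  qed
  then show ?thesis by blast
qed

lemma bop_adjoint_exists:
  fixes T :: "'g::chilbert_space bop"
  shows "\<exists>S::'g bop. \<forall>x y. cinner (bop_apply S x) y = cinner x (bop_apply T y)"
proof -
  have bl: "bounded_linear (bop_apply T)"
    unfolding bop_apply_def by (rule blinfun.bounded_linear_right)
  have "\<exists>u. \<forall>y. inner x (bop_apply T y) = inner u y" for x
    by (rule real_riesz) (rule bounded_linear_compose[OF bounded_linear_inner_right bl])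
  then obtain S where S: "\<And>x y. inner x (bop_apply T y) = inner (S x) y" by metis
  have eqI: "a = b" if "\<And>y. inner a y = inner b (y::'g)" for a b
    by (metis that inner_diff_left inner_eq_zero_iff right_minus_eq)
  have cadj: "inner (c *\<^sub>C a) b = inner a (cnj c *\<^sub>C b)" for c and a b :: 'g
    by (simp add: inner_eq_Re_cinner cinner_scaleC_left cinner_scaleC_right)
  have SC: "S (c *\<^sub>C x) = c *\<^sub>C S x" for c x
    by (rule eqI) (metis S cadj bop_apply_scaleC)
  have add: "S (x + y) = S x + S y" for x y
    by (rule eqI) (simp add: inner_add_left flip: S)
  have sc: "S (r *\<^sub>R x) = r *\<^sub>R S x" for r x
    by (simp add: scaleR_scaleC SC)
  obtain K where K: "\<And>x. norm (bop_apply T x) \<le> norm x * K" "0 < K"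
    using bounded_linear.pos_bounded[OF bl] by blast
  have bnd: "norm (S x) \<le> norm x * K" for x
  proof -
    have "(norm (S x))\<^sup>2 = inner x (bop_apply T (S x))"
      by (simp add: S power2_norm_eq_inner)
    also have "\<dots> \<le> norm x * norm (bop_apply T (S x))" by (rule norm_cauchy_schwarz)
    also have "\<dots> \<le> norm x * (norm (S x) * K)" by (intro mult_left_mono K) auto
    finally have "norm (S x) * norm (S x) \<le> norm (S x) * (norm x * K)"
      by (simp add: power2_eq_square algebra_simps)
    then show ?thesis
      using K(2) by (cases "S x = 0") auto
  qed
  have blS: "bounded_linear S"
    by (rule bounded_linear_intro[of _ K]) (auto simp: add sc bnd)
  then have app: "bop_apply (Abs_bop (Blinfun S)) = S"
    by (simp add: bop_apply_def Abs_bop_inverse bounded_linear_Blinfun_apply SC)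
  have "cinner (S x) y = cinner x (bop_apply T y)" for x y
    by (simp add: cinner_eq_inner S flip: SC)
  then show ?thesis by (metis app)
qed

instantiation bop :: (chilbert_space) real_normed_vector
begin

definition "0 = Abs_bop 0"
definition "S + T = Abs_bop (blinfun_of_bop S + blinfun_of_bop T)"
definition "S - T = Abs_bop (blinfun_of_bop S - blinfun_of_bop T)"
definition "- T = Abs_bop (- blinfun_of_bop T)"
definition "r *\<^sub>R T = Abs_bop (r *\<^sub>R blinfun_of_bop T)"
definition "norm T = norm (blinfun_of_bop T)"
definition "dist S T = norm (S - T :: 'a bop)"
definition "sgn T = inverse (norm T) *\<^sub>R (T :: 'a bop)"
definition
  "(uniformity :: ('a bop \<times> 'a bop) filter) = (INF e\<in>{0<..}. principal {(x, y). dist x y < e})"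
definition
  "open (U :: 'a bop set) \<longleftrightarrow> (\<forall>x\<in>U. \<forall>\<^sub>F (x', y) in uniformity. x' = x \<longrightarrow> y \<in> U)"

lemma blinfun_of_bop_ops:
  "blinfun_of_bop (0 :: 'a bop) = 0"
  "blinfun_of_bop (S + T :: 'a bop) = blinfun_of_bop S + blinfun_of_bop T"
  "blinfun_of_bop (S - T) = blinfun_of_bop S - blinfun_of_bop T"
  "blinfun_of_bop (- T) = - blinfun_of_bop T"
  "blinfun_of_bop (r *\<^sub>R T) = r *\<^sub>R blinfun_of_bop T"
  using bop_apply_scaleC[of S] bop_apply_scaleC[of T]
  by (auto simp: zero_bop_def plus_bop_def minus_bop_def uminus_bop_def
      scaleR_bop_def bop_apply_def blinfun.bilinear_simps scaleC_add_right scaleC_diff_right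
      scaleC_minus_right scaleC_scaleR intro!: Abs_bop_inverse)

instance
proof
  fix S T U :: "'a bop" and r s :: real
  show "S + T + U = S + (T + U)" "S + T = T + S" "0 + S = S" "- S + S = 0" "S - T = S + - T"
    "r *\<^sub>R (S + T) = r *\<^sub>R S + r *\<^sub>R T" "(r + s) *\<^sub>R S = r *\<^sub>R S + s *\<^sub>R S"
    "r *\<^sub>R s *\<^sub>R S = (r * s) *\<^sub>R S" "1 *\<^sub>R S = S"
    by (simp_all add: blinfun_of_bop_ops scaleR_add_right scaleR_add_left
        flip: blinfun_of_bop_inject)
  show "dist S T = norm (S - T)" "sgn S = inverse (norm S) *\<^sub>R S"
    by (simp_all add: dist_bop_def sgn_bop_def)
  show "(uniformity :: ('a bop \<times> 'a bop) filter) = (INF e\<in>{0<..}. principal {(x, y). dist x y < e})"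
    by (rule uniformity_bop_def)
  show "open A \<longleftrightarrow> (\<forall>x\<in>A. \<forall>\<^sub>F (x', y) in uniformity. x' = x \<longrightarrow> y \<in> A)" for A :: "'a bop set"
    by (rule open_bop_def)
  show "norm S = 0 \<longleftrightarrow> S = 0"
    by (simp add: norm_bop_def blinfun_of_bop_ops flip: blinfun_of_bop_inject)
  show "norm (S + T) \<le> norm S + norm T" "norm (r *\<^sub>R S) = \<bar>r\<bar> * norm S"
    by (simp_all add: norm_bop_def blinfun_of_bop_ops norm_triangle_ineq)
qed

end

lemma norm_bop_apply: "norm (bop_apply T x) \<le> norm T * norm x"
  by (simp add: bop_apply_def norm_bop_def norm_blinfun)

lemma norm_bop_bound: "0 \<le> b \<Longrightarrow> (\<And>x. norm (bop_apply T x) \<le> b * norm x) \<Longrightarrow> norm T \<le> b"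
  by (simp add: bop_apply_def norm_bop_def norm_blinfun_bound)

instance bop :: (chilbert_space) banach
proof
  fix X :: "nat \<Rightarrow> 'a bop"
  assume X: "Cauchy X"
  have dist: "dist S T = dist (blinfun_of_bop S) (blinfun_of_bop T)" for S T :: "'a bop"
    by (simp add: dist_bop_def norm_bop_def blinfun_of_bop_ops dist_norm)
  have "Cauchy (\<lambda>n. blinfun_of_bop (X n))"
    using X by (simp add: Cauchy_def dist)
  then obtain L where L: "(\<lambda>n. blinfun_of_bop (X n)) \<longlonglongrightarrow> L"
    by (auto simp: Cauchy_convergent_iff convergent_def)
  have ptw: "(\<lambda>n. bop_apply (X n) x) \<longlonglongrightarrow> blinfun_apply L x" for x
    unfolding bop_apply_def by (intro tendsto_intros L)
  have "blinfun_apply L (c *\<^sub>C x) = c *\<^sub>C blinfun_apply L x" for c x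
  proof (rule LIMSEQ_unique[OF ptw])
    have "bounded_linear (\<lambda>v::'a. c *\<^sub>C v)"
      by (rule bounded_linear_intro[of _ "cmod c"])
        (simp_all add: scaleC_add_right scaleC_scaleR chilbert_norm_scaleC)
    from bounded_linear.tendsto[OF this ptw]
    show "(\<lambda>n. bop_apply (X n) (c *\<^sub>C x)) \<longlonglongrightarrow> c *\<^sub>C blinfun_apply L x"
      by (simp add: bop_apply_scaleC)
  qed
  then have "blinfun_of_bop (Abs_bop L) = L" by (simp add: Abs_bop_inverse)
  then have "X \<longlonglongrightarrow> Abs_bop L"
    using L by (simp add: lim_sequentially dist)
  then show "convergent X" by (auto simp: convergent_def)
qed

instantiation bop :: (chilbert_space) unital_cstar_algebra
begin

definition "1 = Abs_bop id_blinfun"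
definition "S * T = Abs_bop (blinfun_of_bop S o\<^sub>L blinfun_of_bop T)"
definition "c *\<^sub>C T = Abs_bop (Blinfun (\<lambda>x. c *\<^sub>C bop_apply T x))"

text \<open>The adjoint; it exists by \<open>bop_adjoint_exists\<close> and is unique.\<close>

definition star_bop :: "'a bop \<Rightarrow> 'a bop" where
  "star T = (THE S. \<forall>x y. cinner (bop_apply S x) y = cinner x (bop_apply T y))"

lemma blinfun_of_bop_times: "blinfun_of_bop (S * T :: 'a bop) = blinfun_of_bop S o\<^sub>L blinfun_of_bop T"
  using bop_apply_scaleC[of S] bop_apply_scaleC[of T]
  by (auto simp: times_bop_def bop_apply_def intro!: Abs_bop_inverse)

lemma bop_apply_ops:
  "bop_apply (1 :: 'a bop) x = x"
  "bop_apply (S + T :: 'a bop) x = bop_apply S x + bop_apply T x"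
  "bop_apply (S * T) x = bop_apply S (bop_apply T x)"
  "bop_apply (r *\<^sub>R T) x = r *\<^sub>R bop_apply T x"
  by (simp_all add: bop_apply_def blinfun_of_bop_ops blinfun_of_bop_times one_bop_def
      Abs_bop_inverse blinfun.bilinear_simps)

lemma bop_apply_scaleC_bop: "bop_apply (c *\<^sub>C T :: 'a bop) x = c *\<^sub>C bop_apply T x"
proof -
  have "bounded_linear (\<lambda>x. c *\<^sub>C bop_apply T x)"
  proof (rule bounded_linear_intro[of _ "cmod c * norm T"])
    show "norm (c *\<^sub>C bop_apply T x) \<le> norm x * (cmod c * norm T)" for x
      using mult_left_mono[OF norm_bop_apply[of T x] norm_ge_zero[of c]]
      by (simp add: chilbert_norm_scaleC algebra_simps)
  qed (simp_all add: bop_apply_add bop_apply_scaleR scaleC_add_right scaleC_scaleR)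
  then show ?thesis
    unfolding scaleC_bop_def
    by (simp add: bop_apply_def[of "Abs_bop _"] Abs_bop_inverse bounded_linear_Blinfun_apply
        bop_apply_scaleC scaleC_scaleC mult.commute)
qed

lemma bop_apply_star: "cinner (bop_apply (star T) x) y = cinner x (bop_apply (T :: 'a bop) y)"
proof -
  have "\<exists>!S. \<forall>x y. cinner (bop_apply S x) y = cinner x (bop_apply T y)"
  proof (rule ex_ex1I[OF bop_adjoint_exists])
    fix S S' :: "'a bop"
    assume "\<forall>x y. cinner (bop_apply S x) y = cinner x (bop_apply T y)"
      and "\<forall>x y. cinner (bop_apply S' x) y = cinner x (bop_apply T y)"
    then have "inner (bop_apply S x) y = inner (bop_apply S' x) y" for x y
      by (simp add: inner_eq_Re_cinner)
    then show "S = S'"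
      by (metis bop_eqI inner_diff_left inner_eq_zero_iff right_minus_eq)
  qed
  from theI'[OF this] show ?thesis unfolding star_bop_def by blast
qed

lemma bop_apply_star': "cinner x (bop_apply (star T) y) = cinner (bop_apply (T :: 'a bop) x) y"
  by (metis bop_apply_star cinner_commute)

lemma bop_eqI_cinner:
  assumes "\<And>x y. cinner (bop_apply S x) y = cinner (bop_apply (T :: 'a bop) x) y"
  shows "S = T"
  by (rule bop_eqI)
    (metis assms inner_eq_Re_cinner inner_diff_left inner_eq_zero_iff right_minus_eq)

lemma norm_bop_times: "norm (S * T) \<le> norm S * norm (T :: 'a bop)"
  by (simp add: norm_bop_def blinfun_of_bop_times norm_blinfun_compose)

lemma norm_bop_scaleC_le: "norm (c *\<^sub>C S) \<le> cmod c * norm (S :: 'a bop)"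
proof (rule norm_bop_bound)
  show "norm (bop_apply (c *\<^sub>C S) x) \<le> cmod c * norm S * norm x" for x
    using mult_left_mono[OF norm_bop_apply[of S x] norm_ge_zero[of c]]
    by (simp add: bop_apply_scaleC_bop chilbert_norm_scaleC mult.assoc)
qed simp

lemma norm_bop_scaleC: "norm (c *\<^sub>C S) = cmod c * norm (S :: 'a bop)"
proof (cases "c = 0")
  case True
  then show ?thesis using norm_bop_scaleC_le[of 0 S] by simp
next
  case False
  have "inverse c *\<^sub>C c *\<^sub>C S = S"
    using False by (intro bop_eqI) (simp add: bop_apply_scaleC_bop scaleC_scaleC scaleC_one)
  then have "norm S \<le> cmod (inverse c) * norm (c *\<^sub>C S)"
    using norm_bop_scaleC_le[of "inverse c" "c *\<^sub>C S"] by simp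
  from mult_left_mono[OF this norm_ge_zero[of c]] have "cmod c * norm S \<le> norm (c *\<^sub>C S)"
    using False by (simp only: norm_inverse mult.assoc[symmetric]) simp
  with norm_bop_scaleC_le[of c S] show ?thesis by simp
qed

lemma norm_bop_square_le: "(norm S)\<^sup>2 \<le> norm (star S * (S :: 'a bop))"
proof -
  have "norm S \<le> sqrt (norm (star S * S))"
  proof (rule norm_bop_bound)
    fix x
    have "(norm (bop_apply S x))\<^sup>2 = inner (bop_apply S x) (bop_apply S x)"
      by (rule power2_norm_eq_inner)
    also have "\<dots> = inner (bop_apply (star S * S) x) x"
      by (simp only: inner_eq_Re_cinner bop_apply_ops bop_apply_star)
    also have "\<dots> \<le> norm (bop_apply (star S * S) x) * norm x" by (rule norm_cauchy_schwarz)
    also have "\<dots> \<le> norm (star S * S) * norm x * norm x"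
      by (intro mult_right_mono norm_bop_apply) auto
    also have "\<dots> = (sqrt (norm (star S * S)) * norm x)\<^sup>2"
      by (simp add: power_mult_distrib) (simp add: power2_eq_square)
    finally show "norm (bop_apply S x) \<le> sqrt (norm (star S * S)) * norm x"
      by (rule power2_le_imp_le) simp
  qed simp
  from power_mono[OF this norm_ge_zero, of 2] show ?thesis by simp
qed

lemma star_star_bop: "star (star S) = (S :: 'a bop)"
  by (rule bop_eqI_cinner) (simp only: bop_apply_star bop_apply_star')

lemma norm_star_bop: "norm (star S) = norm (S :: 'a bop)"
proof -
  have le: "norm S \<le> norm (star S)" for S :: "'a bop"
  proof (cases "norm S = 0")
    case False
    have "norm S * norm S \<le> norm (star S) * norm S"
      using order_trans[OF norm_bop_square_le[of S] norm_bop_times[of "star S" S]]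
      by (simp only: power2_eq_square)
    then show ?thesis using False by simp
  qed simp
  from le[of S] le[of "star S"] show ?thesis by (simp only: star_star_bop)
qed

instance
proof
  fix S T U :: "'a bop" and c d :: complex and r :: real
  show "c *\<^sub>C (S + T) = c *\<^sub>C S + c *\<^sub>C T" "(c + d) *\<^sub>C S = c *\<^sub>C S + d *\<^sub>C S"
    "c *\<^sub>C d *\<^sub>C S = (c * d) *\<^sub>C S"
    "S * T * U = S * (T * U)" "1 * S = S" "S * 1 = S"
    "(S + T) * U = S * U + T * U" "S * (T + U) = S * T + S * U"
    "(r *\<^sub>R S) * T = r *\<^sub>R (S * T)" "S * (r *\<^sub>R T) = r *\<^sub>R (S * T)"
    "(c *\<^sub>C S) * T = c *\<^sub>C (S * T)" "S * (c *\<^sub>C T) = c *\<^sub>C (S * T)"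
    by (rule bop_eqI; simp add: bop_apply_ops bop_apply_scaleC_bop bop_apply_scaleC bop_apply_add
          bop_apply_scaleR scaleC_add_right scaleC_add_left scaleC_scaleC; fail)+
  show "r *\<^sub>R S = complex_of_real r *\<^sub>C S"
    by (rule bop_eqI) (simp only: bop_apply_ops bop_apply_scaleC_bop scaleR_scaleC)
  show "norm (S * T) \<le> norm S * norm T" by (rule norm_bop_times)
  show "norm (c *\<^sub>C S) = cmod c * norm S" by (rule norm_bop_scaleC)
  have cadd: "cinner (a + b) z = cinner a z + cinner b z" for a b z :: 'a
    by (metis cinner_commute cinner_add_right complex_cnj_add)
  show "star (S + T) = star S + star T"
    by (rule bop_eqI_cinner) (simp only: bop_apply_star bop_apply_ops cadd cinner_add_right)
  show "star (c *\<^sub>C S) = cnj c *\<^sub>C star S"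
    by (rule bop_eqI_cinner)
      (simp only: bop_apply_star bop_apply_scaleC_bop cinner_scaleC_left cinner_scaleC_right
        complex_cnj_cnj)
  show "star (S * T) = star T * star S"
    by (rule bop_eqI_cinner) (simp only: bop_apply_star bop_apply_ops)
  show "star (star S) = S" by (rule star_star_bop)
  show "norm (star S * S) = (norm S)\<^sup>2"
    using norm_bop_square_le[of S] norm_bop_times[of "star S" S]
    by (simp add: norm_star_bop power2_eq_square)
qed

end


section \<open>Matrices over a C*-algebra and completely positive maps\<close>

text \<open>An \<open>n \<times> n\<close> matrix is a function \<open>nat \<Rightarrow> nat \<Rightarrow> 'a\<close>, of which only the entries with indices
  below \<open>n\<close> are relevant.\<close>

definition matrices :: "nat \<Rightarrow> 'a set \<Rightarrow> (nat \<Rightarrow> nat \<Rightarrow> 'a) set" where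
  "matrices n S = {X. \<forall>i<n. \<forall>j<n. X i j \<in> S}"

text \<open>\<open>X\<close> is a positive element of \<open>M\<^sub>n(S)\<close>: it has the form \<open>Y\<^sup>* Y\<close> with \<open>Y\<close> in \<open>M\<^sub>n(S)\<close>.\<close>

definition positive_matrix ::
    "'a::unital_cstar_algebra set \<Rightarrow> nat \<Rightarrow> (nat \<Rightarrow> nat \<Rightarrow> 'a) \<Rightarrow> bool" where
  "positive_matrix S n X \<longleftrightarrow>
     (\<exists>Y\<in>matrices n S. \<forall>i<n. \<forall>j<n. X i j = (\<Sum>k<n. star (Y k i) * Y k j))"

definition completely_positive ::
    "'a::unital_cstar_algebra set \<Rightarrow> 'd::unital_cstar_algebra set \<Rightarrow> ('a \<Rightarrow> 'd) \<Rightarrow> bool" where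
  "completely_positive S D \<phi> \<longleftrightarrow>
     (\<forall>a\<in>S. \<phi> a \<in> D) \<and>
     (\<forall>a\<in>S. \<forall>b\<in>S. \<phi> (a + b) = \<phi> a + \<phi> b) \<and> (\<forall>c. \<forall>a\<in>S. \<phi> (c *\<^sub>C a) = c *\<^sub>C \<phi> a) \<and>
     (\<forall>n. \<forall>X\<in>matrices n S. positive_matrix S n X \<longrightarrow> positive_matrix D n (\<lambda>i j. \<phi> (X i j)))"

definition UCP ::
    "'a::unital_cstar_algebra set \<Rightarrow> 'd::unital_cstar_algebra set \<Rightarrow> ('a \<Rightarrow> 'd) set" where
  "UCP S D = {\<phi>. completely_positive S D \<phi> \<and> \<phi> 1 = 1}"

text \<open>Injectivity: UCP maps into \<open>B\<close> extend from C*-subalgebras. A formula of HOL cannot quantify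
  over all C*-algebras \<open>T\<close>; here \<open>T\<close> ranges over all unital C*-subalgebras of the type \<open>'t\<close>.
  As a hypothesis, this is implied by injectivity for all \<open>T\<close>, whichever of the usual variants
  (completely positive maps, completely positive contractions, operator systems in place of
  C*-subalgebras) is meant: an extension of a UCP map maps 1 to 1.\<close>

definition injective_cstar_algebra ::
    "'t::unital_cstar_algebra itself \<Rightarrow> 'd::unital_cstar_algebra set \<Rightarrow> bool" where
  "injective_cstar_algebra _ B \<longleftrightarrow>
     (\<forall>(S::'t set) T \<phi>. cstar_subalgebra S \<and> cstar_subalgebra T \<and> S \<subseteq> T \<and> \<phi> \<in> UCP S B \<longrightarrow>
        (\<exists>\<psi>\<in>UCP T B. \<forall>s\<in>S. \<psi> s = \<phi> s))"


section \<open>Hilbert modules\<close>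

text \<open>As for the library's modules, the multiplicative fields of the underlying ring record play no
  role. The action is a right action: \<open>d \<odot>\<^bsub>E\<^esub> x\<close> stands for \<open>x d\<close>. Because \<open>D\<close> is unital, the
  complex scalar multiplication of a Hilbert \<open>D\<close>-module is \<open>c x = x (c 1)\<close>.\<close>

record ('d, 'e) hilbert_module = "('d, 'e) module" +
  ip :: "'e \<Rightarrow> 'e \<Rightarrow> 'd"

definition module_norm :: "('d::unital_cstar_algebra, 'e) hilbert_module \<Rightarrow> 'e \<Rightarrow> real" where
  "module_norm E x = sqrt (norm (ip E x x))"

definition is_hilbert_module ::
    "'d::unital_cstar_algebra set \<Rightarrow> ('d, 'e) hilbert_module \<Rightarrow> bool" where
  "is_hilbert_module D E \<longleftrightarrow>
     abelian_group E \<and>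
     (\<forall>x\<in>carrier E. \<forall>d\<in>D. d \<odot>\<^bsub>E\<^esub> x \<in> carrier E) \<and>
     (\<forall>x\<in>carrier E. \<forall>y\<in>carrier E. \<forall>d\<in>D. d \<odot>\<^bsub>E\<^esub> (x \<oplus>\<^bsub>E\<^esub> y) = d \<odot>\<^bsub>E\<^esub> x \<oplus>\<^bsub>E\<^esub> d \<odot>\<^bsub>E\<^esub> y) \<and>
     (\<forall>x\<in>carrier E. \<forall>c\<in>D. \<forall>d\<in>D. (c + d) \<odot>\<^bsub>E\<^esub> x = c \<odot>\<^bsub>E\<^esub> x \<oplus>\<^bsub>E\<^esub> d \<odot>\<^bsub>E\<^esub> x) \<and>
     (\<forall>x\<in>carrier E. \<forall>c\<in>D. \<forall>d\<in>D. (c * d) \<odot>\<^bsub>E\<^esub> x = d \<odot>\<^bsub>E\<^esub> (c \<odot>\<^bsub>E\<^esub> x)) \<and>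
     (\<forall>x\<in>carrier E. 1 \<odot>\<^bsub>E\<^esub> x = x) \<and>
     (\<forall>x\<in>carrier E. \<forall>y\<in>carrier E. ip E x y \<in> D) \<and>
     (\<forall>x\<in>carrier E. \<forall>y\<in>carrier E. \<forall>z\<in>carrier E. ip E x (y \<oplus>\<^bsub>E\<^esub> z) = ip E x y + ip E x z) \<and>
     (\<forall>x\<in>carrier E. \<forall>y\<in>carrier E. \<forall>d\<in>D. ip E x (d \<odot>\<^bsub>E\<^esub> y) = ip E x y * d) \<and>
     (\<forall>x\<in>carrier E. \<forall>y\<in>carrier E. ip E y x = star (ip E x y)) \<and>
     (\<forall>x\<in>carrier E. \<exists>d\<in>D. ip E x x = star d * d) \<and>
     (\<forall>x\<in>carrier E. ip E x x = 0 \<longrightarrow> x = \<zero>\<^bsub>E\<^esub>) \<and>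
     (\<forall>s. (\<forall>n. s n \<in> carrier E) \<and>
          (\<forall>\<epsilon>>0. \<exists>N::nat. \<forall>m\<ge>N. \<forall>n\<ge>N. module_norm E (s m \<ominus>\<^bsub>E\<^esub> s n) < \<epsilon>) \<longrightarrow>
          (\<exists>x\<in>carrier E. (\<lambda>n. module_norm E (s n \<ominus>\<^bsub>E\<^esub> x)) \<longlonglongrightarrow> 0))"

text \<open>Maps on \<open>E\<close> are functions on the type \<open>'e\<close>, of which only the values on the carrier matter.\<close>

definition is_adjoint ::
    "('d, 'e) hilbert_module \<Rightarrow> ('e \<Rightarrow> 'e) \<Rightarrow> ('e \<Rightarrow> 'e) \<Rightarrow> bool" where
  "is_adjoint E T S \<longleftrightarrow>
     (\<forall>x\<in>carrier E. S x \<in> carrier E) \<and>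
     (\<forall>x\<in>carrier E. \<forall>y\<in>carrier E. ip E (T x) y = ip E x (S y))"

text \<open>The algebra \<open>B\<^sup>a(E)\<close>. Linearity over \<open>D\<close> is a consequence of adjointability.\<close>

definition adjointable_maps :: "('d::unital_cstar_algebra, 'e) hilbert_module \<Rightarrow> ('e \<Rightarrow> 'e) set" where
  "adjointable_maps E =
     {T. (\<forall>x\<in>carrier E. T x \<in> carrier E) \<and>
         (\<exists>K. \<forall>x\<in>carrier E. module_norm E (T x) \<le> K * module_norm E x) \<and>
         (\<exists>S. is_adjoint E T S)}"

definition unital_star_hom ::
    "('d::unital_cstar_algebra, 'e) hilbert_module \<Rightarrow> ('a::unital_cstar_algebra \<Rightarrow> 'e \<Rightarrow> 'e) \<Rightarrow> bool" where
  "unital_star_hom E \<sigma> \<longleftrightarrow>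
     (\<forall>a. \<sigma> a \<in> adjointable_maps E) \<and>
     (\<forall>a b. \<forall>x\<in>carrier E. \<sigma> (a + b) x = \<sigma> a x \<oplus>\<^bsub>E\<^esub> \<sigma> b x) \<and>
     (\<forall>c a. \<forall>x\<in>carrier E. \<sigma> (c *\<^sub>C a) x = (c *\<^sub>C 1) \<odot>\<^bsub>E\<^esub> \<sigma> a x) \<and>
     (\<forall>a b. \<forall>x\<in>carrier E. \<sigma> (a * b) x = \<sigma> a (\<sigma> b x)) \<and>
     (\<forall>x\<in>carrier E. \<sigma> 1 x = x) \<and>
     (\<forall>a. is_adjoint E (\<sigma> a) (\<sigma> (star a)))"


section \<open>The completely bounded norm\<close>

text \<open>The C*-norm of \<open>M\<^sub>n(A)\<close> is the operator norm on the Hilbert \<open>A\<close>-module \<open>A\<^sup>n\<close>, and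
  \<open>M\<^sub>n(B\<^sup>a(E)) = B\<^sup>a(E\<^sup>n)\<close> carries the operator norm on \<open>E\<^sup>n\<close>.\<close>

definition column_norm :: "nat \<Rightarrow> (nat \<Rightarrow> 'a::unital_cstar_algebra) \<Rightarrow> real" where
  "column_norm n v = sqrt (norm (\<Sum>i<n. star (v i) * v i))"

definition matrix_norm :: "nat \<Rightarrow> (nat \<Rightarrow> nat \<Rightarrow> 'a::unital_cstar_algebra) \<Rightarrow> ennreal" where
  "matrix_norm n X =
     (SUP v\<in>{v. column_norm n v \<le> 1}. ennreal (column_norm n (\<lambda>i. \<Sum>j<n. X i j * v j)))"

definition module_column_norm ::
    "('d::unital_cstar_algebra, 'e) hilbert_module \<Rightarrow> nat \<Rightarrow> (nat \<Rightarrow> 'e) \<Rightarrow> real" where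
  "module_column_norm E n \<xi> = sqrt (norm (\<Sum>i<n. ip E (\<xi> i) (\<xi> i)))"

definition operator_matrix_norm ::
    "('d::unital_cstar_algebra, 'e) hilbert_module \<Rightarrow> nat \<Rightarrow> (nat \<Rightarrow> nat \<Rightarrow> 'e \<Rightarrow> 'e) \<Rightarrow> ennreal" where
  "operator_matrix_norm E n T =
     (SUP \<xi>\<in>{\<xi>. (\<forall>i<n. \<xi> i \<in> carrier E) \<and> module_column_norm E n \<xi> \<le> 1}.
        ennreal (module_column_norm E n (\<lambda>i. \<Oplus>\<^bsub>E\<^esub>j\<in>{..<n}. T i j (\<xi> j))))"

definition cb_norm ::
    "('d::unital_cstar_algebra, 'e) hilbert_module \<Rightarrow> ('a::unital_cstar_algebra \<Rightarrow> 'e \<Rightarrow> 'e) \<Rightarrow> ennreal" where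
  "cb_norm E \<Delta> =
     (SUP n. SUP X\<in>{X. matrix_norm n X \<le> 1}. operator_matrix_norm E n (\<lambda>i j. \<Delta> (X i j)))"


section \<open>Joint representation tuples and \<open>\<gamma>\<close>\<close>

definition joint_rep ::
    "'d::unital_cstar_algebra set \<Rightarrow> ('a::unital_cstar_algebra \<Rightarrow> 'd) \<Rightarrow> ('a \<Rightarrow> 'd) \<Rightarrow>
     ('d, 'e) hilbert_module \<Rightarrow> ('a \<Rightarrow> 'e \<Rightarrow> 'e) \<Rightarrow> ('a \<Rightarrow> 'e \<Rightarrow> 'e) \<Rightarrow> 'e \<Rightarrow> bool" where
  "joint_rep D \<phi>1 \<phi>2 E \<sigma>1 \<sigma>2 x \<longleftrightarrow>
     is_hilbert_module D E \<and> unital_star_hom E \<sigma>1 \<and> unital_star_hom E \<sigma>2 \<and>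
     x \<in> carrier E \<and> ip E x x = 1 \<and>
     (\<forall>a. \<phi>1 a = ip E x (\<sigma>1 a x)) \<and> (\<forall>a. \<phi>2 a = ip E x (\<sigma>2 a x))"

text \<open>The infimum defining \<open>\<gamma>\<close> is over Hilbert modules of any size, whereas a set in HOL contains
  only modules with carrier in a fixed type. The type below is large enough: restricting a tuple
  \<open>(E, \<sigma>\<^sub>1, \<sigma>\<^sub>2, x)\<close> to the closed submodule generated by \<open>x\<close> under both representations gives a
  tuple for the same maps without increasing the norm of \<open>\<sigma>\<^sub>1 - \<sigma>\<^sub>2\<close>, and each element of this
  submodule is the limit of a sequence of finite sums of vectors \<open>\<sigma>\<^sub>i(a) \<dots> \<sigma>\<^sub>j(b) x d\<close>, hence is
  coded by a sequence of lists as in \<open>generated\<close>. The arbitrary summand \<open>'e\<close> lets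
  modules over every type occur literally, and makes visible that \<open>\<gamma>\<close> does not depend on the
  choice.\<close>

type_synonym ('a, 'd) generated = "nat \<Rightarrow> ((bool \<times> 'a) list \<times> 'd) list"

type_synonym ('a, 'd, 'e) vectors = "'e + ('a, 'd) generated"

text \<open>The value is \<open>\<infinity>\<close> if there is no joint representation tuple.\<close>

definition gamma ::
    "'e itself \<Rightarrow> 'd::unital_cstar_algebra set \<Rightarrow> ('a::unital_cstar_algebra \<Rightarrow> 'd) \<Rightarrow> ('a \<Rightarrow> 'd) \<Rightarrow>
     ennreal" where
  "gamma _ D \<phi>1 \<phi>2 =
     (INF (E, \<sigma>1, \<sigma>2, x)\<in>{(E :: ('d, ('a, 'd, 'e) vectors) hilbert_module, \<sigma>1, \<sigma>2, x).
                               joint_rep D \<phi>1 \<phi>2 E \<sigma>1 \<sigma>2 x}.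
        cb_norm E (\<lambda>a \<xi>. \<sigma>1 a \<xi> \<ominus>\<^bsub>E\<^esub> \<sigma>2 a \<xi>))"

end

theory Submission
  imports Defs "HOL-Real_Asymp.Real_Asymp"
begin

text \<open>For \<open>D\<close> equal to \<open>B\<close> or to the algebra of all bounded operators, \<open>gamma\<close> over \<open>D\<close> equals the
  infimum over pairs of dilations \<open>\<phi>\<^sub>i(a) = V\<^sup>* \<sigma>\<^sub>i(a) V\<close> on Hilbert spaces, which does not depend
  on \<open>D\<close>. In one direction, a Hilbert \<open>D\<close>-module \<open>E\<close> is replaced by the Hilbert space
  \<open>E \<otimes>\<^sub>D G\<close>. In the other direction, injectivity yields a conditional expectation \<open>P\<close> onto \<open>B\<close>; the words
  \<open>w\<close> in \<open>\<sigma>\<^sub>1(a), \<sigma>\<^sub>2(a)\<close> receive the \<open>B\<close>-valued inner product \<open>P(V\<^sup>* w\<^sup>* w' V)\<close>, and complete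
  positivity and the bimodule property of \<open>P\<close> preserve the completely bounded norm of
  \<open>\<sigma>\<^sub>1 - \<sigma>\<^sub>2\<close>.

  For the triangle inequality, dilations \<open>(\<sigma>\<^sub>1, \<sigma>\<^sub>2)\<close> on \<open>H\<close> and \<open>(\<tau>\<^sub>2, \<tau>\<^sub>3)\<close> on \<open>K\<close> are glued along
  the minimal Stinespring dilation of \<open>\<phi>\<^sub>2\<close>, which embeds into both: the symmetry \<open>S\<close> of
  \<open>H \<oplus> K\<close> that interchanges the two copies commutes with \<open>\<sigma>\<^sub>2 \<oplus> \<tau>\<^sub>2\<close>, so that
  \<open>\<sigma>\<^sub>1 \<oplus> \<tau>\<^sub>2\<close> and \<open>S (\<sigma>\<^sub>2 \<oplus> \<tau>\<^sub>3) S\<close> are dilations of \<open>\<phi>\<^sub>1\<close> and \<open>\<phi>\<^sub>3\<close> by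
  the same isometry, whose difference has norm at most the sum of the two.\<close>

section \<open>Positivity in unital C*-algebras\<close>

text \<open>\<open>P\<close> is not multiplicative, so the represented operators themselves cannot
  be pushed down to \<open>B\<close>. What survives is a Gram kernel: free words form an index set
  on which the algebra acts by prefixing letters, and only the inner products of words pass through
  \<open>P\<close>. Spaces and representations are therefore built from kernels. The recurring
  analytic difficulty is twofold. A \<open>D\<close>-valued form is tested by columns with entries
  in \<open>D\<close>, whereas the Hilbert space needs arbitrary vectors of \<open>G\<close>; this
  gap is closed by \<open>positive_matrix_transfer\<close>. Cb norms bound norms, whereas
  \<open>P\<close> is applied to order inequalities; \<open>pos_of_norm_conj\<close> converts the
  former into the latter. Kernels arise within proofs and cannot index types. Their spaces are
  blocks of one universal space, so the representations obtained are unital only on a common block;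
  this is why joint dilations carry the condition \<open>\<sigma>1 1 = \<sigma>2 1\<close>.\<close>

lemma scaleC_zero_left [simp]: "0 *\<^sub>C (x::'v::complex_vector) = 0"
  using scaleR_scaleC[of 0 x] by simp

lemma scaleC_minus_left: "(- c) *\<^sub>C (x::'v::complex_vector) = - (c *\<^sub>C x)"
  using scaleC_add_left[of c "- c" x] by (simp add: eq_neg_iff_add_eq_0 add.commute)

lemma star_zero [simp]: "star (0::'a::unital_cstar_algebra) = 0"
  using star_scaleC[of 0 "0::'a"] by simp

lemma star_minus: "star (- x) = - star (x::'a::unital_cstar_algebra)"
  using star_scaleC[of "-1" x] by (simp add: scaleC_minus_left scaleC_one)

lemma star_diff: "star (x - y) = star x - star (y::'a::unital_cstar_algebra)"
  using star_add[of x "- y"] by (simp add: star_minus)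

lemma star_scaleR: "star (r *\<^sub>R x) = r *\<^sub>R star (x::'a::unital_cstar_algebra)"
  by (simp add: scaleR_scaleC star_scaleC)

lemma star_one [simp]: "star (1::'a::unital_cstar_algebra) = 1"
  by (metis mult_1_left mult_1_right star_mult star_star)

lemma star_sum: "star (\<Sum>i\<in>I. f i) = (\<Sum>i\<in>I. star (f i :: 'a::unital_cstar_algebra))"
  by (induction I rule: infinite_finite_induct) (simp_all add: star_add)

lemma star_power: "star (x ^ n) = star (x::'a::unital_cstar_algebra) ^ n"
  by (induction n) (simp_all add: star_mult power_commutes)

lemma norm_star [simp]: "norm (star x) = norm (x::'a::unital_cstar_algebra)"
proof -
  have le: "norm y \<le> norm (star y)" for y :: 'a
  proof (cases "norm y = 0")
    case False
    have "norm y * norm y \<le> norm (star y) * norm y"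
      using norm_mult_ineq[of "star y" y] cstar_identity[of y] by (simp add: power2_eq_square)
    then show ?thesis using False by simp
  qed simp
  from le[of x] le[of "star x"] show ?thesis by (simp add: star_star)
qed

lemma norm_one_le: "norm (1::'a::unital_cstar_algebra) \<le> 1"
proof -
  have "norm (1::'a) = norm (1::'a) * norm (1::'a)"
    using cstar_identity[of "1::'a"] by (simp add: power2_eq_square del: mult_cancel_right1)
  then show ?thesis by (metis mult_cancel_left1 order_refl zero_le_one)
qed

lemma norm_selfadj_square: "star s = s \<Longrightarrow> norm (s * s) = (norm (s::'a::unital_cstar_algebra))\<^sup>2"
  using cstar_identity[of s] by simp

text \<open>Stands in for the spectral radius formula: iterating the C*-identity makes the norm
  multiplicative along the exponents \<open>2 ^ k\<close>, which is enough to compare growth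
  rates.\<close>

lemma norm_selfadj_pow2: "star s = s \<Longrightarrow> norm ((s::'a::unital_cstar_algebra) ^ (2 ^ k)) = norm s ^ (2 ^ k)"
proof (induction k)
  case (Suc k)
  have "s ^ (2 ^ Suc k) = s ^ (2 ^ k) * s ^ (2 ^ k)"
    by (simp add: power_add[symmetric] mult_2)
  then show ?case using Suc by (simp add: norm_selfadj_square star_power power_mult[symmetric] mult.commute)
qed simp

lemma bounded_linear_star: "bounded_linear (star :: 'a::unital_cstar_algebra \<Rightarrow> 'a)"
  by (rule bounded_linear_intro[of _ 1]) (simp_all add: star_add star_scaleR)

lemma tendsto_star: "(f \<longlongrightarrow> l) F \<Longrightarrow> ((\<lambda>x. star (f x)) \<longlongrightarrow> star (l::'a::unital_cstar_algebra)) F"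
  by (rule bounded_linear.tendsto[OF bounded_linear_star])

lemma cstar_subalgebra_UNIV: "cstar_subalgebra UNIV"
  by (simp add: cstar_subalgebra_def)

lemma cstar_subalgebraD:
  assumes "cstar_subalgebra D"
  shows "1 \<in> D" "x \<in> D \<Longrightarrow> y \<in> D \<Longrightarrow> x + y \<in> D" "x \<in> D \<Longrightarrow> y \<in> D \<Longrightarrow> x * y \<in> D"
    "x \<in> D \<Longrightarrow> c *\<^sub>C x \<in> D" "x \<in> D \<Longrightarrow> star x \<in> D" "closed D"
    "0 \<in> D" "x \<in> D \<Longrightarrow> r *\<^sub>R x \<in> D" "x \<in> D \<Longrightarrow> - x \<in> D" "x \<in> D \<Longrightarrow> y \<in> D \<Longrightarrow> x - y \<in> D"
    "(\<And>i. i \<in> I \<Longrightarrow> f i \<in> D) \<Longrightarrow> (\<Sum>i\<in>I. f i) \<in> D"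
proof -
  show basic: "1 \<in> D" "x \<in> D \<Longrightarrow> y \<in> D \<Longrightarrow> x + y \<in> D" "x \<in> D \<Longrightarrow> y \<in> D \<Longrightarrow> x * y \<in> D"
    "x \<in> D \<Longrightarrow> c *\<^sub>C x \<in> D" "x \<in> D \<Longrightarrow> star x \<in> D" "closed D" for x y c
    using assms by (auto simp: cstar_subalgebra_def)
  show zero: "0 \<in> D" using basic(4)[OF basic(1), of 0] by simp
  show "x \<in> D \<Longrightarrow> r *\<^sub>R x \<in> D" by (simp add: scaleR_scaleC basic)
  show uminus: "x \<in> D \<Longrightarrow> - x \<in> D" for x
    using basic(4)[of x "-1"] by (simp add: scaleC_minus_left scaleC_one)
  show "x \<in> D \<Longrightarrow> y \<in> D \<Longrightarrow> x - y \<in> D"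
    using basic(2)[of x "- y"] uminus by simp
  show "(\<Sum>i\<in>I. f i) \<in> D" if "\<And>i. i \<in> I \<Longrightarrow> f i \<in> D"
    using that by (induction I rule: infinite_finite_induct) (simp_all add: zero basic)
qed

section \<open>Square roots near the identity by a fixed-point iteration\<close>

primrec sqrt_iter :: "'a::unital_cstar_algebra \<Rightarrow> nat \<Rightarrow> 'a" where
  "sqrt_iter r 0 = 0"
| "sqrt_iter r (Suc n) = (1/2) *\<^sub>R (r + sqrt_iter r n * sqrt_iter r n)"

primrec sqrt_iter_real :: "nat \<Rightarrow> real" where
  "sqrt_iter_real 0 = 0"
| "sqrt_iter_real (Suc n) = (1/2) * (1 + sqrt_iter_real n * sqrt_iter_real n)"

lemma sqrt_iter_real_bounds: "0 \<le> sqrt_iter_real n \<and> sqrt_iter_real n \<le> sqrt_iter_real (Suc n) \<and> sqrt_iter_real n \<le> 1"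
proof (induction n)
  case (Suc n)
  let ?a = "sqrt_iter_real n"
  let ?b = "sqrt_iter_real (Suc n)"
  have "?a * ?a \<le> 1" using Suc by (simp add: mult_le_one)
  then have "?b \<le> 1" by simp
  moreover have "?a * ?a \<le> ?b * ?b" using Suc by (intro mult_mono) auto
  ultimately show ?case using Suc by simp
qed simp

text \<open>Both bounds go through one induction. The difference of consecutive squares is split as
  \<open>S (S - T) + (S - T) T\<close>, which is valid without commutativity and whose estimate is
  an equality for the scalar iteration.\<close>

lemma sqrt_iter_norm:
  assumes "norm r \<le> 1"
  shows "norm (sqrt_iter r n) \<le> sqrt_iter_real n \<and>
    norm (sqrt_iter r (Suc n) - sqrt_iter r n) \<le> sqrt_iter_real (Suc n) - sqrt_iter_real n"
proof (induction n)
  case 0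
  then show ?case using assms by simp
next
  case (Suc n)
  let ?S = "sqrt_iter r" and ?s = "sqrt_iter_real"
  have b: "norm (?S (Suc n)) \<le> ?s (Suc n)"
    using Suc norm_triangle_ineq[of "?S (Suc n) - ?S n" "?S n"] by (simp del: sqrt_iter.simps sqrt_iter_real.simps)
  have "?S (Suc (Suc n)) - ?S (Suc n)
      = (1/2) *\<^sub>R (?S (Suc n) * (?S (Suc n) - ?S n) + (?S (Suc n) - ?S n) * ?S n)"
    by (simp only: sqrt_iter.simps(2)[of r "Suc n"] sqrt_iter.simps(2)[of r n, THEN arg_cong, of "\<lambda>x. _ - x"])
       (simp add: algebra_simps del: sqrt_iter.simps)
  then have "norm (?S (Suc (Suc n)) - ?S (Suc n))
      \<le> (1/2) * (norm (?S (Suc n) * (?S (Suc n) - ?S n)) + norm ((?S (Suc n) - ?S n) * ?S n))"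
    using norm_triangle_ineq by (simp del: sqrt_iter.simps)
  also have "\<dots> \<le> (1/2) * (?s (Suc n) * (?s (Suc n) - ?s n) + (?s (Suc n) - ?s n) * ?s n)"
    using Suc b sqrt_iter_real_bounds[of n] sqrt_iter_real_bounds[of "Suc n"]
    by (intro mult_left_mono add_mono order_trans[OF norm_mult_ineq] mult_mono)
      (simp_all del: sqrt_iter.simps sqrt_iter_real.simps)
  also have "\<dots> = ?s (Suc (Suc n)) - ?s (Suc n)"
    by (simp add: algebra_simps)
  finally show ?case using b by blast
qed

text \<open>The iteration \<open>S \<mapsto> (r + S\<^sup>2) / 2\<close> is dominated by its scalar version with \<open>r = 1\<close>; its limit
  \<open>S\<close> satisfies \<open>(1 - S)\<^sup>2 = 1 - r\<close>.\<close>

lemma sqrt_exists: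
  fixes a :: "'a::unital_cstar_algebra"
  assumes a: "star a = a" and n: "norm (1 - a) \<le> 1"
  shows "\<exists>s. star s = s \<and> s * s = a \<and> norm (1 - s) \<le> 1 \<and>
    (\<forall>D. cstar_subalgebra D \<and> a \<in> D \<longrightarrow> s \<in> D) \<and> (\<forall>y. y * a = a * y \<longrightarrow> y * s = s * y)"
proof -
  let ?S = "sqrt_iter (1 - a)" and ?s = sqrt_iter_real
  have "incseq ?s" using sqrt_iter_real_bounds by (intro incseq_SucI) blast
  then have conv: "convergent ?s"
    by (intro Bseq_monoseq_convergent BseqI'[of _ 1])
      (use sqrt_iter_real_bounds in \<open>auto simp: monoseq_iff simp del: sqrt_iter_real.simps\<close>)
  \<comment> \<open>Telescoping: the increments are dominated by those of the convergent scalar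
    sequence, hence the iterates are Cauchy.\<close>
  have step: "norm (?S (m + k) - ?S m) \<le> ?s (m + k) - ?s m" for m k
  proof (induction k)
    case (Suc k)
    have "norm (?S (m + Suc k) - ?S m) \<le> norm (?S (Suc (m + k)) - ?S (m + k)) + norm (?S (m + k) - ?S m)"
      using norm_triangle_ineq[of "?S (Suc (m + k)) - ?S (m + k)" "?S (m + k) - ?S m"]
      by (simp del: sqrt_iter.simps)
    then show ?case using Suc sqrt_iter_norm[OF n, of "m + k"] by (simp del: sqrt_iter.simps sqrt_iter_real.simps)
  qed simp
  have "Cauchy ?S"
  proof (rule metric_CauchyI)
    fix e :: real assume "0 < e"
    then obtain M where M: "\<And>m n. M \<le> m \<Longrightarrow> M \<le> n \<Longrightarrow> dist (?s m) (?s n) < e"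
      using conv[THEN convergent_Cauchy] unfolding Cauchy_def by blast
    have "dist (?S m) (?S n) < e" if "M \<le> m" "m \<le> n" for m n
      using M[of n m] that step[of m "n - m"] by (simp add: dist_norm norm_minus_commute)
    then have "dist (?S m) (?S n) < e" if "M \<le> m" "M \<le> n" for m n
      using that by (metis dist_commute linear)
    then show "\<exists>M. \<forall>m\<ge>M. \<forall>n\<ge>M. dist (?S m) (?S n) < e" by blast
  qed
  then obtain L where L: "?S \<longlonglongrightarrow> L" by (auto simp: Cauchy_convergent_iff convergent_def)
  have "?S (Suc n) = (1/2) *\<^sub>R ((1 - a) + ?S n * ?S n)" for n by simp
  then have "(\<lambda>n. ?S (Suc n)) \<longlonglongrightarrow> (1/2) *\<^sub>R ((1 - a) + L * L)"
    by (simp only:) (intro tendsto_intros L)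
  with LIMSEQ_Suc[OF L] have "L = (1/2) *\<^sub>R ((1 - a) + L * L)" by (rule LIMSEQ_unique)
  from arg_cong[OF this, of "\<lambda>x. 2 *\<^sub>R x"] have LL: "2 *\<^sub>R L = (1 - a) + L * L" by simp
  have Ssa: "star (?S n) = ?S n" for n
    by (induction n) (simp_all add: star_scaleR star_add star_diff star_mult a)
  have sa: "star L = L"
    using tendsto_star[OF L] L LIMSEQ_unique by (simp only: Ssa) blast
  have "norm (?S n) \<le> 1" for n
    using sqrt_iter_norm[OF n, of n] sqrt_iter_real_bounds[of n] by linarith
  then have nL: "norm L \<le> 1" by (intro LIMSEQ_le_const2[OF tendsto_norm[OF L]]) auto
  have mem: "1 - L \<in> D" if D: "cstar_subalgebra D" "a \<in> D" for D
  proof -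
    note D' = cstar_subalgebraD[OF D(1)]
    have "?S n \<in> D" for n by (induction n) (auto intro!: D' D)
    then have "L \<in> D" using closed_sequentially[OF D'(6) _ L] by blast
    then show ?thesis by (intro D')
  qed
  have comm: "y * (1 - L) = (1 - L) * y" if y: "y * a = a * y" for y
  proof -
    have Sy: "y * ?S n = ?S n * y" for n
    proof (induction n)
      case (Suc n)
      have "y * (?S n * ?S n) = ?S n * ?S n * y" by (metis Suc mult.assoc)
      then show ?case by (simp add: algebra_simps y)
    qed simp
    have "(\<lambda>n. y * ?S n) \<longlonglongrightarrow> y * L" "(\<lambda>n. ?S n * y) \<longlonglongrightarrow> L * y" by (intro tendsto_intros L)+
    then have "y * L = L * y" by (simp only: Sy) (rule LIMSEQ_unique)
    then show ?thesis by (simp add: algebra_simps)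
  qed
  have "(1 - L) * (1 - L) = a"
    using LL by (simp add: algebra_simps scaleR_2)
  moreover have "star (1 - L) = 1 - L" by (simp add: star_diff sa)
  moreover have "norm (1 - (1 - L)) \<le> 1" using nL by simp
  ultimately show ?thesis using mem comm by blast
qed

section \<open>The positive cone, up to the positivity of \<open>star x * x\<close>\<close>

text \<open>Encoded by a self-adjoint square root rather than by the spectrum. That elements
  \<open>star x * x\<close> are positive becomes a theorem, \<open>pos_star_times\<close>.\<close>

definition pos :: "'a::unital_cstar_algebra \<Rightarrow> bool" where
  "pos a \<longleftrightarrow> (\<exists>s. star s = s \<and> a = s * s)"

lemma pos_selfadj: "pos a \<Longrightarrow> star a = a"
  by (auto simp: pos_def star_mult)

text \<open>The unitary-like element \<open>u = r + i s\<close> satisfies \<open>u\<^sup>* u = r\<^sup>2 + s\<^sup>2\<close> and \<open>2 r = u + u\<^sup>*\<close>.\<close>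

lemma norm_commuting_squares:
  fixes r s :: "'a::unital_cstar_algebra"
  assumes r: "star r = r" and s: "star s = s" and rs: "r * s = s * r"
  shows "norm (r * r) \<le> norm (r * r + s * s)"
proof -
  define u where "u = r + \<i> *\<^sub>C s"
  have su: "star u = r - \<i> *\<^sub>C s"
    by (simp add: u_def star_add star_scaleC r s scaleC_minus_left)
  have "star u * u = r * r + s * s"
    unfolding su unfolding u_def
    by (simp add: algebra_simps mult_scaleC_left mult_scaleC_right scaleC_scaleC rs scaleC_minus_left
        scaleC_one scaleC_diff_right)
  then have nu: "(norm u)\<^sup>2 = norm (r * r + s * s)" by (simp flip: cstar_identity)
  have "2 *\<^sub>R r = u + star u" by (simp add: su) (simp add: u_def scaleR_2)
  then have "2 * norm r \<le> norm u + norm (star u)"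
    by (metis norm_triangle_ineq norm_scaleR abs_numeral)
  then have "norm r \<le> norm u" by simp
  then have "(norm r)\<^sup>2 \<le> (norm u)\<^sup>2" by (simp add: power_mono)
  then show ?thesis by (simp add: nu norm_selfadj_square r)
qed

text \<open>With \<open>r\<close> the square root of \<open>1 - s * s\<close>, the identity
  \<open>r * r + s * s = 1\<close> and the commutation of \<open>r\<close> and \<open>s\<close>
  bound \<open>r * r\<close> by the unit in norm.\<close>

lemma norm_one_minus_square:
  fixes s :: "'a::unital_cstar_algebra"
  assumes s: "star s = s" and n: "norm s \<le> 1"
  shows "norm (1 - s * s) \<le> 1"
proof -
  have "norm (1 - (1 - s * s)) \<le> 1"
    using n by (simp add: norm_selfadj_square s power_le_one)
  moreover have "star (1 - s * s) = 1 - s * s" by (simp add: star_diff star_mult s)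
  ultimately obtain r where r: "star r = r" "r * r = 1 - s * s"
    "\<And>y. y * (1 - s * s) = (1 - s * s) * y \<Longrightarrow> y * r = r * y"
    using sqrt_exists by blast
  have "s * r = r * s" by (rule r(3)) (simp add: algebra_simps)
  then have "norm (r * r) \<le> norm (r * r + s * s)"
    by (intro norm_commuting_squares[OF r(1) s]) simp
  also have "r * r + s * s = 1" using r(2) by simp
  finally show ?thesis using norm_one_le[where ?'a = 'a] r(2) by simp
qed

text \<open>One half of the norm criterion: for \<open>norm a \<le> t\<close>, a self-adjoint
  \<open>a\<close> is positive exactly when \<open>norm (t *\<^sub>R 1 - a) \<le> t\<close>. The
  converse is \<open>posI\<close>, which asks for \<open>0 < t\<close>. Sums and limits of positive
  elements are handled through this criterion. Rescaling by \<open>1 / sqrt t\<close> reduces to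
  \<open>t = 1\<close>.\<close>

lemma pos_norm_le:
  fixes a :: "'a::unital_cstar_algebra"
  assumes "pos a" and t: "norm a \<le> t"
  shows "norm (t *\<^sub>R 1 - a) \<le> t"
proof (cases "t = 0")
  case True
  then show ?thesis using t by simp
next
  case False
  then have tp: "0 < t" using t norm_ge_zero[of a] by linarith
  obtain s where s: "star s = s" "a = s * s" using assms(1) by (auto simp: pos_def)
  have "(norm s)\<^sup>2 \<le> t" using t by (simp add: s norm_selfadj_square)
  then have "norm ((1 / sqrt t) *\<^sub>R s) \<le> 1"
    using tp by (simp add: real_le_rsqrt)
  then have "norm (1 - (1 / sqrt t) *\<^sub>R s * (1 / sqrt t) *\<^sub>R s) \<le> 1"
    by (intro norm_one_minus_square) (simp_all add: star_scaleR s)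
  moreover have "t *\<^sub>R 1 - a = t *\<^sub>R (1 - (1 / sqrt t) *\<^sub>R s * (1 / sqrt t) *\<^sub>R s)"
    using tp by (simp add: s algebra_simps)
  ultimately show ?thesis using tp by (simp add: mult_le_cancel_left1)
qed

text \<open>\<open>sqrt_exists\<close> is applied twice, the second time to the root
  \<open>s\<close> itself, to see that \<open>s\<close> is again positive. One \<open>s\<close>
  serves all subalgebras and all commutation relations at once.\<close>

lemma pos_sqrt:
  fixes a :: "'a::unital_cstar_algebra"
  assumes a: "star a = a" and t: "0 < t" and n: "norm (t *\<^sub>R 1 - a) \<le> t"
  shows "\<exists>s. star s = s \<and> s * s = a \<and> pos s \<and>
    (\<forall>D. cstar_subalgebra D \<and> a \<in> D \<longrightarrow> s \<in> D) \<and> (\<forall>y. y * a = a * y \<longrightarrow> y * s = s * y)"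
proof -
  let ?b = "(1 / t) *\<^sub>R a"
  have "1 - ?b = (1 / t) *\<^sub>R (t *\<^sub>R 1 - a)" using t by (simp add: algebra_simps)
  then have nb: "norm (1 - ?b) \<le> 1" using t n by simp
  have sb: "star ?b = ?b" by (simp add: star_scaleR a)
  then obtain s where s: "star s = s" "s * s = ?b" "norm (1 - s) \<le> 1"
    "\<And>D. cstar_subalgebra D \<Longrightarrow> ?b \<in> D \<Longrightarrow> s \<in> D" "\<And>y. y * ?b = ?b * y \<Longrightarrow> y * s = s * y"
    using sqrt_exists[OF sb nb] by blast
  obtain p where p: "star p = p" "p * p = s" using sqrt_exists[OF s(1,3)] by blast
  have "star (sqrt (sqrt t) *\<^sub>R p) = sqrt (sqrt t) *\<^sub>R p
      \<and> sqrt t *\<^sub>R s = sqrt (sqrt t) *\<^sub>R p * sqrt (sqrt t) *\<^sub>R p"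
    using t by (simp add: star_scaleR p)
  then have "pos (sqrt t *\<^sub>R s)" unfolding pos_def by blast
  moreover have "star (sqrt t *\<^sub>R s) = sqrt t *\<^sub>R s" "sqrt t *\<^sub>R s * sqrt t *\<^sub>R s = a"
    using t by (simp_all add: star_scaleR s(1,2))
  moreover have "sqrt t *\<^sub>R s \<in> D" if "cstar_subalgebra D" "a \<in> D" for D
    using that by (intro cstar_subalgebraD(8) s(4))
  moreover have "y * sqrt t *\<^sub>R s = sqrt t *\<^sub>R s * y" if "y * a = a * y" for y
    using s(5)[of y] that by simp
  ultimately show ?thesis by blast
qed

lemma posI:
  assumes "star a = a" and "0 < t" and "norm (t *\<^sub>R 1 - a) \<le> t"
  shows "pos a"
  using pos_sqrt[OF assms] by (auto simp: pos_def)

lemma pos_has_sqrt: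
  fixes a :: "'a::unital_cstar_algebra"
  assumes "pos a"
  obtains s where "star s = s" "s * s = a" "pos s"
    "\<And>D. cstar_subalgebra D \<Longrightarrow> a \<in> D \<Longrightarrow> s \<in> D" "\<And>y. y * a = a * y \<Longrightarrow> y * s = s * y"
proof -
  have "norm ((norm a + 1) *\<^sub>R 1 - a) \<le> norm a + 1" by (rule pos_norm_le[OF assms]) simp
  moreover have "0 < norm a + 1" using norm_ge_zero[of a] by linarith
  ultimately show ?thesis using pos_sqrt[OF pos_selfadj[OF assms]] that by blast
qed

lemma pos_zero [simp]: "pos 0" and pos_one [simp]: "pos 1"
  by (auto simp: pos_def intro: exI[of _ 0] exI[of _ 1])

text \<open>The norm criterion adds up: the bounds for \<open>norm a *\<^sub>R 1 - a\<close> and for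
  \<open>(norm b + 1) *\<^sub>R 1 - b\<close> combine by the triangle inequality. The extra 1 keeps
  the constant strictly positive.\<close>

lemma pos_add:
  assumes "pos a" "pos b"
  shows "pos (a + b)"
proof (rule posI)
  show "star (a + b) = a + b" using assms by (simp add: star_add pos_selfadj)
  show "0 < norm a + norm b + 1" using norm_ge_zero[of a] norm_ge_zero[of b] by linarith
  have "norm ((norm a + norm b + 1) *\<^sub>R 1 - (a + b))
      \<le> norm (norm a *\<^sub>R 1 - a) + norm ((norm b + 1) *\<^sub>R 1 - b)"
    using norm_triangle_ineq[of "norm a *\<^sub>R 1 - a" "(norm b + 1) *\<^sub>R 1 - b"] by (simp add: algebra_simps)
  also have "\<dots> \<le> norm a + (norm b + 1)"
    using pos_norm_le[OF assms(1) order_refl] pos_norm_le[OF assms(2), of "norm b + 1"] by linarith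
  finally show "norm ((norm a + norm b + 1) *\<^sub>R 1 - (a + b)) \<le> norm a + norm b + 1" by simp
qed

lemma pos_sum: "(\<And>i. i \<in> I \<Longrightarrow> pos (f i)) \<Longrightarrow> pos (\<Sum>i\<in>I. f i)"
  by (induction I rule: infinite_finite_induct) (simp_all add: pos_add)

lemma pos_scaleR:
  assumes "pos a" "0 \<le> r"
  shows "pos (r *\<^sub>R a)"
proof -
  obtain s where "star s = s" "a = s * s" using assms(1) by (auto simp: pos_def)
  then show ?thesis using assms(2)
    by (auto simp: pos_def star_scaleR intro!: exI[of _ "sqrt r *\<^sub>R s"])
qed

text \<open>A bound \<open>K\<close> common to the whole convergent sequence turns the norm
  criterion into one closed condition.\<close>

lemma closed_pos: "closed {a::'a::unital_cstar_algebra. pos a}"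
  unfolding closed_sequential_limits
proof (intro allI impI, elim conjE)
  fix f :: "nat \<Rightarrow> 'a" and l assume f: "\<forall>n. f n \<in> {a. pos a}" and l: "f \<longlonglongrightarrow> l"
  obtain K where K: "\<And>n. norm (f n) \<le> K" "0 < K"
    using convergent_imp_Bseq[of f] l by (auto simp: convergent_def Bseq_def)
  have "(\<lambda>n. norm (K *\<^sub>R 1 - f n)) \<longlonglongrightarrow> norm (K *\<^sub>R 1 - l)" by (intro tendsto_intros l)
  then have "norm (K *\<^sub>R 1 - l) \<le> K"
    by (rule LIMSEQ_le_const2) (use f in \<open>auto intro!: exI[of _ 0] pos_norm_le K\<close>)
  moreover have "star (f n) = f n" for n using f pos_selfadj by auto
  then have "star l = l" using tendsto_star[OF l] l LIMSEQ_unique by simp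
  ultimately show "l \<in> {a. pos a}" using posI K(2) by auto
qed

lemma pos_norm_diff:
  assumes a: "star a = a" and t: "norm a \<le> t"
  shows "pos (t *\<^sub>R 1 - a)"
proof (cases "t = 0")
  case True
  then show ?thesis using t by simp
next
  case False
  then have "0 < t" using t norm_ge_zero[of a] by linarith
  then show ?thesis
    by (rule posI[rotated]) (use t a in \<open>simp_all add: star_diff star_scaleR\<close>)
qed

text \<open>The roots \<open>s\<close> of \<open>a\<close> and \<open>t\<close> of
  \<open>norm b *\<^sub>R 1 - a\<close> commute and their squares add up to a multiple of the unit,
  so that \<open>norm_commuting_squares\<close> applies.\<close>

lemma pos_norm_mono:
  fixes a b :: "'a::unital_cstar_algebra"
  assumes a: "pos a" and ab: "pos (b - a)"
  shows "norm a \<le> norm b"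
proof -
  have "star b = b" using pos_selfadj[OF pos_add[OF ab a]] by simp
  then have "pos ((norm b *\<^sub>R 1 - b) + (b - a))" by (intro pos_add ab pos_norm_diff) simp_all
  then have "pos (norm b *\<^sub>R 1 - a)" by simp
  then obtain t where t: "star t = t" "t * t = norm b *\<^sub>R 1 - a"
    "\<And>y. y * (norm b *\<^sub>R 1 - a) = (norm b *\<^sub>R 1 - a) * y \<Longrightarrow> y * t = t * y"
    by (rule pos_has_sqrt) blast
  obtain s where s: "star s = s" "s * s = a" using a by (auto simp: pos_def)
  have "s * a = a * s" by (simp only: s(2)[symmetric] mult.assoc)
  then have "s * (norm b *\<^sub>R 1 - a) = (norm b *\<^sub>R 1 - a) * s"
    by (simp only: left_diff_distrib right_diff_distrib mult_scaleR_left mult_scaleR_right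
        mult_1_left mult_1_right)
  then have "s * t = t * s" by (rule t(3))
  then have "norm (s * s) \<le> norm (s * s + t * t)" by (rule norm_commuting_squares[OF s(1) t(1)])
  also have "s * s + t * t = norm b *\<^sub>R 1" by (simp add: s t)
  finally show ?thesis
    using mult_left_mono[OF norm_one_le[where ?'a = 'a] norm_ge_zero[of b]] by (simp add: s)
qed

lemma pos_antisym: "pos a \<Longrightarrow> pos (- a) \<Longrightarrow> a = 0"
  using pos_norm_mono[of a 0] by simp

text \<open>Compare the growth in \<open>k\<close> of the two sides of
  \<open>(1 - c\<^sup>* c)\<^sup>k = 1 - (\<Sum>j<k. c\<^sup>* (1 - c c\<^sup>*)\<^sup>j c)\<close>.\<close>

lemma star_times_self_neg:
  fixes c :: "'a::unital_cstar_algebra"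
  assumes "pos (- (star c * c))"
  shows "c = 0"
proof (rule ccontr)
  assume c0: "c \<noteq> 0"
  define e where "e = (1 / norm c) *\<^sub>R c"
  have ne: "norm e = 1" using c0 by (simp add: e_def)
  define b where "b = - (star e * e)"
  have "b = (1 / (norm c)\<^sup>2) *\<^sub>R (- (star c * c))"
    by (simp add: b_def e_def star_scaleR power2_eq_square)
  then have b: "pos b" using assms by (simp add: pos_scaleR del: scaleR_minus_right)
  have sb: "star b = b" by (rule pos_selfadj[OF b])
  \<comment> \<open>Twice the real part and twice the imaginary part of \<open>e\<close>: half the
    sum of their squares is \<open>e * star e + star e * e\<close>, and adding \<open>b\<close>
    leaves \<open>e * star e\<close>.\<close>
  have "pos ((e + star e) * (e + star e))"
    by (auto simp: pos_def star_add star_star add.commute intro!: exI[of _ "e + star e"])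
  moreover have "pos (- ((star e - e) * (star e - e)))"
    unfolding pos_def by (rule exI[of _ "\<i> *\<^sub>C (star e - e)"])
      (simp add: star_diff star_star star_scaleC mult_scaleC_left mult_scaleC_right scaleC_scaleC
        scaleC_minus_left scaleC_one scaleC_diff_right algebra_simps)
  ultimately have "pos ((1/2) *\<^sub>R ((e + star e) * (e + star e) + - ((star e - e) * (star e - e))) + b)"
    by (intro pos_add pos_scaleR b) simp_all
  moreover have "(e + star e) * (e + star e) + - ((star e - e) * (star e - e)) = 2 *\<^sub>R (e * star e + star e * e)"
    by (simp add: distrib_left distrib_right left_diff_distrib right_diff_distrib scaleR_2)
  ultimately have d: "pos (e * star e)" by (simp add: b_def)
  have "norm (e * star e) = 1"
    using cstar_identity[of "star e"] ne by (simp add: star_star)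
  then have nd: "norm (1 - e * star e) \<le> 1"
    using pos_norm_le[OF d, of 1] by simp
  have tel: "(1 + b) ^ n = 1 - (\<Sum>j<n. star e * (1 - e * star e) ^ j * e)" for n
  proof (induction n)
    case (Suc n)
    have comm: "(1 + b) * (star e * (1 - e * star e) ^ j * e) = star e * (1 - e * star e) ^ Suc j * e" for j
      by (simp add: b_def algebra_simps)
    have "(1 + b) ^ Suc n = (1 + b) - (\<Sum>j<n. star e * (1 - e * star e) ^ Suc j * e)"
      by (simp only: power_Suc Suc right_diff_distrib sum_distrib_left comm mult_1_right)
    also have "\<dots> = 1 - (\<Sum>j<Suc n. star e * (1 - e * star e) ^ j * e)"
      by (subst sum.lessThan_Suc_shift) (simp add: b_def)
    finally show ?case .
  qed simp
  have bound: "norm ((1 + b) ^ n) \<le> 1 + real n" for n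
  proof -
    have pw: "norm ((1 - e * star e) ^ j) \<le> 1" for j
    proof (induction j)
      case 0 then show ?case using norm_one_le[where ?'a = 'a] by simp
    next
      case (Suc j)
      have "norm ((1 - e * star e) ^ Suc j) \<le> norm (1 - e * star e) * norm ((1 - e * star e) ^ j)"
        by (simp add: norm_mult_ineq)
      also have "\<dots> \<le> 1 * 1" by (intro mult_mono nd Suc) auto
      finally show ?case by simp
    qed
    have "norm (star e * (1 - e * star e) ^ j * e) \<le> 1" for j
    proof -
      have "norm (star e * (1 - e * star e) ^ j * e) \<le> norm (star e) * norm ((1 - e * star e) ^ j) * norm e"
        by (intro order_trans[OF norm_mult_ineq] mult_right_mono norm_mult_ineq) auto
      then show ?thesis using pw[of j] ne by simp
    qed
    then have "norm (\<Sum>j<n. star e * (1 - e * star e) ^ j * e) \<le> (\<Sum>j<n. 1)"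
      by (intro order_trans[OF norm_sum] sum_mono)
    then show ?thesis unfolding tel
      using norm_triangle_ineq4[of 1 "\<Sum>j<n. star e * (1 - e * star e) ^ j * e"] norm_one_le[where ?'a = 'a]
      by simp
  qed
  \<comment> \<open>The powers of the self-adjoint \<open>1 + b\<close> grow at most linearly, and
    their norm is exactly multiplicative along \<open>2 ^ i\<close>, which excludes a norm above
    1.\<close>
  have "norm (1 + b) \<le> 1"
  proof (rule ccontr)
    assume "\<not> norm (1 + b) \<le> 1"
    then have gt: "1 < norm (1 + b)" by simp
    have "star (1 + b) = 1 + b" by (simp add: star_add sb)
    from norm_selfadj_pow2[OF this] have "norm (1 + b) ^ (2 ^ i) \<le> 1 + 2 ^ i" for i
      using bound[of "2 ^ i"] by simp
    then have le: "norm (1 + b) ^ (2 ^ i) / (1 + 2 ^ i) \<le> 1" for i :: nat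
      by (simp add: add_pos_pos)
    have "filterlim (\<lambda>n. x ^ n / (1 + real n)) at_top sequentially" if "1 < x" for x :: real
      using that by real_asymp
    from this[OF gt]
    have "filterlim (\<lambda>n. norm (1 + b) ^ n / (1 + real n)) at_top sequentially" .
    moreover have "filterlim (\<lambda>i. 2 ^ i :: nat) at_top sequentially"
      by (rule filterlim_subseq) (simp add: strict_mono_def)
    ultimately have "filterlim (\<lambda>i. norm (1 + b) ^ (2 ^ i) / (1 + real (2 ^ i))) at_top sequentially"
      by (rule filterlim_compose)
    then have "eventually (\<lambda>i. 2 \<le> norm (1 + b) ^ (2 ^ i) / (1 + real (2 ^ i))) sequentially"
      by (simp add: filterlim_at_top)
    then obtain i where "2 \<le> norm (1 + b) ^ (2 ^ i) / (1 + real (2 ^ i))"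
      by (auto simp: eventually_sequentially)
    then show False using le[of i] by simp
  qed
  \<comment> \<open>\<open>norm (1 - (- b)) \<le> 1\<close> is the norm criterion for
    \<open>- b\<close>. As \<open>b\<close> is positive too, it vanishes.\<close>
  then have "pos (- b)"
    by (intro posI[of _ 1]) (simp_all add: star_minus sb)
  then have "b = 0" using pos_antisym b by blast
  then show False using ne cstar_identity[of e] by (simp add: b_def)
qed

text \<open>With \<open>m\<close> the absolute value of \<open>a\<close>, the element
  \<open>q = m - a\<close> is twice the negative part, and \<open>a * q = - (m * q)\<close>. Hence
  \<open>star (x * q) * (x * q)\<close> is minus a positive square and \<open>x * q = 0\<close> by
  \<open>star_times_self_neg\<close>; this forces \<open>q * q = 0\<close>, that is,
  \<open>a = m\<close>.\<close>

lemma pos_star_times: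
  fixes x :: "'a::unital_cstar_algebra"
  shows "pos (star x * x)"
proof -
  define a where "a = star x * x"
  have a: "star a = a" by (simp add: a_def star_mult star_star)
  have "pos (a * a)" using a by (auto simp: pos_def)
  then obtain m where m: "star m = m" "m * m = a * a" "pos m" "\<And>y. y * (a * a) = a * a * y \<Longrightarrow> y * m = m * y"
    by (rule pos_has_sqrt) blast
  have am: "a * m = m * a" by (rule m(4)) (simp add: mult.assoc)
  obtain n where n: "star n = n" "n * n = m" "\<And>y. y * m = m * y \<Longrightarrow> y * n = n * y"
    using m(3) by (rule pos_has_sqrt) blast
  define q where "q = m - a"
  have q: "star q = q" by (simp add: q_def star_diff m a)
  have qm: "q * m = m * q" by (simp add: q_def algebra_simps am)
  have qn: "q * n = n * q" by (rule n(3)) (rule qm)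
  have aq: "a * q = - (m * q)" by (simp add: q_def algebra_simps am m(2))
  have "star (x * q) * (x * q) = q * (a * q)" by (simp add: star_mult q a_def mult.assoc)
  also have "\<dots> = - ((n * q) * (n * q))"
    by (simp add: aq flip: n(2)) (metis qn mult.assoc)
  finally have c: "star (x * q) * (x * q) = - ((n * q) * (n * q))" .
  moreover have "pos ((n * q) * (n * q))" by (auto simp: pos_def star_mult n q qn intro!: exI[of _ "n * q"])
  ultimately have "x * q = 0" by (intro star_times_self_neg) simp
  then have "a * q = 0" by (simp add: a_def mult.assoc)
  then have mq: "m * q = 0" using aq by simp
  have "q * q = m * q - a * q" by (simp add: q_def algebra_simps)
  then have "q * q = 0" using mq \<open>a * q = 0\<close> by simp
  then have "q = 0" using norm_selfadj_square[OF q] by simp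
  then show ?thesis using m(3) by (simp add: q_def a_def)
qed

lemma pos_conj:
  assumes "pos a"
  shows "pos (star x * a * x)"
proof -
  obtain s where "star s = s" "a = s * s" using assms by (auto simp: pos_def)
  then have "star x * a * x = star (s * x) * (s * x)" by (simp add: star_mult mult.assoc)
  then show ?thesis by (simp add: pos_star_times)
qed

lemma pos_norm_one_diff: "norm x \<le> t \<Longrightarrow> 0 \<le> t \<Longrightarrow> pos (t\<^sup>2 *\<^sub>R 1 - star x * x)"
  by (rule pos_norm_diff) (simp_all add: star_mult star_star cstar_identity)

section \<open>From norm inequalities to order inequalities\<close>

lemma pos_approx:
  fixes a b :: "'a::unital_cstar_algebra"
  assumes "\<And>\<epsilon>::real. 0 < \<epsilon> \<Longrightarrow> pos (a + \<epsilon> *\<^sub>R b)"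
  shows "pos a"
proof -
  have "(\<lambda>n. a + (1 / real (Suc n)) *\<^sub>R b) \<longlonglongrightarrow> a + 0 *\<^sub>R b"
    by (intro tendsto_intros LIMSEQ_Suc[OF lim_1_over_n])
  with closed_sequentially[OF closed_pos, of "\<lambda>n. a + (1 / real (Suc n)) *\<^sub>R b"] assms
  show ?thesis by simp
qed

text \<open>Neumann series; its partial sums stay in \<open>D\<close>, which is closed, so the
  inverse is found inside \<open>D\<close>.\<close>

lemma inverse_near_one:
  fixes r :: "'a::unital_cstar_algebra"
  assumes D: "cstar_subalgebra D" and r: "r \<in> D" and n: "norm r < 1"
  shows "\<exists>v\<in>D. v * (1 - r) = 1 \<and> (1 - r) * v = 1"
proof -
  note D' = cstar_subalgebraD[OF D]
  have np: "norm (r ^ k) \<le> norm r ^ k" for k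
  proof (induction k)
    case 0 then show ?case using norm_one_le[where ?'a = 'a] by simp
  next
    case (Suc k)
    then show ?case
      using order_trans[OF norm_mult_ineq mult_left_mono[OF Suc norm_ge_zero]] by simp
  qed
  have "summable (\<lambda>k. r ^ k)"
    by (rule summable_comparison_test'[OF summable_geometric[of "norm r"]]) (use n np in auto)
  then have "(\<lambda>k. \<Sum>j<k. r ^ j) \<longlonglongrightarrow> (\<Sum>j. r ^ j)" by (rule summable_LIMSEQ)
  then obtain v where v: "(\<lambda>k. \<Sum>j<k. r ^ j) \<longlonglongrightarrow> v" by blast
  have rp: "r ^ k \<in> D" for k by (induction k) (auto intro!: D' r)
  have "v \<in> D" using closed_sequentially[OF D'(6) _ v] by (auto intro!: D' rp)
  have "(\<lambda>k. norm (r ^ k)) \<longlonglongrightarrow> 0"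
    by (rule Lim_null_comparison[OF _ LIMSEQ_power_zero[of "norm r"]]) (use n np in auto)
  then have z: "(\<lambda>k. r ^ k) \<longlonglongrightarrow> 0" by (simp add: tendsto_norm_zero_iff)
  have tel: "(\<Sum>j<k. r ^ j) * (1 - r) = 1 - r ^ k" "(1 - r) * (\<Sum>j<k. r ^ j) = 1 - r ^ k" for k
  proof (induction k)
    case (Suc k)
    have "(\<Sum>j<Suc k. r ^ j) * (1 - r) = (\<Sum>j<k. r ^ j) * (1 - r) + (r ^ k - r ^ k * r)"
      "(1 - r) * (\<Sum>j<Suc k. r ^ j) = (1 - r) * (\<Sum>j<k. r ^ j) + (r ^ k - r * r ^ k)"
      by (simp_all add: distrib_right distrib_left left_diff_distrib right_diff_distrib)
    then show "(\<Sum>j<Suc k. r ^ j) * (1 - r) = 1 - r ^ Suc k" "(1 - r) * (\<Sum>j<Suc k. r ^ j) = 1 - r ^ Suc k"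
      by (simp_all only: Suc) (simp_all add: power_commutes)
  qed simp_all
  have "(\<lambda>k. (\<Sum>j<k. r ^ j) * (1 - r)) \<longlonglongrightarrow> v * (1 - r)" "(\<lambda>k. (1 - r) * (\<Sum>j<k. r ^ j)) \<longlonglongrightarrow> (1 - r) * v"
    by (intro tendsto_intros v)+
  moreover have "(\<lambda>k. 1 - r ^ k) \<longlonglongrightarrow> 1 - 0" by (intro tendsto_intros z)
  ultimately have "v * (1 - r) = 1" "(1 - r) * v = 1" unfolding tel using LIMSEQ_unique by force+
  with \<open>v \<in> D\<close> show ?thesis by blast
qed

text \<open>Conjugating with \<open>d = (p + \<epsilon>)\<^sup>-\<^sup>1\<^sup>/\<^sup>2\<close> normalizes \<open>p\<close>, which turns the norm inequality into an
  order inequality.\<close>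

lemma pos_of_norm_conj:
  fixes p q :: "'a::unital_cstar_algebra"
  assumes D: "cstar_subalgebra D" and p: "pos p" "p \<in> D" and q: "star q = q" and c: "0 \<le> c"
    and le: "\<And>d. d \<in> D \<Longrightarrow> norm (star d * p * d) \<le> 1 \<Longrightarrow> norm (star d * q * d) \<le> c"
  shows "pos (c *\<^sub>R p - q)"
proof (rule pos_approx[of _ "c *\<^sub>R 1"])
  fix \<epsilon> :: real assume e: "0 < \<epsilon>"
  note D' = cstar_subalgebraD[OF D]
  \<comment> \<open>\<open>u\<close> is \<open>p\<close> made invertible; writing
    \<open>u = t *\<^sub>R (1 - r)\<close> with \<open>norm r < 1\<close> puts its inverse
    \<open>w\<close> into \<open>D\<close>.\<close>
  define u t where "u = p + \<epsilon> *\<^sub>R 1" and "t = norm p + \<epsilon>"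
  have t: "0 < t" using e by (simp add: t_def add_nonneg_pos)
  define r where "r = (1 / t) *\<^sub>R (norm p *\<^sub>R 1 - p)"
  have "norm (norm p *\<^sub>R 1 - p) \<le> norm p" using pos_norm_le[OF p(1) order_refl] .
  then have "norm r < 1" using t e by (simp add: r_def t_def)
  moreover have "r \<in> D" unfolding r_def by (intro D' p)
  ultimately obtain v where v: "v \<in> D" "v * (1 - r) = 1" "(1 - r) * v = 1"
    using inverse_near_one[OF D] by blast
  have u: "u = t *\<^sub>R (1 - r)" using t
    by (simp add: u_def r_def scaleR_right_diff_distrib) (simp add: t_def scaleR_left_distrib)
  define w where "w = (1 / t) *\<^sub>R v"
  have w: "w \<in> D" "w * u = 1" "u * w = 1" using t v by (simp_all add: w_def u D')
  have "pos u" unfolding u_def by (intro pos_add p pos_scaleR) (use e in auto)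
  then obtain h where h: "star h = h" "h * h = u" "\<And>D. cstar_subalgebra D \<Longrightarrow> u \<in> D \<Longrightarrow> h \<in> D"
    by (rule pos_has_sqrt) blast
  have uD: "u \<in> D" unfolding u_def by (intro D' p)
  have hD: "h \<in> D" by (rule h(3)[OF D uD])
  have hw: "h * w = w * h"
  proof -
    have "w * u * (h * w) = w * h * (u * w)" by (simp only: h(2)[symmetric] mult.assoc)
    then show ?thesis by (simp add: w)
  qed
  have sw: "star w = w"
  proof -
    have "star u = u" using \<open>pos u\<close> by (rule pos_selfadj)
    then have "star w * u = 1" using w(3) by (metis star_mult star_one)
    then have "star w * u * w = w" by simp
    then show ?thesis by (simp add: mult.assoc w)
  qed
  \<comment> \<open>\<open>d\<close> is the inverse square root of \<open>u\<close>, since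
    \<open>h\<close> is the root of \<open>u\<close> and commutes with \<open>w\<close>.\<close>
  define d where "d = w * h"
  have dD: "d \<in> D" unfolding d_def by (intro D' w hD)
  have sd: "star d = d" by (simp add: d_def star_mult sw h hw)
  have "d * h = w * (h * h)" "h * d = w * (h * h)"
    by (simp only: d_def mult.assoc) (simp only: d_def mult.assoc[symmetric] hw)
  then have hd: "h * d = 1" "d * h = 1" by (simp_all add: h w)
  have "d * u * d = (d * h) * (h * d)" by (simp only: h(2)[symmetric] mult.assoc)
  then have "d * u * d = 1" by (simp add: hd)
  \<comment> \<open>So \<open>d\<close> is admissible in the hypothesis; conjugating the resulting
    bound with \<open>h\<close> undoes the normalization.\<close>
  then have "1 - d * p * d = \<epsilon> *\<^sub>R (d * d)" by (simp add: u_def algebra_simps)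
  then have "pos (1 - star d * p * d)" using e sd pos_scaleR[OF pos_star_times[of d], of \<epsilon>] by simp
  then have "norm (star d * p * d) \<le> norm (1::'a)" by (intro pos_norm_mono pos_conj p)
  then have "norm (star d * q * d) \<le> c" using norm_one_le[where ?'a = 'a] by (intro le dD) linarith
  then have "pos (c *\<^sub>R 1 - star d * q * d)"
    by (intro pos_norm_diff) (simp_all add: star_mult sd q mult.assoc)
  then have "pos (star h * (c *\<^sub>R 1 - star d * q * d) * h)" by (rule pos_conj)
  moreover have "star h * (c *\<^sub>R 1 - star d * q * d) * h = c *\<^sub>R u - q"
  proof -
    have "h * (d * q * d) * h = (h * d) * q * (d * h)" by (simp only: mult.assoc)
    then have "h * (d * q * d) * h = q" by (simp add: hd)
    then show ?thesis by (simp add: h sd algebra_simps flip: h(2))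
  qed
  moreover have "c *\<^sub>R u - q = c *\<^sub>R p - q + \<epsilon> *\<^sub>R (c *\<^sub>R 1)"
    by (simp add: u_def scaleR_add_right mult.commute)
  ultimately show "pos (c *\<^sub>R p - q + \<epsilon> *\<^sub>R (c *\<^sub>R 1))" by (simp only:)
qed


section \<open>Hilbert spaces and bounded operators\<close>

lemma cinner_add_left: "cinner (x + y) z = cinner x z + cinner y (z::'g::chilbert_space)"
  by (metis cinner_commute cinner_add_right complex_cnj_add)

lemma cinner_zero [simp]: "cinner 0 (x::'g::chilbert_space) = 0" "cinner (x::'g) 0 = 0"
  using cinner_scaleC_left[of 0 "0::'g" x] cinner_scaleC_right[of x 0 "0::'g"] by simp_all

lemma cinner_minus: "cinner (- x) (y::'g::chilbert_space) = - cinner x y" "cinner x (- y) = - cinner x y"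
  using cinner_add_left[of x "- x" y] cinner_add_right[of x y "- y"]
  by (simp_all add: eq_neg_iff_add_eq_0 add.commute)

lemma cinner_diff: "cinner (x - y) (z::'g::chilbert_space) = cinner x z - cinner y z"
  "cinner z (x - y) = cinner z x - cinner z y"
  using cinner_add_left[of x "- y" z] cinner_add_right[of z x "- y"] by (simp_all add: cinner_minus)

lemma cinner_sum_left: "cinner (\<Sum>i\<in>I. f i) (y::'g::chilbert_space) = (\<Sum>i\<in>I. cinner (f i) y)"
  by (induction I rule: infinite_finite_induct) (simp_all add: cinner_add_left)

lemma cinner_sum_right: "cinner x (\<Sum>i\<in>I. f i :: 'g::chilbert_space) = (\<Sum>i\<in>I. cinner x (f i))"
  by (induction I rule: infinite_finite_induct) (simp_all add: cinner_add_right)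

lemma cinner_self: "cinner x (x::'g::chilbert_space) = complex_of_real ((norm x)\<^sup>2)"
proof (rule complex_eqI)
  have "Im (cinner x x) = - Im (cinner x x)"
    using cinner_commute[of x x] by (metis cnj.simps(2))
  then show "Im (cinner x x) = Im (complex_of_real ((norm x)\<^sup>2))" by simp
qed (simp add: power2_norm_eq_inner inner_eq_Re_cinner)

lemma cinner_scaleR: "cinner (r *\<^sub>R x) (y::'g::chilbert_space) = r *\<^sub>R cinner x y"
  "cinner x (r *\<^sub>R y) = r *\<^sub>R cinner x y"
  by (simp_all add: scaleR_scaleC cinner_scaleC_left cinner_scaleC_right scaleR_conv_of_real)

lemma norm_eq_Re_cinner: "(norm (x::'g::chilbert_space))\<^sup>2 = Re (cinner x x)"
  by (simp add: cinner_self)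

lemma cinner_eqI: "(\<And>y. cinner y x = cinner y z) \<Longrightarrow> x = (z::'g::chilbert_space)"
  by (metis cinner_diff(2) cinner_self norm_eq_zero of_real_eq_0_iff power_eq_0_iff right_minus_eq)

lemma tendsto_cinner:
  "(f \<longlongrightarrow> a) F \<Longrightarrow> (g \<longlongrightarrow> b) F \<Longrightarrow> ((\<lambda>x. cinner (f x) (g x)) \<longlongrightarrow> cinner a (b::'g::chilbert_space)) F"
proof -
  assume f: "(f \<longlongrightarrow> a) F" and g: "(g \<longlongrightarrow> b) F"
  have "bounded_linear (\<lambda>v::'g. \<i> *\<^sub>C v)"
    by (rule bounded_linear_intro[of _ "1"])
      (simp_all add: scaleC_add_right scaleC_scaleR chilbert_norm_scaleC)
  from bounded_linear.tendsto[OF this f] show ?thesis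
    unfolding cinner_eq_inner Complex_eq by (intro tendsto_intros f g)
qed

lemma bop_apply_more:
  "bop_apply (0::'g::chilbert_space bop) x = 0" "bop_apply (S - T) x = bop_apply S x - bop_apply T x"
  "bop_apply (- T) x = - bop_apply T x" "bop_apply T 0 = 0" "bop_apply T (- x) = - bop_apply T x"
  "bop_apply T (x - y) = bop_apply T x - bop_apply T y"
  by (simp_all add: bop_apply_def blinfun_of_bop_ops blinfun.bilinear_simps)

lemma bop_apply_sum: "bop_apply (\<Sum>i\<in>I. T i) x = (\<Sum>i\<in>I. bop_apply (T i) (x::'g::chilbert_space))"
  by (induction I rule: infinite_finite_induct) (simp_all add: bop_apply_more bop_apply_ops)

lemma bop_apply_sum_right: "bop_apply T (\<Sum>i\<in>I. f i) = (\<Sum>i\<in>I. bop_apply T (f i :: 'g::chilbert_space))"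
  by (induction I rule: infinite_finite_induct) (simp_all add: bop_apply_more bop_apply_add)

lemma bounded_linear_bop_apply: "bounded_linear (bop_apply (T::'g::chilbert_space bop))"
  unfolding bop_apply_def by (rule blinfun.bounded_linear_right)

text \<open>The form \<open>R - R R\<close> is the sum of \<open>R (1 - R) R\<close> and
  \<open>(1 - R) R (1 - R)\<close>, hence nonnegative, so the squared norm of \<open>R g\<close> is
  at most the value at \<open>g\<close> of the form of \<open>R\<close>.\<close>

lemma Re_cinner_bop_power2:
  fixes R :: "'g::chilbert_space bop"
  assumes R: "star R = R" and pos: "\<And>g. 0 \<le> Re (cinner g (bop_apply R g))"
    and le: "\<And>g. Re (cinner g (bop_apply R g)) \<le> (norm g)\<^sup>2"
  shows "norm R \<le> 1"
proof (rule norm_bop_bound)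
  fix g
  let ?h = "bop_apply R g"
  have sa: "cinner (bop_apply R x) y = cinner x (bop_apply R y)" for x y
    using bop_apply_star[of R x y] by (simp add: R)
  have "Re (cinner g ?h) - (norm ?h)\<^sup>2
      = ((norm ?h)\<^sup>2 - Re (cinner ?h (bop_apply R ?h))) + Re (cinner (g - ?h) (bop_apply R (g - ?h)))"
    by (simp add: norm_eq_Re_cinner cinner_diff bop_apply_more sa)
  then have "(norm ?h)\<^sup>2 \<le> Re (cinner g ?h)" using le[of ?h] pos[of "g - ?h"] by linarith
  then have "(norm ?h)\<^sup>2 \<le> (norm g)\<^sup>2" using le[of g] by linarith
  then show "norm ?h \<le> 1 * norm g" by simp
qed simp

text \<open>Agreement of the abstract order with the order of quadratic forms. For the converse,
  \<open>1 - (1 / t) *\<^sub>R T\<close> has its form between 0 and 1, hence norm at most 1, and the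
  norm criterion concludes.\<close>

lemma pos_bop_iff:
  fixes T :: "'g::chilbert_space bop"
  shows "pos T \<longleftrightarrow> star T = T \<and> (\<forall>g. 0 \<le> Re (cinner g (bop_apply T g)))"
proof (intro iffI conjI allI)
  assume T: "pos T"
  then show "star T = T" by (rule pos_selfadj)
  obtain s where s: "star s = s" "T = s * s" using T by (auto simp: pos_def)
  show "0 \<le> Re (cinner g (bop_apply T g))" for g
    using bop_apply_star[of s g "bop_apply s g", symmetric]
    by (simp add: s bop_apply_ops flip: norm_eq_Re_cinner)
next
  assume T: "star T = T \<and> (\<forall>g. 0 \<le> Re (cinner g (bop_apply T g)))"
  define t where "t = norm T + 1"
  have t: "0 < t" by (simp add: t_def add_nonneg_pos)
  have "norm (1 - (1 / t) *\<^sub>R T) \<le> 1"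
  proof (rule Re_cinner_bop_power2)
    show "star (1 - (1 / t) *\<^sub>R T) = 1 - (1 / t) *\<^sub>R T" using T by (simp add: star_diff star_scaleR)
    fix g
    have "Re (cinner g (bop_apply T g)) \<le> norm g * norm (bop_apply T g)"
      by (simp add: norm_cauchy_schwarz flip: inner_eq_Re_cinner)
    also have "\<dots> \<le> norm g * (t * norm g)"
      using norm_bop_apply[of T g] norm_ge_zero[of g] unfolding t_def distrib_right
      by (intro mult_left_mono) linarith+
    finally have le: "Re (cinner g (bop_apply T g)) / t \<le> (norm g)\<^sup>2"
      using t by (simp add: field_simps power2_eq_square)
    have eq: "Re (cinner g (bop_apply (1 - (1 / t) *\<^sub>R T) g)) = (norm g)\<^sup>2 - Re (cinner g (bop_apply T g)) / t"
      by (simp add: bop_apply_more bop_apply_ops cinner_diff cinner_scaleR norm_eq_Re_cinner)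
    show "0 \<le> Re (cinner g (bop_apply (1 - (1 / t) *\<^sub>R T) g))"
      "Re (cinner g (bop_apply (1 - (1 / t) *\<^sub>R T) g)) \<le> (norm g)\<^sup>2"
      unfolding eq using le T t by auto
  qed
  then have "norm (t *\<^sub>R (1 - (1 / t) *\<^sub>R T)) \<le> t" using t by simp
  then have "norm (t *\<^sub>R 1 - T) \<le> t" using t by (simp add: scaleR_right_diff_distrib)
  then show "pos T" using posI t T by blast
qed

lemma pos_bop_cinner: "pos T \<Longrightarrow> 0 \<le> Re (cinner g (bop_apply T g))"
  by (simp add: pos_bop_iff)


section \<open>Matrices over C*-algebras\<close>

text \<open>The inner product of the Hilbert module \<open>A^n\<close> of columns. Positivity of a
  matrix \<open>X\<close> is tested below through \<open>cip n v (mapp n X v)\<close>.\<close>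

definition cip :: "nat \<Rightarrow> (nat \<Rightarrow> 'a::unital_cstar_algebra) \<Rightarrow> (nat \<Rightarrow> 'a) \<Rightarrow> 'a" where
  "cip n v w = (\<Sum>i<n. star (v i) * w i)"

definition mapp :: "nat \<Rightarrow> (nat \<Rightarrow> nat \<Rightarrow> 'a::unital_cstar_algebra) \<Rightarrow> (nat \<Rightarrow> 'a) \<Rightarrow> nat \<Rightarrow> 'a" where
  "mapp n X v = (\<lambda>i. \<Sum>j<n. X i j * v j)"

definition mmul ::
    "nat \<Rightarrow> (nat \<Rightarrow> nat \<Rightarrow> 'a::unital_cstar_algebra) \<Rightarrow> (nat \<Rightarrow> nat \<Rightarrow> 'a) \<Rightarrow> nat \<Rightarrow> nat \<Rightarrow> 'a" where
  "mmul n X Y = (\<lambda>i j. \<Sum>k<n. X i k * Y k j)"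

definition hermitian_matrix :: "nat \<Rightarrow> (nat \<Rightarrow> nat \<Rightarrow> 'a::unital_cstar_algebra) \<Rightarrow> bool" where
  "hermitian_matrix n X \<longleftrightarrow> (\<forall>i<n. \<forall>j<n. X j i = star (X i j))"

lemma hermitian_matrixD: "hermitian_matrix n X \<Longrightarrow> i < n \<Longrightarrow> j < n \<Longrightarrow> star (X i j) = X j i"
  by (metis hermitian_matrix_def)

lemma cip_diff: "cip n (\<lambda>i. v i - w i) u = cip n v u - cip n w u"
  "cip n u (\<lambda>i. v i - w i) = cip n u v - cip n u w"
  by (simp_all add: cip_def star_diff algebra_simps sum_subtractf)

lemma cip_cong: "(\<And>i. i < n \<Longrightarrow> v i = v' i) \<Longrightarrow> (\<And>i. i < n \<Longrightarrow> w i = w' i) \<Longrightarrow> cip n v w = cip n v' w'"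
  by (simp add: cip_def)

lemma cip_self_pos: "pos (cip n v v)"
  unfolding cip_def by (intro pos_sum pos_star_times)

lemma cip_commute: "star (cip n v w) = cip n w v"
  by (simp add: cip_def star_sum star_mult star_star)

lemma mapp_diff: "mapp n X (\<lambda>i. v i - w i) = (\<lambda>i. mapp n X v i - mapp n X w i)"
  by (simp add: mapp_def right_diff_distrib sum_subtractf)

lemma mapp_mmul: "mapp n (mmul n X Y) v = mapp n X (mapp n Y v)"
proof
  fix i
  have "(\<Sum>j<n. \<Sum>k<n. X i k * Y k j * v j) = (\<Sum>k<n. \<Sum>j<n. X i k * Y k j * v j)" by (rule sum.swap)
  then show "mapp n (mmul n X Y) v i = mapp n X (mapp n Y v) i"
    by (simp add: mapp_def mmul_def sum_distrib_left sum_distrib_right mult.assoc)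
qed

lemma cip_mapp: "cip n v (mapp n X w) = (\<Sum>i<n. \<Sum>j<n. star (v i) * X i j * w j)"
  by (simp add: cip_def mapp_def sum_distrib_left mult.assoc)

lemma cip_mapp_hermitian:
  assumes "hermitian_matrix n X"
  shows "cip n (mapp n X v) w = cip n v (mapp n X w)"
proof -
  have "cip n (mapp n X v) w = star (cip n w (mapp n X v))" by (simp add: cip_commute)
  also have "\<dots> = (\<Sum>i<n. \<Sum>j<n. star (v j) * star (X i j) * w i)"
    by (simp add: cip_mapp star_sum star_mult star_star mult.assoc)
  also have "\<dots> = (\<Sum>i<n. \<Sum>j<n. star (v j) * X j i * w i)"
    by (intro sum.cong refl) (simp add: hermitian_matrixD[OF assms])
  also have "\<dots> = (\<Sum>j<n. \<Sum>i<n. star (v j) * X j i * w i)" by (rule sum.swap)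
  finally show ?thesis by (simp add: cip_mapp)
qed

lemma hermitian_mmul: "hermitian_matrix n X \<Longrightarrow> hermitian_matrix n (mmul n X X)"
  by (subst hermitian_matrix_def) (simp add: mmul_def star_sum star_mult hermitian_matrixD)

text \<open>The matrices \<open>Z\<close> over \<open>S\<close> with \<open>0 \<le> Z \<le> 1\<close> as operators on the module \<open>S\<^sup>n\<close>.\<close>

definition unit_interval_matrix ::
    "'a::unital_cstar_algebra set \<Rightarrow> nat \<Rightarrow> (nat \<Rightarrow> nat \<Rightarrow> 'a) \<Rightarrow> bool" where
  "unit_interval_matrix S n Z \<longleftrightarrow>
     (\<forall>i<n. \<forall>j<n. Z i j \<in> S) \<and> hermitian_matrix n Z \<and>
     (\<forall>v. (\<forall>i<n. v i \<in> S) \<longrightarrow> pos (cip n v (mapp n Z v)) \<and> pos (cip n v v - cip n v (mapp n Z v)))"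

text \<open>\<open>Z - Z\<^sup>2 = Z (1 - Z) Z + (1 - Z) Z (1 - Z)\<close>\<close>

lemma unit_interval_square:
  assumes S: "cstar_subalgebra S" and Z: "unit_interval_matrix S n Z"
  shows "unit_interval_matrix S n (mmul n Z Z)"
proof -
  note S' = cstar_subalgebraD[OF S]
  have mem: "Z i j \<in> S" if "i < n" "j < n" for i j using Z that by (simp add: unit_interval_matrix_def)
  have her: "hermitian_matrix n Z" using Z by (simp add: unit_interval_matrix_def)
  have p: "pos (cip n v (mapp n Z v))" "pos (cip n v v - cip n v (mapp n Z v))" if "\<forall>i<n. v i \<in> S" for v
    using Z that by (auto simp: unit_interval_matrix_def)
  have "pos (cip n v (mapp n (mmul n Z Z) v)) \<and> pos (cip n v v - cip n v (mapp n (mmul n Z Z) v))"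
    if v: "\<forall>i<n. v i \<in> S" for v
  proof
    let ?w = "mapp n Z v"
    have w: "\<forall>i<n. ?w i \<in> S" using v mem by (auto simp: mapp_def intro!: S')
    have vw: "\<forall>i<n. v i - ?w i \<in> S" using v w by (auto intro!: S')
    have sa: "cip n v (mapp n Z x) = cip n ?w x" for x by (rule cip_mapp_hermitian[OF her, symmetric])
    show "pos (cip n v (mapp n (mmul n Z Z) v))" by (simp add: mapp_mmul sa cip_self_pos)
    have "cip n v v - cip n v (mapp n (mmul n Z Z) v)
        = (cip n v v - cip n v ?w) + ((cip n ?w ?w - cip n ?w (mapp n Z ?w))
            + cip n (\<lambda>i. v i - ?w i) (mapp n Z (\<lambda>i. v i - ?w i)))"
      by (simp add: mapp_mmul mapp_diff cip_diff sa)
    also have "pos \<dots>" by (intro pos_add p v w vw)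
    finally show "pos (cip n v v - cip n v (mapp n (mmul n Z Z) v))" .
  qed
  then show ?thesis
    unfolding unit_interval_matrix_def using mem hermitian_mmul[OF her]
    by (auto simp: mmul_def[THEN fun_cong, THEN fun_cong] intro!: S')
qed

lemma pos_sum_diff_term:
  assumes "finite I" "i \<in> I" "\<And>j. j \<in> I \<Longrightarrow> pos (f j)" "pos (c - sum f I)"
  shows "pos (c - f i)"
proof -
  have "c - f i = (c - sum f I) + sum f (I - {i})" using assms(1,2) by (simp add: sum.remove)
  also have "pos \<dots>" using assms by (intro pos_add pos_sum) auto
  finally show ?thesis .
qed

text \<open>The \<open>j\<close>-th column is \<open>Z\<close> applied to a unit vector. As the
  square of \<open>Z\<close> is again at most 1, the column has inner square at most 1, and so does
  each entry.\<close>

lemma unit_interval_entry: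
  assumes S: "cstar_subalgebra S" and Z: "unit_interval_matrix S n Z" and ij: "i < n" "j < n"
  shows "norm (Z i j) \<le> 1"
proof -
  note S' = cstar_subalgebraD[OF S]
  let ?e = "\<lambda>k. if k = j then 1 else 0"
  have her: "hermitian_matrix n Z" using Z by (simp add: unit_interval_matrix_def)
  have e: "mapp n Z ?e = (\<lambda>k. Z k j)" using ij by (auto simp: mapp_def if_distrib[of "\<lambda>x. _ * x"] cong: if_cong)
  have "cip n ?e ?e = (\<Sum>k<n. if k = j then 1 else 0)"
    unfolding cip_def by (intro sum.cong) auto
  then have ee: "cip n ?e ?e = 1" using ij by simp
  have "pos (cip n ?e ?e - cip n ?e (mapp n (mmul n Z Z) ?e))"
    using unit_interval_square[OF S Z] S' by (simp add: unit_interval_matrix_def)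
  then have "pos (1 - cip n (mapp n Z ?e) (mapp n Z ?e))"
    by (simp add: ee mapp_mmul cip_mapp_hermitian[OF her])
  then have "pos (1 - star (Z i j) * Z i j)"
    unfolding e cip_def using ij
    by (intro pos_sum_diff_term[of "{..<n}" i "\<lambda>i. star (Z i j) * Z i j"]) (auto intro: pos_star_times)
  then have "norm (star (Z i j) * Z i j) \<le> norm (1::'a)" by (intro pos_norm_mono pos_star_times)
  then have "(norm (Z i j))\<^sup>2 \<le> 1" using norm_one_le[where ?'a = 'a] by (simp add: cstar_identity)
  then show ?thesis by (simp add: abs_square_le_1)
qed

text \<open>Operator form of Young's inequality: expand the square of
  \<open>sqrt t *\<^sub>R a - (1 / sqrt t) *\<^sub>R (x * b)\<close> and use that
  \<open>star x * x\<close> is at most \<open>t\<^sup>2\<close>.\<close>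

lemma pos_young:
  fixes x a b :: "'a::unital_cstar_algebra"
  assumes t: "norm x \<le> t" "0 < t"
  shows "pos (t *\<^sub>R (star a * a) + t *\<^sub>R (star b * b) - (star a * x * b + star b * star x * a))"
proof -
  define y where "y = sqrt t *\<^sub>R a - (1 / sqrt t) *\<^sub>R (x * b)"
  have "star y * y = t *\<^sub>R (star a * a) - (star a * x * b + star b * star x * a) + (1 / t) *\<^sub>R (star b * (star x * x) * b)"
    using t(2) by (simp add: y_def star_diff star_scaleR star_mult algebra_simps)
  then have "t *\<^sub>R (star a * a) + t *\<^sub>R (star b * b) - (star a * x * b + star b * star x * a)
      = star y * y + (1 / t) *\<^sub>R (star b * (t\<^sup>2 *\<^sub>R 1 - star x * x) * b)"
    using t(2) by (simp add: algebra_simps power2_eq_square)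
  then show ?thesis
    using t by (simp add: pos_add pos_star_times pos_scaleR pos_conj pos_norm_one_diff)
qed

text \<open>\<open>pos_young\<close> for each pair of indices, with \<open>t\<close> above the norms
  of all entries. The constant is crude; it serves to rescale \<open>X\<close> into the unit
  interval.\<close>

lemma hermitian_matrix_bounded:
  fixes X :: "nat \<Rightarrow> nat \<Rightarrow> 'a::unital_cstar_algebra"
  assumes "hermitian_matrix n X"
  shows "\<exists>c>0. \<forall>v. pos (c *\<^sub>R cip n v v - cip n v (mapp n X v))"
proof -
  define t where "t = (\<Sum>i<n. \<Sum>j<n. norm (X i j)) + 1"
  have t: "0 < t" unfolding t_def by (simp add: add_nonneg_pos sum_nonneg)
  have le: "norm (X i j) \<le> t" if "i < n" "j < n" for i j
  proof -
    have "norm (X i j) \<le> (\<Sum>j<n. norm (X i j))" using that by (intro member_le_sum) auto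
    also have "\<dots> \<le> (\<Sum>i<n. \<Sum>j<n. norm (X i j))"
      using that by (intro member_le_sum[of i _ "\<lambda>i. \<Sum>j<n. norm (X i j)"]) (auto intro: sum_nonneg)
    finally show ?thesis by (simp add: t_def)
  qed
  have "pos ((real n * t + 1) *\<^sub>R cip n v v - cip n v (mapp n X v))" for v
  proof -
    let ?f = "\<lambda>i j. star (v i) * X i j * v j"
    have "(\<Sum>i<n. \<Sum>j<n. star (v j) * star (X i j) * v i) = (\<Sum>i<n. \<Sum>j<n. ?f j i)"
      by (intro sum.cong refl) (simp add: hermitian_matrixD[OF assms])
    also have "\<dots> = (\<Sum>i<n. \<Sum>j<n. ?f i j)" by (rule sum.swap)
    finally have sw: "(\<Sum>i<n. \<Sum>j<n. star (v j) * star (X i j) * v i) = cip n v (mapp n X v)"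
      by (simp add: cip_mapp)
    have "pos (\<Sum>i<n. \<Sum>j<n. t *\<^sub>R (star (v i) * v i) + t *\<^sub>R (star (v j) * v j)
        - (?f i j + star (v j) * star (X i j) * v i))"
      using le t by (intro pos_sum pos_young) auto
    also have "(\<Sum>i<n. \<Sum>j<n. t *\<^sub>R (star (v i) * v i) + t *\<^sub>R (star (v j) * v j)
        - (?f i j + star (v j) * star (X i j) * v i))
      = (2 * real n * t) *\<^sub>R cip n v v - 2 *\<^sub>R cip n v (mapp n X v)"
      by (simp add: sum.distrib sum_subtractf sw cip_mapp[symmetric])
        (simp add: cip_def scaleR_sum_right[symmetric] scaleR_2 sum_constant_scaleR algebra_simps,
          simp flip: scaleR_add_left)
    finally have "pos ((1/2) *\<^sub>R ((2 * real n * t) *\<^sub>R cip n v v - 2 *\<^sub>R cip n v (mapp n X v)) + cip n v v)"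
      by (intro pos_add pos_scaleR cip_self_pos) simp_all
    then show ?thesis by (simp add: algebra_simps)
  qed
  then show ?thesis using t by (intro exI[of _ "real n * t + 1"]) (auto intro: add_nonneg_pos)
qed

section \<open>Transfer of matrix positivity along representations\<close>

text \<open>\<open>\<pi> 1\<close> may be a proper projection, because the spaces used later are
  larger than the part on which the algebra acts.\<close>

definition star_hom_on :: "'a::unital_cstar_algebra set \<Rightarrow> ('a \<Rightarrow> 'd::unital_cstar_algebra) \<Rightarrow> bool" where
  "star_hom_on S \<pi> \<longleftrightarrow>
     (\<forall>a\<in>S. \<forall>b\<in>S. \<pi> (a + b) = \<pi> a + \<pi> b \<and> \<pi> (a * b) = \<pi> a * \<pi> b) \<and>
     (\<forall>c. \<forall>a\<in>S. \<pi> (c *\<^sub>C a) = c *\<^sub>C \<pi> a) \<and> (\<forall>a\<in>S. \<pi> (star a) = star (\<pi> a))"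

lemma star_hom_onD:
  assumes "star_hom_on S \<pi>" and S: "cstar_subalgebra S"
  shows "a \<in> S \<Longrightarrow> b \<in> S \<Longrightarrow> \<pi> (a + b) = \<pi> a + \<pi> b" "a \<in> S \<Longrightarrow> b \<in> S \<Longrightarrow> \<pi> (a * b) = \<pi> a * \<pi> b"
    "a \<in> S \<Longrightarrow> \<pi> (c *\<^sub>C a) = c *\<^sub>C \<pi> a" "a \<in> S \<Longrightarrow> \<pi> (star a) = star (\<pi> a)"
    "\<pi> 0 = 0" "a \<in> S \<Longrightarrow> \<pi> (r *\<^sub>R a) = r *\<^sub>R \<pi> a" "a \<in> S \<Longrightarrow> b \<in> S \<Longrightarrow> \<pi> (a - b) = \<pi> a - \<pi> b"
    "(\<And>i. i \<in> I \<Longrightarrow> f i \<in> S) \<Longrightarrow> \<pi> (\<Sum>i\<in>I. f i) = (\<Sum>i\<in>I. \<pi> (f i))"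
proof -
  note S' = cstar_subalgebraD[OF S]
  show basic: "a \<in> S \<Longrightarrow> b \<in> S \<Longrightarrow> \<pi> (a + b) = \<pi> a + \<pi> b" "a \<in> S \<Longrightarrow> b \<in> S \<Longrightarrow> \<pi> (a * b) = \<pi> a * \<pi> b"
    "a \<in> S \<Longrightarrow> \<pi> (c *\<^sub>C a) = c *\<^sub>C \<pi> a" "a \<in> S \<Longrightarrow> \<pi> (star a) = star (\<pi> a)" for a b c
    using assms(1) by (simp_all add: star_hom_on_def)
  show zero: "\<pi> 0 = 0" using basic(3)[OF S'(7), of 0] by simp
  show "a \<in> S \<Longrightarrow> \<pi> (r *\<^sub>R a) = r *\<^sub>R \<pi> a" by (simp add: scaleR_scaleC basic)
  show "a \<in> S \<Longrightarrow> b \<in> S \<Longrightarrow> \<pi> (a - b) = \<pi> a - \<pi> b"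
    using basic(1)[of "a - b" b] S'(10)[of a b] by simp
  show "\<pi> (\<Sum>i\<in>I. f i) = (\<Sum>i\<in>I. \<pi> (f i))" if "\<And>i. i \<in> I \<Longrightarrow> f i \<in> S"
    using that
  proof (induction I rule: infinite_finite_induct)
    case (insert x I)
    then have "sum f I \<in> S" by (intro S') auto
    with insert show ?case by (simp add: basic)
  qed (simp_all add: zero)
qed

text \<open>With \<open>s\<close> the root of \<open>1 - star a * a\<close>, the squared norms of
  \<open>\<pi>(a) \<xi>\<close> and \<open>\<pi>(s) \<xi>\<close> add up to that of
  \<open>\<xi>\<close>. The root is available in \<open>S\<close>, and the hypothesis on
  \<open>\<xi>\<close> makes \<open>\<pi> 1\<close> act as the identity on it.\<close>

lemma star_hom_contractive:
  fixes \<pi> :: "'a::unital_cstar_algebra \<Rightarrow> 'h::chilbert_space bop"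
  assumes hom: "star_hom_on S \<pi>" and S: "cstar_subalgebra S" and a: "a \<in> S" "norm a \<le> 1"
    and \<xi>: "bop_apply (\<pi> 1) \<xi> = \<xi>"
  shows "norm (bop_apply (\<pi> a) \<xi>) \<le> norm \<xi>"
proof -
  note S' = cstar_subalgebraD[OF S] and h = star_hom_onD[OF hom S]
  have "pos (1 - star a * a)" using pos_norm_one_diff[OF a(2)] by simp
  then obtain s where s: "star s = s" "s * s = 1 - star a * a"
    "\<And>D. cstar_subalgebra D \<Longrightarrow> 1 - star a * a \<in> D \<Longrightarrow> s \<in> D" by (rule pos_has_sqrt) blast
  have "1 - star a * a \<in> S" by (intro S' a)
  then have sS: "s \<in> S" using s(3) S by blast
  have n: "(norm (bop_apply (\<pi> b) \<xi>))\<^sup>2 = Re (cinner \<xi> (bop_apply (\<pi> (star b * b)) \<xi>))" if "b \<in> S" for b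
    using that S' by (simp add: norm_eq_Re_cinner h bop_apply_ops bop_apply_star')
  have "(norm (bop_apply (\<pi> s) \<xi>))\<^sup>2 = (norm \<xi>)\<^sup>2 - (norm (bop_apply (\<pi> a) \<xi>))\<^sup>2"
    using a sS S' by (simp add: n s h bop_apply_more \<xi> cinner_diff norm_eq_Re_cinner[of \<xi>])
  then have "(norm (bop_apply (\<pi> a) \<xi>))\<^sup>2 \<le> (norm \<xi>)\<^sup>2"
    using zero_le_power2[of "norm (bop_apply (\<pi> s) \<xi>)"] by linarith
  then show ?thesis by simp
qed

text \<open>The value \<open>\<langle>\<xi>, \<pi>(Z) \<xi>\<rangle>\<close> is at most \<open>\<parallel>\<xi>\<parallel>\<^sup>2\<close> up to a constant depending on \<open>n\<close>; repeated squaring of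
  \<open>Z\<close> removes the constant.\<close>

lemma unit_interval_transfer:
  fixes \<pi> :: "'a::unital_cstar_algebra \<Rightarrow> 'h::chilbert_space bop"
  assumes hom: "star_hom_on S \<pi>" and S: "cstar_subalgebra S" and Z: "unit_interval_matrix S n Z"
    and \<xi>: "\<And>i. i < n \<Longrightarrow> bop_apply (\<pi> 1) (\<xi> i) = \<xi> i"
  shows "Re (\<Sum>i<n. \<Sum>j<n. cinner (\<xi> i) (bop_apply (\<pi> (Z i j)) (\<xi> j))) \<le> (\<Sum>i<n. (norm (\<xi> i))\<^sup>2)"
proof -
  note S' = cstar_subalgebraD[OF S] and h = star_hom_onD[OF hom S]
  define N where "N = (\<Sum>i<n. (norm (\<xi> i))\<^sup>2)"
  have N0: "0 \<le> N" unfolding N_def by (intro sum_nonneg) simp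
  define a where "a Z = Re (\<Sum>i<n. \<Sum>j<n. cinner (\<xi> i) (bop_apply (\<pi> (Z i j)) (\<xi> j)))" for Z
  \<comment> \<open>Entrywise contractivity gives the bound \<open>N\<close> for each of the
    \<open>n\<close> times \<open>n\<close> terms.\<close>
  have crude: "a Z \<le> real n * real n * N" if Z: "unit_interval_matrix S n Z" for Z
  proof -
    have "Re (cinner (\<xi> i) (bop_apply (\<pi> (Z i j)) (\<xi> j))) \<le> N" if ij: "i < n" "j < n" for i j
    proof -
      have ni: "norm (\<xi> i) \<le> sqrt N" if "i < n" for i
        using that unfolding N_def by (intro real_le_rsqrt member_le_sum[of i _ "\<lambda>i. (norm (\<xi> i))\<^sup>2"]) auto
      have "Re (cinner (\<xi> i) (bop_apply (\<pi> (Z i j)) (\<xi> j))) \<le> norm (\<xi> i) * norm (bop_apply (\<pi> (Z i j)) (\<xi> j))"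
        by (simp add: norm_cauchy_schwarz flip: inner_eq_Re_cinner)
      also have "\<dots> \<le> sqrt N * sqrt N"
      proof (intro mult_mono ni ij)
        have "norm (bop_apply (\<pi> (Z i j)) (\<xi> j)) \<le> norm (\<xi> j)"
          using Z ij \<xi> unit_interval_entry[OF S Z]
          by (intro star_hom_contractive[OF hom S]) (auto simp: unit_interval_matrix_def)
        then show "norm (bop_apply (\<pi> (Z i j)) (\<xi> j)) \<le> sqrt N" using ni[OF ij(2)] by linarith
      qed (use N0 in auto)
      finally show ?thesis using N0 by simp
    qed
    then have "a Z \<le> (\<Sum>i<n. \<Sum>j<n. N)" unfolding a_def Re_sum by (intro sum_mono) auto
    then show ?thesis by (simp add: mult.assoc)
  qed
  \<comment> \<open>Cauchy-Schwarz in the n-fold direct sum, where the squared norm of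
    \<open>\<pi>(Z) \<xi>\<close> is the form of the square of \<open>Z\<close>.\<close>
  have sq: "(a Z)\<^sup>2 \<le> N * a (mmul n Z Z)" if Z: "unit_interval_matrix S n Z" for Z
  proof -
    define \<eta> where "\<eta> i = (\<Sum>j<n. bop_apply (\<pi> (Z i j)) (\<xi> j))" for i
    have mem: "Z i j \<in> S" "star (Z i j) = Z j i" if "i < n" "j < n" for i j
      using Z that by (auto simp: unit_interval_matrix_def hermitian_matrixD)
    have "\<bar>a Z\<bar> \<le> (\<Sum>i<n. \<bar>norm (\<xi> i)\<bar> * \<bar>norm (\<eta> i)\<bar>)"
    proof -
      have "a Z = (\<Sum>i<n. inner (\<xi> i) (\<eta> i))"
        by (simp add: a_def \<eta>_def inner_eq_Re_cinner cinner_sum_right Re_sum)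
      also have "\<bar>\<dots>\<bar> \<le> (\<Sum>i<n. \<bar>norm (\<xi> i)\<bar> * \<bar>norm (\<eta> i)\<bar>)"
        by (intro order_trans[OF sum_abs] sum_mono) (simp add: Cauchy_Schwarz_ineq2)
      finally show ?thesis .
    qed
    also have "\<dots> \<le> L2_set (\<lambda>i. norm (\<xi> i)) {..<n} * L2_set (\<lambda>i. norm (\<eta> i)) {..<n}"
      by (rule L2_set_mult_ineq)
    finally have "(a Z)\<^sup>2 \<le> (L2_set (\<lambda>i. norm (\<xi> i)) {..<n} * L2_set (\<lambda>i. norm (\<eta> i)) {..<n})\<^sup>2"
      by (rule abs_le_square_iff[THEN iffD1, OF order_trans]) simp
    also have "\<dots> = N * (\<Sum>i<n. (norm (\<eta> i))\<^sup>2)"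
      by (simp add: power_mult_distrib L2_set_def N_def sum_nonneg)
    also have "(\<Sum>i<n. (norm (\<eta> i))\<^sup>2) = a (mmul n Z Z)"
    proof -
      have c: "cinner (bop_apply (\<pi> (Z i j)) (\<xi> j)) (bop_apply (\<pi> (Z i k)) (\<xi> k))
          = cinner (\<xi> j) (bop_apply (\<pi> (Z j i * Z i k)) (\<xi> k))" if "i < n" "j < n" "k < n" for i j k
      proof -
        have "star (\<pi> (Z i j)) = \<pi> (Z j i)" using h(4)[of "Z i j"] mem that by simp
        then show ?thesis
          using that mem by (simp add: h(2) bop_apply_ops flip: bop_apply_star')
      qed
      have "(\<Sum>i<n. (norm (\<eta> i))\<^sup>2)
          = Re (\<Sum>i<n. \<Sum>j<n. \<Sum>k<n. cinner (\<xi> j) (bop_apply (\<pi> (Z j i * Z i k)) (\<xi> k)))"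
        unfolding norm_eq_Re_cinner \<eta>_def Re_sum[symmetric] unfolding cinner_sum_left unfolding cinner_sum_right
        by (intro arg_cong[of _ _ Re] sum.cong refl) (simp add: c)
      also have "(\<Sum>i<n. \<Sum>j<n. \<Sum>k<n. cinner (\<xi> j) (bop_apply (\<pi> (Z j i * Z i k)) (\<xi> k)))
          = (\<Sum>j<n. \<Sum>i<n. \<Sum>k<n. cinner (\<xi> j) (bop_apply (\<pi> (Z j i * Z i k)) (\<xi> k)))"
        by (rule sum.swap)
      also have "\<dots> = (\<Sum>j<n. \<Sum>k<n. \<Sum>i<n. cinner (\<xi> j) (bop_apply (\<pi> (Z j i * Z i k)) (\<xi> k)))"
        by (intro sum.cong refl sum.swap)
      also have "\<dots> = (\<Sum>j<n. \<Sum>k<n. cinner (\<xi> j) (bop_apply (\<pi> (mmul n Z Z j k)) (\<xi> k)))"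
      proof (intro sum.cong refl)
        fix j k assume jk: "j \<in> {..<n}" "k \<in> {..<n}"
        have "\<pi> (mmul n Z Z j k) = (\<Sum>i<n. \<pi> (Z j i * Z i k))"
          unfolding mmul_def using jk by (intro h(8)) (auto intro!: S' mem)
        then show "(\<Sum>i<n. cinner (\<xi> j) (bop_apply (\<pi> (Z j i * Z i k)) (\<xi> k)))
            = cinner (\<xi> j) (bop_apply (\<pi> (mmul n Z Z j k)) (\<xi> k))"
          by (simp add: bop_apply_sum cinner_sum_right)
      qed
      finally show ?thesis by (simp add: a_def)
    qed
    finally show ?thesis .
  qed
  define Zs where "Zs k = ((\<lambda>Z. mmul n Z Z) ^^ k) Z" for k
  have Zs: "unit_interval_matrix S n (Zs k)" for k
    by (induction k) (simp_all add: Zs_def Z unit_interval_square[OF S])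
  have "a Z \<le> N"
  proof (rule ccontr)
    assume "\<not> a Z \<le> N"
    then have gt: "N < a Z" by simp
    have Np: "0 < N"
    proof (rule ccontr)
      assume "\<not> 0 < N"
      then have "N = 0" using N0 by simp
      then show False using gt crude[OF Z] by simp
    qed
    \<comment> \<open>The normalized values satisfy \<open>(b k)\<^sup>2 \<le> b (Suc k)\<close> and
      stay below a fixed bound, which is incompatible with \<open>1 < b 0\<close>.\<close>
    define b where "b k = a (Zs k) / N" for k
    have b0: "1 < b 0" using gt Np by (simp add: b_def Zs_def)
    have bs: "(b k)\<^sup>2 \<le> b (Suc k)" for k
      using sq[OF Zs[of k]] Np by (simp add: b_def Zs_def field_simps power2_eq_square)
    have "b 0 ^ (2 ^ k) \<le> b k" for k
    proof (induction k)
      case (Suc k)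
      have "b 0 ^ (2 ^ Suc k) = (b 0 ^ (2 ^ k))\<^sup>2" by (simp add: power_mult[symmetric] mult.commute)
      also have "\<dots> \<le> (b k)\<^sup>2" using Suc b0 by (intro power_mono) auto
      finally show ?case using bs[of k] by linarith
    qed simp
    moreover have "b k \<le> real n * real n" for k
      using crude[OF Zs[of k]] Np by (simp add: b_def field_simps)
    ultimately have le: "b 0 ^ (2 ^ k) \<le> real n * real n" for k using order_trans by blast
    obtain m where m: "real n * real n < b 0 ^ m" using real_arch_pow[OF b0] by blast
    have "b 0 ^ m \<le> b 0 ^ (2 ^ m)" using b0 by (intro power_increasing) (auto simp: less_imp_le)
    then show False using m le[of m] by linarith
  qed
  then show ?thesis by (simp add: a_def N_def)
qed

text \<open>The matrix \<open>Z = 1 - X / c\<close> lies in the unit interval, so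
  \<open>unit_interval_transfer\<close> bounds its form by that of the identity, which is the claim
  for \<open>X\<close>. Positivity is assumed against columns over \<open>S\<close> and obtained
  against vectors of the Hilbert space, without a factorization of \<open>X\<close> in the matrix
  algebra over \<open>S\<close>.\<close>

theorem positive_matrix_transfer:
  fixes \<pi> :: "'a::unital_cstar_algebra \<Rightarrow> 'h::chilbert_space bop"
  assumes hom: "star_hom_on S \<pi>" and S: "cstar_subalgebra S"
    and X: "\<And>i j. i < n \<Longrightarrow> j < n \<Longrightarrow> X i j \<in> S" "hermitian_matrix n X"
    and pos: "\<And>v. (\<And>i. i < n \<Longrightarrow> v i \<in> S) \<Longrightarrow> pos (cip n v (mapp n X v))"
    and \<xi>: "\<And>i. i < n \<Longrightarrow> bop_apply (\<pi> 1) (\<xi> i) = \<xi> i"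
  shows "0 \<le> Re (\<Sum>i<n. \<Sum>j<n. cinner (\<xi> i) (bop_apply (\<pi> (X i j)) (\<xi> j)))"
proof -
  note S' = cstar_subalgebraD[OF S] and h = star_hom_onD[OF hom S]
  obtain c where c: "0 < c" "\<And>v. pos (c *\<^sub>R cip n v v - cip n v (mapp n X v))"
    using hermitian_matrix_bounded[OF X(2)] by blast
  define Z where "Z i j = (if i = j then 1 else 0) - (1 / c) *\<^sub>R X i j" for i j
  have Zv: "mapp n Z v i = v i - (1 / c) *\<^sub>R mapp n X v i" if "i < n" for v i
  proof -
    have "mapp n Z v i = (\<Sum>j<n. (if i = j then v j else 0) - (1 / c) *\<^sub>R (X i j * v j))"
      unfolding mapp_def Z_def by (intro sum.cong) (auto simp: left_diff_distrib)
    then show ?thesis using that by (simp add: sum_subtractf mapp_def scaleR_sum_right)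
  qed
  have qZ: "cip n v (mapp n Z v) = cip n v v - (1 / c) *\<^sub>R cip n v (mapp n X v)" for v
  proof -
    have "cip n v (mapp n Z v) = cip n v (\<lambda>i. v i - (1 / c) *\<^sub>R mapp n X v i)"
      by (rule cip_cong) (simp_all add: Zv)
    then show ?thesis by (simp add: cip_diff) (simp add: cip_def scaleR_sum_right)
  qed
  have "unit_interval_matrix S n Z"
    unfolding unit_interval_matrix_def
  proof (intro conjI allI impI)
    show "Z i j \<in> S" if "i < n" "j < n" for i j using that X(1) by (auto simp: Z_def intro!: S')
    show "hermitian_matrix n Z"
      by (subst hermitian_matrix_def) (auto simp: Z_def star_diff star_scaleR hermitian_matrixD[OF X(2)])
    fix v assume v: "\<forall>i<n. v i \<in> S"
    have "pos ((1 / c) *\<^sub>R (c *\<^sub>R cip n v v - cip n v (mapp n X v)))"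
      using c by (intro pos_scaleR) auto
    then show "pos (cip n v (mapp n Z v))" using c(1) by (simp add: qZ scaleR_right_diff_distrib)
    show "pos (cip n v v - cip n v (mapp n Z v))" using c(1) v by (simp add: qZ pos_scaleR pos)
  qed
  from unit_interval_transfer[OF hom S this \<xi>]
  have le: "Re (\<Sum>i<n. \<Sum>j<n. cinner (\<xi> i) (bop_apply (\<pi> (Z i j)) (\<xi> j))) \<le> (\<Sum>i<n. (norm (\<xi> i))\<^sup>2)" by simp
  have "cinner (\<xi> i) (bop_apply (\<pi> (Z i j)) (\<xi> j))
      = (if i = j then cinner (\<xi> i) (\<xi> j) else 0) - (1 / c) *\<^sub>R cinner (\<xi> i) (bop_apply (\<pi> (X i j)) (\<xi> j))"
    if "i < n" "j < n" for i j
    using that X(1) S' by (auto simp: Z_def h bop_apply_more bop_apply_ops cinner_diff cinner_scaleR \<xi>)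
  then have "(\<Sum>i<n. \<Sum>j<n. cinner (\<xi> i) (bop_apply (\<pi> (Z i j)) (\<xi> j)))
      = (\<Sum>i<n. \<Sum>j<n. (if i = j then cinner (\<xi> i) (\<xi> j) else 0)
          - (1 / c) *\<^sub>R cinner (\<xi> i) (bop_apply (\<pi> (X i j)) (\<xi> j)))"
    by (intro sum.cong refl) auto
  also have "\<dots> = (\<Sum>i<n. cinner (\<xi> i) (\<xi> i))
      - (1 / c) *\<^sub>R (\<Sum>i<n. \<Sum>j<n. cinner (\<xi> i) (bop_apply (\<pi> (X i j)) (\<xi> j)))"
    by (simp add: sum_subtractf scaleR_sum_right)
  finally have "Re (\<Sum>i<n. \<Sum>j<n. cinner (\<xi> i) (bop_apply (\<pi> (Z i j)) (\<xi> j)))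
      = (\<Sum>i<n. (norm (\<xi> i))\<^sup>2) - (1 / c) * Re (\<Sum>i<n. \<Sum>j<n. cinner (\<xi> i) (bop_apply (\<pi> (X i j)) (\<xi> j)))"
    by (simp add: norm_eq_Re_cinner Re_sum)
  with le have "0 \<le> (1 / c) * Re (\<Sum>i<n. \<Sum>j<n. cinner (\<xi> i) (bop_apply (\<pi> (X i j)) (\<xi> j)))" by linarith
  then show ?thesis using c(1) by (simp add: zero_le_divide_iff)
qed


section \<open>Operators between Hilbert spaces\<close>

definition bclin :: "('g::chilbert_space \<Rightarrow> 'h::chilbert_space) \<Rightarrow> bool" where
  "bclin T \<longleftrightarrow> bounded_linear T \<and> (\<forall>c x. T (c *\<^sub>C x) = c *\<^sub>C T x)"

lemma bclinI:
  assumes "\<And>x y. T (x + y) = T x + T y" "\<And>c x. T (c *\<^sub>C x) = c *\<^sub>C T x" "\<And>x. norm (T x) \<le> K * norm x"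
  shows "bclin T"
  unfolding bclin_def using assms
  by (auto intro!: bounded_linear_intro[of _ K] simp: scaleR_scaleC mult.commute)

lemma bclinD:
  assumes "bclin T"
  shows "T (x + y) = T x + T y" "T (c *\<^sub>C x) = c *\<^sub>C T x" "T (x - y) = T x - T y" "T 0 = 0"
    "T (\<Sum>i\<in>I. f i) = (\<Sum>i\<in>I. T (f i))" "bounded_linear T"
proof -
  interpret T: bounded_linear T using assms by (simp add: bclin_def)
  show "T (x + y) = T x + T y" "T (c *\<^sub>C x) = c *\<^sub>C T x" "T (x - y) = T x - T y" "T 0 = 0"
    "T (\<Sum>i\<in>I. f i) = (\<Sum>i\<in>I. T (f i))" "bounded_linear T"
    using assms by (simp_all add: bclin_def T.add T.diff T.sum T.bounded_linear_axioms)
qed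

lemma bclin_compose: "bclin S \<Longrightarrow> bclin T \<Longrightarrow> bclin (\<lambda>x. S (T x))"
  by (auto simp: bclin_def intro: bounded_linear_compose)

lemma bclin_add: "bclin S \<Longrightarrow> bclin T \<Longrightarrow> bclin (\<lambda>x. S x + T x)"
  by (auto simp: bclin_def scaleC_add_right intro: bounded_linear_add)

lemma bclin_diff: "bclin S \<Longrightarrow> bclin T \<Longrightarrow> bclin (\<lambda>x. S x - T x)"
  by (auto simp: bclin_def scaleC_diff_right intro: bounded_linear_sub)

lemma bclin_bop_apply: "bclin (bop_apply T)"
  by (simp add: bclin_def bounded_linear_bop_apply bop_apply_scaleC)

lemma bclin_id: "bclin (\<lambda>x. x)"
  by (simp add: bclin_def bounded_linear_ident)

definition bop_of :: "('g::chilbert_space \<Rightarrow> 'g) \<Rightarrow> 'g bop" where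
  "bop_of T = Abs_bop (Blinfun T)"

lemma bop_apply_bop_of: "bclin T \<Longrightarrow> bop_apply (bop_of T) = T"
  by (simp add: bop_apply_def bop_of_def bclin_def Abs_bop_inverse bounded_linear_Blinfun_apply)

lemma bclin_adjoint_exists:
  fixes T :: "'g::chilbert_space \<Rightarrow> 'h::chilbert_space"
  assumes T: "bclin T"
  shows "\<exists>S. bclin S \<and> (\<forall>x y. cinner (S x) y = cinner x (T y))"
proof -
  note T' = bclinD[OF T]
  have "\<exists>u. \<forall>y. inner x (T y) = inner u y" for x
    by (rule real_riesz) (rule bounded_linear_compose[OF bounded_linear_inner_right T'(6)])
  then obtain S where S: "\<And>x y. inner x (T y) = inner (S x) y" by metis
  have c: "cinner (S x) y = cinner x (T y)" for x y
  proof (rule complex_eqI)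
    show "Re (cinner (S x) y) = Re (cinner x (T y))" by (simp add: S flip: inner_eq_Re_cinner)
    have "Im w = - Re (\<i> * w)" for w by simp
    then show "Im (cinner (S x) y) = Im (cinner x (T y))"
      unfolding cinner_scaleC_right[symmetric] T'(2)[symmetric]
      by (metis S T'(2) cinner_scaleC_right inner_eq_Re_cinner)
  qed
  have eqI: "a = b" if "\<And>y. cinner a y = cinner b (y::'g)" for a b
    by (rule cinner_eqI) (metis that cinner_commute)
  obtain K where K: "\<And>x. norm (T x) \<le> norm x * K" "0 < K"
    using bounded_linear.pos_bounded[OF T'(6)] by blast
  have "bclin S"
  proof (rule bclinI)
    show "S (x + y) = S x + S y" for x y by (rule eqI) (simp add: c cinner_add_left)
    show "S (a *\<^sub>C x) = a *\<^sub>C S x" for a x by (rule eqI) (simp add: c cinner_scaleC_left)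
    fix x
    have "(norm (S x))\<^sup>2 = Re (cinner x (T (S x)))" by (simp add: norm_eq_Re_cinner c)
    also have "\<dots> \<le> norm x * norm (T (S x))"
      by (simp add: norm_cauchy_schwarz flip: inner_eq_Re_cinner)
    also have "\<dots> \<le> norm x * (norm (S x) * K)" by (intro mult_left_mono K) auto
    finally have "norm (S x) * norm (S x) \<le> norm (S x) * (K * norm x)"
      by (simp add: power2_eq_square algebra_simps)
    then show "norm (S x) \<le> K * norm x" using K(2) by (cases "S x = 0") auto
  qed
  then show ?thesis using c by blast
qed

definition adj :: "('g::chilbert_space \<Rightarrow> 'h::chilbert_space) \<Rightarrow> 'h \<Rightarrow> 'g" where
  "adj T = (SOME S. bclin S \<and> (\<forall>x y. cinner (S x) y = cinner x (T y)))"

lemma adj: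
  assumes "bclin T"
  shows "bclin (adj T)" "cinner (adj T x) y = cinner x (T y)" "cinner y (adj T x) = cinner (T y) x"
proof -
  have *: "bclin (adj T) \<and> (\<forall>x y. cinner (adj T x) y = cinner x (T y))"
    unfolding adj_def by (rule someI_ex[OF bclin_adjoint_exists[OF assms]])
  then show "bclin (adj T)" "cinner (adj T x) y = cinner x (T y)" by auto
  then show "cinner y (adj T x) = cinner (T y) x" using * by (metis cinner_commute)
qed

section \<open>Direct sums of two Hilbert spaces\<close>

instantiation prod :: (chilbert_space, chilbert_space) chilbert_space
begin

definition "c *\<^sub>C (x::'a \<times> 'b) = (c *\<^sub>C fst x, c *\<^sub>C snd x)"
definition "cinner (x::'a \<times> 'b) y = cinner (fst x) (fst y) + cinner (snd x) (snd y)"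

instance
proof
  fix x y z :: "'a \<times> 'b" and c d :: complex and r :: real
  show "c *\<^sub>C (x + y) = c *\<^sub>C x + c *\<^sub>C y" "(c + d) *\<^sub>C x = c *\<^sub>C x + d *\<^sub>C x"
    "c *\<^sub>C d *\<^sub>C x = (c * d) *\<^sub>C x" "r *\<^sub>R x = complex_of_real r *\<^sub>C x"
    by (simp_all add: scaleC_prod_def scaleC_add_right scaleC_add_left scaleC_scaleC scaleR_scaleC prod_eq_iff)
  show "cinner x y = cnj (cinner y x)"
    using cinner_commute[of "fst x" "fst y"] cinner_commute[of "snd x" "snd y"] by (simp add: cinner_prod_def)
  show "cinner x (y + z) = cinner x y + cinner x z" "cinner x (c *\<^sub>C y) = c * cinner x y"
    "inner x y = Re (cinner x y)"
    by (simp_all add: cinner_prod_def scaleC_prod_def cinner_add_right cinner_scaleC_right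
        inner_prod_def inner_eq_Re_cinner algebra_simps)
qed

end


section \<open>A Hilbert space containing all reproducing kernel spaces over an index type\<close>

text \<open>A type cannot depend on a kernel. Instead, one type serves all kernels on \<open>'i\<close> at once: it is the
  completion of the space spanned by pairs of a kernel and an index, where vectors belonging to
  different kernels are orthogonal.\<close>

type_synonym 'i kernel = "'i \<Rightarrow> 'i \<Rightarrow> complex"
type_synonym 'i formal = "(complex \<times> 'i) list"

definition fip :: "'i kernel \<Rightarrow> 'i formal \<Rightarrow> 'i formal \<Rightarrow> complex" where
  "fip k x y = (\<Sum>u\<leftarrow>x. \<Sum>v\<leftarrow>y. cnj (fst u) * fst v * k (snd u) (snd v))"

definition psd_kernel :: "'i kernel \<Rightarrow> bool" where
  "psd_kernel k \<longleftrightarrow> (\<forall>i j. k j i = cnj (k i j)) \<and> (\<forall>x. 0 \<le> Re (fip k x x))"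

lemma psd_kernelD: "psd_kernel k \<Longrightarrow> cnj (k i j) = k j i" "psd_kernel k \<Longrightarrow> 0 \<le> Re (fip k x x)"
  by (metis psd_kernel_def) (simp add: psd_kernel_def)

definition fscale :: "complex \<Rightarrow> 'i formal \<Rightarrow> 'i formal" where
  "fscale c x = map (\<lambda>u. (c * fst u, snd u)) x"

definition fdiff :: "'i formal \<Rightarrow> 'i formal \<Rightarrow> 'i formal" where
  "fdiff x y = x @ fscale (-1) y"

lemma fip_simps:
  "fip k (x @ y) z = fip k x z + fip k y z" "fip k z (x @ y) = fip k z x + fip k z y"
  "fip k [] z = 0" "fip k z [] = 0" "fip k (fscale c x) y = cnj c * fip k x y" "fip k x (fscale c y) = c * fip k x y"
  by (simp_all add: fip_def sum_list_addf fscale_def o_def sum_list_const_mult[symmetric] mult.assoc mult.left_commute)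

lemma fip_fdiff: "fip k (fdiff x y) z = fip k x z - fip k y z" "fip k z (fdiff x y) = fip k z x - fip k z y"
  by (simp_all add: fdiff_def fip_simps)

lemma cnj_sum_list: "cnj (sum_list xs) = (\<Sum>x\<leftarrow>xs. cnj x)"
  by (induction xs) simp_all

lemma sum_list_swap: "(\<Sum>u\<leftarrow>x. \<Sum>v\<leftarrow>y. f u v) = (\<Sum>v\<leftarrow>y. \<Sum>u\<leftarrow>x. f u v :: 'z::comm_monoid_add)"
  by (induction x) (simp_all add: sum_list_addf)

lemma fip_commute:
  assumes "\<And>i j. k j i = cnj (k i j)"
  shows "fip k y x = cnj (fip k x y)"
  unfolding fip_def by (subst sum_list_swap) (simp add: cnj_sum_list o_def assms[symmetric] mult_ac)

text \<open>Kernels that fail to be positive semidefinite contribute the zero form, so that the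
  direct sum over all kernels whatsoever is semidefinite.\<close>

definition block_kernel :: "('i kernel \<times> 'i) kernel" where
  "block_kernel p q = (if fst p = fst q \<and> psd_kernel (fst p) then fst p (snd p) (snd q) else 0)"

abbreviation bip :: "('i kernel \<times> 'i) formal \<Rightarrow> ('i kernel \<times> 'i) formal \<Rightarrow> complex" where
  "bip \<equiv> fip block_kernel"

definition block :: "'i kernel \<Rightarrow> ('i kernel \<times> 'i) formal \<Rightarrow> ('i kernel \<times> 'i) formal" where
  "block K x = filter (\<lambda>u. fst (snd u) = K) x"

definition block_compl :: "'i kernel \<Rightarrow> ('i kernel \<times> 'i) formal \<Rightarrow> ('i kernel \<times> 'i) formal" where
  "block_compl K x = filter (\<lambda>u. fst (snd u) \<noteq> K) x"

lemma sum_list_filter_split: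
  "(\<Sum>u\<leftarrow>x. f u) = (\<Sum>u\<leftarrow>filter P x. f u) + (\<Sum>u\<leftarrow>filter (\<lambda>u. \<not> P u) x. f u :: 'z::comm_monoid_add)"
  by (induction x) (simp_all add: ac_simps)

lemma sum_list_map_zero: "(\<And>u. u \<in> set x \<Longrightarrow> f u = 0) \<Longrightarrow> (\<Sum>u\<leftarrow>x. f u) = (0::'z::comm_monoid_add)"
  by (induction x) simp_all

lemma bip_block: "bip x y = bip (block K x) (block K y) + bip (block_compl K x) (block_compl K y)"
proof -
  have z: "bip (block K x) (block_compl K y) = 0" "bip (block_compl K x) (block K y) = 0"
    by (auto simp: fip_def block_def block_compl_def block_kernel_def intro!: sum_list_map_zero)
  have "bip x y = bip (block K x) y + bip (block_compl K x) y" for x y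
    unfolding fip_def block_def block_compl_def by (rule sum_list_filter_split)
  moreover have "bip x y = bip x (block K y) + bip x (block_compl K y)" for x y
    unfolding fip_def block_def block_compl_def
    by (subst sum_list_filter_split[of _ y "\<lambda>u. fst (snd u) = K"]) (simp add: sum_list_addf)
  ultimately show ?thesis using z by (metis add.left_neutral add.right_neutral)
qed

lemma bip_block_eq:
  "psd_kernel K \<Longrightarrow> bip (block K x) (block K y)
    = fip K (map (\<lambda>u. (fst u, snd (snd u))) (block K x)) (map (\<lambda>u. (fst u, snd (snd u))) (block K y))"
  unfolding fip_def by (auto simp: o_def block_def block_kernel_def intro!: arg_cong[of _ _ sum_list] map_cong)

text \<open>Induction on the length: the block of the first summand is orthogonal to the rest, and
  removing it shortens the sum.\<close>

lemma bip_self_nonneg: "0 \<le> Re (bip x x)"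
proof (induction "length x" arbitrary: x rule: less_induct)
  case less
  show ?case
  proof (cases x)
    case (Cons u y)
    let ?K = "fst (snd u)"
    have "length (block_compl ?K x) < length x"
      by (simp add: block_compl_def Cons le_imp_less_Suc)
    then have "0 \<le> Re (bip (block_compl ?K x) (block_compl ?K x))" by (rule less)
    moreover have "0 \<le> Re (bip (block ?K x) (block ?K x))"
    proof (cases "psd_kernel ?K")
      case True
      then show ?thesis by (simp add: bip_block_eq psd_kernelD)
    next
      case False
      have "bip (block ?K x) (block ?K x) = 0"
        using False by (auto simp: fip_def block_def block_kernel_def intro!: sum_list_map_zero)
      then show ?thesis by simp
    qed
    ultimately show ?thesis by (subst bip_block[of _ _ ?K]) simp
  qed (simp add: fip_simps)
qed

lemma psd_block_kernel: "psd_kernel block_kernel"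
  unfolding psd_kernel_def[of block_kernel]
proof (intro conjI allI bip_self_nonneg)
  show "block_kernel q p = cnj (block_kernel p q)" for p q
    by (auto simp: block_kernel_def psd_kernelD)
qed

lemma bip_commute: "bip y x = cnj (bip x y)"
  by (intro fip_commute) (simp add: psd_kernelD[OF psd_block_kernel])

definition fnorm :: "('i kernel \<times> 'i) formal \<Rightarrow> real" where
  "fnorm x = sqrt (Re (bip x x))"

lemma fnorm_nonneg: "0 \<le> fnorm x" and fnorm_square: "(fnorm x)\<^sup>2 = Re (bip x x)"
  by (simp_all add: fnorm_def bip_self_nonneg)

lemma bip_self: "bip x x = complex_of_real ((fnorm x)\<^sup>2)"
  using bip_commute[of x x] by (auto simp: fnorm_square complex_eq_iff)

lemma cmod_bip_le: "cmod (bip x y) \<le> fnorm x * fnorm y"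
proof -
  define s where "s = bip x y"
  \<comment> \<open>A phase that makes \<open>u * s\<close> real and nonnegative; the value 1 for
    \<open>s = 0\<close> keeps it of modulus 1.\<close>
  define u where "u = (if s = 0 then 1 else cnj s / cmod s)"
  have u: "cmod u = 1" "u * s = cmod s"
    using complex_norm_square[of s] by (auto simp: u_def norm_divide field_simps power2_eq_square)
  have q: "0 \<le> (fnorm x)\<^sup>2 + 2 * t * cmod s + t\<^sup>2 * (fnorm y)\<^sup>2" for t :: real
  proof -
    let ?z = "x @ fscale (complex_of_real t * u) y"
    have us: "cnj u * cnj s = cmod s" using arg_cong[OF u(2), of cnj] by simp
    have uu: "cnj u * u = 1" using complex_norm_square[of u] u(1) by (simp add: mult.commute)
    have "bip ?z ?z = bip x x + t * (u * s) + t * (cnj u * cnj s) + t * t * (cnj u * u) * bip y y"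
      by (simp add: fip_simps s_def bip_commute[of y x] algebra_simps)
    also have "\<dots> = complex_of_real ((fnorm x)\<^sup>2 + 2 * t * cmod s + t\<^sup>2 * (fnorm y)\<^sup>2)"
      by (simp only: u us uu bip_self) (simp add: power2_eq_square)
    finally show ?thesis using bip_self_nonneg[of ?z] by simp
  qed
  have "(cmod s)\<^sup>2 \<le> (fnorm x)\<^sup>2 * (fnorm y)\<^sup>2"
  proof (cases "fnorm y = 0")
    case True
    have "cmod s = 0"
    proof (rule ccontr)
      assume "cmod s \<noteq> 0"
      \<comment> \<open>With \<open>fnorm y = 0\<close> the quadratic is affine in \<open>t\<close>;
        the chosen \<open>t\<close> gives it the value -1.\<close>
      then show False using q[of "- ((fnorm x)\<^sup>2 + 1) / (2 * cmod s)"] True by (simp add: field_simps)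
    qed
    then show ?thesis by simp
  next
    case False
    then have y: "0 < (fnorm y)\<^sup>2" by simp
    have "(fnorm x)\<^sup>2 + 2 * (- cmod s / (fnorm y)\<^sup>2) * cmod s + (- cmod s / (fnorm y)\<^sup>2)\<^sup>2 * (fnorm y)\<^sup>2
        = ((fnorm x)\<^sup>2 * (fnorm y)\<^sup>2 - (cmod s)\<^sup>2) / (fnorm y)\<^sup>2"
      using False by (simp add: field_simps power2_eq_square)
    then show ?thesis
      using q[of "- cmod s / (fnorm y)\<^sup>2"] y by (simp only: zero_le_divide_iff) linarith
  qed
  then have "(cmod s)\<^sup>2 \<le> (fnorm x * fnorm y)\<^sup>2" by (simp add: power_mult_distrib)
  then show ?thesis
    unfolding s_def by (rule power2_le_imp_le) (simp add: fnorm_nonneg)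
qed

lemma fnorm_append: "fnorm (x @ y) \<le> fnorm x + fnorm y"
proof (rule power2_le_imp_le)
  have "Re (bip (x @ y) (x @ y)) = Re (bip x x) + 2 * Re (bip x y) + Re (bip y y)"
    by (simp add: fip_simps bip_commute[of y x])
  also have "\<dots> \<le> (fnorm x)\<^sup>2 + 2 * (fnorm x * fnorm y) + (fnorm y)\<^sup>2"
    using cmod_bip_le[of x y] complex_Re_le_cmod[of "bip x y"] by (simp add: fnorm_square)
  finally show "(fnorm (x @ y))\<^sup>2 \<le> (fnorm x + fnorm y)\<^sup>2"
    unfolding fnorm_square[of "x @ y"] power2_sum by linarith
qed (simp add: fnorm_nonneg)

lemma fnorm_scale: "fnorm (fscale c x) = cmod c * fnorm x"
proof -
  have "bip (fscale c x) (fscale c x) = (c * cnj c) * bip x x" by (simp add: fip_simps mult_ac)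
  also have "\<dots> = complex_of_real ((cmod c)\<^sup>2 * (fnorm x)\<^sup>2)"
    by (simp only: bip_self of_real_mult complex_norm_square)
  finally have "Re (bip (fscale c x) (fscale c x)) = (cmod c * fnorm x)\<^sup>2"
    by (simp add: power_mult_distrib)
  then show ?thesis by (simp add: fnorm_def[of "fscale c x"] fnorm_nonneg)
qed

text \<open>\<open>fdist\<close> is only evaluated through \<open>bip\<close>, so rearrangements of formal sums cost nothing.\<close>

abbreviation fdist :: "('i kernel \<times> 'i) formal \<Rightarrow> ('i kernel \<times> 'i) formal \<Rightarrow> real" where
  "fdist x y \<equiv> fnorm (fdiff x y)"

lemma fnorm_le_fdist: "fnorm x \<le> fnorm y + fdist x y"
proof -
  have "fnorm x = fnorm (y @ fdiff x y)" by (simp add: fnorm_def fip_fdiff fip_simps)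
  then show ?thesis using fnorm_append[of y "fdiff x y"] by simp
qed

section \<open>Completion of the formal sums\<close>

definition fcauchy :: "(nat \<Rightarrow> ('i kernel \<times> 'i) formal) \<Rightarrow> bool" where
  "fcauchy X \<longleftrightarrow> (\<forall>e>0. \<exists>N. \<forall>m\<ge>N. \<forall>n\<ge>N. fdist (X m) (X n) < e)"

text \<open>A vector of the completion is taken to be the functional that it induces on formal sums
  by the inner product, so equality of functionals divides out the null vectors without a quotient
  type.\<close>

definition frep :: "(nat \<Rightarrow> ('i kernel \<times> 'i) formal) \<Rightarrow> (('i kernel \<times> 'i) formal \<Rightarrow> complex) \<Rightarrow> bool" where
  "frep X f \<longleftrightarrow> fcauchy X \<and> (\<forall>y. (\<lambda>n. bip y (X n)) \<longlonglongrightarrow> f y)"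

lemma fcauchy_bounded:
  assumes "fcauchy X"
  shows "\<exists>C>0. \<forall>n. fnorm (X n) \<le> C"
proof -
  obtain N where N: "\<And>m n. N \<le> m \<Longrightarrow> N \<le> n \<Longrightarrow> fdist (X m) (X n) < 1"
    using assms unfolding fcauchy_def by (meson zero_less_one)
  define C where "C = fnorm (X N) + 1 + (\<Sum>n<N. fnorm (X n))"
  have s: "0 \<le> (\<Sum>n<N. fnorm (X n))" by (simp add: sum_nonneg fnorm_nonneg)
  have "fnorm (X n) \<le> C" for n
  proof (cases "n < N")
    case True
    then have "fnorm (X n) \<le> (\<Sum>n<N. fnorm (X n))" by (intro member_le_sum) (auto simp: fnorm_nonneg)
    then show ?thesis using fnorm_nonneg[of "X N"] by (simp add: C_def)
  next
    case False
    then show ?thesis using fnorm_le_fdist[of "X n" "X N"] N[of n N] s by (simp add: C_def)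
  qed
  moreover have "0 < C" using s fnorm_nonneg[of "X N"] by (simp add: C_def)
  ultimately show ?thesis by blast
qed

lemma bip_diff_bound: "cmod (bip x y - bip x' y') \<le> fnorm x * fdist y y' + fdist x x' * fnorm y'"
proof -
  have "bip x y - bip x' y' = bip x (fdiff y y') + bip (fdiff x x') y'" by (simp add: fip_fdiff)
  also have "cmod \<dots> \<le> fnorm x * fdist y y' + fdist x x' * fnorm y'"
    by (intro norm_triangle_mono cmod_bip_le)
  finally show ?thesis .
qed

lemma fcauchy_bip:
  assumes X: "fcauchy X" and Y: "fcauchy Y"
  shows "convergent (\<lambda>n. bip (X n) (Y n))"
proof -
  obtain C where C: "0 < C" "\<And>n. fnorm (X n) \<le> C" using fcauchy_bounded[OF X] by blast
  obtain D where D: "0 < D" "\<And>n. fnorm (Y n) \<le> D" using fcauchy_bounded[OF Y] by blast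
  have "Cauchy (\<lambda>n. bip (X n) (Y n))"
  proof (rule metric_CauchyI)
    fix e :: real assume e: "0 < e"
    obtain M where M: "\<And>m n. M \<le> m \<Longrightarrow> M \<le> n \<Longrightarrow> fdist (X m) (X n) < e / (2 * D)"
      using X e D(1) unfolding fcauchy_def by (meson divide_pos_pos mult_pos_pos zero_less_numeral)
    obtain N where N: "\<And>m n. N \<le> m \<Longrightarrow> N \<le> n \<Longrightarrow> fdist (Y m) (Y n) < e / (2 * C)"
      using Y e C(1) unfolding fcauchy_def by (meson divide_pos_pos mult_pos_pos zero_less_numeral)
    have "dist (bip (X m) (Y m)) (bip (X n) (Y n)) < e" if "max M N \<le> m" "max M N \<le> n" for m n
    proof -
      have "dist (bip (X m) (Y m)) (bip (X n) (Y n)) \<le> fnorm (X m) * fdist (Y m) (Y n) + fdist (X m) (X n) * fnorm (Y n)"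
        by (simp add: dist_norm bip_diff_bound)
      also have "\<dots> \<le> C * fdist (Y m) (Y n) + fdist (X m) (X n) * D"
        by (intro add_mono mult_mono C D fnorm_nonneg order_refl) (use C D in auto)
      also have "\<dots> < C * (e / (2 * C)) + e / (2 * D) * D"
        using that C(1) D(1) by (intro add_strict_mono mult_strict_left_mono mult_strict_right_mono M N) auto
      also have "\<dots> = e" using C(1) D(1) by simp
      finally show ?thesis .
    qed
    then show "\<exists>M. \<forall>m\<ge>M. \<forall>n\<ge>M. dist (bip (X m) (Y m)) (bip (X n) (Y n)) < e" by blast
  qed
  then show ?thesis by (simp add: Cauchy_convergent_iff)
qed

lemma fcauchy_const: "fcauchy (\<lambda>_. x)"
  by (simp add: fcauchy_def fnorm_def fip_fdiff)

lemma fcauchy_frep: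
  assumes "fcauchy X"
  shows "\<exists>f. frep X f"
proof -
  have "\<forall>y. \<exists>l. (\<lambda>n. bip y (X n)) \<longlonglongrightarrow> l"
    using fcauchy_bip[OF fcauchy_const assms] by (simp add: convergent_def)
  from choice[OF this] show ?thesis using assms by (simp add: frep_def)
qed

lemma frep_const: "frep (\<lambda>_. x) (\<lambda>y. bip y x)"
  by (simp add: frep_def fcauchy_const)

lemma fcauchy_append:
  assumes "fcauchy X" "fcauchy Y"
  shows "fcauchy (\<lambda>n. X n @ Y n)"
  unfolding fcauchy_def
proof (intro allI impI)
  fix e :: real assume "0 < e"
  then obtain M N where M: "\<And>m n. M \<le> m \<Longrightarrow> M \<le> n \<Longrightarrow> fdist (X m) (X n) < e / 2"
    and N: "\<And>m n. N \<le> m \<Longrightarrow> N \<le> n \<Longrightarrow> fdist (Y m) (Y n) < e / 2"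
    using assms unfolding fcauchy_def by (meson half_gt_zero)
  have "fdist (X m @ Y m) (X n @ Y n) < e" if "max M N \<le> m" "max M N \<le> n" for m n
  proof -
    have "fdist (X m @ Y m) (X n @ Y n) = fnorm (fdiff (X m) (X n) @ fdiff (Y m) (Y n))"
      by (simp add: fnorm_def fip_fdiff fip_simps)
    also have "\<dots> \<le> fdist (X m) (X n) + fdist (Y m) (Y n)" by (rule fnorm_append)
    also have "\<dots> < e" using M[of m n] N[of m n] that by simp
    finally show ?thesis .
  qed
  then show "\<exists>N. \<forall>m\<ge>N. \<forall>n\<ge>N. fdist (X m @ Y m) (X n @ Y n) < e" by blast
qed

lemma fcauchy_scale:
  assumes "fcauchy X"
  shows "fcauchy (\<lambda>n. fscale c (X n))"
  unfolding fcauchy_def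
proof (intro allI impI)
  fix e :: real assume "0 < e"
  then have "0 < e / (cmod c + 1)" by (simp add: add_nonneg_pos)
  then obtain M where M: "\<And>m n. M \<le> m \<Longrightarrow> M \<le> n \<Longrightarrow> fdist (X m) (X n) < e / (cmod c + 1)"
    using assms unfolding fcauchy_def by meson
  have "fdist (fscale c (X m)) (fscale c (X n)) < e" if "M \<le> m" "M \<le> n" for m n
  proof -
    have "fdist (fscale c (X m)) (fscale c (X n)) = fnorm (fscale c (fdiff (X m) (X n)))"
      by (simp add: fnorm_def fip_fdiff fip_simps algebra_simps)
    also have "\<dots> \<le> (cmod c + 1) * fdist (X m) (X n)"
      by (simp add: fnorm_scale mult_right_mono fnorm_nonneg)
    also have "\<dots> < e"
      using M[OF that] by (simp only: pos_less_divide_eq add_nonneg_pos[OF norm_ge_zero zero_less_one] mult.commute)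
    finally show ?thesis .
  qed
  then show "\<exists>N. \<forall>m\<ge>N. \<forall>n\<ge>N. fdist (fscale c (X m)) (fscale c (X n)) < e" by blast
qed

lemma frep_append: "frep X f \<Longrightarrow> frep Y g \<Longrightarrow> frep (\<lambda>n. X n @ Y n) (\<lambda>y. f y + g y)"
  by (auto simp: frep_def fip_simps fcauchy_append intro: tendsto_add)

lemma frep_scale: "frep X f \<Longrightarrow> frep (\<lambda>n. fscale c (X n)) (\<lambda>y. c * f y)"
  by (auto simp: frep_def fip_simps fcauchy_scale intro: tendsto_mult_left)

lemma frep_zero: "frep (\<lambda>n. []) (\<lambda>y. 0)"
  using frep_const[of "[]"] by (simp add: fip_simps)

text \<open>A Cauchy sequence with weak limit zero tends to zero in norm: fix \<open>n\<close> and
  let \<open>m\<close> grow in the bound of the squared norm of \<open>D n\<close> by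
  \<open>fnorm (D n) * (e / 2) + cmod (bip (D n) (D m))\<close>.\<close>

lemma frep_zero_null:
  assumes "frep D (\<lambda>y. 0)"
  shows "(\<lambda>n. fnorm (D n)) \<longlonglongrightarrow> 0"
proof (rule metric_LIMSEQ_I)
  fix e :: real assume "0 < e"
  then obtain N where N: "\<And>m n. N \<le> m \<Longrightarrow> N \<le> n \<Longrightarrow> fdist (D m) (D n) < e / 2"
    using assms unfolding frep_def fcauchy_def by (meson half_gt_zero)
  have "fnorm (D n) < e" if n: "N \<le> n" for n
  proof -
    have "(fnorm (D n))\<^sup>2 \<le> fnorm (D n) * (e / 2) + cmod (bip (D n) (D m))" if m: "N \<le> m" for m
    proof -
      have "cmod (bip (D n) (D n)) \<le> cmod (bip (D n) (fdiff (D n) (D m))) + cmod (bip (D n) (D m))"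
        using norm_triangle_ineq[of "bip (D n) (fdiff (D n) (D m))" "bip (D n) (D m)"] by (simp add: fip_fdiff)
      also have "cmod (bip (D n) (fdiff (D n) (D m))) \<le> fnorm (D n) * fdist (D n) (D m)" by (rule cmod_bip_le)
      also have "\<dots> \<le> fnorm (D n) * (e / 2)" using N[OF n m] by (intro mult_left_mono fnorm_nonneg) simp
      finally show ?thesis by (simp add: bip_self norm_power)
    qed
    moreover have "(\<lambda>m. fnorm (D n) * (e / 2) + cmod (bip (D n) (D m))) \<longlonglongrightarrow> fnorm (D n) * (e / 2) + cmod 0"
      using assms by (intro tendsto_intros) (auto simp: frep_def)
    ultimately have "(fnorm (D n))\<^sup>2 \<le> fnorm (D n) * (e / 2)"
      by (intro LIMSEQ_le_const[of _ "fnorm (D n) * (e / 2)"]) auto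
    then have "fnorm (D n) \<le> e / 2 \<or> fnorm (D n) = 0"
      using fnorm_nonneg[of "D n"] by (auto simp: power2_eq_square mult_le_cancel_left)
    then show ?thesis using \<open>0 < e\<close> by auto
  qed
  then show "\<exists>N. \<forall>n\<ge>N. dist (fnorm (D n)) 0 < e" by (auto simp: fnorm_nonneg)
qed

lemma frep_unique_null:
  assumes "frep X f" "frep X' f"
  shows "(\<lambda>n. fdist (X n) (X' n)) \<longlonglongrightarrow> 0"
  using frep_append[OF assms(1) frep_scale[OF assms(2), of "-1"]] unfolding fdiff_def
  by (intro frep_zero_null) simp

text \<open>Makes the limit of inner products independent of the representing sequences, so that the
  choice in \<open>urep\<close> is harmless.\<close>

lemma frep_bip_unique:
  assumes X: "frep X f" "frep X' f" and Y: "frep Y g" "frep Y' g" and l: "(\<lambda>n. bip (X n) (Y n)) \<longlonglongrightarrow> l"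
  shows "(\<lambda>n. bip (X' n) (Y' n)) \<longlonglongrightarrow> l"
proof -
  obtain C where C: "0 < C" "\<And>n. fnorm (X n) \<le> C" using fcauchy_bounded[of X] X by (auto simp: frep_def)
  obtain D where D: "0 < D" "\<And>n. fnorm (Y' n) \<le> D" using fcauchy_bounded[of Y'] Y by (auto simp: frep_def)
  have "(\<lambda>n. bip (X n) (Y n) - bip (X' n) (Y' n)) \<longlonglongrightarrow> 0"
  proof (rule Lim_null_comparison)
    have "norm (bip (X n) (Y n) - bip (X' n) (Y' n)) \<le> C * fdist (Y n) (Y' n) + fdist (X n) (X' n) * D" for n
      by (rule order_trans[OF bip_diff_bound])
        (intro add_mono mult_mono C D fnorm_nonneg order_refl; use C D in auto)
    then show "\<forall>\<^sub>F n in sequentially. norm (bip (X n) (Y n) - bip (X' n) (Y' n)) \<le> C * fdist (Y n) (Y' n) + fdist (X n) (X' n) * D"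
      by simp
    have "(\<lambda>n. C * fdist (Y n) (Y' n) + fdist (X n) (X' n) * D) \<longlonglongrightarrow> C * 0 + 0 * D"
      by (intro tendsto_intros frep_unique_null[OF X] frep_unique_null[OF Y])
    then show "(\<lambda>n. C * fdist (Y n) (Y' n) + fdist (X n) (X' n) * D) \<longlonglongrightarrow> 0" by simp
  qed
  from tendsto_diff[OF l this] show ?thesis by simp
qed


typedef 'i uhil = "{f :: ('i kernel \<times> 'i) formal \<Rightarrow> complex. \<exists>X. frep X f}"
  morphisms uval Abs_uhil
  using frep_zero by blast

definition urep :: "'i uhil \<Rightarrow> nat \<Rightarrow> ('i kernel \<times> 'i) formal" where
  "urep f = (SOME X. frep X (uval f))"

lemma frep_urep: "frep (urep f) (uval f)"
proof -
  have "\<exists>X. frep X (uval f)" using uval[of f] by simp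
  then show ?thesis unfolding urep_def by (rule someI_ex)
qed

lemma uval_Abs: "frep X f \<Longrightarrow> uval (Abs_uhil f) = f"
  by (rule Abs_uhil_inverse) blast

lemma uhil_eqI: "(\<And>y. uval f y = uval g y) \<Longrightarrow> f = g"
  by (metis ext uval_inject)

instantiation uhil :: (type) complex_vector
begin

definition "0 = Abs_uhil (\<lambda>_. 0)"
definition "f + g = Abs_uhil (\<lambda>y. uval f y + uval g y)"
definition "c *\<^sub>C f = Abs_uhil (\<lambda>y. c * uval f y)"
definition "r *\<^sub>R (f :: 'a uhil) = complex_of_real r *\<^sub>C f"
definition "- (f :: 'a uhil) = (-1) *\<^sub>C f"
definition "(f :: 'a uhil) - g = f + - g"

lemma uval_ops: "uval (0::'a uhil) = (\<lambda>_. 0)" "uval (f + g) = (\<lambda>y. uval f y + uval g y)"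
  "uval (c *\<^sub>C f) = (\<lambda>y. c * uval f y)" "uval (r *\<^sub>R f) = (\<lambda>y. complex_of_real r * uval f y)"
  "uval (- f) = (\<lambda>y. - uval f y)" "uval (f - g) = (\<lambda>y. uval f y - uval g y)"
proof -
  show add: "uval (f + g) = (\<lambda>y. uval f y + uval g y)" for f g :: "'a uhil"
    unfolding plus_uhil_def by (rule uval_Abs[OF frep_append[OF frep_urep frep_urep]])
  show sc: "uval (c *\<^sub>C f) = (\<lambda>y. c * uval f y)" for c and f :: "'a uhil"
    unfolding scaleC_uhil_def by (rule uval_Abs[OF frep_scale[OF frep_urep]])
  show "uval (0::'a uhil) = (\<lambda>_. 0)" unfolding zero_uhil_def by (rule uval_Abs[OF frep_zero])
  show "uval (r *\<^sub>R f) = (\<lambda>y. complex_of_real r * uval f y)" "uval (- f) = (\<lambda>y. - uval f y)"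
    "uval (f - g) = (\<lambda>y. uval f y - uval g y)"
    by (simp_all add: scaleR_uhil_def uminus_uhil_def minus_uhil_def add sc)
qed

instance
  by standard (rule uhil_eqI; simp add: uval_ops algebra_simps; fail | simp add: scaleR_uhil_def)+

end

definition ucinner :: "'i uhil \<Rightarrow> 'i uhil \<Rightarrow> complex" where
  "ucinner f g = lim (\<lambda>n. bip (urep f n) (urep g n))"

lemma ucinner_lim:
  assumes "frep X (uval f)" "frep Y (uval g)"
  shows "(\<lambda>n. bip (X n) (Y n)) \<longlonglongrightarrow> ucinner f g"
proof -
  have "convergent (\<lambda>n. bip (urep f n) (urep g n))"
    using frep_urep by (intro fcauchy_bip) (auto simp: frep_def)
  then have "(\<lambda>n. bip (urep f n) (urep g n)) \<longlonglongrightarrow> ucinner f g"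
    unfolding ucinner_def by (simp add: convergent_LIMSEQ_iff)
  then show ?thesis by (rule frep_bip_unique[OF frep_urep assms(1) frep_urep assms(2)])
qed

lemma frep_uval_add: "frep (\<lambda>n. urep f n @ urep g n) (uval (f + g))"
  unfolding uval_ops by (rule frep_append[OF frep_urep frep_urep])

lemma frep_uval_scaleC: "frep (\<lambda>n. fscale c (urep f n)) (uval (c *\<^sub>C f))"
  unfolding uval_ops by (rule frep_scale[OF frep_urep])

lemma ucinner_add_right: "ucinner f (g + h) = ucinner f g + ucinner f h"
proof (rule LIMSEQ_unique)
  show "(\<lambda>n. bip (urep f n) (urep g n @ urep h n)) \<longlonglongrightarrow> ucinner f (g + h)"
    by (rule ucinner_lim[OF frep_urep frep_uval_add])
  show "(\<lambda>n. bip (urep f n) (urep g n @ urep h n)) \<longlonglongrightarrow> ucinner f g + ucinner f h"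
    unfolding fip_simps by (intro tendsto_add ucinner_lim frep_urep)
qed

lemma ucinner_scaleC_right: "ucinner f (c *\<^sub>C g) = c * ucinner f g"
proof (rule LIMSEQ_unique)
  show "(\<lambda>n. bip (urep f n) (fscale c (urep g n))) \<longlonglongrightarrow> ucinner f (c *\<^sub>C g)"
    by (rule ucinner_lim[OF frep_urep frep_uval_scaleC])
  show "(\<lambda>n. bip (urep f n) (fscale c (urep g n))) \<longlonglongrightarrow> c * ucinner f g"
    unfolding fip_simps by (intro tendsto_mult_left ucinner_lim frep_urep)
qed

lemma ucinner_commute: "ucinner f g = cnj (ucinner g f)"
proof (rule LIMSEQ_unique)
  show "(\<lambda>n. bip (urep f n) (urep g n)) \<longlonglongrightarrow> ucinner f g" by (intro ucinner_lim frep_urep)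
  show "(\<lambda>n. bip (urep f n) (urep g n)) \<longlonglongrightarrow> cnj (ucinner g f)"
    by (subst bip_commute) (intro tendsto_cnj ucinner_lim frep_urep)
qed

lemma fnorm_lim:
  assumes "frep X (uval f)"
  shows "(\<lambda>n. (fnorm (X n))\<^sup>2) \<longlonglongrightarrow> Re (ucinner f f)"
  unfolding fnorm_square by (intro tendsto_Re ucinner_lim assms)

lemma ucinner_self_zero:
  fixes f :: "'i uhil"
  assumes "Re (ucinner f f) = 0"
  shows "f = 0"
proof (rule uhil_eqI)
  fix y :: "('i kernel \<times> 'i) formal"
  have "(\<lambda>n. (fnorm (urep f n))\<^sup>2) \<longlonglongrightarrow> 0" using fnorm_lim[OF frep_urep, of f] assms by simp
  then have "(\<lambda>n. sqrt ((fnorm (urep f n))\<^sup>2)) \<longlonglongrightarrow> sqrt 0" by (rule tendsto_real_sqrt)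
  then have "(\<lambda>n. fnorm y * fnorm (urep f n)) \<longlonglongrightarrow> fnorm y * 0"
    by (intro tendsto_mult_left) (simp add: fnorm_nonneg)
  then have "(\<lambda>n. fnorm y * fnorm (urep f n)) \<longlonglongrightarrow> 0" by simp
  with always_eventually have "(\<lambda>n. bip y (urep f n)) \<longlonglongrightarrow> 0"
    by (rule Lim_null_comparison) (simp add: cmod_bip_le)
  moreover have "(\<lambda>n. bip y (urep f n)) \<longlonglongrightarrow> uval f y" using frep_urep[of f] by (simp add: frep_def)
  ultimately show "uval f y = uval 0 y" by (simp add: uval_ops LIMSEQ_unique)
qed

instantiation uhil :: (type) real_inner
begin

definition "inner f g = Re (ucinner f (g :: 'a uhil))"
definition "norm f = sqrt (inner f (f :: 'a uhil))"
definition "dist f g = norm (f - g :: 'a uhil)"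
definition "sgn f = inverse (norm f) *\<^sub>R (f :: 'a uhil)"
definition
  "(uniformity :: ('a uhil \<times> 'a uhil) filter) = (INF e\<in>{0<..}. principal {(x, y). dist x y < e})"
definition
  "open (U :: 'a uhil set) \<longleftrightarrow> (\<forall>x\<in>U. \<forall>\<^sub>F (x', y) in uniformity. x' = x \<longrightarrow> y \<in> U)"

instance
proof
  fix f g h :: "'a uhil" and r :: real
  show "dist f g = norm (f - g)" "sgn f = inverse (norm f) *\<^sub>R f"
    by (simp_all add: dist_uhil_def sgn_uhil_def)
  show "(uniformity :: ('a uhil \<times> 'a uhil) filter) = (INF e\<in>{0<..}. principal {(x, y). dist x y < e})"
    by (rule uniformity_uhil_def)
  show "open A \<longleftrightarrow> (\<forall>x\<in>A. \<forall>\<^sub>F (x', y) in uniformity. x' = x \<longrightarrow> y \<in> A)" for A :: "'a uhil set"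
    by (rule open_uhil_def)
  show comm: "inner f g = inner g f" for f g :: "'a uhil"
    unfolding inner_uhil_def by (subst ucinner_commute) simp
  have add: "inner f (g + h) = inner f g + inner f h" for f g h :: "'a uhil"
    by (simp add: inner_uhil_def ucinner_add_right)
  have sc: "inner f (r *\<^sub>R g) = r * inner f g" for r and f g :: "'a uhil"
    by (simp add: inner_uhil_def scaleR_scaleC ucinner_scaleC_right)
  show "inner (f + g) h = inner f h + inner g h" by (metis comm add)
  show "inner (r *\<^sub>R f) g = r * inner f g" by (metis comm sc)
  show "0 \<le> inner f f" unfolding inner_uhil_def
    by (rule LIMSEQ_le_const[OF fnorm_lim[OF frep_urep]]) simp
  show "inner f f = 0 \<longleftrightarrow> f = 0"
  proof
    assume "f = 0"
    then show "inner f f = 0" using sc[of f 0 f] by simp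
  qed (simp add: inner_uhil_def ucinner_self_zero)
  show "norm f = sqrt (inner f f)" by (rule norm_uhil_def)
qed

end

definition fval :: "('i kernel \<times> 'i) formal \<Rightarrow> 'i uhil" where
  "fval x = Abs_uhil (\<lambda>y. bip y x)"

lemma frep_fval: "frep (\<lambda>_. x) (uval (fval x))"
  unfolding fval_def using frep_const uval_Abs by metis

lemma uval_fval: "uval (fval x) y = bip y x"
  unfolding fval_def using uval_Abs[OF frep_const] by metis

lemma ucinner_fval: "ucinner (fval x) (fval y) = bip x y"
  using ucinner_lim[OF frep_fval frep_fval, of x y] by (simp add: LIMSEQ_const_iff)

lemma fval_simps: "fval (x @ y) = fval x + fval y" "fval (fscale c x) = c *\<^sub>C fval x" "fval [] = 0"
  "fval (fdiff x y) = fval x - fval y"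
  by (rule uhil_eqI; simp add: uval_fval uval_ops fip_simps fip_fdiff)+

lemma norm_fval: "norm (fval x) = fnorm x"
  by (simp add: norm_uhil_def inner_uhil_def ucinner_fval fnorm_def)

lemma fval_tendsto:
  assumes X: "frep X (uval f)"
  shows "(\<lambda>n. fval (X n)) \<longlonglongrightarrow> f"
proof (rule metric_LIMSEQ_I)
  fix e :: real assume e: "0 < e"
  then obtain N where N: "\<And>m n. N \<le> m \<Longrightarrow> N \<le> n \<Longrightarrow> fdist (X m) (X n) < e / 2"
    using X unfolding frep_def fcauchy_def by (meson half_gt_zero)
  have "dist (fval (X n)) f < e" if n: "N \<le> n" for n
  proof -
    have "frep (\<lambda>m. fdiff (X n) (X m)) (uval (fval (X n) - f))"
      using frep_append[OF frep_fval frep_scale[OF X, of "-1"], of "X n"] by (simp add: uval_ops fdiff_def)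
    then have "(\<lambda>m. (fdist (X n) (X m))\<^sup>2) \<longlonglongrightarrow> Re (ucinner (fval (X n) - f) (fval (X n) - f))"
      by (rule fnorm_lim)
    moreover have "(fdist (X n) (X m))\<^sup>2 \<le> (e / 2)\<^sup>2" if "N \<le> m" for m
      using N[OF n that] by (intro power_mono) (auto simp: fnorm_nonneg)
    ultimately have "Re (ucinner (fval (X n) - f) (fval (X n) - f)) \<le> (e / 2)\<^sup>2"
      by (intro LIMSEQ_le_const2) auto
    then have "norm (fval (X n) - f) \<le> e / 2"
      unfolding norm_uhil_def inner_uhil_def using e by (intro real_le_lsqrt) auto
    then show ?thesis using e by (simp add: dist_norm)
  qed
  then show "\<exists>N. \<forall>n\<ge>N. dist (fval (X n)) f < e" by blast
qed

lemma fval_dense: "\<exists>X. (\<lambda>n. fval (X n)) \<longlonglongrightarrow> f"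
  using fval_tendsto[OF frep_urep] by blast

instance uhil :: (type) banach
proof
  fix F :: "nat \<Rightarrow> 'a uhil" assume F: "Cauchy F"
  \<comment> \<open>Formal sums are dense, so \<open>F\<close> is replaced by a nearby sequence of
    formal sums, whose limit exists by construction of the type.\<close>
  have "\<exists>x. dist (fval x) (F n) < 1 / real (Suc n)" for n
  proof -
    have "\<exists>N. \<forall>m\<ge>N. dist (fval (urep (F n) m)) (F n) < 1 / real (Suc n)"
      using fval_tendsto[OF frep_urep] by (rule metric_LIMSEQ_D) simp
    then show ?thesis by blast
  qed
  then obtain x where x: "\<And>n. dist (fval (x n)) (F n) < 1 / real (Suc n)" by metis
  have lim0: "(\<lambda>n. dist (fval (x n)) (F n)) \<longlonglongrightarrow> 0"
    by (rule Lim_null_comparison[OF _ LIMSEQ_Suc[OF lim_1_over_n]])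
      (use x in \<open>auto intro!: always_eventually less_imp_le\<close>)
  have "Cauchy (\<lambda>n. fval (x n))"
  proof (rule metric_CauchyI)
    fix e :: real assume e: "0 < e"
    obtain M where M: "\<And>m n. M \<le> m \<Longrightarrow> M \<le> n \<Longrightarrow> dist (F m) (F n) < e / 3"
      using F e unfolding Cauchy_def by (meson divide_pos_pos zero_less_numeral)
    obtain N where N: "\<And>n. N \<le> n \<Longrightarrow> dist (fval (x n)) (F n) < e / 3"
      using metric_LIMSEQ_D[OF lim0, of "e / 3"] e by auto
    have "dist (fval (x m)) (fval (x n)) < e" if "max M N \<le> m" "max M N \<le> n" for m n
      using dist_triangle[of "fval (x m)" "fval (x n)" "F m"] dist_triangle[of "F m" "fval (x n)" "F n"]
        M[of m n] N[of m] N[of n] that by (simp add: dist_commute)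
    then show "\<exists>M. \<forall>m\<ge>M. \<forall>n\<ge>M. dist (fval (x m)) (fval (x n)) < e" by blast
  qed
  then have "fcauchy x"
    by (simp add: Cauchy_def fcauchy_def dist_norm norm_fval flip: fval_simps(4))
  then obtain f where f: "frep x f" using fcauchy_frep by blast
  then have "(\<lambda>n. fval (x n)) \<longlonglongrightarrow> Abs_uhil f" by (intro fval_tendsto) (simp add: uval_Abs[OF f])
  moreover have "(\<lambda>n. fval (x n) - F n) \<longlonglongrightarrow> 0"
    using lim0 by (simp add: dist_norm tendsto_norm_zero_iff)
  ultimately have "(\<lambda>n. fval (x n) - (fval (x n) - F n)) \<longlonglongrightarrow> Abs_uhil f - 0" by (rule tendsto_diff)
  then have "F \<longlonglongrightarrow> Abs_uhil f" by simp
  then show "convergent F" by (auto simp: convergent_def)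
qed

instantiation uhil :: (type) chilbert_space
begin

definition "cinner = (ucinner :: 'a uhil \<Rightarrow> _)"

instance
  by standard (simp_all add: cinner_uhil_def ucinner_add_right ucinner_scaleC_right inner_uhil_def
      ucinner_commute[symmetric])

end

section \<open>Operators defined on generators\<close>

definition gen :: "'i kernel \<times> 'i \<Rightarrow> 'i uhil" where
  "gen p = fval [(1, p)]"

lemma cinner_fval: "cinner (fval x) (fval y) = bip x y"
  by (simp add: cinner_uhil_def ucinner_fval)

lemma cinner_gen: "cinner (gen p) (gen q) = block_kernel p q"
  by (simp add: gen_def cinner_fval) (simp add: fip_def)

lemma fval_Cons: "fval (u # x) = fst u *\<^sub>C gen (snd u) + fval x"
proof -
  have "u # x = fscale (fst u) [(1, snd u)] @ x" by (simp add: fscale_def)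
  then show ?thesis by (simp only: fval_simps gen_def)
qed

lemma bclin_uhil_eqI:
  assumes S: "bclin S" and T: "bclin T" and eq: "\<And>p. S (gen p) = T (gen p)"
  shows "S f = T (f :: 'i uhil)"
proof -
  have fv: "S (fval x) = T (fval x)" for x
    by (induction x) (simp_all add: fval_Cons fval_simps bclinD[OF S] bclinD[OF T] eq)
  obtain X where X: "(\<lambda>n. fval (X n)) \<longlonglongrightarrow> f" using fval_dense by blast
  have "(\<lambda>n. S (fval (X n))) \<longlonglongrightarrow> S f" "(\<lambda>n. T (fval (X n))) \<longlonglongrightarrow> T f"
    by (intro bounded_linear.tendsto[OF _ X] bclinD(6) S T)+
  then show ?thesis unfolding fv by (rule LIMSEQ_unique)
qed

lemma uhil_eqI_gen:
  assumes "\<And>p. cinner (gen p) f = cinner (gen p) g"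
  shows "f = (g :: 'i uhil)"
proof -
  have fv: "cinner (fval x) f = cinner (fval x) g" for x
    by (induction x) (simp_all add: fval_Cons fval_simps cinner_add_left cinner_scaleC_left assms)
  obtain X where X: "(\<lambda>n. fval (X n)) \<longlonglongrightarrow> f - g" using fval_dense by blast
  have "(\<lambda>n. cinner (fval (X n)) (f - g)) \<longlonglongrightarrow> cinner (f - g) (f - g)"
    by (intro tendsto_cinner X tendsto_const)
  then have "cinner (f - g) (f - g) = 0" by (simp add: cinner_diff fv LIMSEQ_const_iff)
  then show ?thesis by (simp add: cinner_self)
qed

lemma bounded_linear_scaleC: "bounded_linear (\<lambda>v::'h::chilbert_space. c *\<^sub>C v)"
  by (rule bounded_linear_intro[of _ "cmod c"])
    (simp_all add: scaleC_add_right scaleC_scaleR chilbert_norm_scaleC)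

text \<open>The estimate is demanded of formal sums. It makes the map both compatible with null
  vectors and bounded, so limits along any approximating sequence define \<open>T\<close>.\<close>

lemma uhil_extend:
  fixes \<tau> :: "'i kernel \<times> 'i \<Rightarrow> 'h::chilbert_space"
  assumes C: "0 \<le> C" and bd: "\<And>x. norm (\<Sum>u\<leftarrow>x. fst u *\<^sub>C \<tau> (snd u)) \<le> C * norm (fval x)"
  shows "\<exists>T. bclin T \<and> (\<forall>p. T (gen p) = \<tau> p)"
proof -
  define L where "L x = (\<Sum>u\<leftarrow>x. fst u *\<^sub>C \<tau> (snd u))" for x
  have L: "L (x @ y) = L x + L y" "L (fscale c x) = c *\<^sub>C L x" for x y c
  proof -
    show "L (x @ y) = L x + L y" by (simp add: L_def)
    show "L (fscale c x) = c *\<^sub>C L x"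
      by (induction x) (simp_all add: L_def fscale_def scaleC_add_right scaleC_scaleC)
  qed
  have Ld: "L x - L y = L (fdiff x y)" for x y
    by (simp add: fdiff_def L scaleC_minus_left scaleC_one)
  have bd': "norm (L x - L y) \<le> C * norm (fval x - fval y)" for x y
    using bd[of "fdiff x y"] unfolding Ld unfolding L_def fval_simps .
  define T where "T f = lim (\<lambda>n. L (urep f n))" for f
  have conv: "convergent (\<lambda>n. L (X n))" if X: "(\<lambda>n. fval (X n)) \<longlonglongrightarrow> f" for X f
  proof -
    have "Cauchy (\<lambda>n. L (X n))"
    proof (rule metric_CauchyI)
      fix e :: real assume e: "0 < e"
      then have "0 < e / (C + 1)" using C by simp
      then obtain M where M: "\<And>m n. M \<le> m \<Longrightarrow> M \<le> n \<Longrightarrow> dist (fval (X m)) (fval (X n)) < e / (C + 1)"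
        using LIMSEQ_imp_Cauchy[OF X] unfolding Cauchy_def by meson
      have "dist (L (X m)) (L (X n)) < e" if "M \<le> m" "M \<le> n" for m n
      proof -
        have "dist (L (X m)) (L (X n)) \<le> C * dist (fval (X m)) (fval (X n))"
          by (simp add: dist_norm bd')
        also have "\<dots> \<le> (C + 1) * dist (fval (X m)) (fval (X n))" by (intro mult_right_mono) auto
        also have "\<dots> < e" using M[OF that] C by (simp add: pos_less_divide_eq mult.commute)
        finally show ?thesis .
      qed
      then show "\<exists>M. \<forall>m\<ge>M. \<forall>n\<ge>M. dist (L (X m)) (L (X n)) < e" by blast
    qed
    then show ?thesis by (simp add: Cauchy_convergent_iff)
  qed
  have T: "(\<lambda>n. L (X n)) \<longlonglongrightarrow> T f" if X: "(\<lambda>n. fval (X n)) \<longlonglongrightarrow> f" for X f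
  proof -
    have U: "(\<lambda>n. fval (urep f n)) \<longlonglongrightarrow> f" by (rule fval_tendsto[OF frep_urep])
    have "(\<lambda>n. C * norm (fval (X n) - fval (urep f n))) \<longlonglongrightarrow> C * norm (f - f)"
      by (intro tendsto_intros X U)
    then have "(\<lambda>n. C * norm (fval (X n) - fval (urep f n))) \<longlonglongrightarrow> 0" by simp
    with always_eventually have "(\<lambda>n. L (X n) - L (urep f n)) \<longlonglongrightarrow> 0"
      by (rule Lim_null_comparison) (simp add: bd')
    moreover have "(\<lambda>n. L (urep f n)) \<longlonglongrightarrow> T f"
      using conv[OF U] unfolding T_def by (simp add: convergent_LIMSEQ_iff)
    ultimately show ?thesis using tendsto_add by fastforce
  qed
  have "bclin T"
  proof (rule bclinI)
    fix f g :: "'i uhil" and c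
    obtain X Y where X: "(\<lambda>n. fval (X n)) \<longlonglongrightarrow> f" and Y: "(\<lambda>n. fval (Y n)) \<longlonglongrightarrow> g"
      using fval_dense by metis
    have "(\<lambda>n. L (X n @ Y n)) \<longlonglongrightarrow> T (f + g)" by (rule T) (simp add: fval_simps tendsto_add X Y)
    moreover have "(\<lambda>n. L (X n @ Y n)) \<longlonglongrightarrow> T f + T g" unfolding L by (intro tendsto_add T X Y)
    ultimately show "T (f + g) = T f + T g" by (rule LIMSEQ_unique)
    have "(\<lambda>n. L (fscale c (X n))) \<longlonglongrightarrow> T (c *\<^sub>C f)"
      by (rule T) (simp add: fval_simps bounded_linear.tendsto[OF bounded_linear_scaleC X])
    moreover have "(\<lambda>n. L (fscale c (X n))) \<longlonglongrightarrow> c *\<^sub>C T f"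
      unfolding L by (rule bounded_linear.tendsto[OF bounded_linear_scaleC T[OF X]])
    ultimately show "T (c *\<^sub>C f) = c *\<^sub>C T f" by (rule LIMSEQ_unique)
    have "(\<lambda>n. norm (L (X n))) \<longlonglongrightarrow> norm (T f)" "(\<lambda>n. C * norm (fval (X n))) \<longlonglongrightarrow> C * norm f"
      by (intro tendsto_intros T X)+
    then show "norm (T f) \<le> C * norm f" by (rule LIMSEQ_le) (use bd in \<open>auto simp: L_def\<close>)
  qed
  moreover have "T (gen p) = \<tau> p" for p
    using T[of "\<lambda>_. [(1, p)]" "gen p"] by (simp add: gen_def L_def scaleC_one LIMSEQ_const_iff)
  ultimately show ?thesis by blast
qed

lemma cinner_kv: "psd_kernel k \<Longrightarrow> cinner (gen (k, i)) (gen (k, j)) = k i j"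
  by (simp add: cinner_gen block_kernel_def)

text \<open>Left multiplication by \<open>a\<close> is bounded by the argument of Gelfand, Naimark
  and Segal: \<open>(norm a)\<^sup>2 *\<^sub>R 1 - star a * a\<close> is a square, and the
  functional \<open>Q\<close> is positive. The algebra acts on mere indices, so linearity is asked
  of the kernel. On the blocks of other kernels the operators are zero.\<close>

lemma gns_representation:
  fixes \<alpha> :: "'a::unital_cstar_algebra \<Rightarrow> 'i \<Rightarrow> 'i"
  assumes k: "psd_kernel k"
    and add: "\<And>a b p q. k p (\<alpha> (a + b) q) = k p (\<alpha> a q) + k p (\<alpha> b q)"
    and scale: "\<And>a c p q. k p (\<alpha> (c *\<^sub>C a) q) = c * k p (\<alpha> a q)"
    and mult: "\<And>a b p q. k p (\<alpha> (a * b) q) = k p (\<alpha> a (\<alpha> b q))"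
    and one: "\<And>p q. k p (\<alpha> 1 q) = k p q"
    and star: "\<And>a p q. k (\<alpha> a p) q = k p (\<alpha> (star a) q)"
  shows "\<exists>\<sigma> :: 'a \<Rightarrow> 'i uhil bop. star_hom_on UNIV \<sigma> \<and>
    (\<forall>a p. bop_apply (\<sigma> a) (gen (k, p)) = gen (k, \<alpha> a p)) \<and>
    (\<forall>a K p. K \<noteq> k \<longrightarrow> bop_apply (\<sigma> a) (gen (K, p)) = 0)"
proof -
  define \<tau> where "\<tau> a q = (if fst q = k then gen (k, \<alpha> a (snd q)) else 0)" for a and q :: "'i kernel \<times> 'i"
  have bd: "norm (\<Sum>u\<leftarrow>x. fst u *\<^sub>C \<tau> a (snd u)) \<le> norm a * norm (fval x)" for a x
  proof -
    define y where "y = map (\<lambda>u. (fst u, snd (snd u))) (block k x)"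
    define m where "m a = map (\<lambda>u. (fst u, \<alpha> a (snd u))) y" for a
    \<comment> \<open>The vector functional of the component of \<open>x\<close> in the block of
      \<open>k\<close>.\<close>
    define Q where "Q a = fip k y (m a)" for a
    have Q: "Q (a + b) = Q a + Q b" "Q (c *\<^sub>C a) = c * Q a" for a b c
      by (simp_all add: Q_def m_def fip_def o_def add scale algebra_simps sum_list_addf sum_list_const_mult[symmetric])
    have Qd: "Q (a - b) = Q a - Q b" for a b using Q(1)[of "a - b" b] by simp
    have Qs: "Q (star a * a) = fip k (m a) (m a)" for a
      by (simp add: Q_def m_def fip_def o_def mult star)
    have Q1: "Q 1 = fip k y y" by (simp add: Q_def m_def fip_def o_def one)
    have lin: "(\<Sum>u\<leftarrow>x. fst u *\<^sub>C \<tau> a (snd u)) = fval (map (\<lambda>u. (fst u, (k, snd u))) (m a))"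
      unfolding m_def y_def block_def
      by (induction x) (auto simp: fval_Cons fval_simps \<tau>_def)
    have "pos ((norm a)\<^sup>2 *\<^sub>R 1 - star a * a)" by (rule pos_norm_one_diff) simp_all
    then obtain s where s: "star s = s" "(norm a)\<^sup>2 *\<^sub>R 1 - star a * a = s * s" by (auto simp: pos_def)
    have "0 \<le> Re (Q (star s * s))" unfolding Qs by (rule psd_kernelD[OF k])
    then have "Re (Q (star a * a)) \<le> (norm a)\<^sup>2 * Re (Q 1)"
      by (simp add: s(1) s(2)[symmetric] Qd scaleR_scaleC Q)
    also have "Re (Q 1) \<le> Re (bip x x)"
      using bip_self_nonneg[of "block_compl k x"] by (subst bip_block[of _ _ k]) (simp add: bip_block_eq k Q1 y_def)
    finally have le: "Re (Q (star a * a)) \<le> (norm a)\<^sup>2 * Re (bip x x)" by (simp add: mult_left_mono)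
    have "(norm (\<Sum>u\<leftarrow>x. fst u *\<^sub>C \<tau> a (snd u)))\<^sup>2 = Re (Q (star a * a))"
      unfolding lin norm_eq_Re_cinner cinner_fval Qs by (simp add: fip_def o_def block_kernel_def k)
    also have "\<dots> \<le> (norm a * norm (fval x))\<^sup>2"
      using le by (simp add: norm_fval power_mult_distrib fnorm_square)
    finally show ?thesis by (rule power2_le_imp_le) simp
  qed
  have "\<forall>a. \<exists>T. bclin T \<and> (\<forall>p. T (gen p) = \<tau> a p)" by (intro allI uhil_extend[OF norm_ge_zero bd])
  then obtain T where T: "\<And>a. bclin (T a)" "\<And>a p. T a (gen p) = \<tau> a p" by metis
  define \<sigma> where "\<sigma> a = bop_of (T a)" for a
  have \<sigma>: "bop_apply (\<sigma> a) (gen p) = \<tau> a p" for a p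
    by (simp add: \<sigma>_def bop_apply_bop_of T)
  have bopI: "A = B" if "\<And>p. bop_apply A (gen p) = bop_apply B (gen p)" for A B :: "'i uhil bop"
    by (rule bop_eqI) (rule bclin_uhil_eqI[OF bclin_bop_apply bclin_bop_apply that])
  have cin: "cinner (gen q) (\<tau> a p) = (if fst p = k \<and> fst q = k then k (snd q) (\<alpha> a (snd p)) else 0)" for q p a
    by (auto simp: \<tau>_def cinner_gen block_kernel_def k)
  have cin2: "cinner (\<tau> a q) (gen p) = (if fst p = k \<and> fst q = k then k (\<alpha> a (snd q)) (snd p) else 0)" for q p a
    by (auto simp: \<tau>_def cinner_gen block_kernel_def k)
  have "star_hom_on UNIV \<sigma>"
    unfolding star_hom_on_def
  proof (intro conjI ballI allI)
    fix a b c
    show "\<sigma> (a + b) = \<sigma> a + \<sigma> b"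
      by (rule bopI, rule uhil_eqI_gen) (simp add: bop_apply_ops \<sigma> cinner_add_right cin add)
    show "\<sigma> (c *\<^sub>C a) = c *\<^sub>C \<sigma> a"
      by (rule bopI, rule uhil_eqI_gen) (simp add: bop_apply_scaleC_bop \<sigma> cinner_scaleC_right cin scale)
    show "\<sigma> (a * b) = \<sigma> a * \<sigma> b"
    proof (rule bopI, rule uhil_eqI_gen)
      fix p q
      have "bop_apply (\<sigma> a) (\<tau> b p) = (if fst p = k then \<tau> a (k, \<alpha> b (snd p)) else 0)"
        by (simp add: \<tau>_def[of b] \<sigma> bop_apply_more)
      then show "cinner (gen q) (bop_apply (\<sigma> (a * b)) (gen p)) = cinner (gen q) (bop_apply (\<sigma> a * \<sigma> b) (gen p))"
        by (simp add: bop_apply_ops \<sigma> cin mult)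
    qed
    show "\<sigma> (star a) = star (\<sigma> a)"
      by (rule bopI, rule uhil_eqI_gen) (simp add: bop_apply_star' \<sigma> cin cin2 star)
  qed
  then show ?thesis by (intro exI[of _ \<sigma>]) (auto simp: \<sigma> \<tau>_def)
qed


section \<open>Dilations on Hilbert spaces\<close>

text \<open>For \<open>0 \<le> c\<close>, the condition that the completely bounded norm is at most
  \<open>c\<close>, written with squared norms so that it expands into inner products.\<close>

definition cb_bounded :: "real \<Rightarrow> ('a::unital_cstar_algebra \<Rightarrow> 'h::chilbert_space bop) \<Rightarrow> bool" where
  "cb_bounded c \<delta> \<longleftrightarrow> (\<forall>n X \<xi>. matrix_norm n X \<le> 1 \<longrightarrow>
     (\<Sum>i<n. (norm (\<Sum>j<n. bop_apply (\<delta> (X i j)) (\<xi> j)))\<^sup>2) \<le> c\<^sup>2 * (\<Sum>j<n. (norm (\<xi> j))\<^sup>2))"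

text \<open>The representations are not assumed to be unital on \<open>'h\<close>: they live on the range of the
  projection \<open>\<sigma> 1\<close>.\<close>

definition dilation ::
    "('a::unital_cstar_algebra \<Rightarrow> 'g::chilbert_space bop) \<Rightarrow> ('a \<Rightarrow> 'h::chilbert_space bop) \<Rightarrow> ('g \<Rightarrow> 'h) \<Rightarrow> bool" where
  "dilation \<phi> \<sigma> V \<longleftrightarrow> star_hom_on UNIV \<sigma> \<and> bclin V \<and> (\<forall>g h. cinner (V g) (V h) = cinner g h) \<and>
     (\<forall>g. bop_apply (\<sigma> 1) (V g) = V g) \<and>
     (\<forall>a g h. cinner (V g) (bop_apply (\<sigma> a) (V h)) = cinner g (bop_apply (\<phi> a) h))"

text \<open>The equation of the units says that both representations live on the same subspace,
  which replaces unitality on \<open>'h\<close>.\<close>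

definition joint_dilation ::
    "real \<Rightarrow> ('a::unital_cstar_algebra \<Rightarrow> 'g::chilbert_space bop) \<Rightarrow> ('a \<Rightarrow> 'g bop) \<Rightarrow>
      ('a \<Rightarrow> 'h::chilbert_space bop) \<Rightarrow> ('a \<Rightarrow> 'h bop) \<Rightarrow> ('g \<Rightarrow> 'h) \<Rightarrow> bool" where
  "joint_dilation c \<phi>1 \<phi>2 \<sigma>1 \<sigma>2 V \<longleftrightarrow>
     dilation \<phi>1 \<sigma>1 V \<and> dilation \<phi>2 \<sigma>2 V \<and> \<sigma>1 1 = \<sigma>2 1 \<and> cb_bounded c (\<lambda>a. \<sigma>1 a - \<sigma>2 a)"

section \<open>Representations are completely contractive\<close>

lemma column_norm_cip: "column_norm n v = sqrt (norm (cip n v v))"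
  by (simp add: column_norm_def cip_def)

lemma matrix_norm_contraction:
  assumes X: "matrix_norm n X \<le> 1" and v: "norm (cip n v v) \<le> 1"
  shows "norm (cip n (mapp n X v) (mapp n X v)) \<le> 1"
proof -
  have "ennreal (column_norm n (mapp n X v)) \<le> matrix_norm n X"
    unfolding matrix_norm_def mapp_def using v
    by (intro SUP_upper2[of v]) (auto simp: column_norm_cip)
  then have "ennreal (column_norm n (mapp n X v)) \<le> 1" using X by (rule order_trans)
  then show ?thesis by (simp add: column_norm_cip ennreal_le_1)
qed

text \<open>A contractive matrix \<open>X\<close> satisfies \<open>X^* X \<le> 1\<close> as a form
  on columns, and \<open>positive_matrix_transfer\<close> carries this to vectors. Vectors outside
  the range of \<open>\<sigma> 1\<close> are projected onto it, which does not increase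
  norms.\<close>

lemma star_hom_cb_bounded:
  fixes \<sigma> :: "'a::unital_cstar_algebra \<Rightarrow> 'h::chilbert_space bop"
  assumes hom: "star_hom_on UNIV \<sigma>"
  shows "cb_bounded 1 \<sigma>"
  unfolding cb_bounded_def
proof (intro allI impI)
  fix n and X :: "nat \<Rightarrow> nat \<Rightarrow> 'a" and \<xi> :: "nat \<Rightarrow> 'h" assume X: "matrix_norm n X \<le> 1"
  note h = star_hom_onD[OF hom cstar_subalgebra_UNIV, simplified]
  define Z where "Z i j = (if i = j then 1 else 0) - (\<Sum>k<n. star (X k i) * X k j)" for i j
  have Zv: "cip n v (mapp n Z v) = cip n v v - cip n (mapp n X v) (mapp n X v)" for v
  proof -
    have "cip n v (mapp n Z v) = (\<Sum>i<n. \<Sum>j<n. (if i = j then star (v i) * v j else 0)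
        - (\<Sum>k<n. star (v i) * star (X k i) * (X k j * v j)))"
      unfolding cip_mapp Z_def
      by (intro sum.cong refl) (auto simp: algebra_simps sum_distrib_left sum_distrib_right)
    also have "\<dots> = cip n v v - (\<Sum>i<n. \<Sum>j<n. \<Sum>k<n. star (v i) * star (X k i) * (X k j * v j))"
      by (simp add: sum_subtractf cip_def)
    also have "(\<Sum>i<n. \<Sum>j<n. \<Sum>k<n. star (v i) * star (X k i) * (X k j * v j))
        = (\<Sum>i<n. \<Sum>k<n. \<Sum>j<n. star (v i) * star (X k i) * (X k j * v j))"
      by (intro sum.cong refl sum.swap)
    also have "\<dots> = (\<Sum>k<n. \<Sum>i<n. \<Sum>j<n. star (v i) * star (X k i) * (X k j * v j))"
      by (rule sum.swap)
    also have "\<dots> = cip n (mapp n X v) (mapp n X v)"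
      by (simp add: cip_def mapp_def star_sum star_mult sum_product)
    finally show ?thesis .
  qed
  have "pos (cip n v v - cip n (mapp n X v) (mapp n X v))" for v
  proof -
    \<comment> \<open>Replacing the column \<open>v\<close> by \<open>v d\<close> turns
      contractivity of \<open>X\<close> on all columns into the hypothesis of
      \<open>pos_of_norm_conj\<close>.\<close>
    have conj: "star d * cip n w w * d = cip n (\<lambda>i. w i * d) (\<lambda>i. w i * d)" for d w
      by (simp add: cip_def sum_distrib_left sum_distrib_right star_mult mult.assoc)
    have md: "mapp n X (\<lambda>i. v i * d) = (\<lambda>i. mapp n X v i * d)" for d
      by (simp add: mapp_def sum_distrib_right mult.assoc)
    have "pos (1 *\<^sub>R cip n v v - cip n (mapp n X v) (mapp n X v))"
    proof (rule pos_of_norm_conj[OF cstar_subalgebra_UNIV cip_self_pos UNIV_I cip_commute])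
      fix d assume "norm (star d * cip n v v * d) \<le> 1"
      then show "norm (star d * cip n (mapp n X v) (mapp n X v) * d) \<le> 1"
        unfolding conj md[symmetric] by (rule matrix_norm_contraction[OF X])
    qed simp
    then show ?thesis by simp
  qed
  then have posZ: "pos (cip n v (mapp n Z v))" for v by (simp add: Zv)
  define \<eta> where "\<eta> i = bop_apply (\<sigma> 1) (\<xi> i)" for i
  have e: "bop_apply (\<sigma> 1) (\<eta> i) = \<eta> i" for i
    using h(2)[of 1 1] by (simp add: \<eta>_def flip: bop_apply_ops)
  have \<sigma>\<eta>: "bop_apply (\<sigma> a) (\<eta> i) = bop_apply (\<sigma> a) (\<xi> i)" for a i
    using h(2)[of a 1] by (simp add: \<eta>_def flip: bop_apply_ops)
  have n\<eta>: "norm (\<eta> i) \<le> norm (\<xi> i)" for i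
  proof -
    have "(norm (\<eta> i))\<^sup>2 = Re (cinner (\<xi> i) (bop_apply (\<sigma> 1) (\<eta> i)))"
      using h(4)[of 1] by (simp add: norm_eq_Re_cinner \<eta>_def flip: bop_apply_star)
    also have "\<dots> \<le> norm (\<xi> i) * norm (\<eta> i)"
      by (simp add: e norm_cauchy_schwarz flip: inner_eq_Re_cinner)
    finally show ?thesis by (cases "norm (\<eta> i) = 0") (simp_all add: power2_eq_square)
  qed
  have "hermitian_matrix n Z"
    by (auto simp: hermitian_matrix_def Z_def star_diff star_sum star_mult star_star)
  then have "0 \<le> Re (\<Sum>i<n. \<Sum>j<n. cinner (\<eta> i) (bop_apply (\<sigma> (Z i j)) (\<eta> j)))"
    by (intro positive_matrix_transfer[OF hom cstar_subalgebra_UNIV] posZ e) auto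
  also have "(\<Sum>i<n. \<Sum>j<n. cinner (\<eta> i) (bop_apply (\<sigma> (Z i j)) (\<eta> j)))
      = (\<Sum>i<n. \<Sum>j<n. (if i = j then cinner (\<eta> i) (\<eta> j) else 0)
          - (\<Sum>k<n. cinner (bop_apply (\<sigma> (X k i)) (\<eta> i)) (bop_apply (\<sigma> (X k j)) (\<eta> j))))"
    by (intro sum.cong refl)
      (auto simp: Z_def h bop_apply_more bop_apply_sum bop_apply_ops cinner_diff cinner_sum_right e bop_apply_star')
  also have "\<dots> = (\<Sum>i<n. cinner (\<eta> i) (\<eta> i))
      - (\<Sum>i<n. \<Sum>j<n. \<Sum>k<n. cinner (bop_apply (\<sigma> (X k i)) (\<eta> i)) (bop_apply (\<sigma> (X k j)) (\<eta> j)))"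
    by (simp add: sum_subtractf)
  also have "(\<Sum>i<n. \<Sum>j<n. \<Sum>k<n. cinner (bop_apply (\<sigma> (X k i)) (\<eta> i)) (bop_apply (\<sigma> (X k j)) (\<eta> j)))
      = (\<Sum>i<n. \<Sum>k<n. \<Sum>j<n. cinner (bop_apply (\<sigma> (X k i)) (\<eta> i)) (bop_apply (\<sigma> (X k j)) (\<eta> j)))"
    by (intro sum.cong refl sum.swap)
  also have "\<dots> = (\<Sum>k<n. \<Sum>i<n. \<Sum>j<n. cinner (bop_apply (\<sigma> (X k i)) (\<eta> i)) (bop_apply (\<sigma> (X k j)) (\<eta> j)))"
    by (rule sum.swap)
  also have "\<dots> = (\<Sum>k<n. cinner (\<Sum>j<n. bop_apply (\<sigma> (X k j)) (\<xi> j)) (\<Sum>j<n. bop_apply (\<sigma> (X k j)) (\<xi> j)))"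
    unfolding cinner_sum_left unfolding cinner_sum_right \<sigma>\<eta> ..
  finally have "(\<Sum>k<n. (norm (\<Sum>j<n. bop_apply (\<sigma> (X k j)) (\<xi> j)))\<^sup>2) \<le> (\<Sum>i<n. (norm (\<eta> i))\<^sup>2)"
    by (simp add: norm_eq_Re_cinner Re_sum)
  also have "\<dots> \<le> (\<Sum>i<n. (norm (\<xi> i))\<^sup>2)"
    by (intro sum_mono power_mono n\<eta>) simp
  finally show "(\<Sum>i<n. (norm (\<Sum>j<n. bop_apply (\<sigma> (X i j)) (\<xi> j)))\<^sup>2) \<le> 1\<^sup>2 * (\<Sum>j<n. (norm (\<xi> j))\<^sup>2)" by simp
qed

text \<open>\<open>F\<close> is the Gram kernel of a family of vectors in a Hilbert \<open>D\<close>-module.\<close>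

definition gram_kernel :: "'g::chilbert_space bop set \<Rightarrow> ('x \<Rightarrow> 'x \<Rightarrow> 'g bop) \<Rightarrow> bool" where
  "gram_kernel D F \<longleftrightarrow> cstar_subalgebra D \<and> (\<forall>x y. F x y \<in> D) \<and> (\<forall>x y. star (F x y) = F y x) \<and>
     (\<forall>(n::nat) \<xi> v. (\<forall>i<n. v i \<in> D) \<longrightarrow> pos (\<Sum>i<n. \<Sum>j<n. star (v i) * F (\<xi> i) (\<xi> j) * v j))"

text \<open>\<open>'x\<close> is a bare index type, so the laws of a representation are stated
  through \<open>F\<close>; they hold for the vectors that the indices represent.\<close>

definition kernel_action ::
    "('x \<Rightarrow> 'x \<Rightarrow> 'g::chilbert_space bop) \<Rightarrow> ('a::unital_cstar_algebra \<Rightarrow> 'x \<Rightarrow> 'x) \<Rightarrow> bool" where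
  "kernel_action F \<alpha> \<longleftrightarrow>
     (\<forall>a b x y. F x (\<alpha> (a + b) y) = F x (\<alpha> a y) + F x (\<alpha> b y)) \<and>
     (\<forall>a c x y. F x (\<alpha> (c *\<^sub>C a) y) = c *\<^sub>C F x (\<alpha> a y)) \<and>
     (\<forall>a b x y. F x (\<alpha> (a * b) y) = F x (\<alpha> a (\<alpha> b y))) \<and>
     (\<forall>x y. F x (\<alpha> 1 y) = F x y) \<and>
     (\<forall>a x y. F (\<alpha> a x) y = F x (\<alpha> (star a) y))"

section \<open>Interior tensor products with the Hilbert space\<close>

text \<open>The inner product of elementary tensors \<open>x \<otimes> g\<close> in
  \<open>E \<otimes>\<^sub>D G\<close>, for a module \<open>E\<close> with Gram kernel
  \<open>F\<close>; \<open>kvec F x g\<close> is that tensor.\<close>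

definition scalar_kernel :: "('x \<Rightarrow> 'x \<Rightarrow> 'g::chilbert_space bop) \<Rightarrow> ('x \<times> 'g) kernel" where
  "scalar_kernel F p q = cinner (snd p) (bop_apply (F (fst p) (fst q)) (snd q))"

definition kvec :: "('x \<Rightarrow> 'x \<Rightarrow> 'g::chilbert_space bop) \<Rightarrow> 'x \<Rightarrow> 'g \<Rightarrow> ('x \<times> 'g) uhil" where
  "kvec F x g = gen (scalar_kernel F, (x, g))"

lemma star_hom_on_id: "star_hom_on D (\<lambda>b. b)"
  by (simp add: star_hom_on_def)

text \<open>\<open>positive_matrix_transfer\<close> for the inclusion of \<open>D\<close>:
  positivity against columns over \<open>D\<close> gives positivity against all tuples of vectors of
  \<open>'g\<close>.\<close>

lemma positive_matrix_bop:
  fixes X :: "nat \<Rightarrow> nat \<Rightarrow> 'g::chilbert_space bop"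
  assumes D: "cstar_subalgebra D"
    and X: "\<And>i j. i < n \<Longrightarrow> j < n \<Longrightarrow> X i j \<in> D" "\<And>i j. i < n \<Longrightarrow> j < n \<Longrightarrow> star (X i j) = X j i"
    and pos: "\<And>v. (\<And>i. i < n \<Longrightarrow> v i \<in> D) \<Longrightarrow> pos (\<Sum>i<n. \<Sum>j<n. star (v i) * X i j * v j)"
  shows "0 \<le> Re (\<Sum>i<n. \<Sum>j<n. cinner (g i) (bop_apply (X i j) (g j)))"
proof -
  have "hermitian_matrix n X" unfolding hermitian_matrix_def using X(2) by metis
  then show ?thesis
    by (intro positive_matrix_transfer[OF star_hom_on_id D]) (simp_all add: X pos cip_mapp bop_apply_ops)
qed

lemma psd_scalar_kernel:
  assumes "gram_kernel D F"
  shows "psd_kernel (scalar_kernel F)"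
  unfolding psd_kernel_def
proof (intro conjI allI)
  note mk = assms[unfolded gram_kernel_def]
  have st: "star (F x y) = F y x" for x y using mk by blast
  show "scalar_kernel F j i = cnj (scalar_kernel F i j)" for i j
    unfolding scalar_kernel_def st[symmetric, of "fst i"] bop_apply_star' by (rule cinner_commute)
  fix x :: "(complex \<times> 'b \<times> 'a) list"
  let ?n = "length x"
  define \<xi> where "\<xi> i = fst (snd (x ! i))" for i
  define g where "g i = fst (x ! i) *\<^sub>C snd (snd (x ! i))" for i
  have "fip (scalar_kernel F) x x = (\<Sum>i<?n. \<Sum>j<?n. cinner (g i) (bop_apply (F (\<xi> i) (\<xi> j)) (g j)))"
    by (simp add: fip_def sum_list_sum_nth scalar_kernel_def \<xi>_def g_def atLeast0LessThan
        bop_apply_scaleC cinner_scaleC_left cinner_scaleC_right mult.assoc mult.left_commute)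
  moreover have "0 \<le> Re (\<Sum>i<?n. \<Sum>j<?n. cinner (g i) (bop_apply (F (\<xi> i) (\<xi> j)) (g j)))"
    by (rule positive_matrix_bop[of D]) (use mk in \<open>auto simp: st\<close>)
  ultimately show "0 \<le> Re (fip (scalar_kernel F) x x)" by simp
qed

lemma cinner_kvec: "gram_kernel D F \<Longrightarrow> cinner (kvec F x g) (kvec F y h) = cinner g (bop_apply (F x y) h)"
  by (simp add: kvec_def cinner_kv psd_scalar_kernel) (simp add: scalar_kernel_def)

text \<open>Generators of foreign blocks are orthogonal to both sides, so tensors suffice as test
  vectors.\<close>

lemma kvec_eqI:
  fixes F :: "'x \<Rightarrow> 'x \<Rightarrow> 'g::chilbert_space bop"
  assumes mk: "gram_kernel D F"
    and eq: "\<And>x g. cinner (kvec F x g) (\<Sum>i\<in>I. a i *\<^sub>C kvec F (\<xi> i) (h i)) = cinner (kvec F x g) (\<Sum>j\<in>J. b j *\<^sub>C kvec F (\<eta> j) (k j))"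
  shows "(\<Sum>i\<in>I. a i *\<^sub>C kvec F (\<xi> i) (h i)) = (\<Sum>j\<in>J. b j *\<^sub>C kvec F (\<eta> j) (k j))"
proof (rule uhil_eqI_gen)
  fix p :: "('x \<times> 'g) kernel \<times> 'x \<times> 'g"
  show "cinner (gen p) (\<Sum>i\<in>I. a i *\<^sub>C kvec F (\<xi> i) (h i)) = cinner (gen p) (\<Sum>j\<in>J. b j *\<^sub>C kvec F (\<eta> j) (k j))"
  proof (cases "fst p = scalar_kernel F")
    case True
    then have "gen p = kvec F (fst (snd p)) (snd (snd p))" by (cases p) (auto simp: kvec_def)
    then show ?thesis by (simp add: eq)
  next
    case False
    then have "cinner (gen p) (kvec F x g) = 0" for x g by (simp add: kvec_def cinner_gen block_kernel_def)
    then show ?thesis by (simp add: cinner_sum_right cinner_scaleC_right)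
  qed
qed

lemma kvec_linear:
  assumes mk: "gram_kernel D F"
  shows "kvec F x (g + h) = kvec F x g + kvec F x h" "kvec F x (c *\<^sub>C g) = c *\<^sub>C kvec F x g"
proof -
  note ck = cinner_kvec[OF mk]
  have "(\<Sum>i\<in>{()}. 1 *\<^sub>C kvec F x (g + h)) = (\<Sum>j\<in>{True, False}. 1 *\<^sub>C kvec F x (if j then g else h))"
    by (rule kvec_eqI[OF mk]) (simp add: scaleC_one cinner_add_right ck bop_apply_add)
  then show "kvec F x (g + h) = kvec F x g + kvec F x h" by (simp add: scaleC_one)
  have "(\<Sum>i\<in>{()}. 1 *\<^sub>C kvec F x (c *\<^sub>C g)) = (\<Sum>j\<in>{()}. c *\<^sub>C kvec F x g)"
    by (rule kvec_eqI[OF mk]) (simp add: scaleC_one cinner_scaleC_right ck bop_apply_scaleC)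
  then show "kvec F x (c *\<^sub>C g) = c *\<^sub>C kvec F x g" by (simp add: scaleC_one)
qed

text \<open>Vanishing on foreign blocks determines the operators completely, so that
  \<open>\<sigma> 1\<close> is the projection onto the block of \<open>F\<close> for every kernel
  action; this yields \<open>kernel_rep_one_eq\<close>.\<close>

definition kernel_rep ::
    "('x \<Rightarrow> 'x \<Rightarrow> 'g::chilbert_space bop) \<Rightarrow> ('a::unital_cstar_algebra \<Rightarrow> 'x \<Rightarrow> 'x) \<Rightarrow> ('a \<Rightarrow> ('x \<times> 'g) uhil bop) \<Rightarrow> bool" where
  "kernel_rep F \<alpha> \<sigma> \<longleftrightarrow> star_hom_on UNIV \<sigma> \<and>
     (\<forall>a x g. bop_apply (\<sigma> a) (kvec F x g) = kvec F (\<alpha> a x) g) \<and>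
     (\<forall>a p. fst p \<noteq> scalar_kernel F \<longrightarrow> bop_apply (\<sigma> a) (gen p) = 0)"

lemma kernel_repD:
  assumes "kernel_rep F \<alpha> \<sigma>"
  shows "star_hom_on UNIV \<sigma>" "bop_apply (\<sigma> a) (kvec F x g) = kvec F (\<alpha> a x) g"
    "fst p \<noteq> scalar_kernel F \<Longrightarrow> bop_apply (\<sigma> a) (gen p) = 0"
  using assms unfolding kernel_rep_def by blast+

lemma kernel_rep_exists:
  assumes mk: "gram_kernel D F" and act: "kernel_action F \<alpha>"
  shows "\<exists>\<sigma>. kernel_rep F \<alpha> \<sigma>"
proof -
  note act' = act[unfolded kernel_action_def]
  let ?\<alpha> = "\<lambda>a p. (\<alpha> a (fst p), snd p)"
  have "\<exists>\<sigma>. star_hom_on UNIV \<sigma> \<and>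
    (\<forall>a p. bop_apply (\<sigma> a) (gen (scalar_kernel F, p)) = gen (scalar_kernel F, ?\<alpha> a p)) \<and>
    (\<forall>a K p. K \<noteq> scalar_kernel F \<longrightarrow> bop_apply (\<sigma> a) (gen (K, p)) = 0)"
    by (rule gns_representation[OF psd_scalar_kernel[OF mk]])
      (simp_all add: scalar_kernel_def act' bop_apply_ops bop_apply_scaleC_bop cinner_add_right cinner_scaleC_right)
  then show ?thesis by (auto simp: kernel_rep_def kvec_def)
qed

lemma kernel_rep_one:
  assumes mk: "gram_kernel D F" and act: "kernel_action F \<alpha>" and rep: "kernel_rep F \<alpha> \<sigma>"
  shows "bop_apply (\<sigma> 1) (kvec F x g) = kvec F x g"
proof -
  have one: "F x (\<alpha> 1 y) = F x y" for x y using act by (simp add: kernel_action_def)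
  have "(\<Sum>i\<in>{()}. 1 *\<^sub>C kvec F (\<alpha> 1 x) g) = (\<Sum>j\<in>{()}. 1 *\<^sub>C kvec F x g)"
    by (rule kvec_eqI[OF mk]) (simp add: scaleC_one cinner_kvec[OF mk] one)
  then show ?thesis using rep by (simp add: scaleC_one kernel_rep_def)
qed

lemma kernel_rep_one_eq:
  fixes F :: "'x \<Rightarrow> 'x \<Rightarrow> 'g::chilbert_space bop"
  assumes mk: "gram_kernel D F" and "kernel_action F \<alpha>" "kernel_rep F \<alpha> \<sigma>"
    and "kernel_action F \<beta>" "kernel_rep F \<beta> \<tau>"
  shows "\<sigma> 1 = \<tau> 1"
proof (rule bop_eqI, rule bclin_uhil_eqI[OF bclin_bop_apply bclin_bop_apply])
  fix p :: "('x \<times> 'g) kernel \<times> 'x \<times> 'g"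
  show "bop_apply (\<sigma> 1) (gen p) = bop_apply (\<tau> 1) (gen p)"
  proof (cases "fst p = scalar_kernel F")
    case True
    then have "gen p = kvec F (fst (snd p)) (snd (snd p))" by (cases p) (auto simp: kvec_def)
    then show ?thesis using kernel_rep_one[OF mk] assms by metis
  next
    case False
    then show ?thesis using assms by (simp add: kernel_repD)
  qed
qed

lemma kernel_dilation:
  assumes mk: "gram_kernel D F" and act: "kernel_action F \<alpha>" and rep: "kernel_rep F \<alpha> \<sigma>"
    and x: "F x x = 1" "\<And>a. F x (\<alpha> a x) = \<phi> a"
  shows "dilation \<phi> \<sigma> (kvec F x)"
  unfolding dilation_def
proof (intro conjI allI)
  note ck = cinner_kvec[OF mk]
  show "star_hom_on UNIV \<sigma>" using rep by (simp add: kernel_rep_def)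
  show iso: "cinner (kvec F x g) (kvec F x h) = cinner g h" for g h by (simp add: ck x bop_apply_ops)
  show "bclin (kvec F x)"
  proof (rule bclinI[OF kvec_linear[OF mk]])
    fix g
    have "(norm (kvec F x g))\<^sup>2 = (norm g)\<^sup>2" by (simp add: norm_eq_Re_cinner iso)
    then show "norm (kvec F x g) \<le> 1 * norm g" by simp
  qed
  show "bop_apply (\<sigma> 1) (kvec F x g) = kvec F x g" for g by (rule kernel_rep_one[OF mk act rep])
  show "cinner (kvec F x g) (bop_apply (\<sigma> a) (kvec F x h)) = cinner g (bop_apply (\<phi> a) h)" for a g h
    using rep by (simp add: kernel_rep_def ck x)
qed

text \<open>\<open>\<Delta>(a, x; b, y) = \<langle>(\<sigma>\<^sub>1 a - \<sigma>\<^sub>2 a) x, (\<sigma>\<^sub>1 b - \<sigma>\<^sub>2 b) y\<rangle>\<close>\<close>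

definition diff_kernel ::
    "('x \<Rightarrow> 'x \<Rightarrow> 'g::chilbert_space bop) \<Rightarrow> ('a::unital_cstar_algebra \<Rightarrow> 'x \<Rightarrow> 'x) \<Rightarrow> ('a \<Rightarrow> 'x \<Rightarrow> 'x) \<Rightarrow>
      'a \<Rightarrow> 'x \<Rightarrow> 'a \<Rightarrow> 'x \<Rightarrow> 'g bop" where
  "diff_kernel F \<alpha>1 \<alpha>2 a x b y =
     (F (\<alpha>1 a x) (\<alpha>1 b y) - F (\<alpha>1 a x) (\<alpha>2 b y)) - (F (\<alpha>2 a x) (\<alpha>1 b y) - F (\<alpha>2 a x) (\<alpha>2 b y))"

text \<open>Complete boundedness by \<open>c\<close>, stated for the vectors of \<open>E\<^sup>n\<close> with entries
  \<open>\<Sum>\<^sub>l \<xi>\<^sub>l v\<^sub>l\<close>, where \<open>\<xi>\<^sub>l v\<^sub>l\<close> contributes to the coordinate \<open>s l\<close>.\<close>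

definition kernel_cb_bounded ::
    "real \<Rightarrow> 'g::chilbert_space bop set \<Rightarrow> ('x \<Rightarrow> 'x \<Rightarrow> 'g bop) \<Rightarrow>
      ('a::unital_cstar_algebra \<Rightarrow> 'x \<Rightarrow> 'x) \<Rightarrow> ('a \<Rightarrow> 'x \<Rightarrow> 'x) \<Rightarrow> bool" where
  "kernel_cb_bounded c D F \<alpha>1 \<alpha>2 \<longleftrightarrow>
     (\<forall>n X (m::nat) s \<xi> v. matrix_norm n X \<le> 1 \<longrightarrow> (\<forall>l<m. s l < n \<and> v l \<in> D) \<longrightarrow>
        pos (\<Sum>l<m. \<Sum>l'<m. star (v l) * (c\<^sup>2 *\<^sub>R (if s l = s l' then F (\<xi> l) (\<xi> l') else 0)
          - (\<Sum>i<n. diff_kernel F \<alpha>1 \<alpha>2 (X i (s l)) (\<xi> l) (X i (s l')) (\<xi> l'))) * v l'))"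

text \<open>The matrix \<open>?M\<close> is positive against columns over \<open>D\<close> by
  hypothesis; \<open>positive_matrix_bop\<close> evaluates it at the vectors \<open>g l\<close>,
  where it becomes the difference of the two sides.\<close>

lemma kernel_rep_cb_bounded_span:
  fixes m n :: nat
  assumes mk: "gram_kernel D F" and cb: "kernel_cb_bounded c D F \<alpha>1 \<alpha>2"
    and rep: "kernel_rep F \<alpha>1 \<sigma>1" "kernel_rep F \<alpha>2 \<sigma>2"
    and X: "matrix_norm n X \<le> 1" and s: "\<And>l. l < m \<Longrightarrow> s l < n"
    and y: "\<And>j. j < n \<Longrightarrow> y j = (\<Sum>l<m. if s l = j then kvec F (\<xi> l) (g l) else 0)"
  shows "(\<Sum>i<n. (norm (\<Sum>j<n. bop_apply (\<sigma>1 (X i j) - \<sigma>2 (X i j)) (y j)))\<^sup>2) \<le> c\<^sup>2 * (\<Sum>j<n. (norm (y j))\<^sup>2)"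
proof -
  note ck = cinner_kvec[OF mk] and mk' = mk[unfolded gram_kernel_def]
  have D: "cstar_subalgebra D" using mk' by blast
  note D' = cstar_subalgebraD[OF D]
  have F: "F x y \<in> D" "star (F x y) = F y x" for x y using mk' by auto
  let ?d = "\<lambda>i l l'. diff_kernel F \<alpha>1 \<alpha>2 (X i (s l)) (\<xi> l) (X i (s l')) (\<xi> l')"
  let ?M = "\<lambda>l l'. c\<^sup>2 *\<^sub>R (if s l = s l' then F (\<xi> l) (\<xi> l') else 0) - (\<Sum>i<n. ?d i l l')"
  have "0 \<le> Re (\<Sum>l<m. \<Sum>l'<m. cinner (g l) (bop_apply (?M l l') (g l')))"
  proof (rule positive_matrix_bop[OF D, where X = ?M])
    show "?M l l' \<in> D" for l l' by (auto simp: diff_kernel_def intro!: D' F)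
    show "star (?M l l') = ?M l' l" for l l'
      by (simp add: diff_kernel_def star_diff star_scaleR star_sum F if_distrib[of star] eq_commute[of "s l"] cong: if_cong)
        (simp add: algebra_simps)
    show "pos (\<Sum>l<m. \<Sum>l'<m. star (v l) * ?M l l' * v l')" if "\<And>l. l < m \<Longrightarrow> v l \<in> D" for v
      using cb X s that unfolding kernel_cb_bounded_def by blast
  qed
  moreover have "(\<Sum>j<n. (norm (y j))\<^sup>2)
      = Re (\<Sum>l<m. \<Sum>l'<m. if s l = s l' then cinner (g l) (bop_apply (F (\<xi> l) (\<xi> l')) (g l')) else 0)"
  proof -
    have yy: "cinner (y j) (y j) = (\<Sum>l<m. \<Sum>l'<m.
        cinner (if s l = j then kvec F (\<xi> l) (g l) else 0) (if s l' = j then kvec F (\<xi> l') (g l') else 0))"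
      if "j < n" for j
      unfolding y[OF that] unfolding cinner_sum_left unfolding cinner_sum_right ..
    have "(\<Sum>j<n. (norm (y j))\<^sup>2) = Re (\<Sum>j<n. \<Sum>l<m. \<Sum>l'<m.
        cinner (if s l = j then kvec F (\<xi> l) (g l) else 0) (if s l' = j then kvec F (\<xi> l') (g l') else 0))"
      unfolding norm_eq_Re_cinner Re_sum[symmetric] by (intro arg_cong[of _ _ Re] sum.cong refl yy) simp
    also have "(\<Sum>j<n. \<Sum>l<m. \<Sum>l'<m.
        cinner (if s l = j then kvec F (\<xi> l) (g l) else 0) (if s l' = j then kvec F (\<xi> l') (g l') else 0))
      = (\<Sum>l<m. \<Sum>l'<m. \<Sum>j<n. 
        cinner (if s l = j then kvec F (\<xi> l) (g l) else 0) (if s l' = j then kvec F (\<xi> l') (g l') else 0))"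
      by (subst sum.swap) (intro sum.cong refl sum.swap)
    also have "\<dots> = (\<Sum>l<m. \<Sum>l'<m. \<Sum>j<n. if j = s l then
        (if s l = s l' then cinner (g l) (bop_apply (F (\<xi> l) (\<xi> l')) (g l')) else 0) else 0)"
      by (intro sum.cong refl) (auto simp: ck)
    finally show ?thesis using s by simp
  qed
  moreover have "(\<Sum>i<n. (norm (\<Sum>j<n. bop_apply (\<sigma>1 (X i j) - \<sigma>2 (X i j)) (y j)))\<^sup>2)
      = Re (\<Sum>l<m. \<Sum>l'<m. \<Sum>i<n. cinner (g l) (bop_apply (?d i l l') (g l')))"
  proof -
    let ?w = "\<lambda>i l. kvec F (\<alpha>1 (X i (s l)) (\<xi> l)) (g l) - kvec F (\<alpha>2 (X i (s l)) (\<xi> l)) (g l)"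
    have w: "(\<Sum>j<n. bop_apply (\<sigma>1 (X i j) - \<sigma>2 (X i j)) (y j)) = (\<Sum>l<m. ?w i l)" for i
    proof -
      have "(\<Sum>j<n. bop_apply (\<sigma>1 (X i j) - \<sigma>2 (X i j)) (y j))
          = (\<Sum>j<n. \<Sum>l<m. if j = s l then ?w i l else 0)"
        using rep by (intro sum.cong refl)
          (auto simp: y bop_apply_sum_right bop_apply_more kernel_rep_def intro!: sum.cong)
      also have "\<dots> = (\<Sum>l<m. \<Sum>j<n. if j = s l then ?w i l else 0)" by (rule sum.swap)
      finally show ?thesis using s by simp
    qed
    have cw: "cinner (?w i l) (?w i l') = cinner (g l) (bop_apply (?d i l l') (g l'))" for i l l'
      by (simp add: diff_kernel_def cinner_diff ck bop_apply_more)
    have "(\<Sum>i<n. (norm (\<Sum>l<m. ?w i l))\<^sup>2) = Re (\<Sum>i<n. \<Sum>l<m. \<Sum>l'<m. cinner (?w i l) (?w i l'))"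
      unfolding norm_eq_Re_cinner Re_sum[symmetric] unfolding cinner_sum_left unfolding cinner_sum_right ..
    also have "(\<Sum>i<n. \<Sum>l<m. \<Sum>l'<m. cinner (?w i l) (?w i l')) = (\<Sum>l<m. \<Sum>l'<m. \<Sum>i<n. cinner (?w i l) (?w i l'))"
      by (subst sum.swap) (intro sum.cong refl sum.swap)
    finally show ?thesis unfolding w cw .
  qed
  moreover have M: "cinner (g l) (bop_apply (?M l l') (g l'))
      = c\<^sup>2 *\<^sub>R (if s l = s l' then cinner (g l) (bop_apply (F (\<xi> l) (\<xi> l')) (g l')) else 0)
        - (\<Sum>i<n. cinner (g l) (bop_apply (?d i l l') (g l')))" for l l'
    by (simp add: bop_apply_more bop_apply_ops bop_apply_sum cinner_diff cinner_scaleR cinner_sum_right)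
  moreover have "(\<Sum>l<m. \<Sum>l'<m. cinner (g l) (bop_apply (?M l l') (g l')))
      = c\<^sup>2 *\<^sub>R (\<Sum>l<m. \<Sum>l'<m. if s l = s l' then cinner (g l) (bop_apply (F (\<xi> l) (\<xi> l')) (g l')) else 0)
        - (\<Sum>l<m. \<Sum>l'<m. \<Sum>i<n. cinner (g l) (bop_apply (?d i l l') (g l')))"
    unfolding M sum_subtractf scaleR_sum_right ..
  ultimately show ?thesis by (simp del: Re_sum)
qed

lemma sum_list_map_concat: "(\<Sum>p\<leftarrow>concat (map h xs). f p) = (\<Sum>i\<leftarrow>xs. \<Sum>p\<leftarrow>h i. f p :: 'z::comm_monoid_add)"
  by (induction xs) simp_all

lemma kernel_rep_cb_bounded:
  fixes \<alpha>1 \<alpha>2 :: "'a::unital_cstar_algebra \<Rightarrow> 'x \<Rightarrow> 'x"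
  assumes mk: "gram_kernel D (F :: 'x \<Rightarrow> 'x \<Rightarrow> 'g::chilbert_space bop)"
    and cb: "kernel_cb_bounded c D F \<alpha>1 \<alpha>2"
    and rep: "kernel_rep F \<alpha>1 \<sigma>1" "kernel_rep F \<alpha>2 \<sigma>2"
  shows "cb_bounded c (\<lambda>a. \<sigma>1 a - \<sigma>2 a)"
  unfolding cb_bounded_def
proof (intro allI impI)
  fix n and X :: "nat \<Rightarrow> nat \<Rightarrow> 'a" and \<xi> :: "nat \<Rightarrow> ('x \<times> 'g) uhil" assume X: "matrix_norm n X \<le> 1"
  let ?k = "scalar_kernel F"
  let ?\<delta> = "\<lambda>a. \<sigma>1 a - \<sigma>2 a"
  have fin: "(\<Sum>i<n. (norm (\<Sum>j<n. bop_apply (?\<delta> (X i j)) (fval (y j))))\<^sup>2) \<le> c\<^sup>2 * (\<Sum>j<n. (norm (fval (y j)))\<^sup>2)"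
    for y
  proof -
    \<comment> \<open>One list for all coordinates: the pair \<open>(j, u)\<close> records that the
      summand \<open>u\<close> occurs in \<open>y j\<close>, which yields the slots \<open>s\<close>
      of the span lemma.\<close>
    define L where "L = concat (map (\<lambda>j. map (Pair j) (block ?k (y j))) [0..<n])"
    have sl: "fst (L ! l) < n" if "l < length L" for l
      using nth_mem[OF that] by (auto simp: L_def)
    have blk: "fval (block ?k (y j)) = (\<Sum>l<length L. if fst (L ! l) = j
        then kvec F (fst (snd (snd (snd (L ! l))))) (fst (snd (L ! l)) *\<^sub>C snd (snd (snd (snd (L ! l))))) else 0)"
      if "j < n" for j
    proof -
      let ?f = "\<lambda>u. kvec F (fst (snd (snd u))) (fst u *\<^sub>C snd (snd (snd u)))"
      have fv: "fval (block ?k x) = (\<Sum>u\<leftarrow>block ?k x. ?f u)" for x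
        unfolding block_def
        by (induction x) (auto simp: fval_Cons fval_simps kvec_linear[OF mk], auto simp: kvec_def)
      have "(\<Sum>l<length L. if fst (L ! l) = j then ?f (snd (L ! l)) else 0) = (\<Sum>p\<leftarrow>L. if fst p = j then ?f (snd p) else 0)"
        by (simp add: sum_list_sum_nth atLeast0LessThan)
      also have "\<dots> = (\<Sum>i\<leftarrow>[0..<n]. if i = j then \<Sum>u\<leftarrow>block ?k (y i). ?f u else 0)"
        unfolding L_def sum_list_map_concat
        by (intro arg_cong[of _ _ sum_list] map_cong refl) (auto simp: o_def sum_list_map_zero)
      also have "\<dots> = (\<Sum>i\<in>{0..<n}. if i = j then \<Sum>u\<leftarrow>block ?k (y i). ?f u else 0)"
        by (simp add: sum_list_distinct_conv_sum_set)
      finally show ?thesis using that by (simp add: fv)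
    qed
    \<comment> \<open>Both representations vanish on foreign blocks, so each \<open>y j\<close> may
      be cut down to the block of \<open>F\<close>, which does not increase its norm.\<close>
    have kill: "bop_apply (?\<delta> a) (fval x) = bop_apply (?\<delta> a) (fval (block ?k x))" for a x
    proof (induction x)
      case (Cons u x)
      have "bop_apply (?\<delta> a) (gen (snd u)) = 0" if "fst (snd u) \<noteq> ?k"
        using that by (simp add: rep[THEN kernel_repD(3)] bop_apply_more)
      with Cons show ?case
        by (auto simp: block_def fval_Cons bop_apply_add bop_apply_scaleC)
    qed (simp add: block_def)
    have nb: "(norm (fval (block ?k x)))\<^sup>2 \<le> (norm (fval x))\<^sup>2" for x
      using bip_self_nonneg[of "block_compl ?k x"] bip_block[of x x ?k] by (simp add: norm_fval fnorm_square)
    have "(\<Sum>i<n. (norm (\<Sum>j<n. bop_apply (?\<delta> (X i j)) (fval (y j))))\<^sup>2)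
        = (\<Sum>i<n. (norm (\<Sum>j<n. bop_apply (?\<delta> (X i j)) (fval (block ?k (y j)))))\<^sup>2)"
      unfolding kill[of _ "y _"] ..
    also have "\<dots> \<le> c\<^sup>2 * (\<Sum>j<n. (norm (fval (block ?k (y j))))\<^sup>2)"
      by (rule kernel_rep_cb_bounded_span[OF mk cb rep X sl blk])
    also have "\<dots> \<le> c\<^sup>2 * (\<Sum>j<n. (norm (fval (y j)))\<^sup>2)"
      by (intro mult_left_mono sum_mono nb) simp
    finally show ?thesis .
  qed
  have "\<forall>j. \<exists>Y. (\<lambda>k. fval (Y k)) \<longlonglongrightarrow> \<xi> j" using fval_dense by blast
  then obtain Y where Y: "\<And>j. (\<lambda>k. fval (Y j k)) \<longlonglongrightarrow> \<xi> j" by metis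
  have "(\<lambda>k. \<Sum>i<n. (norm (\<Sum>j<n. bop_apply (?\<delta> (X i j)) (fval (Y j k))))\<^sup>2)
      \<longlonglongrightarrow> (\<Sum>i<n. (norm (\<Sum>j<n. bop_apply (?\<delta> (X i j)) (\<xi> j)))\<^sup>2)"
    by (intro tendsto_intros bounded_linear.tendsto[OF bounded_linear_bop_apply] Y)
  moreover have "(\<lambda>k. c\<^sup>2 * (\<Sum>j<n. (norm (fval (Y j k)))\<^sup>2)) \<longlonglongrightarrow> c\<^sup>2 * (\<Sum>j<n. (norm (\<xi> j))\<^sup>2)"
    by (intro tendsto_intros Y)
  ultimately show "(\<Sum>i<n. (norm (\<Sum>j<n. bop_apply (?\<delta> (X i j)) (\<xi> j)))\<^sup>2) \<le> c\<^sup>2 * (\<Sum>j<n. (norm (\<xi> j))\<^sup>2)"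
    by (rule LIMSEQ_le) (use fin[of "\<lambda>j. Y j _"] in blast)
qed

lemma kernel_joint_dilation:
  assumes mk: "gram_kernel D F" and cb: "kernel_cb_bounded c D F \<alpha>1 \<alpha>2"
    and act: "kernel_action F \<alpha>1" "kernel_action F \<alpha>2"
    and x: "F x x = 1" "\<And>a. F x (\<alpha>1 a x) = \<phi>1 a" "\<And>a. F x (\<alpha>2 a x) = \<phi>2 a"
  shows "\<exists>\<sigma>1 \<sigma>2. kernel_rep F \<alpha>1 \<sigma>1 \<and> kernel_rep F \<alpha>2 \<sigma>2 \<and> joint_dilation c \<phi>1 \<phi>2 \<sigma>1 \<sigma>2 (kvec F x)"
proof -
  obtain \<sigma>1 \<sigma>2 where rep: "kernel_rep F \<alpha>1 \<sigma>1" "kernel_rep F \<alpha>2 \<sigma>2"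
    using kernel_rep_exists[OF mk] act by metis
  show ?thesis unfolding joint_dilation_def
    using rep kernel_dilation[OF mk act(1) rep(1) x(1,2)] kernel_dilation[OF mk act(2) rep(2) x(1,3)]
      kernel_rep_one_eq[OF mk act(1) rep(1) act(2) rep(2)] kernel_rep_cb_bounded[OF mk cb rep] by blast
qed


section \<open>Compression by a conditional expectation\<close>

text \<open>The operator \<open>S^* T\<close>, the operator-valued inner product of \<open>S\<close>
  and \<open>T\<close>.\<close>

definition gram :: "('g::chilbert_space \<Rightarrow> 'h::chilbert_space) \<Rightarrow> ('g \<Rightarrow> 'h) \<Rightarrow> 'g bop" where
  "gram S T = bop_of (\<lambda>g. adj S (T g))"

lemma bop_eqI_cinner_right:
  assumes "\<And>g h. cinner g (bop_apply A h) = cinner g (bop_apply (B::'g::chilbert_space bop) h)"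
  shows "A = B"
  by (rule bop_eqI, rule cinner_eqI) (rule assms)

lemma cinner_gram:
  assumes "bclin S" "bclin T"
  shows "cinner g (bop_apply (gram S T) h) = cinner (S g) (T h)"
  by (simp add: gram_def bop_apply_bop_of bclin_compose[OF adj(1) assms(2)] adj assms)

lemma star_gram: "bclin S \<Longrightarrow> bclin T \<Longrightarrow> star (gram S T) = gram T S"
  by (rule bop_eqI_cinner_right) (metis cinner_gram bop_apply_star' cinner_commute)

lemma gram_eqI:
  assumes "bclin S" "bclin T" "\<And>g h. cinner g (bop_apply A h) = cinner (S g) (T h)"
  shows "A = gram S T"
  by (rule bop_eqI_cinner_right) (simp add: cinner_gram assms)

text \<open>Complete positivity is implicit: by the bimodule property
  \<open>v^* P(T) w = P(v^* T w)\<close> for \<open>v\<close>, \<open>w\<close> in \<open>D\<close>,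
  so matrix positivity against columns over \<open>D\<close> reduces to positivity of
  \<open>P\<close>.\<close>

definition conditional_expectation :: "'d::unital_cstar_algebra set \<Rightarrow> ('d \<Rightarrow> 'd) \<Rightarrow> bool" where
  "conditional_expectation D P \<longleftrightarrow> cstar_subalgebra D \<and> (\<forall>T. P T \<in> D) \<and> (\<forall>d\<in>D. P d = d) \<and>
     (\<forall>S T. P (S + T) = P S + P T) \<and> (\<forall>c T. P (c *\<^sub>C T) = c *\<^sub>C P T) \<and>
     (\<forall>T. P (star T) = star (P T)) \<and> (\<forall>T. pos T \<longrightarrow> pos (P T)) \<and>
     (\<forall>d\<in>D. \<forall>T. P (d * T) = d * P T \<and> P (T * d) = P T * d)"

lemma conditional_expectationD:
  assumes "conditional_expectation D P"
  shows "cstar_subalgebra D" "P T \<in> D" "d \<in> D \<Longrightarrow> P d = d" "P (S + T) = P S + P T" "P (c *\<^sub>C T) = c *\<^sub>C P T"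
    "P (star T) = star (P T)" "pos T \<Longrightarrow> pos (P T)" "d \<in> D \<Longrightarrow> P (d * T) = d * P T" "d \<in> D \<Longrightarrow> P (T * d) = P T * d"
    "P 0 = 0" "P (S - T) = P S - P T" "P (r *\<^sub>R T) = r *\<^sub>R P T" "P (\<Sum>i\<in>I. f i) = (\<Sum>i\<in>I. P (f i))"
proof -
  show basic: "cstar_subalgebra D" "P T \<in> D" "d \<in> D \<Longrightarrow> P d = d" "P (S + T) = P S + P T" "P (c *\<^sub>C T) = c *\<^sub>C P T"
    "P (star T) = star (P T)" "pos T \<Longrightarrow> pos (P T)" "d \<in> D \<Longrightarrow> P (d * T) = d * P T" "d \<in> D \<Longrightarrow> P (T * d) = P T * d"
    for T S d c
    using assms unfolding conditional_expectation_def by blast+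
  show zero: "P 0 = 0" using basic(5)[of 0 0] by simp
  show "P (S - T) = P S - P T" using basic(4)[of "S - T" T] by simp
  show "P (r *\<^sub>R T) = r *\<^sub>R P T" by (simp add: scaleR_scaleC basic)
  show "P (\<Sum>i\<in>I. f i) = (\<Sum>i\<in>I. P (f i))"
    by (induction I rule: infinite_finite_induct) (simp_all add: zero basic)
qed

lemma conditional_expectation_id: "conditional_expectation UNIV (\<lambda>T. T)"
  by (simp add: conditional_expectation_def cstar_subalgebra_UNIV)

text \<open>The left-hand side of \<open>kernel_cb_bounded\<close> and of \<open>cb_bounded\<close>, for vectors of a Hilbert space.\<close>

lemma slot_sum_eq:
  fixes y :: "nat \<Rightarrow> 'h::chilbert_space" and m n :: nat
  assumes s: "\<And>l. l < m \<Longrightarrow> s l < n"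
  defines "Y \<equiv> \<lambda>j. \<Sum>l<m. if s l = j then y l else 0"
  shows "Re (\<Sum>l<m. \<Sum>l'<m. c\<^sup>2 *\<^sub>R (if s l = s l' then cinner (y l) (y l') else 0)
      - (\<Sum>i<n. cinner (bop_apply (\<delta> i (s l)) (y l)) (bop_apply (\<delta> i (s l')) (y l'))))
    = c\<^sup>2 * (\<Sum>j<n. (norm (Y j))\<^sup>2) - (\<Sum>i<n. (norm (\<Sum>j<n. bop_apply (\<delta> i j) (Y j)))\<^sup>2)"
proof -
  have "(\<Sum>j<n. cinner (Y j) (Y j)) = (\<Sum>j<n. \<Sum>l<m. \<Sum>l'<m. cinner (if s l = j then y l else 0) (if s l' = j then y l' else 0))"
    unfolding Y_def unfolding cinner_sum_left unfolding cinner_sum_right ..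
  also have "\<dots> = (\<Sum>l<m. \<Sum>l'<m. \<Sum>j<n. cinner (if s l = j then y l else 0) (if s l' = j then y l' else 0))"
    by (subst sum.swap) (intro sum.cong refl sum.swap)
  also have "\<dots> = (\<Sum>l<m. \<Sum>l'<m. \<Sum>j<n. if j = s l then (if s l = s l' then cinner (y l) (y l') else 0) else 0)"
    by (intro sum.cong refl) auto
  also have "\<dots> = (\<Sum>l<m. \<Sum>l'<m. if s l = s l' then cinner (y l) (y l') else 0)"
    using s by simp
  finally have 1: "(\<Sum>j<n. cinner (Y j) (Y j)) = (\<Sum>l<m. \<Sum>l'<m. if s l = s l' then cinner (y l) (y l') else 0)" .
  have w: "(\<Sum>j<n. bop_apply (\<delta> i j) (Y j)) = (\<Sum>l<m. bop_apply (\<delta> i (s l)) (y l))" for i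
  proof -
    have "(\<Sum>j<n. bop_apply (\<delta> i j) (Y j)) = (\<Sum>j<n. \<Sum>l<m. if j = s l then bop_apply (\<delta> i (s l)) (y l) else 0)"
      by (intro sum.cong refl) (auto simp: Y_def bop_apply_sum_right bop_apply_more intro!: sum.cong)
    also have "\<dots> = (\<Sum>l<m. \<Sum>j<n. if j = s l then bop_apply (\<delta> i (s l)) (y l) else 0)" by (rule sum.swap)
    finally show ?thesis using s by simp
  qed
  have "(\<Sum>i<n. cinner (\<Sum>j<n. bop_apply (\<delta> i j) (Y j)) (\<Sum>j<n. bop_apply (\<delta> i j) (Y j)))
      = (\<Sum>i<n. \<Sum>l<m. \<Sum>l'<m. cinner (bop_apply (\<delta> i (s l)) (y l)) (bop_apply (\<delta> i (s l')) (y l')))"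
    unfolding w unfolding cinner_sum_left unfolding cinner_sum_right ..
  also have "\<dots> = (\<Sum>l<m. \<Sum>l'<m. \<Sum>i<n. cinner (bop_apply (\<delta> i (s l)) (y l)) (bop_apply (\<delta> i (s l')) (y l')))"
    by (subst sum.swap) (intro sum.cong refl sum.swap)
  finally have 2: "(\<Sum>i<n. cinner (\<Sum>j<n. bop_apply (\<delta> i j) (Y j)) (\<Sum>j<n. bop_apply (\<delta> i j) (Y j))) = \<dots>" .
  have 3: "(\<Sum>j<n. (norm (f j))\<^sup>2) = Re (\<Sum>j<n. cinner (f j) (f j))" for f :: "nat \<Rightarrow> 'h"
    by (simp add: norm_eq_Re_cinner)
  show ?thesis unfolding 3 1 2 sum_subtractf scaleR_sum_right[symmetric] by (simp del: Re_sum)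
qed

section \<open>Words in the two representations\<close>

primrec word_act :: "(bool \<Rightarrow> 'a \<Rightarrow> 'h::chilbert_space bop) \<Rightarrow> (bool \<times> 'a) list \<Rightarrow> 'h \<Rightarrow> 'h" where
  "word_act \<sigma> [] h = h"
| "word_act \<sigma> (u # w) h = bop_apply (\<sigma> (fst u) (snd u)) (word_act \<sigma> w h)"

lemma bclin_word_act: "bclin (word_act \<sigma> w)"
proof (induction w)
  case Nil then show ?case using bclin_id by (simp add: fun_eq_iff[symmetric] word_act.simps(1)[abs_def])
next
  case (Cons u w)
  have "word_act \<sigma> (u # w) = (\<lambda>h. bop_apply (\<sigma> (fst u) (snd u)) (word_act \<sigma> w h))" by auto
  then show ?case using bclin_compose[OF bclin_bop_apply Cons] by simp
qed

definition word_vec where "word_vec \<sigma> V w = (\<lambda>g. word_act \<sigma> w (V g))"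

lemma bclin_word_vec: "bclin V \<Longrightarrow> bclin (word_vec \<sigma> V w)"
  unfolding word_vec_def by (rule bclin_compose[OF bclin_word_act])

lemma word_act_kernel_rep:
  assumes "\<And>b. kernel_rep F (\<lambda>a w. (b, a) # w) (\<sigma> b)"
  shows "word_act \<sigma> w (kvec F w' g) = kvec F (w @ w') g"
  by (induction w) (simp_all add: kernel_repD(2)[OF assms])

text \<open>The new Hilbert space is the completion of the span of the vectors \<open>w V \<otimes> g\<close> with the inner product
  \<open>\<langle>w V \<otimes> g, w' V \<otimes> h\<rangle> = \<langle>g, P (V\<^sup>* w\<^sup>* w' V) h\<rangle>\<close>.\<close>

lemma joint_dilation_compress:
  fixes \<phi>1 \<phi>2 :: "'a::unital_cstar_algebra \<Rightarrow> 'g::chilbert_space bop"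
  assumes P: "conditional_expectation D P" and \<phi>: "\<And>a. \<phi>1 a \<in> D" "\<And>a. \<phi>2 a \<in> D"
    and jd: "joint_dilation c \<phi>1 \<phi>2 \<sigma>1 \<sigma>2 V"
  shows "\<exists>(\<tau>1 :: 'a \<Rightarrow> ((bool \<times> 'a) list \<times> 'g) uhil bop) \<tau>2 W. joint_dilation c \<phi>1 \<phi>2 \<tau>1 \<tau>2 W \<and>
    (\<forall>w w'. gram (word_vec (\<lambda>b. if b then \<tau>1 else \<tau>2) W w) (word_vec (\<lambda>b. if b then \<tau>1 else \<tau>2) W w') \<in> D)"
proof -
  note E = conditional_expectationD[OF P]
  note D' = cstar_subalgebraD[OF E(1)]
  have hom: "star_hom_on UNIV \<sigma>1" "star_hom_on UNIV \<sigma>2" and V: "bclin V" "\<And>g h. cinner (V g) (V h) = cinner g h"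
    and one: "\<sigma>1 1 = \<sigma>2 1" "\<And>g. bop_apply (\<sigma>1 1) (V g) = V g"
    and \<phi>eq: "\<And>a g h. cinner (V g) (bop_apply (\<sigma>1 a) (V h)) = cinner g (bop_apply (\<phi>1 a) h)"
      "\<And>a g h. cinner (V g) (bop_apply (\<sigma>2 a) (V h)) = cinner g (bop_apply (\<phi>2 a) h)"
    and cb: "cb_bounded c (\<lambda>a. \<sigma>1 a - \<sigma>2 a)"
    using jd unfolding joint_dilation_def dilation_def by blast+
  define \<sigma> where "\<sigma> b = (if b then \<sigma>1 else \<sigma>2)" for b
  have \<sigma>hom: "star_hom_on UNIV (\<sigma> b)" for b by (simp add: \<sigma>_def hom)
  note h = star_hom_onD[OF \<sigma>hom cstar_subalgebra_UNIV, simplified]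
  define T where "T w = word_vec \<sigma> V w" for w
  have bT: "bclin (T w)" for w unfolding T_def by (rule bclin_word_vec[OF V(1)])
  have Tc: "T (u # w) g = bop_apply (\<sigma> (fst u) (snd u)) (T w g)" for u w g by (simp add: T_def word_vec_def)
  \<comment> \<open>A nonempty word maps into the range of the common unit, and the empty word does
    so by the dilation property.\<close>
  have T1: "bop_apply (\<sigma> b 1) (T w g) = T w g" for b w g
  proof (cases w)
    case Nil
    then show ?thesis using one by (simp add: T_def word_vec_def \<sigma>_def)
  next
    case (Cons u w')
    have "\<sigma> b 1 = \<sigma> (fst u) 1" using one by (simp add: \<sigma>_def)
    then show ?thesis by (simp add: Cons Tc flip: bop_apply_ops h(2))
  qed
  define G where "G w w' = gram (T w) (T w')" for w w'
  have cG: "cinner g (bop_apply (G w w') k) = cinner (T w g) (T w' k)" for g k w w'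
    unfolding G_def by (rule cinner_gram[OF bT bT])
  define F where "F w w' = P (G w w')" for w w'
  have sG: "star (G w w') = G w' w" for w w' by (simp add: G_def star_gram bT)
  have mk: "gram_kernel D F"
    unfolding gram_kernel_def
  proof (intro conjI allI impI)
    show "cstar_subalgebra D" "F w w' \<in> D" for w w' by (simp_all add: E F_def)
    show "star (F w w') = F w' w" for w w' by (simp add: F_def sG flip: E(6))
    fix n :: nat and \<xi> v assume v: "\<forall>i<n. v i \<in> D"
    \<comment> \<open>By the bimodule property the sum over \<open>F\<close> is \<open>P\<close> of
      the same sum over \<open>G\<close>, whose form at \<open>g\<close> is the squared norm of one
      vector.\<close>
    let ?Q = "\<Sum>i<n. \<Sum>j<n. star (v i) * G (\<xi> i) (\<xi> j) * v j"
    have "(\<Sum>i<n. \<Sum>j<n. star (v i) * F (\<xi> i) (\<xi> j) * v j) = P ?Q"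
      using v by (simp add: F_def E D')
    moreover have "pos ?Q"
      unfolding pos_bop_iff
    proof (intro conjI allI)
      show "star ?Q = ?Q"
        by (subst sum.swap) (simp add: star_sum star_mult sG star_star mult.assoc)
      fix g
      have "cinner g (bop_apply ?Q g) = cinner (\<Sum>i<n. T (\<xi> i) (bop_apply (v i) g)) (\<Sum>i<n. T (\<xi> i) (bop_apply (v i) g))"
        unfolding cinner_sum_left unfolding cinner_sum_right
        by (simp add: bop_apply_sum bop_apply_ops cinner_sum_right bop_apply_star' cG)
      then show "0 \<le> Re (cinner g (bop_apply ?Q g))" by (simp add: cinner_self)
    qed
    ultimately show "pos (\<Sum>i<n. \<Sum>j<n. star (v i) * F (\<xi> i) (\<xi> j) * v j)" by (simp only: E(7))
  qed
  define \<alpha> where "\<alpha> b a w = (b, a) # w" for b :: bool and a :: 'a and w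
  have T\<alpha>: "T (\<alpha> b a w) g = bop_apply (\<sigma> b a) (T w g)" for b a w g by (simp add: \<alpha>_def Tc)
  have act: "kernel_action F (\<alpha> b)" for b
  proof -
    have G: "G x (\<alpha> b (a + a') y) = G x (\<alpha> b a y) + G x (\<alpha> b a' y)"
      "G x (\<alpha> b (k *\<^sub>C a) y) = k *\<^sub>C G x (\<alpha> b a y)" "G x (\<alpha> b (a * a') y) = G x (\<alpha> b a (\<alpha> b a' y))"
      "G x (\<alpha> b 1 y) = G x y" "G (\<alpha> b a x) y = G x (\<alpha> b (star a) y)" for a a' k x y
      by (rule bop_eqI_cinner_right; simp add: cG T\<alpha> h bop_apply_ops bop_apply_scaleC_bop
          cinner_add_right cinner_scaleC_right T1 bop_apply_star')+
    show ?thesis unfolding kernel_action_def F_def by (simp add: G E)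
  qed
  have kcb: "kernel_cb_bounded c D F (\<alpha> True) (\<alpha> False)"
    unfolding kernel_cb_bounded_def
  proof (intro allI impI)
    fix n m :: nat and X :: "nat \<Rightarrow> nat \<Rightarrow> 'a" and s :: "nat \<Rightarrow> nat" and \<xi> :: "nat \<Rightarrow> (bool \<times> 'a) list" and v
    assume X: "matrix_norm n X \<le> 1" and sv: "\<forall>l<m. s l < n \<and> v l \<in> D"
    let ?d = "\<lambda>K i l l'. diff_kernel K (\<alpha> True) (\<alpha> False) (X i (s l)) (\<xi> l) (X i (s l')) (\<xi> l')"
    let ?M = "\<lambda>K l l'. c\<^sup>2 *\<^sub>R (if s l = s l' then K (\<xi> l) (\<xi> l') else 0) - (\<Sum>i<n. ?d K i l l')"
    \<comment> \<open>The same device: for \<open>G\<close> the complete bound is an operator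
      inequality, and \<open>P\<close> preserves it.\<close>
    let ?Q = "\<Sum>l<m. \<Sum>l'<m. star (v l) * ?M G l l' * v l'"
    have FG: "?M F l l' = P (?M G l l')" for l l'
      by (simp add: F_def diff_kernel_def E)
    have "(\<Sum>l<m. \<Sum>l'<m. star (v l) * ?M F l l' * v l') = P ?Q"
      using sv unfolding FG by (simp add: E(8,9,13) D')
    moreover have "pos ?Q"
      unfolding pos_bop_iff
    proof (intro conjI allI)
      have "star (?M G l l') = ?M G l' l" for l l'
        by (simp add: diff_kernel_def star_diff star_scaleR star_sum sG if_distrib[of star] eq_commute[of "s l"] cong: if_cong)
          (simp add: algebra_simps)
      then show "star ?Q = ?Q"
        by (subst sum.swap) (simp add: star_sum star_mult star_star mult.assoc del: star_diff)
      fix g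
      let ?y = "\<lambda>l. T (\<xi> l) (bop_apply (v l) g)"
      let ?Y = "\<lambda>j. \<Sum>l<m. if s l = j then ?y l else 0"
      have d: "cinner (bop_apply (v l) g) (bop_apply (?d G i l l') (bop_apply (v l') g))
          = cinner (bop_apply (\<sigma>1 (X i (s l)) - \<sigma>2 (X i (s l))) (?y l)) (bop_apply (\<sigma>1 (X i (s l')) - \<sigma>2 (X i (s l'))) (?y l'))"
        for i l l'
        by (simp add: diff_kernel_def bop_apply_more cinner_diff cG T\<alpha> \<sigma>_def)
      have "cinner g (bop_apply (star (v l) * ?M G l l' * v l') g)
          = c\<^sup>2 *\<^sub>R (if s l = s l' then cinner (?y l) (?y l') else 0)
            - (\<Sum>i<n. cinner (bop_apply (\<sigma>1 (X i (s l)) - \<sigma>2 (X i (s l))) (?y l)) (bop_apply (\<sigma>1 (X i (s l')) - \<sigma>2 (X i (s l'))) (?y l')))"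
        for l l'
        unfolding d[symmetric]
        by (simp add: bop_apply_ops(3) bop_apply_star')
          (simp add: bop_apply_more bop_apply_ops bop_apply_sum cinner_diff cinner_minus cinner_scaleR cinner_sum_right cG)
      then have "Re (cinner g (bop_apply ?Q g)) = c\<^sup>2 * (\<Sum>j<n. (norm (?Y j))\<^sup>2)
          - (\<Sum>i<n. (norm (\<Sum>j<n. bop_apply (\<sigma>1 (X i j) - \<sigma>2 (X i j)) (?Y j)))\<^sup>2)"
        unfolding bop_apply_sum cinner_sum_right using sv
        by (simp only: slot_sum_eq[of m s n c ?y "\<lambda>i j. \<sigma>1 (X i j) - \<sigma>2 (X i j)"])
      moreover have "(\<Sum>i<n. (norm (\<Sum>j<n. bop_apply (\<sigma>1 (X i j) - \<sigma>2 (X i j)) (?Y j)))\<^sup>2)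
          \<le> c\<^sup>2 * (\<Sum>j<n. (norm (?Y j))\<^sup>2)"
        using cb[unfolded cb_bounded_def, rule_format, OF X] .
      ultimately show "0 \<le> Re (cinner g (bop_apply ?Q g))" by linarith
    qed
    ultimately show "pos (\<Sum>l<m. \<Sum>l'<m. star (v l) * ?M F l l' * v l')" by (simp only: E(7))
  qed
  have G0: "G [] [] = 1" "G [] (\<alpha> True a []) = \<phi>1 a" "G [] (\<alpha> False a []) = \<phi>2 a" for a
    by (rule bop_eqI_cinner_right;
        simp add: cG T\<alpha> bop_apply_ops; simp add: T_def word_vec_def \<sigma>_def V \<phi>eq)+
  obtain \<tau>1 \<tau>2 where \<tau>: "kernel_rep F (\<alpha> True) \<tau>1" "kernel_rep F (\<alpha> False) \<tau>2"
    "joint_dilation c \<phi>1 \<phi>2 \<tau>1 \<tau>2 (kvec F [])"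
    using kernel_joint_dilation[OF mk kcb act act, of "[]" \<phi>1 \<phi>2] by (auto simp: F_def G0 E \<phi> D')
  let ?\<tau> = "\<lambda>b. if b then \<tau>1 else \<tau>2"
  have "kernel_rep F (\<lambda>a w. (b, a) # w) (?\<tau> b)" for b
    using \<tau>(1,2) by (simp add: \<alpha>_def[abs_def])
  \<comment> \<open>Words act on the cyclic tensor by concatenation, so all Gram operators of the
    new dilation are values of \<open>F\<close>, hence lie in \<open>D\<close>.\<close>
  then have wv: "word_vec ?\<tau> (kvec F []) w = kvec F w" for w
    unfolding word_vec_def using word_act_kernel_rep[of F ?\<tau> w "[]"] by simp
  have bk: "bclin (kvec F w)" for w
  proof -
    have "bclin (kvec F [])" using \<tau>(3) by (simp add: joint_dilation_def dilation_def)
    then show ?thesis using bclin_word_vec[of "kvec F []" ?\<tau> w] by (simp add: wv)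
  qed
  have "gram (kvec F w) (kvec F w') = F w w'" for w w'
    by (rule gram_eqI[symmetric, OF bk bk]) (simp add: cinner_kvec[OF mk])
  then have "gram (word_vec ?\<tau> (kvec F []) w) (word_vec ?\<tau> (kvec F []) w') \<in> D" for w w'
    by (simp add: wv F_def E)
  with \<tau>(3) show ?thesis by blast
qed


section \<open>Dilations of unital completely positive maps\<close>

text \<open>The matrix \<open>star (\<xi> i) * \<xi> j\<close> is \<open>Y^* Y\<close> for the
  \<open>Y\<close> with first row \<open>\<xi>\<close> and zeros elsewhere; \<open>0 < n\<close>
  provides that row.\<close>

lemma UCP_gram:
  fixes \<phi> :: "'a::unital_cstar_algebra \<Rightarrow> 'd::unital_cstar_algebra"
  assumes \<phi>: "\<phi> \<in> UCP S D" and S: "cstar_subalgebra S" and n: "0 < (n::nat)" and \<xi>: "\<And>i. i < n \<Longrightarrow> \<xi> i \<in> S"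
  shows "\<exists>Z. \<forall>i<n. \<forall>j<n. \<phi> (star (\<xi> i) * \<xi> j) = (\<Sum>k<n. star (Z k i) * Z k j)"
proof -
  note S' = cstar_subalgebraD[OF S]
  let ?X = "\<lambda>i j. star (\<xi> i) * \<xi> j"
  have "positive_matrix S n ?X"
    unfolding positive_matrix_def
  proof (intro bexI[of _ "\<lambda>k j. if k = 0 then \<xi> j else 0"] allI impI)
    show "(\<lambda>k j. if k = 0 then \<xi> j else 0) \<in> matrices n S" using \<xi> S' by (auto simp: matrices_def)
    fix i j
    have "(\<Sum>k<n. star (if k = 0 then \<xi> i else 0) * (if k = 0 then \<xi> j else 0)) = (\<Sum>k<n. if k = 0 then ?X i j else 0)"
      by (intro sum.cong) auto
    then show "?X i j = (\<Sum>k<n. star (if k = 0 then \<xi> i else 0) * (if k = 0 then \<xi> j else 0))" using n by simp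
  qed
  moreover have "?X \<in> matrices n S" using \<xi> S' by (auto simp: matrices_def)
  ultimately have "positive_matrix D n (\<lambda>i j. \<phi> (?X i j))"
    using \<phi> unfolding UCP_def completely_positive_def by blast
  then show ?thesis unfolding positive_matrix_def by blast
qed

text \<open>For the pair \<open>1, a\<close> the two off-diagonal entries of the positive 2 by 2
  matrix are adjoint to each other.\<close>

lemma UCP_star:
  fixes \<phi> :: "'a::unital_cstar_algebra \<Rightarrow> 'd::unital_cstar_algebra"
  assumes "\<phi> \<in> UCP UNIV D"
  shows "\<phi> (star a) = star (\<phi> a)"
proof -
  obtain Z where Z: "\<forall>i<2::nat. \<forall>j<2::nat. \<phi> (star (if i = 0 then 1 else a) * (if j = 0 then 1 else a)) = (\<Sum>k<(2::nat). star (Z k i) * Z k j)"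
    using UCP_gram[OF assms cstar_subalgebra_UNIV, of 2 "\<lambda>i. if i = 0 then 1 else a"] by auto
  have "\<phi> a = (\<Sum>k<2. star (Z k 0) * Z k 1)" using Z[rule_format, of 0 1] by simp
  moreover have "\<phi> (star a) = (\<Sum>k<2. star (Z k 1) * Z k 0)" using Z[rule_format, of 1 0] by simp
  ultimately show ?thesis by (simp add: star_sum star_mult star_star star_add)
qed

lemma UCP_gram_pos:
  fixes \<phi> :: "'a::unital_cstar_algebra \<Rightarrow> 'd::unital_cstar_algebra"
  assumes "\<phi> \<in> UCP UNIV D"
  shows "pos (\<Sum>i<n. \<Sum>j<n::nat. star (v i) * \<phi> (star (\<xi> i) * \<xi> j) * v j)"
proof (cases "n = 0")
  case False
  then obtain Z where Z: "\<forall>i<n. \<forall>j<n. \<phi> (star (\<xi> i) * \<xi> j) = (\<Sum>k<n. star (Z k i) * Z k j)"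
    using UCP_gram[OF assms cstar_subalgebra_UNIV, of n \<xi>] by auto
  have "(\<Sum>i<n. \<Sum>j<n. star (v i) * \<phi> (star (\<xi> i) * \<xi> j) * v j)
      = (\<Sum>i<n. \<Sum>j<n. \<Sum>k<n. star (v i) * star (Z k i) * (Z k j * v j))"
    using Z by (intro sum.cong refl) (simp add: sum_distrib_left sum_distrib_right mult.assoc)
  also have "\<dots> = (\<Sum>i<n. \<Sum>k<n. \<Sum>j<n. star (v i) * star (Z k i) * (Z k j * v j))"
    by (intro sum.cong refl sum.swap)
  also have "\<dots> = (\<Sum>k<n. \<Sum>i<n. \<Sum>j<n. star (v i) * star (Z k i) * (Z k j * v j))" by (rule sum.swap)
  also have "\<dots> = (\<Sum>k<n. star (\<Sum>i<n. Z k i * v i) * (\<Sum>i<n. Z k i * v i))"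
    by (simp add: star_sum star_mult sum_product)
  also have "pos \<dots>" by (intro pos_sum pos_star_times)
  finally show ?thesis .
qed simp

definition stinespring_kernel :: "('a::unital_cstar_algebra \<Rightarrow> 'd) \<Rightarrow> 'a \<Rightarrow> 'a \<Rightarrow> 'd" where
  "stinespring_kernel \<phi> a b = \<phi> (star a * b)"

lemma UCPD:
  assumes "\<phi> \<in> UCP UNIV D"
  shows "\<phi> a \<in> D" "\<phi> (a + b) = \<phi> a + \<phi> b" "\<phi> (c *\<^sub>C a) = c *\<^sub>C \<phi> a" "\<phi> 1 = 1"
  using assms by (simp_all add: UCP_def completely_positive_def)

lemma stinespring:
  fixes \<phi> :: "'a::unital_cstar_algebra \<Rightarrow> 'g::chilbert_space bop"
  assumes \<phi>: "\<phi> \<in> UCP UNIV D"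
  shows "gram_kernel UNIV (stinespring_kernel \<phi>)"
    "\<exists>\<sigma>. kernel_rep (stinespring_kernel \<phi>) (*) \<sigma> \<and> dilation \<phi> \<sigma> (kvec (stinespring_kernel \<phi>) 1)"
proof -
  let ?F = "stinespring_kernel \<phi>"
  show mk: "gram_kernel UNIV ?F"
    unfolding gram_kernel_def stinespring_kernel_def
    by (auto simp: cstar_subalgebra_UNIV UCP_gram_pos[OF \<phi>] star_mult star_star simp flip: UCP_star[OF \<phi>])
  have act: "kernel_action ?F (*)"
    by (simp add: kernel_action_def stinespring_kernel_def distrib_left distrib_right UCPD[OF \<phi>]
        mult_scaleC_left mult_scaleC_right mult.assoc star_mult)
  obtain \<sigma> where \<sigma>: "kernel_rep ?F (*) \<sigma>" using kernel_rep_exists[OF mk act] by blast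
  have "dilation \<phi> \<sigma> (kvec ?F 1)"
    by (rule kernel_dilation[OF mk act \<sigma>]) (simp_all add: stinespring_kernel_def UCPD[OF \<phi>])
  with \<sigma> show "\<exists>\<sigma>. kernel_rep ?F (*) \<sigma> \<and> dilation \<phi> \<sigma> (kvec ?F 1)" by blast
qed

text \<open>The Schwarz inequality \<open>P(a\<^sup>* a) \<ge> P(a)\<^sup>* P(a)\<close> makes \<open>(a, b) \<mapsto> P(a\<^sup>* b) - P(a)\<^sup>* P(b)\<close> a positive
  semidefinite form; it vanishes at \<open>(d, d)\<close> for \<open>d \<in> D\<close>, hence at \<open>(d, b)\<close> for all \<open>b\<close>.\<close>

lemma conditional_expectation_of_UCP:
  fixes P :: "'g::chilbert_space bop \<Rightarrow> 'g bop"
  assumes D: "cstar_subalgebra D" and P: "P \<in> UCP UNIV D" and idD: "\<And>d. d \<in> D \<Longrightarrow> P d = d"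
  shows "conditional_expectation D P"
proof -
  note P' = UCPD[OF P] and D' = cstar_subalgebraD[OF D]
  have Pd: "P (a - b) = P a - P b" for a b using P'(2)[of "a - b" b] by simp
  define K where "K a b = P (star a * b) - star (P a) * P b" for a b
  have K: "K a (b + c) = K a b + K a c" "K a (t *\<^sub>C b) = t *\<^sub>C K a b" "star (K a b) = K b a" for a b c t
    by (simp_all add: K_def distrib_left distrib_right P' mult_scaleC_right scaleC_diff_right star_diff star_mult star_star
        flip: UCP_star[OF P])
  have Kp: "0 \<le> Re (cinner g (bop_apply (K a a) g))" for a g
  proof -
    \<comment> \<open>The Schwarz inequality: the pair \<open>1, a\<close> tested against the column
      \<open>- P a, 1\<close> gives \<open>K a a\<close>.\<close>
    let ?\<xi> = "\<lambda>i. if i = 0 then 1 else a" and ?v = "\<lambda>i. if i = (0::nat) then - P a else 1"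
    have "pos (\<Sum>i<2. \<Sum>j<2. star (?v i) * P (star (?\<xi> i) * ?\<xi> j) * ?v j)" by (rule UCP_gram_pos[OF P])
    also have "(\<Sum>i<2. \<Sum>j<2. star (?v i) * P (star (?\<xi> i) * ?\<xi> j) * ?v j) = K a a"
      by (simp add: numeral_2_eq_2 K_def P' UCP_star[OF P] star_minus)
    finally show ?thesis by (rule pos_bop_cinner)
  qed
  have K0: "K d b = 0" if d: "K d d = 0" for d b
  proof (rule bop_eqI)
    have "cinner g (bop_apply (K d b) g) = 0" for g
    proof (rule ccontr)
      let ?z = "cinner g (bop_apply (K d b) g)"
      assume ne: "?z \<noteq> 0"
      \<comment> \<open>Chosen so that the form at \<open>t *\<^sub>C d + b\<close> takes the value
        -1 at \<open>g\<close>.\<close>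
      define r where "r = (Re (cinner g (bop_apply (K b b) g)) + 1) / (2 * (cmod ?z)\<^sup>2)"
      define t where "t = - (complex_of_real r * ?z)"
      have "K (t *\<^sub>C d + b) (t *\<^sub>C d + b) = cnj t *\<^sub>C K d b + t *\<^sub>C K b d + K b b"
      proof -
        have left: "K (x + y) z = K x z + K y z" "K (s *\<^sub>C x) z = cnj s *\<^sub>C K x z" for x y z s
          using K(3)[of z "x + y"] K(3)[of z "s *\<^sub>C x"]
          by (metis K(1,3) star_add, metis K(2,3) star_scaleC)
        show ?thesis by (simp add: K(1,2) left d)
      qed
      then have "Re (cinner g (bop_apply (K (t *\<^sub>C d + b) (t *\<^sub>C d + b)) g))
          = Re (cnj t * ?z + t * cinner g (bop_apply (K b d) g)) + Re (cinner g (bop_apply (K b b) g))"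
        by (simp add: bop_apply_ops bop_apply_scaleC_bop cinner_add_right cinner_scaleC_right)
      also have "cinner g (bop_apply (K b d) g) = cnj ?z"
        by (simp add: K(3)[of d b, symmetric] bop_apply_star' cinner_commute[of g])
      also have "Re (cnj t * ?z + t * cnj ?z) = - (2 * r * (cmod ?z)\<^sup>2)"
        by (simp add: t_def cmod_power2) (simp add: power2_eq_square algebra_simps)
      also have "\<dots> + Re (cinner g (bop_apply (K b b) g)) = - 1" using ne by (simp add: r_def field_simps)
      finally show False using Kp[of g "t *\<^sub>C d + b"] by simp
    qed
    then have z: "cinner g (bop_apply (K d b) g) = 0" for g .
    fix h
    \<comment> \<open>Polarization: over the complex numbers the vanishing of the quadratic form
      kills the operator, even though \<open>K d b\<close> need not be self-adjoint.\<close>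
    have "cinner g (bop_apply (K d b) h) = 0" for g
    proof -
      let ?Q = "bop_apply (K d b)"
      have "cinner (g + h) (?Q (g + h)) = 0" "cinner (g + \<i> *\<^sub>C h) (?Q (g + \<i> *\<^sub>C h)) = 0" by (rule z)+
      then have "cinner g (?Q h) + cinner h (?Q g) = 0" "\<i> * cinner g (?Q h) - \<i> * cinner h (?Q g) = 0"
        by (simp_all add: bop_apply_add bop_apply_scaleC cinner_add_left cinner_add_right cinner_scaleC_left
            cinner_scaleC_right z)
      then have "cinner g (?Q h) + cinner h (?Q g) = 0" "cinner g (?Q h) - cinner h (?Q g) = 0"
        by (simp_all flip: right_diff_distrib)
      then show ?thesis by simp
    qed
    then have "bop_apply (K d b) h = 0" by (intro cinner_eqI) simp
    then show "bop_apply (K d b) h = bop_apply 0 h" by (simp add: bop_apply_more)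
  qed
  have bim: "P (d * b) = d * P b" if d: "d \<in> D" for d b
  proof -
    have "K (star d) (star d) = 0" using d D' by (simp add: K_def idD star_star)
    then have "K (star d) b = 0" by (rule K0)
    then show ?thesis using d D' by (simp add: K_def idD star_star)
  qed
  have "P (b * d) = P b * d" if d: "d \<in> D" for d b
    using bim[of "star d" "star b"] d D' by (metis UCP_star[OF P] star_mult star_star)
  moreover have "pos (P T)" if "pos T" for T
  proof -
    obtain s where s: "star s = s" "T = s * s" using \<open>pos T\<close> by (auto simp: pos_def)
    have "pos (\<Sum>i<(1::nat). \<Sum>j<(1::nat). star 1 * P (star s * s) * 1)" by (rule UCP_gram_pos[OF P])
    then show ?thesis by (simp add: s)
  qed
  ultimately show ?thesis
    unfolding conditional_expectation_def using D P' idD UCP_star[OF P] bim by simp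
qed

text \<open>Injectivity enters here: the identity of \<open>B\<close> extends to a unital completely
  positive map of all operators into \<open>B\<close>, and such a projection is automatically a
  conditional expectation.\<close>

lemma injective_conditional_expectation:
  fixes B :: "'g::chilbert_space bop set"
  assumes B: "cstar_subalgebra B" and inj: "injective_cstar_algebra TYPE('g bop) B"
  shows "\<exists>P. conditional_expectation B P"
proof -
  have "(\<lambda>b. b) \<in> UCP B B"
    using cstar_subalgebraD[OF B] by (auto simp: UCP_def completely_positive_def)
  then obtain P where "P \<in> UCP UNIV B" "\<forall>b\<in>B. P b = b"
    using inj B cstar_subalgebra_UNIV unfolding injective_cstar_algebra_def by (metis subset_UNIV)
  then show ?thesis using conditional_expectation_of_UCP[OF B] by blast
qed


section \<open>From Hilbert modules to Hilbert spaces\<close>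

lemma hilbert_moduleD:
  assumes "is_hilbert_module D E"
  shows "abelian_group E"
    "x \<in> carrier E \<Longrightarrow> d \<in> D \<Longrightarrow> d \<odot>\<^bsub>E\<^esub> x \<in> carrier E"
    "x \<in> carrier E \<Longrightarrow> y \<in> carrier E \<Longrightarrow> ip E x y \<in> D"
    "x \<in> carrier E \<Longrightarrow> y \<in> carrier E \<Longrightarrow> z \<in> carrier E \<Longrightarrow> ip E x (y \<oplus>\<^bsub>E\<^esub> z) = ip E x y + ip E x z"
    "x \<in> carrier E \<Longrightarrow> y \<in> carrier E \<Longrightarrow> d \<in> D \<Longrightarrow> ip E x (d \<odot>\<^bsub>E\<^esub> y) = ip E x y * d"
    "x \<in> carrier E \<Longrightarrow> y \<in> carrier E \<Longrightarrow> star (ip E x y) = ip E y x"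
    "x \<in> carrier E \<Longrightarrow> \<exists>d\<in>D. ip E x x = star d * d"
    "x \<in> carrier E \<Longrightarrow> ip E x x = 0 \<Longrightarrow> x = \<zero>\<^bsub>E\<^esub>"
proof -
  note 1 = assms[unfolded is_hilbert_module_def]
  note 2 = 1[THEN conjunct2] note 3 = 2[THEN conjunct2] note 4 = 3[THEN conjunct2]
  note 5 = 4[THEN conjunct2] note 6 = 5[THEN conjunct2] note 7 = 6[THEN conjunct2]
  note 8 = 7[THEN conjunct2] note 9 = 8[THEN conjunct2] note 10 = 9[THEN conjunct2]
  note 11 = 10[THEN conjunct2] note 12 = 11[THEN conjunct2]
  show "abelian_group E" using 1 by (rule conjunct1)
  show "x \<in> carrier E \<Longrightarrow> d \<in> D \<Longrightarrow> d \<odot>\<^bsub>E\<^esub> x \<in> carrier E" using 2[THEN conjunct1] by blast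
  show "x \<in> carrier E \<Longrightarrow> y \<in> carrier E \<Longrightarrow> ip E x y \<in> D" using 7[THEN conjunct1] by blast
  show "x \<in> carrier E \<Longrightarrow> y \<in> carrier E \<Longrightarrow> z \<in> carrier E \<Longrightarrow> ip E x (y \<oplus>\<^bsub>E\<^esub> z) = ip E x y + ip E x z"
    using 8[THEN conjunct1] by blast
  show "x \<in> carrier E \<Longrightarrow> y \<in> carrier E \<Longrightarrow> d \<in> D \<Longrightarrow> ip E x (d \<odot>\<^bsub>E\<^esub> y) = ip E x y * d"
    using 9[THEN conjunct1] by blast
  show "x \<in> carrier E \<Longrightarrow> y \<in> carrier E \<Longrightarrow> star (ip E x y) = ip E y x"
    by (rule bspec[OF bspec[OF 10[THEN conjunct1]], symmetric])
  show "x \<in> carrier E \<Longrightarrow> \<exists>d\<in>D. ip E x x = star d * d" using 11[THEN conjunct1] by blast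
  show "x \<in> carrier E \<Longrightarrow> ip E x x = 0 \<Longrightarrow> x = \<zero>\<^bsub>E\<^esub>" using 12[THEN conjunct1] by blast
qed

context
  fixes D :: "'d::unital_cstar_algebra set" and E :: "('d, 'e) hilbert_module"
  assumes E: "is_hilbert_module D E"
begin

interpretation abelian_group E
  by (rule hilbert_moduleD(1)[OF E])

lemma ip_zero_right: "x \<in> carrier E \<Longrightarrow> ip E x \<zero>\<^bsub>E\<^esub> = 0"
  using hilbert_moduleD(4)[OF E, of x "\<zero>\<^bsub>E\<^esub>" "\<zero>\<^bsub>E\<^esub>"] by simp

lemma ip_zero_left: "x \<in> carrier E \<Longrightarrow> ip E \<zero>\<^bsub>E\<^esub> x = 0"
  using hilbert_moduleD(6)[OF E, of x "\<zero>\<^bsub>E\<^esub>"] by (simp add: ip_zero_right)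

lemma ip_minus_right: "x \<in> carrier E \<Longrightarrow> y \<in> carrier E \<Longrightarrow> z \<in> carrier E \<Longrightarrow> ip E x (y \<ominus>\<^bsub>E\<^esub> z) = ip E x y - ip E x z"
proof -
  assume a: "x \<in> carrier E" "y \<in> carrier E" "z \<in> carrier E"
  have "ip E x ((y \<ominus>\<^bsub>E\<^esub> z) \<oplus>\<^bsub>E\<^esub> z) = ip E x (y \<ominus>\<^bsub>E\<^esub> z) + ip E x z"
    using a by (intro hilbert_moduleD(4)[OF E]) auto
  moreover have "(y \<ominus>\<^bsub>E\<^esub> z) \<oplus>\<^bsub>E\<^esub> z = y" using a by (simp add: minus_eq a_assoc l_neg)
  ultimately show ?thesis by simp
qed

lemma ip_minus_left: "x \<in> carrier E \<Longrightarrow> y \<in> carrier E \<Longrightarrow> z \<in> carrier E \<Longrightarrow> ip E (y \<ominus>\<^bsub>E\<^esub> z) x = ip E y x - ip E z x"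
  using hilbert_moduleD(6)[OF E] ip_minus_right[of x y z] by (metis minus_closed star_diff)

lemma ip_finsum_right:
  assumes "x \<in> carrier E" "\<And>i. i \<in> I \<Longrightarrow> f i \<in> carrier E" "finite I"
  shows "ip E x (\<Oplus>\<^bsub>E\<^esub>i\<in>I. f i) = (\<Sum>i\<in>I. ip E x (f i))"
  using assms(3,2)
proof (induction I)
  case empty then show ?case using assms(1) by (simp add: ip_zero_right)
next
  case (insert i I)
  then show ?case using assms(1) by (subst finsum_insert) (auto simp: hilbert_moduleD(4)[OF E] Pi_def)
qed

lemma ip_finsum_left:
  assumes "x \<in> carrier E" "\<And>i. i \<in> I \<Longrightarrow> f i \<in> carrier E" "finite I"
  shows "ip E (\<Oplus>\<^bsub>E\<^esub>i\<in>I. f i) x = (\<Sum>i\<in>I. ip E (f i) x)"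
proof -
  have "(\<Oplus>\<^bsub>E\<^esub>i\<in>I. f i) \<in> carrier E" using assms by (intro finsum_closed) auto
  then have "ip E (\<Oplus>\<^bsub>E\<^esub>i\<in>I. f i) x = star (ip E x (\<Oplus>\<^bsub>E\<^esub>i\<in>I. f i))"
    using assms(1) by (simp add: hilbert_moduleD(6)[OF E])
  also have "\<dots> = (\<Sum>i\<in>I. star (ip E x (f i)))"
    using assms by (simp add: ip_finsum_right star_sum)
  finally show ?thesis using assms by (simp add: hilbert_moduleD(6)[OF E])
qed

lemma ip_scale_left: "x \<in> carrier E \<Longrightarrow> y \<in> carrier E \<Longrightarrow> d \<in> D \<Longrightarrow> ip E (d \<odot>\<^bsub>E\<^esub> y) x = star d * ip E y x"
  using hilbert_moduleD(6)[OF E, of x "d \<odot>\<^bsub>E\<^esub> y"]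
  by (simp add: hilbert_moduleD(2,5)[OF E] star_mult hilbert_moduleD(6)[OF E] flip: hilbert_moduleD(6)[OF E, of x "d \<odot>\<^bsub>E\<^esub> y"])

end

lemma unital_star_homD:
  assumes "unital_star_hom E \<sigma>"
  shows "x \<in> carrier E \<Longrightarrow> \<sigma> a x \<in> carrier E"
    "x \<in> carrier E \<Longrightarrow> \<sigma> (a + b) x = \<sigma> a x \<oplus>\<^bsub>E\<^esub> \<sigma> b x"
    "x \<in> carrier E \<Longrightarrow> \<sigma> (c *\<^sub>C a) x = (c *\<^sub>C 1) \<odot>\<^bsub>E\<^esub> \<sigma> a x"
    "x \<in> carrier E \<Longrightarrow> \<sigma> (a * b) x = \<sigma> a (\<sigma> b x)"
    "x \<in> carrier E \<Longrightarrow> \<sigma> 1 x = x"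
    "x \<in> carrier E \<Longrightarrow> y \<in> carrier E \<Longrightarrow> ip E (\<sigma> a x) y = ip E x (\<sigma> (star a) y)"
proof -
  note 1 = assms[unfolded unital_star_hom_def]
  note 2 = 1[THEN conjunct2] note 3 = 2[THEN conjunct2] note 4 = 3[THEN conjunct2]
  note 5 = 4[THEN conjunct2] note 6 = 5[THEN conjunct2]
  have ad: "\<sigma> a \<in> adjointable_maps E" for a using 1[THEN conjunct1] by (rule spec)
  show "x \<in> carrier E \<Longrightarrow> \<sigma> a x \<in> carrier E"
    using ad[of a] unfolding adjointable_maps_def by blast
  show "x \<in> carrier E \<Longrightarrow> \<sigma> (a + b) x = \<sigma> a x \<oplus>\<^bsub>E\<^esub> \<sigma> b x" using 2[THEN conjunct1] by blast
  show "x \<in> carrier E \<Longrightarrow> \<sigma> (c *\<^sub>C a) x = (c *\<^sub>C 1) \<odot>\<^bsub>E\<^esub> \<sigma> a x" using 3[THEN conjunct1] by blast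
  show "x \<in> carrier E \<Longrightarrow> \<sigma> (a * b) x = \<sigma> a (\<sigma> b x)" using 4[THEN conjunct1] by blast
  show "x \<in> carrier E \<Longrightarrow> \<sigma> 1 x = x" using 5[THEN conjunct1] by blast
  show "x \<in> carrier E \<Longrightarrow> y \<in> carrier E \<Longrightarrow> ip E (\<sigma> a x) y = ip E x (\<sigma> (star a) y)"
    using 6 unfolding is_adjoint_def by blast
qed

lemma cb_norm_contraction:
  assumes cb: "cb_norm E \<Delta> \<le> ennreal c" and c: "0 \<le> c" and X: "matrix_norm n X \<le> 1"
    and \<xi>: "\<And>i. i < n \<Longrightarrow> \<xi> i \<in> carrier E" "norm (\<Sum>i<n. ip E (\<xi> i) (\<xi> i)) \<le> 1"
  defines "\<eta> \<equiv> \<lambda>i. \<Oplus>\<^bsub>E\<^esub>j\<in>{..<n}. \<Delta> (X i j) (\<xi> j)"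
  shows "norm (\<Sum>i<n. ip E (\<eta> i) (\<eta> i)) \<le> c\<^sup>2"
proof -
  have "ennreal (module_column_norm E n \<eta>) \<le> operator_matrix_norm E n (\<lambda>i j. \<Delta> (X i j))"
    unfolding operator_matrix_norm_def \<eta>_def using \<xi>
    by (intro SUP_upper2[of \<xi>]) (auto simp: module_column_norm_def)
  also have "\<dots> \<le> cb_norm E \<Delta>"
    unfolding cb_norm_def using X by (intro SUP_upper2[of n] SUP_upper2[of X]) auto
  finally have "ennreal (module_column_norm E n \<eta>) \<le> ennreal c" using cb order_trans by blast
  then have "sqrt (norm (\<Sum>i<n. ip E (\<eta> i) (\<eta> i))) \<le> c"
    using c by (simp add: module_column_norm_def)
  then show ?thesis using sqrt_le_D by blast
qed

lemma sum_rotate: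
  "(\<Sum>i\<in>A. \<Sum>j\<in>B. \<Sum>k\<in>C. f i j k) = (\<Sum>j\<in>B. \<Sum>k\<in>C. \<Sum>i\<in>A. f i j k :: 'z::comm_monoid_add)"
  by (subst sum.swap) (intro sum.cong refl sum.swap)

text \<open>Localization of the module: the Gram kernel of all vectors of \<open>E\<close> gives
  \<open>E \<otimes>\<^sub>D G\<close>. The cb norm bounds the norms of \<open>D\<close>-valued
  inner squares; applied to all columns \<open>v d\<close>, it becomes the operator inequality that
  \<open>kernel_cb_bounded\<close> demands.\<close>

lemma joint_rep_dilation:
  fixes D :: "'g::chilbert_space bop set" and E :: "('g bop, 'e) hilbert_module"
    and \<phi>1 \<phi>2 :: "'a::unital_cstar_algebra \<Rightarrow> 'g bop"
  assumes D: "cstar_subalgebra D" and jr: "joint_rep D \<phi>1 \<phi>2 E \<sigma>1 \<sigma>2 x"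
    and cb: "cb_norm E (\<lambda>a \<xi>. \<sigma>1 a \<xi> \<ominus>\<^bsub>E\<^esub> \<sigma>2 a \<xi>) \<le> ennreal c" and c: "0 \<le> c"
  shows "\<exists>(\<tau>1 :: 'a \<Rightarrow> ('e \<times> 'g) uhil bop) \<tau>2 V. joint_dilation c \<phi>1 \<phi>2 \<tau>1 \<tau>2 V"
proof -
  have E: "is_hilbert_module D E" and hom: "unital_star_hom E \<sigma>1" "unital_star_hom E \<sigma>2"
    and x: "x \<in> carrier E" "ip E x x = 1" and \<phi>: "\<And>a. \<phi>1 a = ip E x (\<sigma>1 a x)" "\<And>a. \<phi>2 a = ip E x (\<sigma>2 a x)"
    using jr by (auto simp: joint_rep_def)
  note H = hilbert_moduleD[OF E] and D' = cstar_subalgebraD[OF D]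
  note h1 = unital_star_homD[OF hom(1)] and h2 = unital_star_homD[OF hom(2)]
  interpret abelian_group E by (rule H(1))
  \<comment> \<open>Indices range over the whole type \<open>'e\<close>, so those outside the
    carrier are read as zero.\<close>
  define r where "r y = (if y \<in> carrier E then y else \<zero>\<^bsub>E\<^esub>)" for y
  have r: "r y \<in> carrier E" "y \<in> carrier E \<Longrightarrow> r y = y" for y by (auto simp: r_def)
  define F where "F y z = ip E (r y) (r z)" for y z
  define \<alpha>1 \<alpha>2 where "\<alpha>1 a y = \<sigma>1 a (r y)" and "\<alpha>2 a y = \<sigma>2 a (r y)" for a y
  have mk: "gram_kernel D F"
    unfolding gram_kernel_def
  proof (intro conjI allI impI D)
    show "F y z \<in> D" "star (F y z) = F z y" for y z by (simp_all add: F_def r H)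
    fix n :: nat and \<xi> v assume v: "\<forall>i<n. v i \<in> D"
    let ?z = "\<Oplus>\<^bsub>E\<^esub>i\<in>{..<n}. v i \<odot>\<^bsub>E\<^esub> r (\<xi> i)"
    have z: "?z \<in> carrier E" using v by (intro finsum_closed) (auto intro!: H(2) r(1))
    have c: "v i \<odot>\<^bsub>E\<^esub> r (\<xi> i) \<in> carrier E" if "i \<in> {..<n}" for i using v that by (auto intro!: H(2) r(1))
    have "ip E ?z ?z = (\<Sum>i<n. ip E (v i \<odot>\<^bsub>E\<^esub> r (\<xi> i)) ?z)"
      by (rule ip_finsum_left[OF E z c]) simp_all
    also have "\<dots> = (\<Sum>i<n. \<Sum>j<n. ip E (v i \<odot>\<^bsub>E\<^esub> r (\<xi> i)) (v j \<odot>\<^bsub>E\<^esub> r (\<xi> j)))"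
      by (intro sum.cong refl ip_finsum_right[OF E c c]) simp_all
    also have "\<dots> = (\<Sum>i<n. \<Sum>j<n. star (v i) * F (\<xi> i) (\<xi> j) * v j)"
      using v c by (intro sum.cong refl) (simp add: H(5) r ip_scale_left[OF E] F_def mult.assoc)
    finally have "ip E ?z ?z = (\<Sum>i<n. \<Sum>j<n. star (v i) * F (\<xi> i) (\<xi> j) * v j)" .
    moreover have "pos (ip E ?z ?z)" using H(7)[OF z] by (auto intro: pos_star_times)
    ultimately show "pos (\<Sum>i<n. \<Sum>j<n. star (v i) * F (\<xi> i) (\<xi> j) * v j)" by simp
  qed
  have act: "kernel_action F \<alpha>1" "kernel_action F \<alpha>2"
    unfolding kernel_action_def F_def \<alpha>1_def \<alpha>2_def
    by (simp_all add: r h1 h2 H D' mult_scaleC_right)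
  have dk: "diff_kernel F \<alpha>1 \<alpha>2 a y b z
      = ip E (\<sigma>1 a (r y) \<ominus>\<^bsub>E\<^esub> \<sigma>2 a (r y)) (\<sigma>1 b (r z) \<ominus>\<^bsub>E\<^esub> \<sigma>2 b (r z))" for a b y z
    by (simp add: diff_kernel_def F_def \<alpha>1_def \<alpha>2_def r h1(1) h2(1) ip_minus_left[OF E] ip_minus_right[OF E])
  have dD: "diff_kernel F \<alpha>1 \<alpha>2 a y b z \<in> D" for a b y z
    using mk by (auto simp: diff_kernel_def gram_kernel_def intro!: D')
  have kcb: "kernel_cb_bounded c D F \<alpha>1 \<alpha>2"
    unfolding kernel_cb_bounded_def
  proof (intro allI impI)
    fix n m :: nat and X :: "nat \<Rightarrow> nat \<Rightarrow> 'a" and s :: "nat \<Rightarrow> nat" and \<xi> :: "nat \<Rightarrow> 'e" and v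
    assume X: "matrix_norm n X \<le> 1" and sv: "\<forall>l<m. s l < n \<and> v l \<in> D"
    \<comment> \<open>The coordinates of the vector of \<open>E^n\<close> with coefficients
      \<open>w\<close>; \<open>p w\<close> is its inner square and \<open>q w\<close> that of its
      image under the amplified difference.\<close>
    define \<zeta> where "\<zeta> w j = (\<Oplus>\<^bsub>E\<^esub>l\<in>{..<m}. if s l = j then w l \<odot>\<^bsub>E\<^esub> r (\<xi> l) else \<zero>\<^bsub>E\<^esub>)" for w j
    define p where "p w = (\<Sum>l<m. \<Sum>l'<m. star (w l) * (if s l = s l' then F (\<xi> l) (\<xi> l') else 0) * w l')" for w
    define q where "q w = (\<Sum>l<m. \<Sum>l'<m. star (w l)
      * (\<Sum>i<n. diff_kernel F \<alpha>1 \<alpha>2 (X i (s l)) (\<xi> l) (X i (s l')) (\<xi> l')) * w l')" for w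
    let ?\<Delta> = "\<lambda>a y. \<sigma>1 a y \<ominus>\<^bsub>E\<^esub> \<sigma>2 a y"
    have term_closed: "(if s l = j then w l \<odot>\<^bsub>E\<^esub> r (\<xi> l) else \<zero>\<^bsub>E\<^esub>) \<in> carrier E"
      if "w l \<in> D" for w l j using that by (auto intro!: H(2) r(1))
    have \<zeta>: "\<zeta> w j \<in> carrier E" if "\<forall>l<m. w l \<in> D" for w j
      unfolding \<zeta>_def using that by (intro finsum_closed) (auto intro!: H(2) r(1))
    have ip\<zeta>: "ip E y (\<zeta> w j) = (\<Sum>l<m. if s l = j then ip E y (r (\<xi> l)) * w l else 0)"
      "ip E (\<zeta> w j) y = (\<Sum>l<m. if s l = j then star (w l) * ip E (r (\<xi> l)) y else 0)"
      if "y \<in> carrier E" "\<forall>l<m. w l \<in> D" for y w j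
    proof -
      show "ip E y (\<zeta> w j) = (\<Sum>l<m. if s l = j then ip E y (r (\<xi> l)) * w l else 0)"
        unfolding \<zeta>_def using that
        by (subst ip_finsum_right[OF E]) (auto simp: term_closed H r ip_zero_right[OF E] intro!: sum.cong)
      show "ip E (\<zeta> w j) y = (\<Sum>l<m. if s l = j then star (w l) * ip E (r (\<xi> l)) y else 0)"
        unfolding \<zeta>_def using that
        by (subst ip_finsum_left[OF E]) (auto simp: term_closed H r ip_zero_left[OF E] ip_scale_left[OF E] intro!: sum.cong)
    qed
    have p: "(\<Sum>j<n. ip E (\<zeta> w j) (\<zeta> w j)) = p w" if w: "\<forall>l<m. w l \<in> D" for w
    proof -
      have "(\<Sum>j<n. ip E (\<zeta> w j) (\<zeta> w j)) = (\<Sum>j<n. \<Sum>l<m. \<Sum>l'<m.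
          if j = s l then star (w l) * (if s l = s l' then F (\<xi> l) (\<xi> l') else 0) * w l' else 0)"
        by (intro sum.cong refl)
          (auto simp: ip\<zeta>(2)[OF \<zeta>[OF w] w] ip\<zeta>(1)[OF r(1) w] F_def sum_distrib_left mult.assoc intro!: sum.cong)
      also have "\<dots> = (\<Sum>l<m. \<Sum>l'<m. \<Sum>j<n.
          if j = s l then star (w l) * (if s l = s l' then F (\<xi> l) (\<xi> l') else 0) * w l' else 0)"
        by (subst sum.swap) (intro sum.cong refl sum.swap)
      finally show ?thesis using sv by (simp add: p_def)
    qed
    have \<Delta>c: "?\<Delta> a y \<in> carrier E" if "y \<in> carrier E" for a y using that by (simp add: h1(1) h2(1))
    have \<Delta>adj: "ip E (?\<Delta> a y) z = ip E y (?\<Delta> (star a) z)" if "y \<in> carrier E" "z \<in> carrier E" for a y z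
      using that by (simp add: ip_minus_left[OF E] ip_minus_right[OF E] h1(1,6) h2(1,6))
    have \<Delta>adj': "ip E z (?\<Delta> a y) = ip E (?\<Delta> (star a) z) y" if "y \<in> carrier E" "z \<in> carrier E" for a y z
      using \<Delta>adj[of z y "star a"] that by (simp add: star_star)
    have \<Delta>\<zeta>: "ip E (?\<Delta> a (\<zeta> w j)) (?\<Delta> b (\<zeta> w j')) = (\<Sum>l<m. \<Sum>l'<m. if s l = j \<and> s l' = j' then
        star (w l) * diff_kernel F \<alpha>1 \<alpha>2 a (\<xi> l) b (\<xi> l') * w l' else 0)" if w: "\<forall>l<m. w l \<in> D" for a b w j j'
    proof -
      note z = \<zeta>[OF w]
      \<comment> \<open>Linearity over \<open>D\<close> is drawn from adjointability: the difference
        is moved to the other side, where the sum \<open>\<zeta>\<close> expands, and then moved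
        back.\<close>
      have inner: "ip E (r (\<xi> l)) (?\<Delta> (star a) (?\<Delta> b (\<zeta> w j')))
          = (\<Sum>l'<m. if s l' = j' then diff_kernel F \<alpha>1 \<alpha>2 a (\<xi> l) b (\<xi> l') * w l' else 0)" for l
      proof -
        have "ip E (r (\<xi> l)) (?\<Delta> (star a) (?\<Delta> b (\<zeta> w j'))) = ip E (?\<Delta> a (r (\<xi> l))) (?\<Delta> b (\<zeta> w j'))"
          by (rule \<Delta>adj[OF r(1) \<Delta>c[OF z], symmetric])
        also have "\<dots> = ip E (?\<Delta> (star b) (?\<Delta> a (r (\<xi> l)))) (\<zeta> w j')"
          by (rule \<Delta>adj'[OF z \<Delta>c[OF r(1)]])
        also have "\<dots> = (\<Sum>l'<m. if s l' = j' then ip E (?\<Delta> (star b) (?\<Delta> a (r (\<xi> l)))) (r (\<xi> l')) * w l' else 0)"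
          by (rule ip\<zeta>(1)[OF \<Delta>c[OF \<Delta>c[OF r(1)]] w])
        finally show ?thesis by (simp only: dk \<Delta>adj'[OF r(1) \<Delta>c[OF r(1)]])
      qed
      have "ip E (?\<Delta> a (\<zeta> w j)) (?\<Delta> b (\<zeta> w j')) = ip E (\<zeta> w j) (?\<Delta> (star a) (?\<Delta> b (\<zeta> w j')))"
        by (rule \<Delta>adj[OF z \<Delta>c[OF z]])
      also have "\<dots> = (\<Sum>l<m. if s l = j then star (w l) * ip E (r (\<xi> l)) (?\<Delta> (star a) (?\<Delta> b (\<zeta> w j'))) else 0)"
        by (rule ip\<zeta>(2)[OF \<Delta>c[OF \<Delta>c[OF z]] w])
      finally show ?thesis unfolding inner by (auto simp: sum_distrib_left mult.assoc intro!: sum.cong)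
    qed
    have q: "(\<Sum>i<n. ip E (\<Oplus>\<^bsub>E\<^esub>j\<in>{..<n}. ?\<Delta> (X i j) (\<zeta> w j)) (\<Oplus>\<^bsub>E\<^esub>j\<in>{..<n}. ?\<Delta> (X i j) (\<zeta> w j))) = q w"
      if w: "\<forall>l<m. w l \<in> D" for w
    proof -
      have fc: "(\<Oplus>\<^bsub>E\<^esub>j\<in>{..<n}. ?\<Delta> (X i j) (\<zeta> w j)) \<in> carrier E" for i
        by (intro finsum_closed) (auto intro: \<Delta>c \<zeta>[OF w])
      let ?t = "\<lambda>i l l'. star (w l) * diff_kernel F \<alpha>1 \<alpha>2 (X i (s l)) (\<xi> l) (X i (s l')) (\<xi> l') * w l'"
      have "ip E (\<Oplus>\<^bsub>E\<^esub>j\<in>{..<n}. ?\<Delta> (X i j) (\<zeta> w j)) (\<Oplus>\<^bsub>E\<^esub>j\<in>{..<n}. ?\<Delta> (X i j) (\<zeta> w j)) = (\<Sum>l<m. \<Sum>l'<m. ?t i l l')" for i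
      proof -
        have "ip E (\<Oplus>\<^bsub>E\<^esub>j\<in>{..<n}. ?\<Delta> (X i j) (\<zeta> w j)) (\<Oplus>\<^bsub>E\<^esub>j\<in>{..<n}. ?\<Delta> (X i j) (\<zeta> w j))
            = (\<Sum>j<n. \<Sum>j'<n. ip E (?\<Delta> (X i j) (\<zeta> w j)) (?\<Delta> (X i j') (\<zeta> w j')))"
          by (simp only: ip_finsum_left[OF E fc \<Delta>c[OF \<zeta>[OF w]] finite_lessThan]
              ip_finsum_right[OF E \<Delta>c[OF \<zeta>[OF w]] \<Delta>c[OF \<zeta>[OF w]] finite_lessThan])
        also have "\<dots> = (\<Sum>j<n. \<Sum>j'<n. \<Sum>l<m. \<Sum>l'<m. if j' = s l' then (if j = s l then ?t i l l' else 0) else 0)"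
          unfolding \<Delta>\<zeta>[OF w] by (intro sum.cong refl) auto
        also have "\<dots> = (\<Sum>j<n. \<Sum>l<m. \<Sum>l'<m. \<Sum>j'<n. if j' = s l' then (if j = s l then ?t i l l' else 0) else 0)"
          by (rule sum.cong[OF refl]) (rule sum_rotate)
        also have "\<dots> = (\<Sum>j<n. \<Sum>l<m. \<Sum>l'<m. if j = s l then ?t i l l' else 0)" using sv by simp
        also have "\<dots> = (\<Sum>l<m. \<Sum>l'<m. \<Sum>j<n. if j = s l then ?t i l l' else 0)"
          by (subst sum.swap) (intro sum.cong refl sum.swap)
        finally show ?thesis using sv by simp
      qed
      then have "(\<Sum>i<n. ip E (\<Oplus>\<^bsub>E\<^esub>j\<in>{..<n}. ?\<Delta> (X i j) (\<zeta> w j)) (\<Oplus>\<^bsub>E\<^esub>j\<in>{..<n}. ?\<Delta> (X i j) (\<zeta> w j)))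
          = (\<Sum>i<n. \<Sum>l<m. \<Sum>l'<m. ?t i l l')" by simp
      also have "\<dots> = (\<Sum>l<m. \<Sum>l'<m. \<Sum>i<n. ?t i l l')"
        by (subst sum.swap) (intro sum.cong refl sum.swap)
      finally show ?thesis by (simp add: q_def sum_distrib_left sum_distrib_right)
    qed
    have sF: "star (diff_kernel F \<alpha>1 \<alpha>2 a y b z) = diff_kernel F \<alpha>1 \<alpha>2 b z a y" for a b y z
      unfolding dk by (rule H(6)) (auto intro: \<Delta>c r)
    have v: "\<forall>l<m. v l \<in> D" using sv by blast
    have "pos (c\<^sup>2 *\<^sub>R p v - q v)"
    proof (rule pos_of_norm_conj[OF D])
      have "pos (ip E (\<zeta> v j) (\<zeta> v j))" for j using H(7)[OF \<zeta>[OF v], of j] by (auto intro: pos_star_times)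
      then show "pos (p v)" unfolding p[OF v, symmetric] by (intro pos_sum)
      show "p v \<in> D" unfolding p[OF v, symmetric] by (intro D' H \<zeta> v)
      show "star (q v) = q v"
        unfolding q_def by (subst sum.swap) (simp add: star_sum star_mult star_star sF mult.assoc)
      fix d assume d: "d \<in> D" "norm (star d * p v * d) \<le> 1"
      let ?w = "\<lambda>l. v l * d"
      have w: "\<forall>l<m. ?w l \<in> D" using v d D' by blast
      have "star d * p v * d = p ?w" "star d * q v * d = q ?w"
        by (simp_all add: p_def q_def sum_distrib_left sum_distrib_right star_mult mult.assoc)
      then show "norm (star d * q v * d) \<le> c\<^sup>2"
        using d(2) unfolding p[OF w, symmetric] q[OF w, symmetric]
        by (simp only:) (intro cb_norm_contraction[OF cb c X] \<zeta>[OF w])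
    qed simp
    moreover have "c\<^sup>2 *\<^sub>R p v - q v = (\<Sum>l<m. \<Sum>l'<m. star (v l) * (c\<^sup>2 *\<^sub>R (if s l = s l' then F (\<xi> l) (\<xi> l') else 0)
          - (\<Sum>i<n. diff_kernel F \<alpha>1 \<alpha>2 (X i (s l)) (\<xi> l) (X i (s l')) (\<xi> l'))) * v l')"
      by (simp add: p_def q_def scaleR_sum_right right_diff_distrib left_diff_distrib sum_subtractf)
    ultimately show "pos (\<Sum>l<m. \<Sum>l'<m. star (v l) * (c\<^sup>2 *\<^sub>R (if s l = s l' then F (\<xi> l) (\<xi> l') else 0)
          - (\<Sum>i<n. diff_kernel F \<alpha>1 \<alpha>2 (X i (s l)) (\<xi> l) (X i (s l')) (\<xi> l'))) * v l')" by (simp only:)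
  qed
  have "F x x = 1" "F x (\<alpha>1 a x) = \<phi>1 a" "F x (\<alpha>2 a x) = \<phi>2 a" for a
    by (simp_all add: F_def \<alpha>1_def \<alpha>2_def r x h1(1) h2(1) \<phi>)
  from kernel_joint_dilation[OF mk kcb act this] show ?thesis by blast
qed


section \<open>From Hilbert spaces to Hilbert modules\<close>

abbreviation blinfun_comp (infixl "\<circ>\<^sub>L" 70) where
  "S \<circ>\<^sub>L T \<equiv> blinfun_compose S T"

definition clinear_blinfun :: "('g::chilbert_space \<Rightarrow>\<^sub>L 'h::chilbert_space) \<Rightarrow> bool" where
  "clinear_blinfun T \<longleftrightarrow> (\<forall>c x. blinfun_apply T (c *\<^sub>C x) = c *\<^sub>C blinfun_apply T x)"

lemma clinear_blinfun_bclin: "clinear_blinfun T \<longleftrightarrow> bclin (blinfun_apply T)"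
  by (simp add: clinear_blinfun_def bclin_def blinfun.bounded_linear_right)

abbreviation bgram :: "('g::chilbert_space \<Rightarrow>\<^sub>L 'h::chilbert_space) \<Rightarrow> ('g \<Rightarrow>\<^sub>L 'h) \<Rightarrow> 'g bop" where
  "bgram S T \<equiv> gram (blinfun_apply S) (blinfun_apply T)"

lemma cinner_bgram:
  "clinear_blinfun S \<Longrightarrow> clinear_blinfun T \<Longrightarrow> cinner g (bop_apply (bgram S T) h) = cinner (blinfun_apply S g) (blinfun_apply T h)"
  by (simp add: clinear_blinfun_bclin cinner_gram)

lemma clinear_blinfun_ops:
  "clinear_blinfun 0" "clinear_blinfun S \<Longrightarrow> clinear_blinfun T \<Longrightarrow> clinear_blinfun (S + T)"
  "clinear_blinfun S \<Longrightarrow> clinear_blinfun T \<Longrightarrow> clinear_blinfun (S - T)"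
  "clinear_blinfun T \<Longrightarrow> clinear_blinfun (T \<circ>\<^sub>L blinfun_of_bop d)"
  "clinear_blinfun T \<Longrightarrow> clinear_blinfun (blinfun_of_bop a \<circ>\<^sub>L T)"
  "(\<And>i. i \<in> I \<Longrightarrow> clinear_blinfun (f i)) \<Longrightarrow> clinear_blinfun (\<Sum>i\<in>I. f i)"
proof -
  show z: "clinear_blinfun 0" and a: "clinear_blinfun S \<Longrightarrow> clinear_blinfun T \<Longrightarrow> clinear_blinfun (S + T)"
    "clinear_blinfun S \<Longrightarrow> clinear_blinfun T \<Longrightarrow> clinear_blinfun (S - T)"
    "clinear_blinfun T \<Longrightarrow> clinear_blinfun (T \<circ>\<^sub>L blinfun_of_bop d)"
    "clinear_blinfun T \<Longrightarrow> clinear_blinfun (blinfun_of_bop a \<circ>\<^sub>L T)" for S T d a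
    by (simp_all add: clinear_blinfun_def blinfun.bilinear_simps scaleC_add_right scaleC_diff_right
        bop_apply_scaleC flip: bop_apply_def)
  show "clinear_blinfun (\<Sum>i\<in>I. f i)" if "\<And>i. i \<in> I \<Longrightarrow> clinear_blinfun (f i)"
    using that by (induction I rule: infinite_finite_induct) (simp_all add: z a)
qed

lemma bgram_add: "clinear_blinfun R \<Longrightarrow> clinear_blinfun S \<Longrightarrow> clinear_blinfun T \<Longrightarrow> bgram R (S + T) = bgram R S + bgram R T"
  and bgram_diff: "clinear_blinfun R \<Longrightarrow> clinear_blinfun S \<Longrightarrow> clinear_blinfun T \<Longrightarrow> bgram R (S - T) = bgram R S - bgram R T"
  and bgram_diff_left: "clinear_blinfun R \<Longrightarrow> clinear_blinfun S \<Longrightarrow> clinear_blinfun T \<Longrightarrow> bgram (S - T) R = bgram S R - bgram T R"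
  and bgram_bop: "clinear_blinfun S \<Longrightarrow> clinear_blinfun T \<Longrightarrow> bgram S (T \<circ>\<^sub>L blinfun_of_bop d) = bgram S T * d"
  and bgram_left: "clinear_blinfun S \<Longrightarrow> clinear_blinfun T \<Longrightarrow>
    bgram (blinfun_of_bop a \<circ>\<^sub>L S) T = bgram S (blinfun_of_bop (star a) \<circ>\<^sub>L T)"
  and star_bgram: "clinear_blinfun S \<Longrightarrow> clinear_blinfun T \<Longrightarrow> star (bgram S T) = bgram T S"
proof -
  show "clinear_blinfun S \<Longrightarrow> clinear_blinfun T \<Longrightarrow> star (bgram S T) = bgram T S"
    by (simp add: star_gram clinear_blinfun_bclin)
qed (rule bop_eqI_cinner_right; simp add: cinner_bgram clinear_blinfun_ops bop_apply_ops bop_apply_more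
      blinfun.bilinear_simps cinner_add_right cinner_diff bop_apply_star' flip: bop_apply_def)+

lemma norm_bgram_le:
  assumes "clinear_blinfun S" "clinear_blinfun T"
  shows "norm (bgram S T) \<le> norm S * norm T"
proof (rule norm_bop_bound)
  fix g
  let ?h = "bop_apply (bgram S T) g"
  have "(norm ?h)\<^sup>2 = Re (cinner (blinfun_apply S ?h) (blinfun_apply T g))"
    by (simp add: norm_eq_Re_cinner cinner_bgram assms)
  also have "\<dots> \<le> norm (blinfun_apply S ?h) * norm (blinfun_apply T g)"
    by (simp add: norm_cauchy_schwarz flip: inner_eq_Re_cinner)
  also have "\<dots> \<le> (norm S * norm ?h) * (norm T * norm g)"
    by (intro mult_mono norm_blinfun) auto
  finally have "norm ?h * norm ?h \<le> norm ?h * (norm S * norm T * norm g)"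
    by (simp add: power2_eq_square algebra_simps)
  then show "norm ?h \<le> norm S * norm T * norm g"
    by (cases "norm ?h = 0") auto
qed simp

text \<open>Identifies the module norm with the operator norm, so that completeness of a closed
  module is inherited from the bounded operators.\<close>

lemma norm_bgram_self:
  assumes "clinear_blinfun T"
  shows "norm (bgram T T) = (norm T)\<^sup>2"
proof (rule antisym)
  show "norm (bgram T T) \<le> (norm T)\<^sup>2" using norm_bgram_le[OF assms assms] by (simp add: power2_eq_square)
  have "norm T \<le> sqrt (norm (bgram T T))"
  proof (rule norm_blinfun_bound)
    fix g
    have "(norm (blinfun_apply T g))\<^sup>2 = Re (cinner g (bop_apply (bgram T T) g))"
      by (simp add: norm_eq_Re_cinner cinner_bgram assms)
    also have "\<dots> \<le> norm g * norm (bop_apply (bgram T T) g)"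
      by (simp add: norm_cauchy_schwarz flip: inner_eq_Re_cinner)
    also have "\<dots> \<le> norm g * (norm (bgram T T) * norm g)" by (intro mult_left_mono norm_bop_apply) auto
    also have "\<dots> = (sqrt (norm (bgram T T)) * norm g)\<^sup>2"
      by (simp add: power_mult_distrib) (simp add: power2_eq_square)
    finally show "norm (blinfun_apply T g) \<le> sqrt (norm (bgram T T)) * norm g"
      by (rule power2_le_imp_le) simp
  qed simp
  from power_mono[OF this norm_ge_zero, of 2] show "(norm T)\<^sup>2 \<le> norm (bgram T T)" by simp
qed

lemma pos_bgram: "clinear_blinfun T \<Longrightarrow> pos (bgram T T)"
  by (simp add: pos_bop_iff star_bgram cinner_bgram cinner_self)

lemma tendsto_bgram:
  assumes "\<And>n. clinear_blinfun (S n)" "\<And>n. clinear_blinfun (T n)" "S \<longlonglongrightarrow> S'" "T \<longlonglongrightarrow> T'"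
    and c: "clinear_blinfun S'" "clinear_blinfun T'"
  shows "(\<lambda>n. bgram (S n) (T n)) \<longlonglongrightarrow> bgram S' T'"
proof -
  have "(\<lambda>n. norm (S n - S') * norm (T n) + norm S' * norm (T n - T')) \<longlonglongrightarrow> norm (S' - S') * norm T' + norm S' * norm (T' - T')"
    by (intro tendsto_intros assms)
  then have z: "(\<lambda>n. norm (S n - S') * norm (T n) + norm S' * norm (T n - T')) \<longlonglongrightarrow> 0" by simp
  have "norm (bgram (S n) (T n) - bgram S' T') \<le> norm (S n - S') * norm (T n) + norm S' * norm (T n - T')" for n
  proof -
    have "bgram (S n) (T n) - bgram S' T' = bgram (S n - S') (T n) + bgram S' (T n - T')"
      by (simp add: bgram_diff bgram_diff_left assms)
    then show ?thesis
      by (simp only:) (intro norm_triangle_mono norm_bgram_le clinear_blinfun_ops assms)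
  qed
  then have "(\<lambda>n. bgram (S n) (T n) - bgram S' T') \<longlonglongrightarrow> 0"
    by (intro Lim_null_comparison[OF always_eventually z]) simp
  then show ?thesis by (rule LIM_zero_cancel)
qed

text \<open>A closed \<open>D\<close>-submodule \<open>M\<close> of the bounded operators from \<open>'g\<close> to \<open>'h\<close>, with inner product
  \<open>S\<^sup>* T\<close>, carried over to another type by an injection.\<close>

locale operator_module =
  fixes D :: "'g::chilbert_space bop set"
    and M :: "('g \<Rightarrow>\<^sub>L 'h::chilbert_space) set"
    and enc :: "('g \<Rightarrow>\<^sub>L 'h) \<Rightarrow> 'e"
  assumes D: "cstar_subalgebra D"
    and M_closed: "closed M"
    and M_zero: "0 \<in> M"
    and M_add: "S \<in> M \<Longrightarrow> T \<in> M \<Longrightarrow> S + T \<in> M"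
    and M_bop: "T \<in> M \<Longrightarrow> d \<in> D \<Longrightarrow> T \<circ>\<^sub>L blinfun_of_bop d \<in> M"
    and M_clinear: "T \<in> M \<Longrightarrow> clinear_blinfun T"
    and M_gram: "S \<in> M \<Longrightarrow> T \<in> M \<Longrightarrow> bgram S T \<in> D"
    and enc: "inj_on enc M"
begin

definition dec :: "'e \<Rightarrow> 'g \<Rightarrow>\<^sub>L 'h" where
  "dec = inv_into M enc"

definition module_of :: "('g bop, 'e) hilbert_module" where
  "module_of = \<lparr>carrier = enc ` M, mult = (\<lambda>u v. undefined), one = undefined, zero = enc 0,
     add = (\<lambda>u v. enc (dec u + dec v)), smult = (\<lambda>d u. enc (dec u \<circ>\<^sub>L blinfun_of_bop d)),
     ip = (\<lambda>u v. bgram (dec u) (dec v))\<rparr>"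

lemma dec_enc [simp]: "T \<in> M \<Longrightarrow> dec (enc T) = T"
  using enc by (simp add: dec_def)

lemma sel:
  "carrier module_of = enc ` M" "zero module_of = enc 0" "add module_of u v = enc (dec u + dec v)"
  "smult module_of d u = enc (dec u \<circ>\<^sub>L blinfun_of_bop d)" "ip module_of u v = bgram (dec u) (dec v)"
  by (simp_all add: module_of_def)

lemma dec_M: "u \<in> carrier module_of \<Longrightarrow> dec u \<in> M" "u \<in> carrier module_of \<Longrightarrow> enc (dec u) = u"
  by (auto simp: sel)

lemma M_uminus: "T \<in> M \<Longrightarrow> - T \<in> M"
proof -
  assume T: "T \<in> M"
  have "T \<circ>\<^sub>L blinfun_of_bop (- 1) = - T"
    by (rule blinfun_eqI) (simp add: bop_apply_more bop_apply_ops blinfun.bilinear_simps flip: bop_apply_def)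
  then show ?thesis using M_bop[OF T, of "- 1"] cstar_subalgebraD[OF D] by metis
qed

lemma M_diff: "S \<in> M \<Longrightarrow> T \<in> M \<Longrightarrow> S - T \<in> M"
  using M_add[of S "- T"] M_uminus[of T] by simp

lemma M_sum: "(\<And>i. i \<in> I \<Longrightarrow> f i \<in> M) \<Longrightarrow> (\<Sum>i\<in>I. f i) \<in> M"
  by (induction I rule: infinite_finite_induct) (simp_all add: M_zero M_add)

lemma abelian_group_module_of: "abelian_group module_of"
proof (rule abelian_groupI)
  fix u assume "u \<in> carrier module_of"
  then show "\<exists>v\<in>carrier module_of. v \<oplus>\<^bsub>module_of\<^esub> u = \<zero>\<^bsub>module_of\<^esub>"
    by (intro bexI[of _ "enc (- dec u)"]) (auto simp: sel M_uminus)
qed (auto simp: sel M_add M_zero add_ac)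

lemma minus_module_of:
  assumes "u \<in> carrier module_of" "v \<in> carrier module_of"
  shows "u \<ominus>\<^bsub>module_of\<^esub> v = enc (dec u - dec v)"
proof -
  interpret abelian_group module_of by (rule abelian_group_module_of)
  have "\<ominus>\<^bsub>module_of\<^esub> v = enc (- dec v)"
    by (rule minus_equality) (use assms in \<open>auto simp: sel M_uminus\<close>)
  then show ?thesis using assms by (auto simp: a_minus_def sel M_uminus)
qed

lemma finsum_module_of:
  assumes "finite I" "\<And>i. i \<in> I \<Longrightarrow> f i \<in> carrier module_of"
  shows "(\<Oplus>\<^bsub>module_of\<^esub>i\<in>I. f i) = enc (\<Sum>i\<in>I. dec (f i))"
proof -
  interpret abelian_group module_of by (rule abelian_group_module_of)
  show ?thesis using assms
  proof (induction I)
    case empty then show ?case by (simp add: sel)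
  next
    case (insert i I)
    have m: "\<And>j. j \<in> I \<Longrightarrow> dec (f j) \<in> M" using insert.prems by (intro dec_M) auto
    have "(\<Oplus>\<^bsub>module_of\<^esub>i\<in>insert i I. f i) = f i \<oplus>\<^bsub>module_of\<^esub> (\<Oplus>\<^bsub>module_of\<^esub>i\<in>I. f i)"
      using insert.prems insert.hyps by (intro finsum_insert) auto
    then show ?case using insert m M_sum[of I "\<lambda>i. dec (f i)"] by (simp add: sel(3))
  qed
qed

lemma module_norm_module_of: "u \<in> carrier module_of \<Longrightarrow> module_norm module_of u = norm (dec u)"
  by (simp add: module_norm_def sel(5) norm_bgram_self M_clinear dec_M)

lemma is_hilbert_module_module_of: "is_hilbert_module D module_of"
proof -
  note D' = cstar_subalgebraD[OF D] and mem = dec_M(1)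
  have comp: "\<exists>x\<in>carrier module_of. (\<lambda>n. module_norm module_of (s n \<ominus>\<^bsub>module_of\<^esub> x)) \<longlonglongrightarrow> 0"
    if s: "\<forall>n. s n \<in> carrier module_of"
      "\<forall>\<epsilon>>0. \<exists>N::nat. \<forall>m\<ge>N. \<forall>n\<ge>N. module_norm module_of (s m \<ominus>\<^bsub>module_of\<^esub> s n) < \<epsilon>" for s
  proof -
    have n: "module_norm module_of (u \<ominus>\<^bsub>module_of\<^esub> v) = norm (dec u - dec v)"
      if "u \<in> carrier module_of" "v \<in> carrier module_of" for u v
    proof -
      have "u \<ominus>\<^bsub>module_of\<^esub> v = enc (dec u - dec v)" "dec u - dec v \<in> M"
        using that by (simp_all add: minus_module_of M_diff mem)
      then show ?thesis by (simp add: module_norm_module_of sel(1))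
    qed
    have "Cauchy (\<lambda>n. dec (s n))"
      using s by (simp add: Cauchy_def dist_norm n)
    then obtain T where T: "(\<lambda>n. dec (s n)) \<longlonglongrightarrow> T" by (auto simp: Cauchy_convergent_iff convergent_def)
    have TM: "T \<in> M" using closed_sequentially[OF M_closed _ T] s mem by blast
    have "(\<lambda>n. norm (dec (s n) - T)) \<longlonglongrightarrow> norm (T - T)" by (intro tendsto_intros T)
    then have "(\<lambda>n. module_norm module_of (s n \<ominus>\<^bsub>module_of\<^esub> enc T)) \<longlonglongrightarrow> 0"
      using s TM by (simp add: n sel(1))
    then show ?thesis using TM by (auto simp: sel(1))
  qed
  have add_bop: "S \<circ>\<^sub>L blinfun_of_bop d + T \<circ>\<^sub>L blinfun_of_bop d = (S + T) \<circ>\<^sub>L blinfun_of_bop d"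
    "T \<circ>\<^sub>L blinfun_of_bop (c + d) = T \<circ>\<^sub>L blinfun_of_bop c + T \<circ>\<^sub>L blinfun_of_bop d"
    "T \<circ>\<^sub>L blinfun_of_bop (c * d) = T \<circ>\<^sub>L blinfun_of_bop c \<circ>\<^sub>L blinfun_of_bop d"
    "T \<circ>\<^sub>L blinfun_of_bop 1 = T" for S T :: "'g \<Rightarrow>\<^sub>L 'h" and c d
    by (rule blinfun_eqI; simp add: blinfun.bilinear_simps bop_apply_ops flip: bop_apply_def)+
  show ?thesis
    unfolding is_hilbert_module_def
  proof (intro conjI)
    show "abelian_group module_of" by (rule abelian_group_module_of)
    show "\<forall>x\<in>carrier module_of. \<exists>d\<in>D. ip module_of x x = star d * d"
    proof
      fix u assume "u \<in> carrier module_of"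
      then have M: "dec u \<in> M" by (rule mem)
      \<comment> \<open>The root of the inner square can be taken in \<open>D\<close>, as
        \<open>is_hilbert_module\<close> demands.\<close>
      obtain q where "star q = q" "q * q = bgram (dec u) (dec u)"
        "\<And>D. cstar_subalgebra D \<Longrightarrow> bgram (dec u) (dec u) \<in> D \<Longrightarrow> q \<in> D"
        by (rule pos_has_sqrt[OF pos_bgram[OF M_clinear[OF M]]]) blast
      then show "\<exists>d\<in>D. ip module_of u u = star d * d"
        using M_gram[OF M M] D by (intro bexI[of _ q]) (simp_all add: sel(5))
    qed
    show "\<forall>x\<in>carrier module_of. ip module_of x x = 0 \<longrightarrow> x = \<zero>\<^bsub>module_of\<^esub>"
    proof (intro ballI impI)
      fix u assume u: "u \<in> carrier module_of" "ip module_of u u = 0"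
      then have "norm (bgram (dec u) (dec u)) = 0" by (simp add: sel(5))
      then have "dec u = 0" using norm_bgram_self[OF M_clinear[OF mem[OF u(1)]]] by simp
      then show "u = \<zero>\<^bsub>module_of\<^esub>" using dec_M(2)[OF u(1)] by (simp add: sel(2))
    qed
    show "\<forall>s. (\<forall>n. s n \<in> carrier module_of) \<and>
        (\<forall>\<epsilon>>0. \<exists>N::nat. \<forall>m\<ge>N. \<forall>n\<ge>N. module_norm module_of (s m \<ominus>\<^bsub>module_of\<^esub> s n) < \<epsilon>) \<longrightarrow>
        (\<exists>x\<in>carrier module_of. (\<lambda>n. module_norm module_of (s n \<ominus>\<^bsub>module_of\<^esub> x)) \<longlonglongrightarrow> 0)"
      using comp by blast
    show "\<forall>x\<in>carrier module_of. \<forall>y\<in>carrier module_of. ip module_of y x = star (ip module_of x y)"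
      by (auto simp: sel star_bgram M_clinear)
    show "\<forall>x\<in>carrier module_of. 1 \<odot>\<^bsub>module_of\<^esub> x = x" by (auto simp: sel add_bop)
    show "\<forall>x\<in>carrier module_of. \<forall>c\<in>D. \<forall>d\<in>D. (c * d) \<odot>\<^bsub>module_of\<^esub> x = d \<odot>\<^bsub>module_of\<^esub> (c \<odot>\<^bsub>module_of\<^esub> x)"
      by (auto simp: sel add_bop M_bop)
  qed (auto simp: sel M_bop M_add add_bop M_gram bgram_add bgram_bop M_clinear)
qed

lemma unital_star_hom_module_of:
  fixes \<tau> :: "'a::unital_cstar_algebra \<Rightarrow> 'h bop"
  assumes hom: "star_hom_on UNIV \<tau>"
    and M: "\<And>a T. T \<in> M \<Longrightarrow> blinfun_of_bop (\<tau> a) \<circ>\<^sub>L T \<in> M"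
    and one: "\<And>T. T \<in> M \<Longrightarrow> blinfun_of_bop (\<tau> 1) \<circ>\<^sub>L T = T"
  shows "unital_star_hom module_of (\<lambda>a u. enc (blinfun_of_bop (\<tau> a) \<circ>\<^sub>L dec u))"
proof -
  note h = star_hom_onD[OF hom cstar_subalgebra_UNIV, simplified]
  have adj: "is_adjoint module_of (\<lambda>u. enc (blinfun_of_bop (\<tau> a) \<circ>\<^sub>L dec u)) (\<lambda>u. enc (blinfun_of_bop (\<tau> (star a)) \<circ>\<^sub>L dec u))" for a
    unfolding is_adjoint_def by (auto simp: sel M bgram_left M_clinear simp flip: h(4))
  have bd: "(\<lambda>u. enc (blinfun_of_bop (\<tau> a) \<circ>\<^sub>L dec u)) \<in> adjointable_maps module_of" for a
    unfolding adjointable_maps_def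
  proof (intro CollectI conjI)
    show "\<forall>x\<in>carrier module_of. enc (blinfun_of_bop (\<tau> a) \<circ>\<^sub>L dec x) \<in> carrier module_of"
      by (auto simp: sel M)
    show "\<exists>K. \<forall>x\<in>carrier module_of. module_norm module_of (enc (blinfun_of_bop (\<tau> a) \<circ>\<^sub>L dec x)) \<le> K * module_norm module_of x"
    proof (intro exI[of _ "norm (blinfun_of_bop (\<tau> a))"] ballI)
      fix u assume u: "u \<in> carrier module_of"
      then have "blinfun_of_bop (\<tau> a) \<circ>\<^sub>L dec u \<in> M" by (intro M dec_M)
      then show "module_norm module_of (enc (blinfun_of_bop (\<tau> a) \<circ>\<^sub>L dec u)) \<le> norm (blinfun_of_bop (\<tau> a)) * module_norm module_of u"
        using u by (simp add: module_norm_module_of sel(1) norm_blinfun_compose)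
    qed
  qed (use adj in blast)
  have ops: "blinfun_of_bop (\<tau> (a + b)) \<circ>\<^sub>L T = blinfun_of_bop (\<tau> a) \<circ>\<^sub>L T + blinfun_of_bop (\<tau> b) \<circ>\<^sub>L T"
    "blinfun_of_bop (\<tau> (a * b)) \<circ>\<^sub>L T = blinfun_of_bop (\<tau> a) \<circ>\<^sub>L (blinfun_of_bop (\<tau> b) \<circ>\<^sub>L T)" for a b and T :: "'g \<Rightarrow>\<^sub>L 'h"
    by (rule blinfun_eqI; simp add: h blinfun.bilinear_simps bop_apply_ops flip: bop_apply_def)+
  have sc: "blinfun_of_bop (\<tau> (c *\<^sub>C a)) \<circ>\<^sub>L T = (blinfun_of_bop (\<tau> a) \<circ>\<^sub>L T) \<circ>\<^sub>L blinfun_of_bop (c *\<^sub>C 1)"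
    if "T \<in> M" for a c and T :: "'g \<Rightarrow>\<^sub>L 'h"
  proof (rule blinfun_eqI)
    fix g
    have "blinfun_apply T (c *\<^sub>C g) = c *\<^sub>C blinfun_apply T g"
      using M_clinear[OF that] by (simp add: clinear_blinfun_def)
    then show "blinfun_apply (blinfun_of_bop (\<tau> (c *\<^sub>C a)) \<circ>\<^sub>L T) g = blinfun_apply ((blinfun_of_bop (\<tau> a) \<circ>\<^sub>L T) \<circ>\<^sub>L blinfun_of_bop (c *\<^sub>C 1)) g"
      by (simp add: h bop_apply_scaleC_bop bop_apply_scaleC bop_apply_ops flip: bop_apply_def)
  qed
  show ?thesis
    unfolding unital_star_hom_def
    by (intro conjI allI ballI bd adj) (auto simp: sel M ops sc one)
qed

text \<open>Evaluating the operators \<open>T j\<close> at a vector \<open>g\<close> reduces to the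
  Hilbert space bound. For all \<open>g\<close> together this says that \<open>?Q\<close> is at most
  \<open>c\<^sup>2 *\<^sub>R ?P\<close> as an operator, and \<open>pos_norm_mono\<close> returns to
  norms.\<close>

lemma cb_norm_module_of:
  fixes \<tau>1 \<tau>2 :: "'a::unital_cstar_algebra \<Rightarrow> 'h bop"
  assumes cb: "cb_bounded c (\<lambda>a. \<tau>1 a - \<tau>2 a)" and c: "0 \<le> c"
    and M: "\<And>a T. T \<in> M \<Longrightarrow> blinfun_of_bop (\<tau>1 a) \<circ>\<^sub>L T \<in> M" "\<And>a T. T \<in> M \<Longrightarrow> blinfun_of_bop (\<tau>2 a) \<circ>\<^sub>L T \<in> M"
  shows "cb_norm module_of (\<lambda>a u. enc (blinfun_of_bop (\<tau>1 a) \<circ>\<^sub>L dec u) \<ominus>\<^bsub>module_of\<^esub> enc (blinfun_of_bop (\<tau>2 a) \<circ>\<^sub>L dec u)) \<le> ennreal c"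
  unfolding cb_norm_def operator_matrix_norm_def
proof (intro SUP_least)
  fix n and X :: "nat \<Rightarrow> nat \<Rightarrow> 'a" and \<xi> :: "nat \<Rightarrow> 'e"
  assume "X \<in> {X. matrix_norm n X \<le> 1}"
    and "\<xi> \<in> {\<xi>. (\<forall>i<n. \<xi> i \<in> carrier module_of) \<and> module_column_norm module_of n \<xi> \<le> 1}"
  then have X: "matrix_norm n X \<le> 1" and \<xi>: "\<And>i. i < n \<Longrightarrow> \<xi> i \<in> carrier module_of" "module_column_norm module_of n \<xi> \<le> 1"
    by auto
  define T where "T j = dec (\<xi> j)" for j
  have TM: "T j \<in> M" if "j < n" for j unfolding T_def by (rule dec_M(1)[OF \<xi>(1)[OF that]])
  define S where "S i = (\<Sum>j<n. blinfun_of_bop (\<tau>1 (X i j)) \<circ>\<^sub>L T j - blinfun_of_bop (\<tau>2 (X i j)) \<circ>\<^sub>L T j)" for i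
  have SM: "S i \<in> M" for i unfolding S_def by (intro M_sum M_diff M TM) auto
  let ?\<Delta> = "\<lambda>a u. enc (blinfun_of_bop (\<tau>1 a) \<circ>\<^sub>L dec u) \<ominus>\<^bsub>module_of\<^esub> enc (blinfun_of_bop (\<tau>2 a) \<circ>\<^sub>L dec u)"
  have \<Delta>: "?\<Delta> a (\<xi> j) = enc (blinfun_of_bop (\<tau>1 a) \<circ>\<^sub>L T j - blinfun_of_bop (\<tau>2 a) \<circ>\<^sub>L T j)" if "j < n" for a j
    using M TM[OF that] by (simp add: minus_module_of sel(1) flip: T_def)
  have fs: "(\<Oplus>\<^bsub>module_of\<^esub>j\<in>{..<n}. ?\<Delta> (X i j) (\<xi> j)) = enc (S i)" for i
  proof -
    have mem: "blinfun_of_bop (\<tau>1 a) \<circ>\<^sub>L T j - blinfun_of_bop (\<tau>2 a) \<circ>\<^sub>L T j \<in> M" if "j < n" for a j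
      using that by (intro M_diff M TM)
    have "(\<Oplus>\<^bsub>module_of\<^esub>j\<in>{..<n}. ?\<Delta> (X i j) (\<xi> j)) = enc (\<Sum>j<n. dec (?\<Delta> (X i j) (\<xi> j)))"
      by (rule finsum_module_of) (auto simp: \<Delta> mem sel(1))
    also have "(\<Sum>j<n. dec (?\<Delta> (X i j) (\<xi> j))) = S i"
      unfolding S_def by (intro sum.cong refl) (auto simp: \<Delta> mem)
    finally show ?thesis .
  qed
  let ?P = "\<Sum>j<n. bgram (T j) (T j)" and ?Q = "\<Sum>i<n. bgram (S i) (S i)"
  have P1: "norm ?P \<le> 1" using \<xi>(2) by (simp add: module_column_norm_def sel(5) T_def)
  have "pos (c\<^sup>2 *\<^sub>R ?P - ?Q)"
    unfolding pos_bop_iff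
  proof (intro conjI allI)
    have "star (bgram (T j) (T j)) = bgram (T j) (T j)" if "j < n" for j
      using TM[OF that] by (simp add: star_bgram M_clinear)
    then show "star (c\<^sup>2 *\<^sub>R ?P - ?Q) = c\<^sup>2 *\<^sub>R ?P - ?Q"
      using SM by (simp add: star_diff star_scaleR star_sum star_bgram M_clinear)
    fix g
    have Tg: "cinner g (bop_apply (bgram (T j) (T j)) g) = complex_of_real ((norm (blinfun_apply (T j) g))\<^sup>2)" if "j < n" for j
      using TM[OF that] by (simp add: cinner_bgram M_clinear cinner_self)
    have Sg: "cinner g (bop_apply (bgram (S i) (S i)) g)
        = complex_of_real ((norm (\<Sum>j<n. bop_apply (\<tau>1 (X i j) - \<tau>2 (X i j)) (blinfun_apply (T j) g)))\<^sup>2)" for i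
      using SM[of i] by (simp add: cinner_bgram M_clinear cinner_self)
        (simp add: S_def blinfun.bilinear_simps bop_apply_more flip: bop_apply_def)
    have "Re (cinner g (bop_apply (c\<^sup>2 *\<^sub>R ?P - ?Q) g)) = c\<^sup>2 * (\<Sum>j<n. (norm (blinfun_apply (T j) g))\<^sup>2)
        - (\<Sum>i<n. (norm (\<Sum>j<n. bop_apply (\<tau>1 (X i j) - \<tau>2 (X i j)) (blinfun_apply (T j) g)))\<^sup>2)"
      by (simp add: bop_apply_more bop_apply_ops bop_apply_sum cinner_diff cinner_scaleR cinner_sum_right Tg Sg)
    moreover have "(\<Sum>i<n. (norm (\<Sum>j<n. bop_apply (\<tau>1 (X i j) - \<tau>2 (X i j)) (blinfun_apply (T j) g)))\<^sup>2)
        \<le> c\<^sup>2 * (\<Sum>j<n. (norm (blinfun_apply (T j) g))\<^sup>2)"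
      using cb[unfolded cb_bounded_def, rule_format, OF X] .
    ultimately show "0 \<le> Re (cinner g (bop_apply (c\<^sup>2 *\<^sub>R ?P - ?Q) g))" by linarith
  qed
  moreover have "pos ?Q" by (intro pos_sum pos_bgram M_clinear SM)
  ultimately have "norm ?Q \<le> norm (c\<^sup>2 *\<^sub>R ?P)" by (intro pos_norm_mono)
  also have "\<dots> \<le> c\<^sup>2" using mult_left_mono[OF P1, of "c\<^sup>2"] by simp
  finally have "sqrt (norm ?Q) \<le> c" using c by (intro real_le_lsqrt) auto
  then show "ennreal (module_column_norm module_of n (\<lambda>i. \<Oplus>\<^bsub>module_of\<^esub>j\<in>{..<n}. ?\<Delta> (X i j) (\<xi> j))) \<le> ennreal c"
    unfolding fs using SM by (intro ennreal_leI) (simp add: module_column_norm_def sel(5))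
qed

end

text \<open>Elements of the closed submodule generated by the operators \<open>w V\<close> are coded by a sequence of
  formal sums converging to them.\<close>

lemma gamma_le_of_dilation:
  fixes \<phi>1 \<phi>2 :: "'a::unital_cstar_algebra \<Rightarrow> 'g::chilbert_space bop"
    and \<tau>1 \<tau>2 :: "'a \<Rightarrow> 'h::chilbert_space bop"
  assumes D: "cstar_subalgebra D" and c: "0 \<le> c" and jd: "joint_dilation c \<phi>1 \<phi>2 \<tau>1 \<tau>2 V"
    and gram: "\<And>w w'. gram (word_vec (\<lambda>b. if b then \<tau>1 else \<tau>2) V w) (word_vec (\<lambda>b. if b then \<tau>1 else \<tau>2) V w') \<in> D"
  shows "gamma TYPE('e) D \<phi>1 \<phi>2 \<le> ennreal c"
proof -
  note D' = cstar_subalgebraD[OF D]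
  have hom: "star_hom_on UNIV \<tau>1" "star_hom_on UNIV \<tau>2" and V: "bclin V" "\<And>g h. cinner (V g) (V h) = cinner g h"
    and one: "\<tau>1 1 = \<tau>2 1" "\<And>g. bop_apply (\<tau>1 1) (V g) = V g"
    and \<phi>eq: "\<And>a g h. cinner (V g) (bop_apply (\<tau>1 a) (V h)) = cinner g (bop_apply (\<phi>1 a) h)"
      "\<And>a g h. cinner (V g) (bop_apply (\<tau>2 a) (V h)) = cinner g (bop_apply (\<phi>2 a) h)"
    and cb: "cb_bounded c (\<lambda>a. \<tau>1 a - \<tau>2 a)"
    using jd unfolding joint_dilation_def dilation_def by blast+
  define \<tau> where "\<tau> b = (if b then \<tau>1 else \<tau>2)" for b
  have \<tau>hom: "star_hom_on UNIV (\<tau> b)" for b by (simp add: \<tau>_def hom)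
  note h = star_hom_onD[OF \<tau>hom cstar_subalgebra_UNIV, simplified]
  define T where "T w = Blinfun (word_vec \<tau> V w)" for w
  have bT: "bclin (word_vec \<tau> V w)" for w by (rule bclin_word_vec[OF V(1)])
  have T: "blinfun_apply (T w) = word_vec \<tau> V w" for w
    unfolding T_def by (rule bounded_linear_Blinfun_apply) (rule bclinD(6)[OF bT])
  have T_Cons: "blinfun_of_bop (\<tau> b a) \<circ>\<^sub>L T w = T ((b, a) # w)" for b a w
    by (rule blinfun_eqI) (simp add: T word_vec_def flip: bop_apply_def)
  have T_one: "blinfun_of_bop (\<tau> b 1) \<circ>\<^sub>L T w = T w" for b w
  proof (rule blinfun_eqI)
    fix g
    have "bop_apply (\<tau> b 1) (word_vec \<tau> V w g) = word_vec \<tau> V w g"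
    proof (cases w)
      case Nil
      then show ?thesis using one by (simp add: word_vec_def \<tau>_def)
    next
      case (Cons u w')
      have "\<tau> b 1 = \<tau> (fst u) 1" using one by (simp add: \<tau>_def)
      then show ?thesis by (simp add: Cons word_vec_def flip: bop_apply_ops h(2))
    qed
    then show "blinfun_apply (blinfun_of_bop (\<tau> b 1) \<circ>\<^sub>L T w) g = blinfun_apply (T w) g"
      by (simp add: T flip: bop_apply_def)
  qed
  \<comment> \<open>The value of a formal sum of words with right coefficients; \<open>M\<close> is
    the closure of those with coefficients in \<open>D\<close>.\<close>
  define val where "val l = (\<Sum>u\<leftarrow>l. T (fst u) \<circ>\<^sub>L blinfun_of_bop (snd u))" for l :: "((bool \<times> 'a) list \<times> 'g bop) list"
  define S0 where "S0 = {val l | l. \<forall>u\<in>set l. snd u \<in> D}"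
  define M where "M = closure S0"
  have S0_clin: "clinear_blinfun A" if "A \<in> S0" for A
  proof -
    have "clinear_blinfun (T w)" for w using bT by (simp add: clinear_blinfun_bclin T)
    then have "clinear_blinfun (val l)" for l
      unfolding val_def by (induction l) (simp_all add: clinear_blinfun_ops)
    then show ?thesis using that by (auto simp: S0_def)
  qed
  have S0_zero: "0 \<in> S0" by (auto simp: S0_def val_def intro!: exI[of _ "[]"])
  have S0_add: "A + B \<in> S0" if AB: "A \<in> S0" "B \<in> S0" for A B
  proof -
    obtain l l' where "A = val l" "\<forall>u\<in>set l. snd u \<in> D" "B = val l'" "\<forall>u\<in>set l'. snd u \<in> D"
      using AB unfolding S0_def by blast
    then show ?thesis unfolding S0_def by (intro CollectI exI[of _ "l @ l'"]) (auto simp: val_def)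
  qed
  have S0_bop: "A \<circ>\<^sub>L blinfun_of_bop d \<in> S0" if AS: "A \<in> S0" "d \<in> D" for A d
  proof -
    obtain l where l: "A = val l" "\<forall>u\<in>set l. snd u \<in> D" using AS unfolding S0_def by blast
    have "val l \<circ>\<^sub>L blinfun_of_bop d = val (map (\<lambda>u. (fst u, snd u * d)) l)"
      unfolding val_def
    proof (induction l)
      case (Cons u l)
      have "(A + B) \<circ>\<^sub>L Q = A \<circ>\<^sub>L Q + B \<circ>\<^sub>L Q" "(A \<circ>\<^sub>L R) \<circ>\<^sub>L Q = A \<circ>\<^sub>L (R \<circ>\<^sub>L Q)"
        for A B :: "'g \<Rightarrow>\<^sub>L 'h" and R Q :: "'g \<Rightarrow>\<^sub>L 'g"
        by (rule blinfun_eqI; simp add: blinfun.bilinear_simps)+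
      then show ?case using Cons by (simp add: blinfun_of_bop_times)
    qed (auto intro: blinfun_eqI)
    moreover have "\<forall>u\<in>set (map (\<lambda>u. (fst u, snd u * d)) l). snd u \<in> D" using l AS(2) by (auto intro: D')
    ultimately show ?thesis unfolding S0_def l(1) by blast
  qed
  have S0_left: "blinfun_of_bop (\<tau> b a) \<circ>\<^sub>L A \<in> S0" if AS: "A \<in> S0" for A b a
  proof -
    obtain l where l: "A = val l" "\<forall>u\<in>set l. snd u \<in> D" using AS unfolding S0_def by blast
    have "blinfun_of_bop (\<tau> b a) \<circ>\<^sub>L val l = val (map (\<lambda>u. ((b, a) # fst u, snd u)) l)"
      unfolding val_def
    proof (induction l)
      case (Cons u l)
      have "Q \<circ>\<^sub>L (A + B) = Q \<circ>\<^sub>L A + Q \<circ>\<^sub>L B" "Q \<circ>\<^sub>L (A \<circ>\<^sub>L R) = (Q \<circ>\<^sub>L A) \<circ>\<^sub>L R"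
        for A B :: "'g \<Rightarrow>\<^sub>L 'h" and Q :: "'h \<Rightarrow>\<^sub>L 'h" and R :: "'g \<Rightarrow>\<^sub>L 'g"
        by (rule blinfun_eqI; simp add: blinfun.bilinear_simps)+
      then show ?case using Cons by (simp add: T_Cons)
    qed (auto intro: blinfun_eqI)
    moreover have "\<forall>u\<in>set (map (\<lambda>u. ((b, a) # fst u, snd u)) l). snd u \<in> D" using l by auto
    ultimately show ?thesis unfolding S0_def l(1) by blast
  qed
  \<comment> \<open>\<open>\<tau> b 1\<close> may be a proper projection of \<open>'h\<close>, but
    it fixes all words, so the representations become unital on \<open>M\<close>.\<close>
  have S0_one: "blinfun_of_bop (\<tau> b 1) \<circ>\<^sub>L A = A" if "A \<in> S0" for A b
  proof -
    have "blinfun_of_bop (\<tau> b 1) \<circ>\<^sub>L val l = val l" for l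
      unfolding val_def
    proof (induction l)
      case (Cons u l)
      have "Q \<circ>\<^sub>L (A + B) = Q \<circ>\<^sub>L A + Q \<circ>\<^sub>L B" "Q \<circ>\<^sub>L (A \<circ>\<^sub>L R) = (Q \<circ>\<^sub>L A) \<circ>\<^sub>L R"
        for A B :: "'g \<Rightarrow>\<^sub>L 'h" and Q :: "'h \<Rightarrow>\<^sub>L 'h" and R :: "'g \<Rightarrow>\<^sub>L 'g"
        by (rule blinfun_eqI; simp add: blinfun.bilinear_simps)+
      then show ?case using Cons by (simp add: T_one)
    qed (auto intro: blinfun_eqI)
    then show ?thesis using that by (auto simp: S0_def)
  qed
  have S0_gram: "bgram A B \<in> D" if AB: "A \<in> S0" "B \<in> S0" for A B
  proof -
    have cT: "clinear_blinfun (T w)" for w using bT by (simp add: clinear_blinfun_bclin T)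
    have cv: "clinear_blinfun (val l)" for l
      unfolding val_def by (induction l) (simp_all add: clinear_blinfun_ops cT)
    have v: "val (u # l) = T (fst u) \<circ>\<^sub>L blinfun_of_bop (snd u) + val l" "val [] = 0" for u l
      by (simp_all add: val_def)
    have b0: "bgram R 0 = 0" if "clinear_blinfun R" for R :: "'g \<Rightarrow>\<^sub>L 'h"
      using bgram_add[OF that clinear_blinfun_ops(1,1)] by simp
    have 1: "bgram (T w) (val l) \<in> D" if "\<forall>u\<in>set l. snd u \<in> D" for w l
      using that
    proof (induction l)
      case (Cons u l)
      have "bgram (T w) (T (fst u)) \<in> D" using gram[of w "fst u"] by (simp add: T \<tau>_def[abs_def])
      with Cons show ?case
        by (simp add: v bgram_add cT cv clinear_blinfun_ops bgram_bop D')
    qed (simp add: v b0 cT D')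
    have 2: "bgram (val l) (T w) \<in> D" if "\<forall>u\<in>set l. snd u \<in> D" for w l
      using D'(5)[OF 1[OF that]] by (simp add: star_bgram cT cv)
    have "bgram (val l') (val l) \<in> D" if "\<forall>u\<in>set l. snd u \<in> D" "\<forall>u\<in>set l'. snd u \<in> D" for l l'
      using that(1)
    proof (induction l)
      case (Cons u l)
      with 2[OF that(2)] show ?case
        by (simp add: v bgram_add cT cv clinear_blinfun_ops bgram_bop D')
    qed (simp add: v b0 cv D')
    then show ?thesis using AB by (auto simp: S0_def)
  qed
  have seq: "\<exists>A. (\<forall>n. A n \<in> S0) \<and> A \<longlonglongrightarrow> B" if BM: "B \<in> M" for B
    using BM unfolding M_def closure_sequential .
  have MI: "B \<in> M" if "\<And>n. A n \<in> S0" "A \<longlonglongrightarrow> B" for A B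
    unfolding M_def closure_sequential using that by blast
  have M_clin: "clinear_blinfun B" if BM: "B \<in> M" for B
  proof -
    obtain A where A: "\<And>n. A n \<in> S0" "A \<longlonglongrightarrow> B" using seq[OF BM] by blast
    have p: "(\<lambda>n. blinfun_apply (A n) x) \<longlonglongrightarrow> blinfun_apply B x" for x by (intro tendsto_intros A)
    show ?thesis unfolding clinear_blinfun_def
    proof (intro allI)
      fix k x
      have "(\<lambda>n. blinfun_apply (A n) (k *\<^sub>C x)) \<longlonglongrightarrow> k *\<^sub>C blinfun_apply B x"
        using bounded_linear.tendsto[OF bounded_linear_scaleC p, of k x] S0_clin[OF A(1)]
        by (simp add: clinear_blinfun_def)
      then show "blinfun_apply B (k *\<^sub>C x) = k *\<^sub>C blinfun_apply B x" using p LIMSEQ_unique by blast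
    qed
  qed
  have comp_left: "(\<lambda>n. Q \<circ>\<^sub>L A n) \<longlonglongrightarrow> Q \<circ>\<^sub>L B" and comp_right: "(\<lambda>n. A n \<circ>\<^sub>L R) \<longlonglongrightarrow> B \<circ>\<^sub>L R"
    if "A \<longlonglongrightarrow> B" for A B and Q :: "'h \<Rightarrow>\<^sub>L 'h" and R :: "'g \<Rightarrow>\<^sub>L 'g"
    using that by (auto intro!: bounded_bilinear.tendsto[OF bounded_bilinear_blinfun_compose])
  have M_left: "blinfun_of_bop (\<tau> b a) \<circ>\<^sub>L B \<in> M" if BM: "B \<in> M" for B b a
  proof -
    obtain A where A: "\<And>n. A n \<in> S0" "A \<longlonglongrightarrow> B" using seq[OF BM] by blast
    show ?thesis by (rule MI[OF S0_left[OF A(1)] comp_left[OF A(2)]])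
  qed
  have M_one: "blinfun_of_bop (\<tau> b 1) \<circ>\<^sub>L B = B" if BM: "B \<in> M" for B b
  proof -
    obtain A where A: "\<And>n. A n \<in> S0" "A \<longlonglongrightarrow> B" using seq[OF BM] by blast
    have "A \<longlonglongrightarrow> blinfun_of_bop (\<tau> b 1) \<circ>\<^sub>L B"
      using comp_left[OF A(2), of "blinfun_of_bop (\<tau> b 1)"] by (simp add: S0_one[OF A(1)])
    then show ?thesis using A(2) LIMSEQ_unique by blast
  qed
  have code: "\<exists>l. (\<lambda>n. val (l n)) \<longlonglongrightarrow> B" if BM: "B \<in> M" for B
  proof -
    obtain A where A: "\<And>n. A n \<in> S0" "A \<longlonglongrightarrow> B" using seq[OF BM] by blast
    have "\<forall>n. \<exists>l. A n = val l" using A(1) by (auto simp: S0_def)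
    then obtain l where "\<And>n. A n = val (l n)" by metis
    then have "A = (\<lambda>n. val (l n))" by auto
    then show ?thesis using A(2) by blast
  qed
  \<comment> \<open>A code is a chosen sequence of formal sums converging to \<open>B\<close>;
    limits are unique, hence injectivity. The codes lie in the right summand of
    \<open>vectors\<close>.\<close>
  define enc :: "('g \<Rightarrow>\<^sub>L 'h) \<Rightarrow> ('a, 'g bop, 'e) vectors" where
    "enc B = Inr (SOME l. (\<lambda>n. val (l n)) \<longlonglongrightarrow> B)" for B
  have enc: "inj_on enc M"
  proof (rule inj_onI)
    fix A B assume AB: "A \<in> M" "B \<in> M" "enc A = enc B"
    have "(SOME l. (\<lambda>n. val (l n)) \<longlonglongrightarrow> A) = (SOME l. (\<lambda>n. val (l n)) \<longlonglongrightarrow> B)"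
      using AB(3) by (simp only: enc_def sum.inject)
    then show "A = B"
      using someI_ex[OF code[OF AB(1)]] someI_ex[OF code[OF AB(2)]] by (simp only: LIMSEQ_unique)
  qed
  interpret operator_module D M enc
  proof
    show "cstar_subalgebra D" by (rule D)
    show "closed M" by (simp add: M_def)
    show "0 \<in> M" using S0_zero closure_subset by (auto simp: M_def)
    show "A + B \<in> M" if AB: "A \<in> M" "B \<in> M" for A B
    proof -
      obtain A' B' where A: "\<And>n. A' n \<in> S0" "A' \<longlonglongrightarrow> A" and B: "\<And>n. B' n \<in> S0" "B' \<longlonglongrightarrow> B"
        using seq[OF AB(1)] seq[OF AB(2)] by blast
      show ?thesis by (rule MI[OF S0_add[OF A(1) B(1)] tendsto_add[OF A(2) B(2)]])
    qed
    show "B \<circ>\<^sub>L blinfun_of_bop d \<in> M" if BM: "B \<in> M" "d \<in> D" for B d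
    proof -
      obtain A where A: "\<And>n. A n \<in> S0" "A \<longlonglongrightarrow> B" using seq[OF BM(1)] by blast
      show ?thesis by (rule MI[OF S0_bop[OF A(1) BM(2)] comp_right[OF A(2)]])
    qed
    show "clinear_blinfun B" if BM: "B \<in> M" for B by (rule M_clin[OF BM])
    show "bgram A B \<in> D" if AB: "A \<in> M" "B \<in> M" for A B
    proof -
      obtain A' B' where A: "\<And>n. A' n \<in> S0" "A' \<longlonglongrightarrow> A" and B: "\<And>n. B' n \<in> S0" "B' \<longlonglongrightarrow> B"
        using seq[OF AB(1)] seq[OF AB(2)] by blast
      have "(\<lambda>n. bgram (A' n) (B' n)) \<longlonglongrightarrow> bgram A B"
        by (intro tendsto_bgram S0_clin A B M_clin AB)
      then show ?thesis by (rule closed_sequentially[OF D'(6) S0_gram[OF A(1) B(1)]])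
    qed
    show "inj_on enc M" by (rule enc)
  qed
  let ?\<sigma> = "\<lambda>b a u. enc (blinfun_of_bop (\<tau> b a) \<circ>\<^sub>L dec u)"
  let ?x = "enc (T [])"
  have TM: "T [] \<in> M"
  proof -
    have "val [([], 1)] = T []"
      by (rule blinfun_eqI) (simp add: val_def bop_apply_ops flip: bop_apply_def)
    then have "T [] \<in> S0" unfolding S0_def using D' by (intro CollectI exI[of _ "[([], 1)]"]) auto
    then show ?thesis using closure_subset by (auto simp: M_def)
  qed
  have TV: "blinfun_apply (T []) = V" by (simp add: T word_vec_def)
  have cT: "clinear_blinfun (T [])" by (rule M_clin[OF TM])
  have hommod: "unital_star_hom module_of (?\<sigma> b)" for b
    by (rule unital_star_hom_module_of[OF \<tau>hom M_left M_one])
  have "joint_rep D \<phi>1 \<phi>2 module_of (?\<sigma> True) (?\<sigma> False) ?x"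
    unfolding joint_rep_def
  proof (intro conjI allI is_hilbert_module_module_of hommod)
    show "?x \<in> carrier module_of" using TM by (simp add: sel(1))
    have "bgram (T []) (T []) = 1"
      by (rule bop_eqI_cinner_right) (simp add: cinner_bgram cT, simp add: TV V bop_apply_ops)
    then show "ip module_of ?x ?x = 1" using TM by (simp add: sel(5))
    have "bgram (T []) (blinfun_of_bop (\<tau> b a) \<circ>\<^sub>L T []) = (if b then \<phi>1 a else \<phi>2 a)" for a b
      by (rule bop_eqI_cinner_right)
        (simp add: cinner_bgram cT clinear_blinfun_ops, simp add: TV \<tau>_def \<phi>eq flip: bop_apply_def)
    note ip = this
    show "\<phi>1 a = ip module_of ?x (?\<sigma> True a ?x)" "\<phi>2 a = ip module_of ?x (?\<sigma> False a ?x)" for a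
      using TM M_left[OF TM, of True a] M_left[OF TM, of False a] ip[of True a] ip[of False a] by (simp_all add: sel(5))
  qed
  then have "gamma TYPE('e) D \<phi>1 \<phi>2 \<le> cb_norm module_of (\<lambda>a \<xi>. ?\<sigma> True a \<xi> \<ominus>\<^bsub>module_of\<^esub> ?\<sigma> False a \<xi>)"
    unfolding gamma_def by (intro INF_lower2[of "(module_of, ?\<sigma> True, ?\<sigma> False, ?x)"]) auto
  also have "\<dots> \<le> ennreal c"
    using cb by (intro cb_norm_module_of c M_left) (simp add: \<tau>_def)
  finally show ?thesis .
qed


section \<open>Gluing dilations\<close>

lemma cb_bounded_L2:
  assumes "0 \<le> c"
  shows "cb_bounded c \<delta> \<longleftrightarrow> (\<forall>n X \<xi>. matrix_norm n X \<le> 1 \<longrightarrow>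
    L2_set (\<lambda>i. norm (\<Sum>j<n. bop_apply (\<delta> (X i j)) (\<xi> j))) {..<n} \<le> c * L2_set (\<lambda>j. norm (\<xi> j)) {..<n})"
proof -
  have "(\<Sum>i<n. (f i)\<^sup>2) \<le> c\<^sup>2 * (\<Sum>j<n. (g j)\<^sup>2) \<longleftrightarrow> L2_set f {..<n} \<le> c * L2_set g {..<n}" for f g :: "nat \<Rightarrow> real" and n
  proof -
    have "c * L2_set g {..<n} = sqrt (c\<^sup>2 * (\<Sum>j<n. (g j)\<^sup>2))"
      using assms by (simp add: L2_set_def real_sqrt_mult)
    then show ?thesis by (simp add: L2_set_def)
  qed
  then show ?thesis by (simp add: cb_bounded_def)
qed

lemma cb_bounded_add:
  assumes "cb_bounded c \<delta>" "cb_bounded d \<epsilon>" "0 \<le> c" "0 \<le> d"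
  shows "cb_bounded (c + d) (\<lambda>a. \<delta> a + \<epsilon> a)"
  unfolding cb_bounded_L2[OF add_nonneg_nonneg[OF assms(3,4)]]
proof (intro allI impI)
  fix n and X :: "nat \<Rightarrow> nat \<Rightarrow> 'a" and \<xi> :: "nat \<Rightarrow> 'b" assume X: "matrix_norm n X \<le> 1"
  let ?f = "\<lambda>i. \<Sum>j<n. bop_apply (\<delta> (X i j)) (\<xi> j)" and ?g = "\<lambda>i. \<Sum>j<n. bop_apply (\<epsilon> (X i j)) (\<xi> j)"
  have "L2_set (\<lambda>i. norm (\<Sum>j<n. bop_apply (\<delta> (X i j) + \<epsilon> (X i j)) (\<xi> j))) {..<n}
      = L2_set (\<lambda>i. norm (?f i + ?g i)) {..<n}"
    by (simp add: bop_apply_ops sum.distrib)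
  also have "\<dots> \<le> L2_set (\<lambda>i. norm (?f i) + norm (?g i)) {..<n}"
    by (intro L2_set_mono norm_triangle_ineq) auto
  also have "\<dots> \<le> L2_set (\<lambda>i. norm (?f i)) {..<n} + L2_set (\<lambda>i. norm (?g i)) {..<n}"
    by (rule L2_set_triangle_ineq)
  also have "\<dots> \<le> c * L2_set (\<lambda>j. norm (\<xi> j)) {..<n} + d * L2_set (\<lambda>j. norm (\<xi> j)) {..<n}"
    using assms X by (intro add_mono) (simp_all add: cb_bounded_L2)
  finally show "L2_set (\<lambda>i. norm (\<Sum>j<n. bop_apply (\<delta> (X i j) + \<epsilon> (X i j)) (\<xi> j))) {..<n}
      \<le> (c + d) * L2_set (\<lambda>j. norm (\<xi> j)) {..<n}" by (simp add: distrib_right)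
qed

lemma cb_bounded_uminus: "cb_bounded c \<delta> \<Longrightarrow> cb_bounded c (\<lambda>a. - \<delta> a)"
  by (simp add: cb_bounded_def bop_apply_more sum_negf)

section \<open>Direct sums, symmetries and the gluing of dilations\<close>

definition bop_dsum :: "'h::chilbert_space bop \<Rightarrow> 'k::chilbert_space bop \<Rightarrow> ('h \<times> 'k) bop" where
  "bop_dsum A B = bop_of (\<lambda>x. (bop_apply A (fst x), bop_apply B (snd x)))"

lemma bop_apply_bop_dsum: "bop_apply (bop_dsum A B) x = (bop_apply A (fst x), bop_apply B (snd x))"
proof -
  have "bclin (\<lambda>x. (bop_apply A (fst x), bop_apply B (snd x)))"
    unfolding bclin_def
    by (auto simp: scaleC_prod_def bop_apply_scaleC
        intro!: bounded_linear_Pair bounded_linear_compose[OF bounded_linear_bop_apply] bounded_linear_fst bounded_linear_snd)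
  then show ?thesis by (simp add: bop_dsum_def bop_apply_bop_of)
qed

lemma bop_dsum_diff: "bop_dsum A B - bop_dsum C E = bop_dsum (A - C) (B - E)"
  by (rule bop_eqI) (simp add: bop_apply_more bop_apply_bop_dsum)

lemma star_bop_dsum: "star (bop_dsum A B) = bop_dsum (star A) (star B)"
  by (rule bop_eqI_cinner_right) (simp add: bop_apply_star', simp add: bop_apply_star' bop_apply_bop_dsum cinner_prod_def)

lemma star_hom_bop_dsum:
  assumes "star_hom_on UNIV \<sigma>" "star_hom_on UNIV \<tau>"
  shows "star_hom_on UNIV (\<lambda>a. bop_dsum (\<sigma> a) (\<tau> a))"
proof -
  note h = star_hom_onD[OF assms(1) cstar_subalgebra_UNIV, simplified]
    star_hom_onD[OF assms(2) cstar_subalgebra_UNIV, simplified]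
  show ?thesis
    unfolding star_hom_on_def
    by (auto simp: h star_bop_dsum bop_apply_bop_dsum bop_apply_ops bop_apply_scaleC_bop scaleC_prod_def intro!: bop_eqI)
qed

lemma norm_components_le: "norm (fst p) \<le> norm p" "norm (snd p) \<le> norm p"
  by (metis prod.collapse norm_fst_le) (metis prod.collapse norm_snd_le)

lemma cb_bounded_bop_dsum_left:
  assumes "cb_bounded c \<delta>"
  shows "cb_bounded c (\<lambda>a. bop_dsum (\<delta> a) 0)"
  unfolding cb_bounded_def
proof (intro allI impI)
  fix n and X :: "nat \<Rightarrow> nat \<Rightarrow> 'a" and \<xi> :: "nat \<Rightarrow> 'b \<times> 'c" assume X: "matrix_norm n X \<le> 1"
  have "(\<Sum>j<n. bop_apply (bop_dsum (\<delta> (X i j)) 0) (\<xi> j)) = (\<Sum>j<n. bop_apply (\<delta> (X i j)) (fst (\<xi> j)), 0)" for i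
    by (simp add: bop_apply_bop_dsum bop_apply_more sum_prod)
  then have "(\<Sum>i<n. (norm (\<Sum>j<n. bop_apply (bop_dsum (\<delta> (X i j)) 0) (\<xi> j)))\<^sup>2)
      = (\<Sum>i<n. (norm (\<Sum>j<n. bop_apply (\<delta> (X i j)) (fst (\<xi> j))))\<^sup>2)" by (simp add: norm_Pair)
  also have "\<dots> \<le> c\<^sup>2 * (\<Sum>j<n. (norm (fst (\<xi> j)))\<^sup>2)" using assms[unfolded cb_bounded_def, rule_format, OF X] .
  also have "\<dots> \<le> c\<^sup>2 * (\<Sum>j<n. (norm (\<xi> j))\<^sup>2)"
    by (intro mult_left_mono sum_mono power_mono norm_components_le) auto
  finally show "(\<Sum>i<n. (norm (\<Sum>j<n. bop_apply (bop_dsum (\<delta> (X i j)) 0) (\<xi> j)))\<^sup>2) \<le> c\<^sup>2 * (\<Sum>j<n. (norm (\<xi> j))\<^sup>2)" .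
qed

lemma cb_bounded_bop_dsum_right:
  assumes "cb_bounded c \<delta>"
  shows "cb_bounded c (\<lambda>a. bop_dsum 0 (\<delta> a))"
  unfolding cb_bounded_def
proof (intro allI impI)
  fix n and X :: "nat \<Rightarrow> nat \<Rightarrow> 'a" and \<xi> :: "nat \<Rightarrow> 'c \<times> 'b" assume X: "matrix_norm n X \<le> 1"
  have "(\<Sum>j<n. bop_apply (bop_dsum 0 (\<delta> (X i j))) (\<xi> j)) = (0, \<Sum>j<n. bop_apply (\<delta> (X i j)) (snd (\<xi> j)))" for i
    by (simp add: bop_apply_bop_dsum bop_apply_more sum_prod)
  then have "(\<Sum>i<n. (norm (\<Sum>j<n. bop_apply (bop_dsum 0 (\<delta> (X i j))) (\<xi> j)))\<^sup>2)
      = (\<Sum>i<n. (norm (\<Sum>j<n. bop_apply (\<delta> (X i j)) (snd (\<xi> j))))\<^sup>2)" by (simp add: norm_Pair)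
  also have "\<dots> \<le> c\<^sup>2 * (\<Sum>j<n. (norm (snd (\<xi> j)))\<^sup>2)" using assms[unfolded cb_bounded_def, rule_format, OF X] .
  also have "\<dots> \<le> c\<^sup>2 * (\<Sum>j<n. (norm (\<xi> j))\<^sup>2)"
    by (intro mult_left_mono sum_mono power_mono norm_components_le) auto
  finally show "(\<Sum>i<n. (norm (\<Sum>j<n. bop_apply (bop_dsum 0 (\<delta> (X i j))) (\<xi> j)))\<^sup>2) \<le> c\<^sup>2 * (\<Sum>j<n. (norm (\<xi> j))\<^sup>2)" .
qed

lemma symmetry_norm:
  assumes "star S = S" "S * S = 1"
  shows "norm (bop_apply S x) = norm (x::'h::chilbert_space)"
proof -
  have "(norm (bop_apply S x))\<^sup>2 = Re (cinner x (bop_apply (S * S) x))"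
    using bop_apply_star'[of x S "bop_apply S x"] by (simp add: norm_eq_Re_cinner bop_apply_ops assms(1))
  also have "\<dots> = (norm x)\<^sup>2" by (simp add: assms bop_apply_ops norm_eq_Re_cinner)
  finally show ?thesis by simp
qed

lemma cb_bounded_conj:
  assumes "cb_bounded c \<delta>" and S: "star S = S" "S * S = 1"
  shows "cb_bounded c (\<lambda>a. S * \<delta> a * S)"
  unfolding cb_bounded_def
proof (intro allI impI)
  fix n and X :: "nat \<Rightarrow> nat \<Rightarrow> 'a" and \<xi> :: "nat \<Rightarrow> 'b" assume X: "matrix_norm n X \<le> 1"
  have "(\<Sum>j<n. bop_apply (S * \<delta> (X i j) * S) (\<xi> j)) = bop_apply S (\<Sum>j<n. bop_apply (\<delta> (X i j)) (bop_apply S (\<xi> j)))" for i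
    by (simp add: bop_apply_ops bop_apply_sum_right)
  then have "(\<Sum>i<n. (norm (\<Sum>j<n. bop_apply (S * \<delta> (X i j) * S) (\<xi> j)))\<^sup>2)
      = (\<Sum>i<n. (norm (\<Sum>j<n. bop_apply (\<delta> (X i j)) (bop_apply S (\<xi> j))))\<^sup>2)"
    by (simp add: symmetry_norm[OF S])
  also have "\<dots> \<le> c\<^sup>2 * (\<Sum>j<n. (norm (bop_apply S (\<xi> j)))\<^sup>2)" using assms(1)[unfolded cb_bounded_def, rule_format, OF X] .
  finally show "(\<Sum>i<n. (norm (\<Sum>j<n. bop_apply (S * \<delta> (X i j) * S) (\<xi> j)))\<^sup>2) \<le> c\<^sup>2 * (\<Sum>j<n. (norm (\<xi> j))\<^sup>2)"
    by (simp add: symmetry_norm[OF S])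
qed

lemma star_hom_conj:
  assumes "star_hom_on UNIV \<sigma>" and S: "star S = S" "S * S = 1"
  shows "star_hom_on UNIV (\<lambda>a. S * \<sigma> a * S)"
proof -
  note h = star_hom_onD[OF assms(1) cstar_subalgebra_UNIV, simplified]
  have "S * (\<sigma> a * \<sigma> b) * S = S * \<sigma> a * S * (S * \<sigma> b * S)" for a b
  proof -
    have "S * \<sigma> a * S * (S * \<sigma> b * S) = S * \<sigma> a * (S * S) * \<sigma> b * S" by (simp only: mult.assoc)
    then show ?thesis by (simp add: S(2) mult.assoc)
  qed
  then show ?thesis
    unfolding star_hom_on_def
    by (simp add: h star_mult S(1) distrib_left distrib_right mult_scaleC_left mult_scaleC_right) (simp add: mult.assoc)
qed

text \<open>A partial isometry \<open>U\<close> from \<open>'h\<close> to \<open>'k\<close> yields the symmetry of \<open>'h \<times> 'k\<close> which interchanges its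
  initial and its final space by means of \<open>U\<close>.\<close>

definition swap_bop :: "('h::chilbert_space \<Rightarrow> 'k::chilbert_space) \<Rightarrow> ('k \<Rightarrow> 'h) \<Rightarrow> ('h \<times> 'k) bop" where
  "swap_bop U U' = bop_of (\<lambda>x. (fst x - U' (U (fst x)) + U' (snd x), snd x - U (U' (snd x)) + U (fst x)))"

definition partial_isometry :: "('h::chilbert_space \<Rightarrow> 'k::chilbert_space) \<Rightarrow> ('k \<Rightarrow> 'h) \<Rightarrow> bool" where
  "partial_isometry U U' \<longleftrightarrow> bclin U \<and> bclin U' \<and> (\<forall>h k. cinner (U h) k = cinner h (U' k)) \<and>
     (\<forall>h. U (U' (U h)) = U h) \<and> (\<forall>k. U' (U (U' k)) = U' k)"

lemma swap_bop:
  assumes "partial_isometry U U'"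
  shows "bop_apply (swap_bop U U') x = (fst x - U' (U (fst x)) + U' (snd x), snd x - U (U' (snd x)) + U (fst x))"
    "star (swap_bop U U') = swap_bop U U'" "swap_bop U U' * swap_bop U U' = 1"
proof -
  have U: "bclin U" "bclin U'" and adj: "\<And>h k. cinner (U h) k = cinner h (U' k)"
    and pi: "\<And>h. U (U' (U h)) = U h" "\<And>k. U' (U (U' k)) = U' k"
    using assms unfolding partial_isometry_def by blast+
  have adj': "cinner (U' k) h = cinner k (U h)" for h k using adj[of h k] by (metis cinner_commute)
  have fs: "bclin (fst :: 'a \<times> 'b \<Rightarrow> 'a)" "bclin (snd :: 'a \<times> 'b \<Rightarrow> 'b)"
    by (simp_all add: bclin_def bounded_linear_fst bounded_linear_snd scaleC_prod_def)
  have "bclin (\<lambda>x. fst x - U' (U (fst x)) + U' (snd x))" "bclin (\<lambda>x. snd x - U (U' (snd x)) + U (fst x))"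
    by (intro bclin_add bclin_diff fs bclin_compose[OF U(1)] bclin_compose[OF U(2)])+
  then have "bclin (\<lambda>x. (fst x - U' (U (fst x)) + U' (snd x), snd x - U (U' (snd x)) + U (fst x)))"
    unfolding bclin_def by (auto simp: scaleC_prod_def intro: bounded_linear_Pair)
  then show ap: "bop_apply (swap_bop U U') x = (fst x - U' (U (fst x)) + U' (snd x), snd x - U (U' (snd x)) + U (fst x))" for x
    by (simp add: swap_bop_def bop_apply_bop_of)
  show "star (swap_bop U U') = swap_bop U U'"
    by (rule bop_eqI_cinner_right)
      (simp add: bop_apply_star', simp add: ap cinner_prod_def cinner_diff cinner_add_left cinner_add_right adj adj')
  show "swap_bop U U' * swap_bop U U' = 1"
    by (rule bop_eqI) (simp add: ap bop_apply_ops bclinD[OF U(1)] bclinD[OF U(2)] pi)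
qed

text \<open>Intertwining by \<open>U\<close> of \<open>A\<close> with \<open>B\<close> and of their
  adjoints passes to \<open>U'\<close>, so the symmetry commutes with
  \<open>bop_dsum A B\<close>.\<close>

lemma swap_bop_commute:
  assumes pi: "partial_isometry U U'" and U: "\<And>h. U (bop_apply A h) = bop_apply B (U h)"
    "\<And>h. U (bop_apply (star A) h) = bop_apply (star B) (U h)"
  shows "swap_bop U U' * bop_dsum A B * swap_bop U U' = bop_dsum A B"
proof -
  have adj: "\<And>h k. cinner (U h) k = cinner h (U' k)" using pi unfolding partial_isometry_def by blast
  have U': "U' (bop_apply B k) = bop_apply A (U' k)" for k
    by (rule cinner_eqI) (simp add: U(2) bop_apply_star flip: adj bop_apply_star)
  have "swap_bop U U' * bop_dsum A B = bop_dsum A B * swap_bop U U'"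
    by (rule bop_eqI) (simp add: bop_apply_ops swap_bop(1)[OF pi] bop_apply_bop_dsum U U' bop_apply_add bop_apply_more)
  then show ?thesis by (simp add: mult.assoc swap_bop(3)[OF pi])
qed

text \<open>The symmetry maps \<open>(V g, 0)\<close> to \<open>(0, W g)\<close>. After conjugation
  the isometry \<open>Y\<close> thus sees the summand \<open>\<tau>3\<close> through
  \<open>W\<close>, while the unconjugated sum shows it \<open>\<sigma>1\<close> through
  \<open>V\<close>.\<close>

lemma glued_dilations:
  fixes \<sigma>1 \<sigma>2 :: "'a::unital_cstar_algebra \<Rightarrow> 'h::chilbert_space bop"
    and \<tau>2 \<tau>3 :: "'a \<Rightarrow> 'k::chilbert_space bop"
  assumes pi: "partial_isometry U U'" and UV: "\<And>g. U (V g) = W g"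
    and d1: "dilation \<phi>1 \<sigma>1 V" and d3: "dilation \<phi>3 \<tau>3 W"
    and hom: "star_hom_on UNIV \<sigma>2" "star_hom_on UNIV \<tau>2" and one: "\<sigma>1 1 = \<sigma>2 1" "\<tau>2 1 = \<tau>3 1"
    and U1: "\<And>h. U (bop_apply (\<sigma>2 1) h) = bop_apply (\<tau>3 1) (U h)"
  defines "S \<equiv> swap_bop U U'" and "Y \<equiv> \<lambda>g. (V g, 0)"
  shows "dilation \<phi>1 (\<lambda>a. bop_dsum (\<sigma>1 a) (\<tau>2 a)) Y \<and> dilation \<phi>3 (\<lambda>a. S * bop_dsum (\<sigma>2 a) (\<tau>3 a) * S) Y \<and>
    bop_dsum (\<sigma>1 1) (\<tau>2 1) = S * bop_dsum (\<sigma>2 1) (\<tau>3 1) * S"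
proof -
  have V: "star_hom_on UNIV \<sigma>1" "bclin V" "\<And>g h. cinner (V g) (V h) = cinner g h" "\<And>g. bop_apply (\<sigma>1 1) (V g) = V g"
    "\<And>a g h. cinner (V g) (bop_apply (\<sigma>1 a) (V h)) = cinner g (bop_apply (\<phi>1 a) h)"
    using d1 unfolding dilation_def by blast+
  have W: "star_hom_on UNIV \<tau>3" "\<And>g h. cinner (W g) (W h) = cinner g h"
    "\<And>a g h. cinner (W g) (bop_apply (\<tau>3 a) (W h)) = cinner g (bop_apply (\<phi>3 a) h)"
    using d3 unfolding dilation_def by blast+
  have U: "bclin U" "bclin U'" and adj: "\<And>h k. cinner (U h) k = cinner h (U' k)"
    and pi': "\<And>h. U (U' (U h)) = U h" "\<And>k. U' (U (U' k)) = U' k"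
    using pi unfolding partial_isometry_def by blast+
  note S = swap_bop[OF pi, folded S_def]
  have s1: "star (\<sigma>2 1) = \<sigma>2 1" "star (\<tau>3 1) = \<tau>3 1"
    using star_hom_onD(4)[OF hom(1) cstar_subalgebra_UNIV, of 1] star_hom_onD(4)[OF W(1) cstar_subalgebra_UNIV, of 1] by simp_all
  have eq: "bop_dsum (\<sigma>1 1) (\<tau>2 1) = S * bop_dsum (\<sigma>2 1) (\<tau>3 1) * S"
    unfolding S_def one by (rule swap_bop_commute[OF pi, symmetric]) (simp_all add: U1 s1)
  \<comment> \<open>\<open>U\<close> maps \<open>V g\<close> to \<open>W g\<close>, which has the
    same norm, so \<open>V g\<close> lies in the initial space of \<open>U\<close>; expanding the
    squared norm verifies this.\<close>
  have UW: "U' (W g) = V g" for g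
  proof -
    have "(norm (V g - U' (W g)))\<^sup>2 = Re (cinner g g) - Re (cinner (U (V g)) (W g)) - Re (cinner (U' (W g)) (V g))
        + Re (cinner (U (U' (W g))) (W g))"
      by (simp add: norm_eq_Re_cinner cinner_diff V adj)
    also have "\<dots> = Re (cinner g g) - Re (cinner (W g) (W g)) - Re (cinner (V g) (U' (W g))) + Re (cinner (W g) (W g))"
      using cinner_commute[of "U' (W g)" "V g"] pi'(1)[of "V g"] by (simp add: UV)
    also have "\<dots> = 0" by (simp add: adj[symmetric] UV W)
    finally show ?thesis by simp
  qed
  have Yc: "cinner (Y g) (Y h) = cinner g h" for g h by (simp add: Y_def cinner_prod_def V)
  have Yb: "bclin Y"
    using V(2) by (auto simp: Y_def bclin_def scaleC_prod_def intro: bounded_linear_Pair bounded_linear_zero)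
  have Y1: "bop_apply (bop_dsum (\<sigma>1 1) (\<tau>2 1)) (Y g) = Y g" for g by (simp add: bop_apply_bop_dsum Y_def V bop_apply_more)
  have SY: "bop_apply S (Y g) = (0, W g)" for g
    by (simp add: S(1) Y_def UV UW bclinD[OF U(1)] bclinD[OF U(2)])
  have S': "cinner x (bop_apply S y) = cinner (bop_apply S x) y" for x y
    using bop_apply_star'[of x S y] by (simp add: S(2))
  have k1: "cinner (Y g) (bop_apply (bop_dsum (\<sigma>1 a) (\<tau>2 a)) (Y h)) = cinner g (bop_apply (\<phi>1 a) h)" for a g h
    by (simp add: Y_def bop_apply_bop_dsum cinner_prod_def V)
  have k3: "cinner (Y g) (bop_apply (S * bop_dsum (\<sigma>2 a) (\<tau>3 a) * S) (Y h)) = cinner g (bop_apply (\<phi>3 a) h)" for a g h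
    by (simp add: bop_apply_ops S' SY, simp add: bop_apply_bop_dsum cinner_prod_def W)
  have "dilation \<phi>1 (\<lambda>a. bop_dsum (\<sigma>1 a) (\<tau>2 a)) Y"
    unfolding dilation_def by (intro conjI allI star_hom_bop_dsum V(1) hom(2) Yb Yc Y1 k1)
  moreover have "dilation \<phi>3 (\<lambda>a. S * bop_dsum (\<sigma>2 a) (\<tau>3 a) * S) Y"
    unfolding dilation_def eq[symmetric]
    by (intro conjI allI star_hom_conj[OF star_hom_bop_dsum[OF hom(1) W(1)] S(2,3)] Yb Yc Y1 k3)
  ultimately show ?thesis using eq by blast
qed

text \<open>Two Stinespring dilations are glued along \<open>W V^*\<close>. The constant 2 is the
  sum of the bounds 1 for the two representations; it is what makes \<open>gamma\<close>
  finite.\<close>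

lemma joint_dilation_exists:
  fixes \<phi>1 \<phi>2 :: "'a::unital_cstar_algebra \<Rightarrow> 'g::chilbert_space bop"
  assumes "\<phi>1 \<in> UCP UNIV D" "\<phi>2 \<in> UCP UNIV D"
  shows "\<exists>(\<tau>1 :: 'a \<Rightarrow> (('a \<times> 'g) uhil \<times> ('a \<times> 'g) uhil) bop) \<tau>2 V. joint_dilation 2 \<phi>1 \<phi>2 \<tau>1 \<tau>2 V"
proof -
  obtain \<sigma> V where d1: "dilation \<phi>1 (\<sigma> :: 'a \<Rightarrow> ('a \<times> 'g) uhil bop) V" using stinespring(2)[OF assms(1)] by blast
  obtain \<tau> W where d2: "dilation \<phi>2 (\<tau> :: 'a \<Rightarrow> ('a \<times> 'g) uhil bop) W" using stinespring(2)[OF assms(2)] by blast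
  have V: "star_hom_on UNIV \<sigma>" "bclin V" "\<And>g h. cinner (V g) (V h) = cinner g h" "\<And>g. bop_apply (\<sigma> 1) (V g) = V g"
    using d1 unfolding dilation_def by blast+
  have W: "star_hom_on UNIV \<tau>" "bclin W" "\<And>g h. cinner (W g) (W h) = cinner g h" "\<And>g. bop_apply (\<tau> 1) (W g) = W g"
    using d2 unfolding dilation_def by blast+
  note aV = adj[OF V(2)] and aW = adj[OF W(2)]
  have V'V: "adj V (V g) = g" "adj W (W g) = g" for g by (rule cinner_eqI; simp add: aV aW V W)+
  let ?U = "\<lambda>h. W (adj V h)" and ?U' = "\<lambda>k. V (adj W k)"
  have pi: "partial_isometry ?U ?U'"
    unfolding partial_isometry_def
  proof (intro conjI allI)
    show "cinner (?U h) k = cinner h (?U' k)" for h k by (simp add: aW(3)[symmetric] aV)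
  qed (simp_all add: V'V bclin_compose[OF V(2) aW(1)] bclin_compose[OF W(2) aV(1)])
  have U1: "?U (bop_apply (\<sigma> 1) h) = bop_apply (\<tau> 1) (?U h)" for h
  proof -
    have "star (\<sigma> 1) = \<sigma> 1" using star_hom_onD(4)[OF V(1) cstar_subalgebra_UNIV, of 1] by simp
    then have "adj V (bop_apply (\<sigma> 1) h) = adj V h"
      using bop_apply_star'[of _ "\<sigma> 1" h] by (intro cinner_eqI) (simp add: aV V)
    then show ?thesis by (simp add: W)
  qed
  let ?S = "swap_bop ?U ?U'"
  have g: "dilation \<phi>1 (\<lambda>a. bop_dsum (\<sigma> a) (\<tau> a)) (\<lambda>g. (V g, 0)) \<and>
      dilation \<phi>2 (\<lambda>a. ?S * bop_dsum (\<sigma> a) (\<tau> a) * ?S) (\<lambda>g. (V g, 0)) \<and>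
      bop_dsum (\<sigma> 1) (\<tau> 1) = ?S * bop_dsum (\<sigma> 1) (\<tau> 1) * ?S"
    by (rule glued_dilations[OF pi _ d1 d2 V(1) W(1) refl refl U1]) (simp add: V'V)
  have "cb_bounded (1 + 1) (\<lambda>a. bop_dsum (\<sigma> a) (\<tau> a) + - (?S * bop_dsum (\<sigma> a) (\<tau> a) * ?S))"
    using g by (intro cb_bounded_add cb_bounded_uminus star_hom_cb_bounded) (auto simp: dilation_def)
  then show ?thesis using g unfolding joint_dilation_def by (auto simp: one_add_one)
qed

text \<open>The minimal Stinespring space embeds by
  \<open>b \<otimes> g \<mapsto> \<sigma> b (V g)\<close>. On the universal space \<open>I\<close>
  is a partial isometry whose initial projection depends on \<open>\<phi>\<close> alone, so the
  intertwiners of two dilations can be composed.\<close>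

lemma stinespring_intertwiner:
  fixes \<phi> :: "'a::unital_cstar_algebra \<Rightarrow> 'g::chilbert_space bop" and V :: "'g \<Rightarrow> 'h::chilbert_space"
  assumes \<phi>: "\<phi> \<in> UCP UNIV D" and d: "dilation \<phi> \<sigma> V"
  defines "F \<equiv> stinespring_kernel \<phi>"
  shows "\<exists>I. bclin I \<and> (\<forall>b g. I (kvec F b g) = bop_apply (\<sigma> b) (V g)) \<and>
    (\<forall>p. fst p \<noteq> scalar_kernel F \<longrightarrow> I (gen p) = 0) \<and>
    (\<forall>p. adj I (I (gen p)) = (if fst p = scalar_kernel F then gen p else 0))"
proof -
  let ?k = "scalar_kernel F"
  have psd: "psd_kernel ?k" unfolding F_def by (rule psd_scalar_kernel[OF stinespring(1)[OF \<phi>]])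
  have hom: "star_hom_on UNIV \<sigma>" and V: "\<And>a g h. cinner (V g) (bop_apply (\<sigma> a) (V h)) = cinner g (bop_apply (\<phi> a) h)"
    using d unfolding dilation_def by blast+
  note h = star_hom_onD[OF hom cstar_subalgebra_UNIV, simplified]
  define \<tau> where "\<tau> p = (if fst p = ?k then bop_apply (\<sigma> (fst (snd p))) (V (snd (snd p))) else 0)" for p :: "('a \<times> 'g) kernel \<times> 'a \<times> 'g"
  have ck: "cinner (bop_apply (\<sigma> a) (V g)) (bop_apply (\<sigma> b) (V h)) = ?k (a, g) (b, h)" for a b g h
  proof -
    have "cinner (bop_apply (\<sigma> a) (V g)) (bop_apply (\<sigma> b) (V h)) = cinner (V g) (bop_apply (\<sigma> (star a * b)) (V h))"
      by (simp add: h bop_apply_ops bop_apply_star')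
    then show ?thesis by (simp add: V scalar_kernel_def F_def stinespring_kernel_def)
  qed
  have c\<tau>: "cinner (\<tau> p) (\<tau> q) = (if fst p = ?k \<and> fst q = ?k then ?k (snd p) (snd q) else 0)" for p q
    using ck[of "fst (snd p)" "snd (snd p)" "fst (snd q)" "snd (snd q)"] by (simp add: \<tau>_def)
  have bd: "norm (\<Sum>u\<leftarrow>x. fst u *\<^sub>C \<tau> (snd u)) \<le> 1 * norm (fval x)" for x
  proof -
    have "cinner (\<Sum>u\<leftarrow>y. fst u *\<^sub>C \<tau> (snd u)) (\<Sum>u\<leftarrow>z. fst u *\<^sub>C \<tau> (snd u)) = bip (block ?k y) (block ?k z)" for y z
    proof -
      have 1: "cinner w (\<Sum>u\<leftarrow>z. fst u *\<^sub>C \<tau> (snd u)) = (\<Sum>u\<leftarrow>z. fst u * cinner w (\<tau> (snd u)))" for w z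
        by (induction z) (simp_all add: cinner_add_right cinner_scaleC_right)
      have 2: "cinner (\<Sum>u\<leftarrow>y. fst u *\<^sub>C \<tau> (snd u)) w = (\<Sum>u\<leftarrow>y. cnj (fst u) * cinner (\<tau> (snd u)) w)" for w y
        by (induction y) (simp_all add: cinner_add_left cinner_scaleC_left)
      have sf: "(\<Sum>u\<leftarrow>block ?k y. f u) = (\<Sum>u\<leftarrow>y. if fst (snd u) = ?k then f u else 0)" for f :: "_ \<Rightarrow> complex" and y
        unfolding block_def by (induction y) auto
      have t: "cnj (fst u) * cinner (\<tau> (snd u)) (\<Sum>v\<leftarrow>z. fst v *\<^sub>C \<tau> (snd v)) = (\<Sum>v\<leftarrow>z. if fst (snd u) = ?k then
          (if fst (snd v) = ?k then cnj (fst u) * fst v * block_kernel (snd u) (snd v) else 0) else 0)" for u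
        unfolding 1 c\<tau> sum_list_const_mult[symmetric]
        by (intro arg_cong[of _ _ sum_list] map_cong refl) (auto simp: block_kernel_def psd)
      show ?thesis
        unfolding 2 t fip_def sf
        by (rule arg_cong[of _ _ sum_list], rule map_cong[OF refl]) (simp add: sum_list_map_zero)
    qed
    then have "(norm (\<Sum>u\<leftarrow>x. fst u *\<^sub>C \<tau> (snd u)))\<^sup>2 = Re (bip (block ?k x) (block ?k x))"
      by (simp add: norm_eq_Re_cinner)
    also have "\<dots> \<le> (norm (fval x))\<^sup>2"
      using bip_self_nonneg[of "block_compl ?k x"] bip_block[of x x ?k] by (simp add: norm_fval fnorm_square)
    finally show ?thesis by simp
  qed
  obtain I where I: "bclin I" "\<And>p. I (gen p) = \<tau> p" using uhil_extend[OF zero_le_one bd] by blast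
  have "adj I (I (gen p)) = (if fst p = ?k then gen p else 0)" for p
    by (rule uhil_eqI_gen) (auto simp: adj[OF I(1)] I(2) c\<tau> cinner_gen block_kernel_def psd)
  then show ?thesis using I by (intro exI[of _ I]) (auto simp: \<tau>_def kvec_def)
qed

lemma joint_dilation_triangle:
  fixes \<sigma>1 \<sigma>2 :: "'a::unital_cstar_algebra \<Rightarrow> 'h::chilbert_space bop"
    and \<tau>2 \<tau>3 :: "'a \<Rightarrow> 'k::chilbert_space bop" and \<phi>2 :: "'a \<Rightarrow> 'g::chilbert_space bop"
  assumes \<phi>: "\<phi>2 \<in> UCP UNIV D" and jd: "joint_dilation c \<phi>1 \<phi>2 \<sigma>1 \<sigma>2 V" "joint_dilation d \<phi>2 \<phi>3 \<tau>2 \<tau>3 W"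
    and cd: "0 \<le> c" "0 \<le> d"
  shows "\<exists>(\<rho>1 :: 'a \<Rightarrow> ('h \<times> 'k) bop) \<rho>3 Y. joint_dilation (c + d) \<phi>1 \<phi>3 \<rho>1 \<rho>3 Y"
proof -
  let ?F = "stinespring_kernel \<phi>2"
  have s: "dilation \<phi>1 \<sigma>1 V" "dilation \<phi>2 \<sigma>2 V" "\<sigma>1 1 = \<sigma>2 1" "cb_bounded c (\<lambda>a. \<sigma>1 a - \<sigma>2 a)"
    and t: "dilation \<phi>2 \<tau>2 W" "dilation \<phi>3 \<tau>3 W" "\<tau>2 1 = \<tau>3 1" "cb_bounded d (\<lambda>a. \<tau>2 a - \<tau>3 a)"
    using jd unfolding joint_dilation_def by blast+
  have hs: "star_hom_on UNIV \<sigma>2" "\<And>g. bop_apply (\<sigma>2 1) (V g) = V g" using s(2) unfolding dilation_def by blast+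
  have ht: "star_hom_on UNIV \<tau>2" "\<And>g. bop_apply (\<tau>2 1) (W g) = W g" using t(1) unfolding dilation_def by blast+
  note h = star_hom_onD[OF hs(1) cstar_subalgebra_UNIV, simplified] star_hom_onD[OF ht(1) cstar_subalgebra_UNIV, simplified]
  obtain I where I: "bclin I" "\<And>b g. I (kvec ?F b g) = bop_apply (\<sigma>2 b) (V g)"
    "\<And>p. fst p \<noteq> scalar_kernel ?F \<Longrightarrow> I (gen p) = 0" "\<And>p. adj I (I (gen p)) = (if fst p = scalar_kernel ?F then gen p else 0)"
    using stinespring_intertwiner[OF \<phi> s(2)] by blast
  obtain J where J: "bclin J" "\<And>b g. J (kvec ?F b g) = bop_apply (\<tau>2 b) (W g)"
    "\<And>p. fst p \<noteq> scalar_kernel ?F \<Longrightarrow> J (gen p) = 0" "\<And>p. adj J (J (gen p)) = (if fst p = scalar_kernel ?F then gen p else 0)"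
    using stinespring_intertwiner[OF \<phi> t(1)] by blast
  obtain \<pi> where \<pi>: "kernel_rep ?F (*) \<pi>" using stinespring(2)[OF \<phi>] by blast
  note hp = star_hom_onD[OF kernel_repD(1)[OF \<pi>] cstar_subalgebra_UNIV, simplified]
  note aI = adj[OF I(1)] and aJ = adj[OF J(1)]
  have gk: "gen p = kvec ?F (fst (snd p)) (snd (snd p))" if "fst p = scalar_kernel ?F" for p :: "('a \<times> 'g) kernel \<times> 'a \<times> 'g"
    using that by (cases p) (auto simp: kvec_def)
  \<comment> \<open>Equal initial projections make \<open>J\<close> after the adjoint of
    \<open>I\<close> a partial isometry.\<close>
  have e: "adj I (I x) = adj J (J x)" for x
    by (rule bclin_uhil_eqI[OF bclin_compose[OF aI(1) I(1)] bclin_compose[OF aJ(1) J(1)]]) (simp add: I J)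
  have IeI: "I (adj I (I x)) = I x" for x
    by (rule bclin_uhil_eqI[OF bclin_compose[OF I(1) bclin_compose[OF aI(1) I(1)]] I(1)])
      (use bclinD(4)[OF I(1)] I(3,4) in auto)
  have JeJ: "J (adj J (J x)) = J x" for x
    by (rule bclin_uhil_eqI[OF bclin_compose[OF J(1) bclin_compose[OF aJ(1) J(1)]] J(1)])
      (use bclinD(4)[OF J(1)] J(3,4) in auto)
  have I\<pi>: "I (bop_apply (\<pi> a) x) = bop_apply (\<sigma>2 a) (I x)" for a x
  proof (rule bclin_uhil_eqI[OF bclin_compose[OF I(1) bclin_bop_apply] bclin_compose[OF bclin_bop_apply I(1)]])
    show "I (bop_apply (\<pi> a) (gen p)) = bop_apply (\<sigma>2 a) (I (gen p))" for p
      by (cases "fst p = scalar_kernel ?F")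
        (simp_all add: gk kernel_repD[OF \<pi>] I h bop_apply_ops bop_apply_more bclinD(4)[OF I(1)])
  qed
  have J\<pi>: "J (bop_apply (\<pi> a) x) = bop_apply (\<tau>2 a) (J x)" for a x
  proof (rule bclin_uhil_eqI[OF bclin_compose[OF J(1) bclin_bop_apply] bclin_compose[OF bclin_bop_apply J(1)]])
    show "J (bop_apply (\<pi> a) (gen p)) = bop_apply (\<tau>2 a) (J (gen p))" for p
      by (cases "fst p = scalar_kernel ?F")
        (simp_all add: gk kernel_repD[OF \<pi>] J h bop_apply_ops bop_apply_more bclinD(4)[OF J(1)])
  qed
  have I'\<sigma>: "adj I (bop_apply (\<sigma>2 a) y) = bop_apply (\<pi> a) (adj I y)" for a y
  proof (rule cinner_eqI)
    fix x
    have "cinner x (adj I (bop_apply (\<sigma>2 a) y)) = cinner (bop_apply (star (\<sigma>2 a)) (I x)) y"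
      by (simp add: aI bop_apply_star)
    also have "\<dots> = cinner (bop_apply (star (\<pi> a)) x) (adj I y)"
      using I\<pi>[of "star a" x] by (simp add: aI h hp)
    finally show "cinner x (adj I (bop_apply (\<sigma>2 a) y)) = cinner x (bop_apply (\<pi> a) (adj I y))"
      by (simp add: bop_apply_star)
  qed
  let ?U = "\<lambda>y. J (adj I y)" and ?U' = "\<lambda>z. I (adj J z)"
  have I'e: "adj I (I (adj I y)) = adj I y" for y
    by (rule cinner_eqI) (simp add: aI IeI flip: aI(2))
  have J'e: "adj J (J (adj J y)) = adj J y" for y
    by (rule cinner_eqI) (simp add: aJ JeJ flip: aJ(2))
  have pi: "partial_isometry ?U ?U'"
    unfolding partial_isometry_def
  proof (intro conjI allI)
    show "cinner (?U y) z = cinner y (?U' z)" for y z by (simp add: aJ(3)[symmetric] aI)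
    show "bclin ?U" "bclin ?U'" by (rule bclin_compose[OF J(1) aI(1)], rule bclin_compose[OF I(1) aJ(1)])
    show "?U (?U' (?U y)) = ?U y" for y by (simp add: e JeJ)
    show "?U' (?U (?U' z)) = ?U' z" for z by (simp add: e[symmetric] IeI)
  qed
  have UV: "?U (V g) = W g" for g
  proof -
    have "V g = I (kvec ?F 1 g)" by (simp add: I hs)
    then have "?U (V g) = J (adj J (J (kvec ?F 1 g)))" by (simp only: e)
    also have "\<dots> = W g" by (simp only: JeJ, simp only: J(2) ht(2))
    finally show ?thesis .
  qed
  have U\<sigma>: "?U (bop_apply (\<sigma>2 a) y) = bop_apply (\<tau>2 a) (?U y)" for a y by (simp add: I'\<sigma> J\<pi>)
  let ?S = "swap_bop ?U ?U'"
  have g: "dilation \<phi>1 (\<lambda>a. bop_dsum (\<sigma>1 a) (\<tau>2 a)) (\<lambda>g. (V g, 0)) \<and>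
      dilation \<phi>3 (\<lambda>a. ?S * bop_dsum (\<sigma>2 a) (\<tau>3 a) * ?S) (\<lambda>g. (V g, 0)) \<and>
      bop_dsum (\<sigma>1 1) (\<tau>2 1) = ?S * bop_dsum (\<sigma>2 1) (\<tau>3 1) * ?S"
    by (rule glued_dilations[OF pi UV s(1) t(2) hs(1) ht(1) s(3) t(3)]) (simp add: U\<sigma> flip: t(3))
  have mid: "?S * bop_dsum (\<sigma>2 a) (\<tau>2 a) * ?S = bop_dsum (\<sigma>2 a) (\<tau>2 a)" for a
    by (rule swap_bop_commute[OF pi]) (simp_all add: U\<sigma> flip: h(4) h(12))
  \<comment> \<open>Telescoping through \<open>bop_dsum (\<sigma>2 a) (\<tau>2 a)\<close>, which the
    symmetry leaves fixed by \<open>mid\<close>: one difference is supported on the first summand,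
    the other, before conjugation, on the second.\<close>
  have "cb_bounded (c + d) (\<lambda>a. bop_dsum (\<sigma>1 a - \<sigma>2 a) 0 + ?S * bop_dsum 0 (\<tau>2 a - \<tau>3 a) * ?S)"
    using s(4) t(4) cd
    by (intro cb_bounded_add cb_bounded_bop_dsum_left cb_bounded_conj[OF _ swap_bop(2,3)[OF pi]] cb_bounded_bop_dsum_right)
  moreover have "bop_dsum (\<sigma>1 a - \<sigma>2 a) 0 + ?S * bop_dsum 0 (\<tau>2 a - \<tau>3 a) * ?S
      = bop_dsum (\<sigma>1 a) (\<tau>2 a) - ?S * bop_dsum (\<sigma>2 a) (\<tau>3 a) * ?S" for a
  proof -
    have "bop_dsum 0 (\<tau>2 a - \<tau>3 a) = bop_dsum (\<sigma>2 a) (\<tau>2 a) - bop_dsum (\<sigma>2 a) (\<tau>3 a)"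
      "bop_dsum (\<sigma>1 a - \<sigma>2 a) 0 = bop_dsum (\<sigma>1 a) (\<tau>2 a) - bop_dsum (\<sigma>2 a) (\<tau>2 a)" by (simp_all add: bop_dsum_diff)
    then show ?thesis by (simp add: right_diff_distrib left_diff_distrib mid)
  qed
  ultimately show ?thesis using g unfolding joint_dilation_def by auto
qed


section \<open>The metric\<close>

lemma gamma_le_of_joint_dilation:
  fixes \<phi>1 \<phi>2 :: "'a::unital_cstar_algebra \<Rightarrow> 'g::chilbert_space bop"
  assumes P: "conditional_expectation D P" and \<phi>: "\<And>a. \<phi>1 a \<in> D" "\<And>a. \<phi>2 a \<in> D"
    and jd: "joint_dilation c \<phi>1 \<phi>2 \<sigma>1 \<sigma>2 V" and c: "0 \<le> c"
  shows "gamma TYPE('e) D \<phi>1 \<phi>2 \<le> ennreal c"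
proof -
  obtain \<tau>1 :: "'a \<Rightarrow> ((bool \<times> 'a) list \<times> 'g) uhil bop" and \<tau>2 W where \<tau>: "joint_dilation c \<phi>1 \<phi>2 \<tau>1 \<tau>2 W"
    "\<And>w w'. gram (word_vec (\<lambda>b. if b then \<tau>1 else \<tau>2) W w) (word_vec (\<lambda>b. if b then \<tau>1 else \<tau>2) W w') \<in> D"
    using joint_dilation_compress[OF P \<phi> jd] by blast
  show ?thesis by (rule gamma_le_of_dilation[OF conditional_expectationD(1)[OF P] c \<tau>])
qed

text \<open>\<open>C\<close> and \<open>D\<close> are unrelated, and so are the types
  \<open>'e\<close> and \<open>'f\<close>. Both inequalities of the theorem are instances, with the
  identity as expectation onto the whole algebra and with \<open>P\<close> onto
  \<open>B\<close>.\<close>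

lemma gamma_mono:
  fixes \<phi>1 \<phi>2 :: "'a::unital_cstar_algebra \<Rightarrow> 'g::chilbert_space bop"
  assumes P: "conditional_expectation D P" and \<phi>: "\<And>a. \<phi>1 a \<in> D" "\<And>a. \<phi>2 a \<in> D" and C: "cstar_subalgebra C"
  shows "gamma TYPE('f) D \<phi>1 \<phi>2 \<le> gamma TYPE('e) C \<phi>1 \<phi>2"
  unfolding gamma_def[of "TYPE('e)"]
proof (rule INF_greatest, clarify)
  fix E :: "('g bop, ('a, 'g bop, 'e) vectors) hilbert_module" and \<sigma>1 \<sigma>2 x
  assume jr: "joint_rep C \<phi>1 \<phi>2 E \<sigma>1 \<sigma>2 x"
  let ?c = "cb_norm E (\<lambda>a \<xi>. \<sigma>1 a \<xi> \<ominus>\<^bsub>E\<^esub> \<sigma>2 a \<xi>)"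
  show "gamma TYPE('f) D \<phi>1 \<phi>2 \<le> ?c"
  proof (cases "?c = \<infinity>")
    case False
    then have c: "?c = ennreal (enn2real ?c)" by (simp add: less_top infinity_ennreal_def)
    obtain \<tau>1 \<tau>2 :: "'a \<Rightarrow> (('a, 'g bop, 'e) vectors \<times> 'g) uhil bop" and V
      where "joint_dilation (enn2real ?c) \<phi>1 \<phi>2 \<tau>1 \<tau>2 V"
      using joint_rep_dilation[OF C jr eq_refl[OF c] enn2real_nonneg] by blast
    from gamma_le_of_joint_dilation[OF P \<phi> this enn2real_nonneg] show ?thesis using c by simp
  qed simp
qed

lemma joint_dilation_of_gamma:
  fixes \<phi>1 \<phi>2 :: "'a::unital_cstar_algebra \<Rightarrow> 'g::chilbert_space bop"
  assumes D: "cstar_subalgebra D" and lt: "gamma TYPE('e) D \<phi>1 \<phi>2 < ennreal c" and c: "0 \<le> c"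
  shows "\<exists>(\<tau>1 :: 'a \<Rightarrow> (('a, 'g bop, 'e) vectors \<times> 'g) uhil bop) \<tau>2 V. joint_dilation c \<phi>1 \<phi>2 \<tau>1 \<tau>2 V"
proof -
  obtain E :: "('g bop, ('a, 'g bop, 'e) vectors) hilbert_module" and \<sigma>1 \<sigma>2 x
    where jr: "joint_rep D \<phi>1 \<phi>2 E \<sigma>1 \<sigma>2 x" and cb: "cb_norm E (\<lambda>a \<xi>. \<sigma>1 a \<xi> \<ominus>\<^bsub>E\<^esub> \<sigma>2 a \<xi>) < ennreal c"
    using lt unfolding gamma_def INF_less_iff by auto
  show ?thesis by (rule joint_rep_dilation[OF D jr less_imp_le[OF cb] c])
qed

text \<open>Exchanging the representations keeps the tuple admissible; the cb norm agrees because
  the inner square of the negated sum expands to the same terms.\<close>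

lemma gamma_sym_le:
  fixes \<phi>1 \<phi>2 :: "'a::unital_cstar_algebra \<Rightarrow> 'd::unital_cstar_algebra"
  shows "gamma TYPE('e) D \<phi>2 \<phi>1 \<le> gamma TYPE('e) D \<phi>1 \<phi>2"
  unfolding gamma_def[of _ D \<phi>1]
proof (rule INF_greatest, clarify)
  fix E :: "('d, ('a, 'd, 'e) vectors) hilbert_module" and \<sigma>1 \<sigma>2 x
  assume jr: "joint_rep D \<phi>1 \<phi>2 E \<sigma>1 \<sigma>2 x"
  then have E: "is_hilbert_module D E" and hom: "unital_star_hom E \<sigma>1" "unital_star_hom E \<sigma>2"
    by (auto simp: joint_rep_def)
  interpret abelian_group E by (rule hilbert_moduleD(1)[OF E])
  note cl = unital_star_homD(1)[OF hom(1)] unital_star_homD(1)[OF hom(2)]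
  have "module_column_norm E n (\<lambda>i. \<Oplus>\<^bsub>E\<^esub>j\<in>{..<n}. \<sigma>2 (X i j) (\<xi> j) \<ominus>\<^bsub>E\<^esub> \<sigma>1 (X i j) (\<xi> j))
      = module_column_norm E n (\<lambda>i. \<Oplus>\<^bsub>E\<^esub>j\<in>{..<n}. \<sigma>1 (X i j) (\<xi> j) \<ominus>\<^bsub>E\<^esub> \<sigma>2 (X i j) (\<xi> j))"
    if \<xi>: "\<forall>i<n. \<xi> i \<in> carrier E" for n X \<xi>
  proof -
    have "ip E (\<Oplus>\<^bsub>E\<^esub>j\<in>{..<n}. a j \<ominus>\<^bsub>E\<^esub> b j) (\<Oplus>\<^bsub>E\<^esub>j\<in>{..<n}. a j \<ominus>\<^bsub>E\<^esub> b j)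
        = (\<Sum>j<n. \<Sum>j'<n. (ip E (a j) (a j') - ip E (b j) (a j')) - (ip E (a j) (b j') - ip E (b j) (b j')))"
      if ab: "\<And>j. j < n \<Longrightarrow> a j \<in> carrier E" "\<And>j. j < n \<Longrightarrow> b j \<in> carrier E" for a b
    proof -
      have m: "a j \<ominus>\<^bsub>E\<^esub> b j \<in> carrier E" if "j \<in> {..<n}" for j using ab that by simp
      have fc: "(\<Oplus>\<^bsub>E\<^esub>j\<in>{..<n}. a j \<ominus>\<^bsub>E\<^esub> b j) \<in> carrier E" using m by (intro finsum_closed) auto
      have "ip E (\<Oplus>\<^bsub>E\<^esub>j\<in>{..<n}. a j \<ominus>\<^bsub>E\<^esub> b j) (\<Oplus>\<^bsub>E\<^esub>j\<in>{..<n}. a j \<ominus>\<^bsub>E\<^esub> b j)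
          = (\<Sum>j<n. ip E (a j \<ominus>\<^bsub>E\<^esub> b j) (\<Oplus>\<^bsub>E\<^esub>j\<in>{..<n}. a j \<ominus>\<^bsub>E\<^esub> b j))"
        by (rule ip_finsum_left[OF E fc m]) simp_all
      also have "\<dots> = (\<Sum>j<n. \<Sum>j'<n. ip E (a j \<ominus>\<^bsub>E\<^esub> b j) (a j' \<ominus>\<^bsub>E\<^esub> b j'))"
        by (intro sum.cong refl ip_finsum_right[OF E m m]) simp_all
      finally show ?thesis using ab by (simp add: ip_minus_left[OF E] ip_minus_right[OF E])
    qed
    note ex = this
    show ?thesis
      unfolding module_column_norm_def
      by (intro arg_cong[of _ _ sqrt] arg_cong[of _ _ norm] sum.cong refl)
        (subst (1 2) ex; use \<xi> cl in \<open>auto simp: algebra_simps intro!: sum.cong\<close>)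
  qed
  then have "cb_norm E (\<lambda>a \<xi>. \<sigma>2 a \<xi> \<ominus>\<^bsub>E\<^esub> \<sigma>1 a \<xi>) = cb_norm E (\<lambda>a \<xi>. \<sigma>1 a \<xi> \<ominus>\<^bsub>E\<^esub> \<sigma>2 a \<xi>)"
    unfolding cb_norm_def operator_matrix_norm_def by (intro SUP_cong refl) auto
  moreover have "joint_rep D \<phi>2 \<phi>1 E \<sigma>2 \<sigma>1 x" using jr by (auto simp: joint_rep_def)
  ultimately show "gamma TYPE('e) D \<phi>2 \<phi>1 \<le> cb_norm E (\<lambda>a \<xi>. \<sigma>1 a \<xi> \<ominus>\<^bsub>E\<^esub> \<sigma>2 a \<xi>)"
    unfolding gamma_def by (intro INF_lower2[of "(E, \<sigma>2, \<sigma>1, x)"]) auto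
qed

lemma gamma_commute: "gamma TYPE('e) D \<phi>1 \<phi>2 = gamma TYPE('e) D \<phi>2 \<phi>1"
  by (intro antisym gamma_sym_le)

lemma gamma_finite:
  fixes \<phi>1 \<phi>2 :: "'a::unital_cstar_algebra \<Rightarrow> 'g::chilbert_space bop"
  assumes P: "conditional_expectation D P" and \<phi>: "\<phi>1 \<in> UCP UNIV D" "\<phi>2 \<in> UCP UNIV D"
  shows "gamma TYPE('e) D \<phi>1 \<phi>2 < \<infinity>"
proof -
  obtain \<tau>1 :: "'a \<Rightarrow> (('a \<times> 'g) uhil \<times> ('a \<times> 'g) uhil) bop" and \<tau>2 V where "joint_dilation 2 \<phi>1 \<phi>2 \<tau>1 \<tau>2 V"
    using joint_dilation_exists[OF \<phi>] by blast
  then have "gamma TYPE('e) D \<phi>1 \<phi>2 \<le> ennreal 2"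
    by (intro gamma_le_of_joint_dilation[OF P]) (simp_all add: UCPD[OF \<phi>(1)] UCPD[OF \<phi>(2)])
  then show ?thesis by (rule le_less_trans) simp
qed

text \<open>The case of 1 by 1 matrices, compressed by the isometry \<open>V\<close>.\<close>

lemma joint_dilation_norm:
  assumes jd: "joint_dilation c \<phi>1 \<phi>2 \<sigma>1 \<sigma>2 V" and c: "0 \<le> c" and a: "norm a \<le> 1"
  shows "norm (\<phi>1 a - \<phi>2 a) \<le> c"
proof (rule norm_bop_bound[OF c])
  fix g
  have V: "\<And>g h. cinner (V g) (V h) = cinner g h"
    "\<And>a g h. cinner (V g) (bop_apply (\<sigma>1 a) (V h)) = cinner g (bop_apply (\<phi>1 a) h)"
    "\<And>a g h. cinner (V g) (bop_apply (\<sigma>2 a) (V h)) = cinner g (bop_apply (\<phi>2 a) h)"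
    and cb: "cb_bounded c (\<lambda>a. \<sigma>1 a - \<sigma>2 a)"
    using jd unfolding joint_dilation_def dilation_def by blast+
  have nV: "norm (V g) = norm g" for g
  proof -
    have "(norm (V g))\<^sup>2 = (norm g)\<^sup>2" by (simp add: norm_eq_Re_cinner V)
    then show ?thesis by simp
  qed
  have "matrix_norm 1 (\<lambda>i j. a) \<le> 1"
    unfolding matrix_norm_def
  proof (intro SUP_least)
    fix v :: "nat \<Rightarrow> 'a" assume "v \<in> {v. column_norm 1 v \<le> 1}"
    then have "norm (v 0) \<le> 1" by (simp add: column_norm_def cstar_identity)
    then have "norm (a * v 0) \<le> 1" using order_trans[OF norm_mult_ineq mult_le_one[OF a norm_ge_zero]] by blast
    then show "ennreal (column_norm 1 (\<lambda>i. \<Sum>j<1. a * v j)) \<le> 1" by (simp add: column_norm_def cstar_identity ennreal_le_1)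
  qed
  from cb[unfolded cb_bounded_def, rule_format, OF this, of "\<lambda>_. V g"]
  have "(norm (bop_apply (\<sigma>1 a - \<sigma>2 a) (V g)))\<^sup>2 \<le> (c * norm g)\<^sup>2" by (simp add: nV power_mult_distrib)
  then have le: "norm (bop_apply (\<sigma>1 a - \<sigma>2 a) (V g)) \<le> c * norm g" by (rule power2_le_imp_le) (simp add: c)
  let ?h = "bop_apply (\<phi>1 a - \<phi>2 a) g"
  have "(norm ?h)\<^sup>2 = Re (cinner (V ?h) (bop_apply (\<sigma>1 a - \<sigma>2 a) (V g)))"
    by (simp add: norm_eq_Re_cinner bop_apply_more cinner_diff(2) V)
  also have "\<dots> \<le> norm (V ?h) * norm (bop_apply (\<sigma>1 a - \<sigma>2 a) (V g))"
    by (simp add: norm_cauchy_schwarz flip: inner_eq_Re_cinner)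
  also have "\<dots> \<le> norm ?h * (c * norm g)" by (simp add: nV le mult_left_mono)
  finally show "norm ?h \<le> c * norm g" by (cases "norm ?h = 0") (auto simp: power2_eq_square c)
qed

lemma gamma_eq_zero_iff:
  fixes \<phi>1 \<phi>2 :: "'a::unital_cstar_algebra \<Rightarrow> 'g::chilbert_space bop"
  assumes P: "conditional_expectation D P" and \<phi>: "\<phi>1 \<in> UCP UNIV D" "\<phi>2 \<in> UCP UNIV D"
  shows "gamma TYPE('e) D \<phi>1 \<phi>2 = 0 \<longleftrightarrow> \<phi>1 = \<phi>2"
proof
  assume z: "gamma TYPE('e) D \<phi>1 \<phi>2 = 0"
  \<comment> \<open>The estimate covers the unit ball; homogeneity of the two maps extends the
    equality to all \<open>a\<close>.\<close>
  have ball: "\<phi>1 a = \<phi>2 a" if a: "norm a \<le> 1" for a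
  proof -
    have "norm (\<phi>1 a - \<phi>2 a) \<le> c" if "0 < c" for c
    proof -
      have "gamma TYPE('e) D \<phi>1 \<phi>2 < ennreal c" using that by (simp add: z)
      from joint_dilation_of_gamma[OF conditional_expectationD(1)[OF P] this] obtain \<tau>1 \<tau>2 :: "'a \<Rightarrow> (('a, 'g bop, 'e) vectors \<times> 'g) uhil bop" and V
        where "joint_dilation c \<phi>1 \<phi>2 \<tau>1 \<tau>2 V" using \<open>0 < c\<close> by auto
      then show ?thesis using \<open>0 < c\<close> a by (intro joint_dilation_norm) auto
    qed
    then have "norm (\<phi>1 a - \<phi>2 a) \<le> 0" by (rule field_le_epsilon[of _ 0, simplified])
    then show ?thesis by simp
  qed
  show "\<phi>1 = \<phi>2"
  proof
    fix a :: 'a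
    let ?t = "norm a + 1"
    have t: "0 < ?t" by (simp add: add_nonneg_pos)
    have "\<phi> a = ?t *\<^sub>R \<phi> ((1 / ?t) *\<^sub>R a)" if "\<phi> \<in> UCP UNIV D" for \<phi> :: "'a \<Rightarrow> 'g bop"
    proof -
      have "\<phi> ((1 / ?t) *\<^sub>R a) = (1 / ?t) *\<^sub>R \<phi> a" by (simp only: scaleR_scaleC UCPD[OF that])
      then show ?thesis using t by simp
    qed
    moreover have "norm ((1 / ?t) *\<^sub>R a) \<le> 1" using t by simp
    ultimately show "\<phi>1 a = \<phi>2 a" using ball \<phi> by metis
  qed
next
  assume "\<phi>1 = \<phi>2"
  \<comment> \<open>A single dilation, used for both maps, has difference zero.\<close>
  obtain \<sigma> where d: "dilation \<phi>1 (\<sigma> :: 'a \<Rightarrow> ('a \<times> 'g) uhil bop) (kvec (stinespring_kernel \<phi>1) 1)"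
    using stinespring(2)[OF \<phi>(1)] by blast
  have "joint_dilation 0 \<phi>1 \<phi>2 \<sigma> \<sigma> (kvec (stinespring_kernel \<phi>1) 1)"
    using d \<open>\<phi>1 = \<phi>2\<close> by (simp add: joint_dilation_def cb_bounded_def bop_apply_more)
  from gamma_le_of_joint_dilation[OF P _ _ this] show "gamma TYPE('e) D \<phi>1 \<phi>2 = 0"
    by (simp add: UCPD[OF \<phi>(1)] UCPD[OF \<phi>(2)])
qed

lemma gamma_triangle:
  fixes \<phi>1 \<phi>2 \<phi>3 :: "'a::unital_cstar_algebra \<Rightarrow> 'g::chilbert_space bop"
  assumes P: "conditional_expectation D P" and \<phi>: "\<phi>1 \<in> UCP UNIV D" "\<phi>2 \<in> UCP UNIV D" "\<phi>3 \<in> UCP UNIV D"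
  shows "enn2real (gamma TYPE('e) D \<phi>1 \<phi>3) \<le> enn2real (gamma TYPE('e) D \<phi>1 \<phi>2) + enn2real (gamma TYPE('e) D \<phi>2 \<phi>3)"
proof (rule field_le_epsilon)
  note D = conditional_expectationD(1)[OF P]
  let ?g = "\<lambda>\<phi> \<psi>. enn2real (gamma TYPE('e) D \<phi> \<psi>)"
  fix \<epsilon> :: real assume e: "0 < \<epsilon>"
  \<comment> \<open>Each infimum is approached up to \<open>\<epsilon> / 2\<close> by an actual
    joint dilation.\<close>
  have lt: "gamma TYPE('e) D \<phi> \<psi> < ennreal (?g \<phi> \<psi> + \<epsilon> / 2)" if "\<phi> \<in> UCP UNIV D" "\<psi> \<in> UCP UNIV D" for \<phi> \<psi> :: "'a \<Rightarrow> 'g bop"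
  proof -
    have "gamma TYPE('e) D \<phi> \<psi> = ennreal (?g \<phi> \<psi>)" using gamma_finite[OF P that, where ?'e = 'e] by (simp add: less_top)
    also have "\<dots> < ennreal (?g \<phi> \<psi> + \<epsilon> / 2)" using e by (intro ennreal_lessI) (simp_all add: add_nonneg_pos)
    finally show ?thesis .
  qed
  have nn: "0 \<le> ?g \<phi> \<psi> + \<epsilon> / 2" for \<phi> \<psi> using e by simp
  obtain \<sigma>1 \<sigma>2 :: "'a \<Rightarrow> (('a, 'g bop, 'e) vectors \<times> 'g) uhil bop" and V
    where 1: "joint_dilation (?g \<phi>1 \<phi>2 + \<epsilon> / 2) \<phi>1 \<phi>2 \<sigma>1 \<sigma>2 V"
    using joint_dilation_of_gamma[OF D lt[OF \<phi>(1,2)] nn] by blast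
  obtain \<tau>2 \<tau>3 :: "'a \<Rightarrow> (('a, 'g bop, 'e) vectors \<times> 'g) uhil bop" and W
    where 2: "joint_dilation (?g \<phi>2 \<phi>3 + \<epsilon> / 2) \<phi>2 \<phi>3 \<tau>2 \<tau>3 W"
    using joint_dilation_of_gamma[OF D lt[OF \<phi>(2,3)] nn] by blast
  from joint_dilation_triangle[OF \<phi>(2) 1 2 nn nn]
  obtain \<rho>1 \<rho>3 :: "'a \<Rightarrow> ((('a, 'g bop, 'e) vectors \<times> 'g) uhil \<times> (('a, 'g bop, 'e) vectors \<times> 'g) uhil) bop" and Y
    where "joint_dilation (?g \<phi>1 \<phi>2 + \<epsilon> / 2 + (?g \<phi>2 \<phi>3 + \<epsilon> / 2)) \<phi>1 \<phi>3 \<rho>1 \<rho>3 Y" by blast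
  then have "gamma TYPE('e) D \<phi>1 \<phi>3 \<le> ennreal (?g \<phi>1 \<phi>2 + \<epsilon> / 2 + (?g \<phi>2 \<phi>3 + \<epsilon> / 2))"
    by (rule gamma_le_of_joint_dilation[OF P UCPD(1)[OF \<phi>(1)] UCPD(1)[OF \<phi>(3)]]) (intro add_nonneg_nonneg nn)
  then have "?g \<phi>1 \<phi>3 \<le> ?g \<phi>1 \<phi>2 + \<epsilon> / 2 + (?g \<phi>2 \<phi>3 + \<epsilon> / 2)"
    by (intro enn2real_leI add_nonneg_nonneg nn)
  then show "?g \<phi>1 \<phi>3 \<le> ?g \<phi>1 \<phi>2 + ?g \<phi>2 \<phi>3 + \<epsilon>" by simp
qed

lemma positive_matrix_enlarge: "positive_matrix B n X \<Longrightarrow> positive_matrix UNIV n X"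
  by (auto simp: positive_matrix_def matrices_def)

lemma UCP_enlarge:
  assumes "\<phi> \<in> UCP UNIV B"
  shows "\<phi> \<in> UCP UNIV UNIV"
proof -
  have "positive_matrix UNIV n (\<lambda>i j. \<phi> (X i j))" if "X \<in> matrices n UNIV" "positive_matrix UNIV n X" for n X
    by (rule positive_matrix_enlarge[of B]) (use assms that in \<open>auto simp: UCP_def completely_positive_def\<close>)
  then show ?thesis using assms unfolding UCP_def completely_positive_def by auto
qed

text \<open>Finiteness is stated apart because \<open>enn2real\<close> sends infinity to 0; together
  with it, the real-valued distance carries the full information of \<open>gamma\<close>. The
  independent parameters \<open>'e\<close> and \<open>'f\<close> express that the value does not
  depend on the ambient type.\<close>

theorem theorem4p4:
  fixes B :: "'g::chilbert_space bop set"
    and \<iota> :: "'g bop \<Rightarrow> 'g bop"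
  assumes "cstar_subalgebra B"
    and "injective_cstar_algebra TYPE('g bop) B"
    and "\<And>b. b \<in> B \<Longrightarrow> \<iota> b = b"
  shows "(\<forall>\<phi>1 \<in> UCP (UNIV :: 'a::unital_cstar_algebra set) B. \<forall>\<phi>2 \<in> UCP UNIV B.
            \<iota> \<circ> \<phi>1 \<in> UCP UNIV UNIV \<and> \<iota> \<circ> \<phi>2 \<in> UCP UNIV UNIV \<and>
            gamma TYPE('e) UNIV (\<iota> \<circ> \<phi>1) (\<iota> \<circ> \<phi>2) = gamma TYPE('f) B \<phi>1 \<phi>2) \<and>
         (\<forall>\<phi>1 \<in> UCP (UNIV :: 'a set) B. \<forall>\<phi>2 \<in> UCP UNIV B. gamma TYPE('f) B \<phi>1 \<phi>2 < \<infinity>) \<and>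
         Metric_space (UCP (UNIV :: 'a set) B) (\<lambda>\<phi>1 \<phi>2. enn2real (gamma TYPE('f) B \<phi>1 \<phi>2))"
proof -
  obtain P where P: "conditional_expectation B P"
    using injective_conditional_expectation[OF assms(1,2)] by blast
  have \<iota>: "\<iota> \<circ> \<phi> = \<phi>" if "\<phi> \<in> UCP UNIV B" for \<phi> :: "'a \<Rightarrow> 'g bop"
    using assms(3) UCPD(1)[OF that] by auto
  have sub: "\<phi> \<in> UCP UNIV UNIV" if "\<phi> \<in> UCP UNIV B" for \<phi> :: "'a \<Rightarrow> 'g bop" using that by (rule UCP_enlarge)
  have "gamma TYPE('e) UNIV \<phi>1 \<phi>2 = gamma TYPE('f) B \<phi>1 \<phi>2" if "\<phi>1 \<in> UCP UNIV B" "\<phi>2 \<in> UCP UNIV B" for \<phi>1 \<phi>2 :: "'a \<Rightarrow> 'g bop"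
    using that assms(1)
    by (intro antisym gamma_mono[OF conditional_expectation_id] gamma_mono[OF P])
      (auto simp: UCPD cstar_subalgebra_UNIV)
  moreover have "Metric_space (UCP (UNIV :: 'a set) B) (\<lambda>\<phi>1 \<phi>2. enn2real (gamma TYPE('f) B \<phi>1 \<phi>2))"
  proof
    fix \<phi>1 \<phi>2 :: "'a \<Rightarrow> 'g bop" assume \<phi>: "\<phi>1 \<in> UCP UNIV B" "\<phi>2 \<in> UCP UNIV B"
    show "enn2real (gamma TYPE('f) B \<phi>1 \<phi>2) = 0 \<longleftrightarrow> \<phi>1 = \<phi>2"
      using gamma_eq_zero_iff[OF P \<phi>, where ?'e = 'f] gamma_finite[OF P \<phi>, where ?'e = 'f]
      by (auto simp: enn2real_eq_0_iff)
  qed (auto simp: gamma_triangle[OF P] intro: arg_cong[OF gamma_commute])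
  ultimately show ?thesis by (intro conjI ballI gamma_finite[OF P]) (simp_all add: \<iota> sub)
qed

end
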